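(* Let $\mathcal{E}\xrightarrow{\gamma}\mathrm{Set}$ be a locally connected Grothendieck topos and let $X\sim(R\to I,\sigma)$ be any locally constant object in $\mathcal{E}$ trivialized by a cover $U\to\gamma^*I$. Then there exist a self-dual simplicial hypercover refinement $H_\bullet\to\gamma^*(S_\bullet)$ of the Čech simplicial family of the cover, satisfying condition G, and a consistent $S_\bullet$-descent datum $\{s_\ell\}_{\ell\in S_1}$ on the family $R\to I$, such that the $H_\bullet$-descent datum $\{\sigma_\ell\}$ corresponding to $\sigma$ is of the form $\sigma_\ell=\gamma^*(s_\ell)\times(\tau_1)_\ell$; and vice-versa, any consistent $S_\bullet$-descent datum on a family $R\to I$, for a self-dual simplicial hypercover refinement $H_\bullet\to\gamma^*(S_\bullet)$ of the Čech simplicial family satisfying condition G, determines a covering projection trivialized by the cover $U\to\gamma^*I$. Thus, when the $U_i$ are connected, $X$ can be constructed from an $S_\bullet$-descent datum $\{s_\ell\}_{\ell\in S_1}$ on the family $R\to I$ (that is, its $H_\bullet$-descent datum is $\sigma_\ell=\gamma^*(s_\ell)\times(\tau_1)_\ell$), where $S_\bullet$ is the indexing simplicial set of the $0$-span refinement $H_\bullet\to\gamma^*(S_\bullet)$ constructed with $\mathcal{C}$ any set of connected generators of $\mathcal{E}$ admissible for the $0$-span construction.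
   Context: $\gamma^*:\mathrm{Set}\to\mathcal{E}$ is the inverse image functor; $\mathcal{E}$ is locally connected if $\gamma^*$ has a left adjoint (equivalently, every object is a coproduct of connected objects). A family $U\xrightarrow{\zeta}\gamma^*I$ is the same as $\{U_i\}_{i\in I}$, $U=\sum_iU_i$, with all $U_i$ non-empty (not initial); it is a cover if $U\to1$ is epimorphic. Simplicial families. A simplicial family $H_\bullet\to\gamma^*(S_\bullet)$ consists of a simplicial object $H_\bullet$ in $\mathcal{E}$ (faces $d_i$, degeneracies $s_i$), a simplicial set $S_\bullet$ (faces $\partial_i$, degeneracies $\sigma_i$) and a morphism of simplicial objects $H_\bullet\to\gamma^*(S_\bullet)$; $H_n=\sum_{w\in S_n}(H_n)_w$ with $(d_i)_w:(H_n)_w\to(H_{n-1})_{\partial_i(w)}$, $(s_i)_w:(H_{n-1})_w\to(H_n)_{\sigma_i(w)}$, all components non-empty. For $\ell\in S_1$, $i\xrightarrow{\ell}j$ means $i=\partial_1(\ell)$, $j=\partial_0(\ell)$. A strict duality on a simplicial object is a family of isomorphisms $\tau_n$ with $\tau_0=\mathrm{id}$, $d_i\tau_n=\tau_{n-1}d_{n-i}$, $s_i\tau_{n-1}=\tau_ns_{n-1-i}$; a simplicial family is self-dual if $H_\bullet$ and $S_\bullet$ carry strict dualities $\tau$ compatible with $H_\bullet\to\gamma^*S_\bullet$; write $w^{op}=\tau_n(w)$, so $(\tau_n)_w:(H_n)_w\to(H_n)_{w^{op}}$. Čech family: $N_n=\{(i_0,\dots,i_n)\in I^{n+1}\mid U_{i_0}\times\cdots\times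 U_{i_n}\ne\emptyset\}$, $U_n=U^{n+1}$, with projections as faces ($\partial_1(i,j)=i$, $\partial_0(i,j)=j$), diagonals as degeneracies, and duality reversing the order. A simplicial family with $S_0=I$, $H_0=U$ (same structure map $\zeta$) has a canonical morphism $(h_\bullet,\alpha_\bullet)$ to the Čech family given by the vertices, e.g. $\alpha_1(\ell)=(\partial_1\ell,\partial_0\ell)$, $(h_1)_\ell=((d_1)_\ell,(d_0)_\ell)$; it is a hypercover refinement if the maps $H_k\to(\mathrm{cosk}_{k-1}H_\bullet)_k$ are epimorphisms for all $k\ge1$. Condition G: for every $\ell\in S_1$, with $i=\partial_1(\ell)$, there exists $w\in S_2$ with $\partial_2(w)=\ell$, $\partial_0(w)=\ell^{op}$ and $(d_1)_{\partial_1(w)}=(d_0)_{\partial_1(w)}$. $S_\bullet$-descent datum on a family of sets $R\to I=S_0$: bijections $s_\ell:R_i\to R_j$ for each $i\xrightarrow{\ell}j$ in $S_1$, with $s_{\sigma_0(i)}=\mathrm{id}_{R_i}$ and $s_{\partial_1(w)}=s_{\partial_0(w)}\circ s_{\partial_2(w)}$ for $w\in S_2$. It is consistent if $s_\ell=s_t$ for all $\ell,t:i\to j$ in $S_1$ for which there is an arrow $f:(H_1)_\ell\to(H_1)_t$ with $(d_1)_tf=(d_1)_\ell$ and $(d_0)_tf=(d_0)_\ell$. $H_\bullet$-descent datum on $\gamma^*R\times_{\gamma^*I}U\to U$: for each $i\xrightarrow{\ell}j$ in $S_1$ an isomorphism $\sigma_\ell:\gamma^*R_i\times(H_1)_\ell\to\gamma^*R_j\times(H_1)_{\ell^{op}}$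 over $(\tau_1)_\ell$; it is determined by its first projection, equivalently by $\widehat\sigma_\ell:(H_1)_\ell\to(\gamma^*R_j)^{\gamma^*R_i}$. One requires (in internal language) $\widehat\sigma_{\sigma_0(i)}((s_0)_i(x))=\mathrm{id}$ for $x\in(H_0)_i$, and $\widehat\sigma_{\partial_0(w)}(d_0x)\circ\widehat\sigma_{\partial_2(w)}(d_2x)=\widehat\sigma_{\partial_1(w)}(d_1x)$ for $w\in S_2$, $x\in(H_2)_w$. For the Čech family this gives $U_\bullet$-descent data $\{\sigma_{j,i}\}_{(i,j)\in N_1}$, $\sigma_{j,i}:\gamma^*R_i\times U_i\times U_j\to\gamma^*R_j\times U_j\times U_i$. The $H_\bullet$-descent datum corresponding to a $U_\bullet$-descent datum $\sigma$ is given by $\widehat\sigma_\ell=\widehat\sigma_{j,i}\circ(h_1)_\ell$ for $i\xrightarrow{\ell}j$; for a hypercover refinement this correspondence is bijective, and an $S_\bullet$-descent datum $\{s_\ell\}$ determines the locally constant object constructed by descent from the $U_\bullet$-descent datum corresponding to $\gamma^*(s_\ell)\times(\tau_1)_\ell$. Locally constant object trivialized by $U\to\gamma^*I$: an object $X$ with a family of sets $\{R_i\}_{i\in I}$ and isomorphisms $\theta_i:\gamma^*R_i\times U_i\to X\times U_i$ over $U_i$. These correspond, by descent, to $U_\bullet$-descent data $\sigma$ via $(\theta_j\times U_i)\circ\sigma_{j,i}=(X\times\tau)\circ(\theta_i\times U_j)$, $\tau$ the symmetry; write $X\sim(R\to I,\sigma)$. It is a covering projection if for each $(i,j)\in N_1$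 the maps $(u,v):V\to U_i\times U_j$ form an epimorphic family, where $V\ne\emptyset$ and $(V,u,v)$ ranges over the action spans, i.e. those for which there is a bijection $s:R_i\to R_j$ with $\sigma_{j,i}\circ(\gamma^*R_i\times(u,v))=(\gamma^*R_j\times(v,u))\circ(\gamma^*s\times V)$. $0$-span refinement. Let $\mathcal{C}$ be a set of non-empty objects, closed under isomorphism (within a fixed small full subcategory of $\mathcal{E}$), with $U_i\in\mathcal{C}$ for all $i$; such $\mathcal{C}$ is called admissible. Let $\mathcal{P}_+[n]$ be the poset of non-empty subsets of $[n]=\{0,\dots,n\}$. $S_n$ is the set of $n$-spans, i.e. functors $D:\mathcal{P}_+[n]^{op}\to\mathcal{E}$ equipped with indices $i_0,\dots,i_n\in I$ such that $D(\{k\})=U_{i_k}$ and $D(A)\in\mathcal{C}$ for all $A$; $H_n=\sum_{D\in S_n}D([n])$. A monotone $\alpha:[m]\to[n]$ sends $D$ to $A\mapsto D(\alpha(A))$ and acts on components by the structure map $D([n])\to D(\alpha([m]))$. Thus $S_0=I$, $H_0=U$, and $S_1$ is the set of all spans $U_i\xleftarrow{u}V\xrightarrow{v}U_j$ with $V\in\mathcal{C}$, with $d_1=u$, $d_0=v$. The self-duality is $D^{op}(A)=D(\rho(A))$, $\rho(k)=n-k$, with $(\tau_n)_D=\mathrm{id}_{D([n])}$. *)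

theory Defs
  imports Main "HOL-Library.Equipollence" "HOL-Library.FuncSet"
begin

section \<open>Universes and categories\<close>

text \<open>The small sets are the sets of cardinality below that of the type 'u. If
  universe holds, the cardinal of 'u is an infinite regular strong limit, so the small subsets
  of 'u are, up to bijection, the sets of a Grothendieck universe, and they stand for Set.
  The countable case (hereditarily finite sets) is not excluded.\<close>

definition small :: "'u itself \<Rightarrow> 's set \<Rightarrow> bool"
  where "small u A \<longleftrightarrow> A \<prec> (UNIV :: 'u set)"

definition universe :: "'u itself \<Rightarrow> bool" where
  "universe u \<longleftrightarrow>
     infinite (UNIV :: 'u set) \<and>
     (\<forall>A :: 'u set. small u A \<longrightarrow> small u (Pow A)) \<and>
     (\<forall>(K :: 'u set) (A :: 'u \<Rightarrow> 'u set).
        small u K \<and> (\<forall>k\<in>K. small u (A k)) \<longrightarrow> small u (\<Union>k\<in>K. A k))"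

record ('o, 'a) cat =
  Ob :: "'o set"
  Ar :: "'a set"
  Src :: "'a \<Rightarrow> 'o"
  Tgt :: "'a \<Rightarrow> 'o"
  Idt :: "'o \<Rightarrow> 'a"
  Cmp :: "'a \<Rightarrow> 'a \<Rightarrow> 'a" (infixr "\<cdot>\<index>" 75)

context
  fixes E :: "('o, 'a) cat" (structure)
begin

definition hom :: "'o \<Rightarrow> 'o \<Rightarrow> 'a set"
  where "hom A B = {f \<in> Ar E. Src E f = A \<and> Tgt E f = B}"

definition category :: bool where
  "category \<longleftrightarrow>
     (\<forall>f\<in>Ar E. Src E f \<in> Ob E \<and> Tgt E f \<in> Ob E) \<and>
     (\<forall>A\<in>Ob E. Idt E A \<in> hom A A) \<and>
     (\<forall>A B C f g. f \<in> hom A B \<and> g \<in> hom B C \<longrightarrow> g \<cdot> f \<in> hom A C) \<and>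
     (\<forall>A B f. f \<in> hom A B \<longrightarrow> f \<cdot> Idt E A = f \<and> Idt E B \<cdot> f = f) \<and>
     (\<forall>A B C D f g h. f \<in> hom A B \<and> g \<in> hom B C \<and> h \<in> hom C D \<longrightarrow>
        (h \<cdot> g) \<cdot> f = h \<cdot> (g \<cdot> f))"

definition iso :: "'a \<Rightarrow> bool" where
  "iso f \<longleftrightarrow> f \<in> Ar E \<and>
     (\<exists>g \<in> hom (Tgt E f) (Src E f). g \<cdot> f = Idt E (Src E f) \<and> f \<cdot> g = Idt E (Tgt E f))"

definition isomorphic :: "'o \<Rightarrow> 'o \<Rightarrow> bool"
  where "isomorphic A B \<longleftrightarrow> (\<exists>f \<in> hom A B. iso f)"

definition monic :: "'a \<Rightarrow> bool" where
  "monic f \<longleftrightarrow> f \<in> Ar E \<and>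
     (\<forall>A. \<forall>g \<in> hom A (Src E f). \<forall>h \<in> hom A (Src E f). f \<cdot> g = f \<cdot> h \<longrightarrow> g = h)"

definition epi_family :: "'o \<Rightarrow> 'a set \<Rightarrow> bool" where
  "epi_family B F \<longleftrightarrow> (\<forall>f\<in>F. f \<in> Ar E \<and> Tgt E f = B) \<and>
     (\<forall>C. \<forall>g \<in> hom B C. \<forall>h \<in> hom B C. (\<forall>f\<in>F. g \<cdot> f = h \<cdot> f) \<longrightarrow> g = h)"

definition epi :: "'a \<Rightarrow> bool" where
  "epi f \<longleftrightarrow> f \<in> Ar E \<and>
     (\<forall>C. \<forall>g \<in> hom (Tgt E f) C. \<forall>h \<in> hom (Tgt E f) C. g \<cdot> f = h \<cdot> f \<longrightarrow> g = h)"


section \<open>Limits and colimits\<close>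

definition terminal :: "'o \<Rightarrow> bool"
  where "terminal T \<longleftrightarrow> T \<in> Ob E \<and> (\<forall>A\<in>Ob E. \<exists>!f. f \<in> hom A T)"

definition initial :: "'o \<Rightarrow> bool"
  where "initial Z \<longleftrightarrow> Z \<in> Ob E \<and> (\<forall>A\<in>Ob E. \<exists>!f. f \<in> hom Z A)"

definition is_product :: "'o \<Rightarrow> 'o \<Rightarrow> 'o \<Rightarrow> 'a \<Rightarrow> 'a \<Rightarrow> bool" where
  "is_product A B P p q \<longleftrightarrow> p \<in> hom P A \<and> q \<in> hom P B \<and>
     (\<forall>C. \<forall>f \<in> hom C A. \<forall>g \<in> hom C B. \<exists>!h. h \<in> hom C P \<and> p \<cdot> h = f \<and> q \<cdot> h = g)"

definition is_pullback :: "'a \<Rightarrow> 'a \<Rightarrow> 'o \<Rightarrow> 'a \<Rightarrow> 'a \<Rightarrow> bool" where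
  "is_pullback f g P p q \<longleftrightarrow> f \<in> Ar E \<and> g \<in> Ar E \<and> Tgt E f = Tgt E g \<and>
     p \<in> hom P (Src E f) \<and> q \<in> hom P (Src E g) \<and> f \<cdot> p = g \<cdot> q \<and>
     (\<forall>C. \<forall>x \<in> hom C (Src E f). \<forall>y \<in> hom C (Src E g). f \<cdot> x = g \<cdot> y \<longrightarrow>
        (\<exists>!h. h \<in> hom C P \<and> p \<cdot> h = x \<and> q \<cdot> h = y))"

definition is_coequalizer :: "'a \<Rightarrow> 'a \<Rightarrow> 'a \<Rightarrow> bool" where
  "is_coequalizer f g q \<longleftrightarrow> f \<in> Ar E \<and> g \<in> hom (Src E f) (Tgt E f) \<and>
     q \<in> Ar E \<and> Src E q = Tgt E f \<and> q \<cdot> f = q \<cdot> g \<and>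
     (\<forall>C. \<forall>x \<in> hom (Tgt E f) C. x \<cdot> f = x \<cdot> g \<longrightarrow>
        (\<exists>!h. h \<in> hom (Tgt E q) C \<and> h \<cdot> q = x))"

definition is_coproduct :: "'s set \<Rightarrow> ('s \<Rightarrow> 'o) \<Rightarrow> 'o \<Rightarrow> ('s \<Rightarrow> 'a) \<Rightarrow> bool" where
  "is_coproduct K A Q \<iota> \<longleftrightarrow> Q \<in> Ob E \<and> (\<forall>k\<in>K. \<iota> k \<in> hom (A k) Q) \<and>
     (\<forall>C\<in>Ob E. \<forall>f. (\<forall>k\<in>K. f k \<in> hom (A k) C) \<longrightarrow>
        (\<exists>!h. h \<in> hom Q C \<and> (\<forall>k\<in>K. h \<cdot> \<iota> k = f k)))"

text \<open>Chosen terminal object, binary products and coproducts; meaningful whenever they exist,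
  in particular (for small index sets of any type) in a Grothendieck topos.\<close>

definition one :: 'o where "one = (SOME T. terminal T)"

definition bang :: "'o \<Rightarrow> 'a" where "bang A = (THE f. f \<in> hom A one)"

definition product_choice :: "'o \<Rightarrow> 'o \<Rightarrow> 'o \<times> 'a \<times> 'a"
  where "product_choice A B = (SOME (P, p, q). is_product A B P p q)"

definition prd :: "'o \<Rightarrow> 'o \<Rightarrow> 'o" where "prd A B = fst (product_choice A B)"
definition p1 :: "'o \<Rightarrow> 'o \<Rightarrow> 'a" where "p1 A B = fst (snd (product_choice A B))"
definition p2 :: "'o \<Rightarrow> 'o \<Rightarrow> 'a" where "p2 A B = snd (snd (product_choice A B))"

definition pair :: "'a \<Rightarrow> 'a \<Rightarrow> 'a" where
  "pair f g = (THE h. h \<in> hom (Src E f) (prd (Tgt E f) (Tgt E g)) \<and>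
     p1 (Tgt E f) (Tgt E g) \<cdot> h = f \<and> p2 (Tgt E f) (Tgt E g) \<cdot> h = g)"

definition pmap :: "'a \<Rightarrow> 'a \<Rightarrow> 'a" where
  "pmap f g = pair (f \<cdot> p1 (Src E f) (Src E g)) (g \<cdot> p2 (Src E f) (Src E g))"

definition swap :: "'o \<Rightarrow> 'o \<Rightarrow> 'a" where "swap A B = pair (p2 A B) (p1 A B)"

definition assoc :: "'o \<Rightarrow> 'o \<Rightarrow> 'o \<Rightarrow> 'a" where
  \<comment> \<open>from A x (B x C) to (A x B) x C\<close>
  "assoc A B C =
     pair (pair (p1 A (prd B C)) (p1 B C \<cdot> p2 A (prd B C))) (p2 B C \<cdot> p2 A (prd B C))"

definition assoc_inv :: "'o \<Rightarrow> 'o \<Rightarrow> 'o \<Rightarrow> 'a" where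
  "assoc_inv A B C =
     pair (p1 A B \<cdot> p1 (prd A B) C) (pair (p2 A B \<cdot> p1 (prd A B) C) (p2 (prd A B) C))"

definition coproduct_choice :: "'s set \<Rightarrow> ('s \<Rightarrow> 'o) \<Rightarrow> 'o \<times> ('s \<Rightarrow> 'a)"
  where "coproduct_choice K A = (SOME (Q, \<iota>). is_coproduct K A Q \<iota>)"

definition coprod :: "'s set \<Rightarrow> ('s \<Rightarrow> 'o) \<Rightarrow> 'o"
  where "coprod K A = fst (coproduct_choice K A)"

definition incl :: "'s set \<Rightarrow> ('s \<Rightarrow> 'o) \<Rightarrow> 's \<Rightarrow> 'a"
  where "incl K A = snd (coproduct_choice K A)"

definition cotuple :: "'s set \<Rightarrow> ('s \<Rightarrow> 'o) \<Rightarrow> 'o \<Rightarrow> ('s \<Rightarrow> 'a) \<Rightarrow> 'a" where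
  "cotuple K A C f = (THE h. h \<in> hom (coprod K A) C \<and> (\<forall>k\<in>K. h \<cdot> incl K A k = f k))"

text \<open>The inverse image functor, i.e. the left adjoint of the global sections functor
  hom one: its defining universal property is that of a coproduct of copies of one.\<close>

definition gs :: "'s set \<Rightarrow> 'o" where "gs S = coprod S (\<lambda>_. one)"

definition gsmap :: "'s set \<Rightarrow> 't set \<Rightarrow> ('s \<Rightarrow> 't) \<Rightarrow> 'a"
  where "gsmap S T f = cotuple S (\<lambda>_. one) (gs T) (\<lambda>s. incl T (\<lambda>_. one) (f s))"


section \<open>Locally connected Grothendieck toposes\<close>

definition equivalence_relation :: "'a \<Rightarrow> 'a \<Rightarrow> bool" where
  "equivalence_relation r s \<longleftrightarrow> r \<in> Ar E \<and> s \<in> hom (Src E r) (Tgt E r) \<and>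
     (\<forall>C. \<forall>x \<in> hom C (Src E r). \<forall>y \<in> hom C (Src E r).
        r \<cdot> x = r \<cdot> y \<and> s \<cdot> x = s \<cdot> y \<longrightarrow> x = y) \<and>
     (\<exists>d \<in> hom (Tgt E r) (Src E r). r \<cdot> d = Idt E (Tgt E r) \<and> s \<cdot> d = Idt E (Tgt E r)) \<and>
     (\<exists>t \<in> hom (Src E r) (Src E r). r \<cdot> t = s \<and> s \<cdot> t = r) \<and>
     (\<forall>P p q. is_pullback s r P p q \<longrightarrow>
        (\<exists>t \<in> hom P (Src E r). r \<cdot> t = r \<cdot> p \<and> s \<cdot> t = s \<cdot> q))"

definition exact_fork :: "'a \<Rightarrow> 'a \<Rightarrow> 'a \<Rightarrow> bool" where
  "exact_fork r s q \<longleftrightarrow> is_coequalizer r s q \<and> is_pullback q q (Src E r) r s"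

definition stably_exact_fork :: "'a \<Rightarrow> 'a \<Rightarrow> 'a \<Rightarrow> bool" where
  \<comment> \<open>every fork (r', s', q') obtained by pulling back along g is exact\<close>
  "stably_exact_fork r s q \<longleftrightarrow> exact_fork r s q \<and>
     (\<forall>g A' a q' R' b c r' s'.
        is_pullback q g A' a q' \<and> is_pullback (q \<cdot> r) g R' b c \<and>
        r' \<in> hom R' A' \<and> a \<cdot> r' = r \<cdot> b \<and> q' \<cdot> r' = c \<and>
        s' \<in> hom R' A' \<and> a \<cdot> s' = s \<cdot> b \<and> q' \<cdot> s' = c \<longrightarrow> exact_fork r' s' q')"

definition generating :: "'o set \<Rightarrow> bool" where
  "generating G \<longleftrightarrow> G \<subseteq> Ob E \<and>
     (\<forall>A B. \<forall>f \<in> hom A B. \<forall>g \<in> hom A B.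
        (\<forall>C\<in>G. \<forall>c \<in> hom C A. f \<cdot> c = g \<cdot> c) \<longrightarrow> f = g)"

text \<open>Giraud's axioms, in the form of Mac Lane and Moerdijk, Sheaves in Geometry and Logic,
  Appendix.\<close>

definition grothendieck_topos :: "'u itself \<Rightarrow> bool" where
  "grothendieck_topos u \<longleftrightarrow>
     category \<and>
     (\<forall>A\<in>Ob E. \<forall>B\<in>Ob E. small u (hom A B)) \<and>
     (\<exists>T. terminal T) \<and>
     (\<forall>f\<in>Ar E. \<forall>g\<in>Ar E. Tgt E f = Tgt E g \<longrightarrow> (\<exists>P p q. is_pullback f g P p q)) \<and>
     (\<forall>(K :: 'u set) A. small u K \<and> (\<forall>k\<in>K. A k \<in> Ob E) \<longrightarrow> (\<exists>Q \<iota>. is_coproduct K A Q \<iota>)) \<and>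
     (\<forall>(K :: 'u set) A Q \<iota>. small u K \<and> (\<forall>k\<in>K. A k \<in> Ob E) \<and> is_coproduct K A Q \<iota> \<longrightarrow>
        (\<forall>k\<in>K. monic (\<iota> k)) \<and>
        (\<forall>k\<in>K. \<forall>l\<in>K. k \<noteq> l \<longrightarrow> (\<forall>P p q. is_pullback (\<iota> k) (\<iota> l) P p q \<longrightarrow> initial P)) \<and>
        (\<forall>f\<in>Ar E. \<forall>B j x. Tgt E f = Q \<and> (\<forall>k\<in>K. is_pullback f (\<iota> k) (B k) (j k) (x k)) \<longrightarrow>
           is_coproduct K B (Src E f) j)) \<and>
     (\<forall>q. epi q \<longrightarrow> (\<exists>f g. is_coequalizer f g q)) \<and>
     (\<forall>r s. equivalence_relation r s \<longrightarrow> (\<exists>q. exact_fork r s q)) \<and>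
     (\<forall>r s q. exact_fork r s q \<longrightarrow> stably_exact_fork r s q) \<and>
     (\<exists>G. small u G \<and> generating G)"

text \<open>Existence of a left adjoint to the inverse image functor, as existence of a universal
  arrow from every object.\<close>

definition locally_connected :: "'u itself \<Rightarrow> bool" where
  "locally_connected u \<longleftrightarrow>
     (\<forall>X\<in>Ob E. \<exists>P :: 'u set. \<exists>\<eta> \<in> hom X (gs P). small u P \<and>
        (\<forall>S :: 'u set. small u S \<longrightarrow> (\<forall>f \<in> hom X (gs S).
           \<exists>!g. g \<in> P \<rightarrow>\<^sub>E S \<and> f = gsmap P S g \<cdot> \<eta>)))"

definition connected_object :: "'o \<Rightarrow> bool" where
  "connected_object X \<longleftrightarrow> X \<in> Ob E \<and> \<not> initial X \<and>
     (\<forall>A \<iota>. is_coproduct (UNIV :: bool set) A X \<iota> \<longrightarrow> initial (A True) \<or> initial (A False))"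

definition cover :: "'u set \<Rightarrow> ('u \<Rightarrow> 'o) \<Rightarrow> bool" where
  "cover I U \<longleftrightarrow> small TYPE('u) I \<and> (\<forall>i\<in>I. U i \<in> Ob E \<and> \<not> initial (U i)) \<and>
     epi (bang (coprod I U))"

end


section \<open>Simplicial families\<close>

text \<open>A monotone map from [m] to [n] is encoded as the list of its m + 1 values. The face and
  degeneracy operators of a functor on the opposite of the simplex category are its values at
  coface and codegen.\<close>

definition monotone_map :: "nat \<Rightarrow> nat \<Rightarrow> nat list \<Rightarrow> bool"
  where "monotone_map m n \<alpha> \<longleftrightarrow> length \<alpha> = Suc m \<and> sorted \<alpha> \<and> set \<alpha> \<subseteq> {..n}"

definition mcomp :: "nat list \<Rightarrow> nat list \<Rightarrow> nat list"
  where "mcomp \<alpha> \<beta> = map (\<lambda>k. \<alpha> ! k) \<beta>"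

definition coface :: "nat \<Rightarrow> nat \<Rightarrow> nat list"
  \<comment> \<open>from [n - 1] to [n], omitting i\<close>
  where "coface n i = [0..<i] @ [Suc i..<Suc n]"

definition codegen :: "nat \<Rightarrow> nat \<Rightarrow> nat list"
  \<comment> \<open>from [n + 1] to [n], repeating i\<close>
  where "codegen n i = [0..<Suc i] @ [i..<Suc n]"

text \<open>A simplicial family is recorded through its components: Ix n is the set of n-simplices of
  the indexing simplicial set S, and Cp n w is the component of H in degree n at w. For a monotone
  map alpha into [n], ixmap n alpha is its action on the n-simplices of S, and cpmap n alpha w its
  action on Cp n w, with values in the component at ixmap n alpha w. The object of H in degree n is
  the coproduct of the components, and the morphism to the inverse image of S is the one induced on
  coproducts by the maps from the components to one. The fields ixop and cpop hold the strict
  duality.\<close>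

record ('s, 'o, 'a) sfam =
  Ix :: "nat \<Rightarrow> 's set"
  ixmap :: "nat \<Rightarrow> nat list \<Rightarrow> 's \<Rightarrow> 's"
  Cp :: "nat \<Rightarrow> 's \<Rightarrow> 'o"
  cpmap :: "nat \<Rightarrow> nat list \<Rightarrow> 's \<Rightarrow> 'a"
  ixop :: "nat \<Rightarrow> 's \<Rightarrow> 's"
  cpop :: "nat \<Rightarrow> 's \<Rightarrow> 'a"

definition fc :: "('s, 'o, 'a) sfam \<Rightarrow> nat \<Rightarrow> nat \<Rightarrow> 's \<Rightarrow> 's"
  where "fc F n i = ixmap F n (coface n i)"

definition dg :: "('s, 'o, 'a) sfam \<Rightarrow> nat \<Rightarrow> nat \<Rightarrow> 's \<Rightarrow> 's"
  where "dg F n i = ixmap F n (codegen n i)"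

definition cfc :: "('s, 'o, 'a) sfam \<Rightarrow> nat \<Rightarrow> nat \<Rightarrow> 's \<Rightarrow> 'a"
  where "cfc F n i = cpmap F n (coface n i)"

definition cdg :: "('s, 'o, 'a) sfam \<Rightarrow> nat \<Rightarrow> nat \<Rightarrow> 's \<Rightarrow> 'a"
  where "cdg F n i = cpmap F n (codegen n i)"

definition simplicial_set :: "('s, 'o, 'a) sfam \<Rightarrow> bool" where
  "simplicial_set F \<longleftrightarrow>
     (\<forall>m n \<alpha>. monotone_map m n \<alpha> \<longrightarrow> ixmap F n \<alpha> \<in> Ix F n \<rightarrow> Ix F m) \<and>
     (\<forall>n. \<forall>w\<in>Ix F n. ixmap F n [0..<Suc n] w = w) \<and>
     (\<forall>l m n \<alpha> \<beta>. monotone_map m n \<alpha> \<and> monotone_map l m \<beta> \<longrightarrow>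
        (\<forall>w\<in>Ix F n. ixmap F m \<beta> (ixmap F n \<alpha> w) = ixmap F n (mcomp \<alpha> \<beta>) w))"

context
  fixes E :: "('o, 'a) cat" (structure)
begin

definition simplicial_family :: "'u itself \<Rightarrow> ('s, 'o, 'a) sfam \<Rightarrow> bool" where
  "simplicial_family u F \<longleftrightarrow>
     (\<forall>n. small u (Ix F n)) \<and> simplicial_set F \<and>
     (\<forall>n. \<forall>w\<in>Ix F n. Cp F n w \<in> Ob E \<and> \<not> initial E (Cp F n w)) \<and>
     (\<forall>m n \<alpha>. monotone_map m n \<alpha> \<longrightarrow>
        (\<forall>w\<in>Ix F n. cpmap F n \<alpha> w \<in> hom E (Cp F n w) (Cp F m (ixmap F n \<alpha> w)))) \<and>
     (\<forall>n. \<forall>w\<in>Ix F n. cpmap F n [0..<Suc n] w = Idt E (Cp F n w)) \<and>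
     (\<forall>l m n \<alpha> \<beta>. monotone_map m n \<alpha> \<and> monotone_map l m \<beta> \<longrightarrow>
        (\<forall>w\<in>Ix F n. cpmap F m \<beta> (ixmap F n \<alpha> w) \<cdot> cpmap F n \<alpha> w = cpmap F n (mcomp \<alpha> \<beta>) w))"

definition self_dual :: "('s, 'o, 'a) sfam \<Rightarrow> bool" where
  "self_dual F \<longleftrightarrow>
     (\<forall>n. bij_betw (ixop F n) (Ix F n) (Ix F n)) \<and>
     (\<forall>n. \<forall>w\<in>Ix F n. cpop F n w \<in> hom E (Cp F n w) (Cp F n (ixop F n w)) \<and> iso E (cpop F n w)) \<and>
     (\<forall>w\<in>Ix F 0. ixop F 0 w = w \<and> cpop F 0 w = Idt E (Cp F 0 w)) \<and>
     (\<forall>n i. 1 \<le> n \<and> i \<le> n \<longrightarrow> (\<forall>w\<in>Ix F n.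
        fc F n i (ixop F n w) = ixop F (n - 1) (fc F n (n - i) w) \<and>
        cfc F n i (ixop F n w) \<cdot> cpop F n w
          = cpop F (n - 1) (fc F n (n - i) w) \<cdot> cfc F n (n - i) w)) \<and>
     (\<forall>n i. 1 \<le> n \<and> i \<le> n - 1 \<longrightarrow> (\<forall>w\<in>Ix F (n - 1).
        dg F (n - 1) i (ixop F (n - 1) w) = ixop F n (dg F (n - 1) (n - 1 - i) w) \<and>
        cdg F (n - 1) i (ixop F (n - 1) w) \<cdot> cpop F (n - 1) w
          = cpop F n (dg F (n - 1) (n - 1 - i) w) \<cdot> cdg F (n - 1) (n - 1 - i) w))"

definition tot :: "('s, 'o, 'a) sfam \<Rightarrow> nat \<Rightarrow> 'o"
  where "tot F n = coprod E (Ix F n) (Cp F n)"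

definition totmap :: "('s, 'o, 'a) sfam \<Rightarrow> nat \<Rightarrow> nat \<Rightarrow> nat list \<Rightarrow> 'a" where
  "totmap F m n \<alpha> = cotuple E (Ix F n) (Cp F n) (tot F m)
     (\<lambda>w. incl E (Ix F m) (Cp F m) (ixmap F n \<alpha> w) \<cdot> cpmap F n \<alpha> w)"

text \<open>The value in degree k of the (k - 1)-coskeleton is the limit of the objects in degree m over
  all monotone maps from [m] to [k] with m < k (pointwise right Kan extension).\<close>

definition is_cosk :: "('s, 'o, 'a) sfam \<Rightarrow> nat \<Rightarrow> 'o \<Rightarrow> (nat list \<Rightarrow> 'a) \<Rightarrow> bool" where
  "is_cosk F k L \<pi> \<longleftrightarrow>
     (let cone = (\<lambda>C c.
        (\<forall>m \<alpha>. m < k \<and> monotone_map m k \<alpha> \<longrightarrow> c \<alpha> \<in> hom E C (tot F m)) \<and>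
        (\<forall>l m \<alpha> \<beta>. l < k \<and> m < k \<and> monotone_map m k \<alpha> \<and> monotone_map l m \<beta> \<longrightarrow>
           totmap F l m \<beta> \<cdot> c \<alpha> = c (mcomp \<alpha> \<beta>)))
      in L \<in> Ob E \<and> cone L \<pi> \<and>
         (\<forall>C\<in>Ob E. \<forall>c. cone C c \<longrightarrow>
            (\<exists>!h. h \<in> hom E C L \<and> (\<forall>m \<alpha>. m < k \<and> monotone_map m k \<alpha> \<longrightarrow> \<pi> \<alpha> \<cdot> h = c \<alpha>))))"

text \<open>The bijection v identifies the 0-simplices with I, so that the family agrees in degree 0 with
  the cover; in the literal case where the 0-simplices are the elements of I it is the identity.\<close>

definition hypercover_refinement ::
  "'u set \<Rightarrow> ('u \<Rightarrow> 'o) \<Rightarrow> ('s \<Rightarrow> 'u) \<Rightarrow> ('s, 'o, 'a) sfam \<Rightarrow> bool" where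
  "hypercover_refinement I U v F \<longleftrightarrow>
     simplicial_family TYPE('u) F \<and>
     bij_betw v (Ix F 0) I \<and> (\<forall>x\<in>Ix F 0. Cp F 0 x = U (v x)) \<and>
     (\<forall>k\<ge>1. \<exists>L \<pi> h. is_cosk F k L \<pi> \<and> h \<in> hom E (tot F k) L \<and>
        (\<forall>m \<alpha>. m < k \<and> monotone_map m k \<alpha> \<longrightarrow> \<pi> \<alpha> \<cdot> h = totmap F m k \<alpha>) \<and> epi E h)"

definition condition_G :: "('s, 'o, 'a) sfam \<Rightarrow> bool" where
  "condition_G F \<longleftrightarrow>
     (\<forall>e\<in>Ix F 1. \<exists>w\<in>Ix F 2. fc F 2 2 w = e \<and> fc F 2 0 w = ixop F 1 e \<and>
        cfc F 1 1 (fc F 2 1 w) = cfc F 1 0 (fc F 2 1 w))"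


subsection \<open>The Cech family\<close>

fun lprd :: "('u \<Rightarrow> 'o) \<Rightarrow> 'u list \<Rightarrow> 'o" where
  "lprd U [] = one E"
| "lprd U [i] = U i"
| "lprd U (i # j # is) = prd E (U i) (lprd U (j # is))"

fun lproj :: "('u \<Rightarrow> 'o) \<Rightarrow> 'u list \<Rightarrow> nat \<Rightarrow> 'a" where
  "lproj U [] k = undefined"
| "lproj U [i] k = Idt E (U i)"
| "lproj U (i # j # is) 0 = p1 E (U i) (lprd U (j # is))"
| "lproj U (i # j # is) (Suc k) = lproj U (j # is) k \<cdot> p2 E (U i) (lprd U (j # is))"

fun ltuple :: "'a list \<Rightarrow> 'a" where
  "ltuple [] = undefined"
| "ltuple [f] = f"
| "ltuple (f # g # fs) = pair E f (ltuple (g # fs))"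

definition cech :: "'u set \<Rightarrow> ('u \<Rightarrow> 'o) \<Rightarrow> ('u list, 'o, 'a) sfam" where
  "cech I U =
    \<lparr> Ix = (\<lambda>n. {is. length is = Suc n \<and> set is \<subseteq> I \<and> \<not> initial E (lprd U is)}),
      ixmap = (\<lambda>n \<alpha> is. map (\<lambda>k. is ! k) \<alpha>),
      Cp = (\<lambda>n is. lprd U is),
      cpmap = (\<lambda>n \<alpha> is. ltuple (map (lproj U is) \<alpha>)),
      ixop = (\<lambda>n is. rev is),
      cpop = (\<lambda>n is. ltuple (map (lproj U is) (rev [0..<Suc n]))) \<rparr>"

text \<open>The canonical morphism to the Cech family, given by the vertices; [k] encodes the k-th vertex
  as a map from [0] to [n].\<close>

definition cech_ix :: "('s \<Rightarrow> 'u) \<Rightarrow> ('s, 'o, 'a) sfam \<Rightarrow> nat \<Rightarrow> 's \<Rightarrow> 'u list"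
  where "cech_ix v F n w = map (\<lambda>k. v (ixmap F n [k] w)) [0..<Suc n]"

definition cech_cp :: "('s, 'o, 'a) sfam \<Rightarrow> nat \<Rightarrow> 's \<Rightarrow> 'a"
  where "cech_cp F n w = ltuple (map (\<lambda>k. cpmap F n [k] w) [0..<Suc n])"


section \<open>Descent data\<close>

text \<open>Families of sets are indexed here by the 0-simplices of F.\<close>

definition S_descent_datum ::
  "('s, 'o, 'a) sfam \<Rightarrow> ('s \<Rightarrow> 'u set) \<Rightarrow> ('s \<Rightarrow> 'u \<Rightarrow> 'u) \<Rightarrow> bool" where
  "S_descent_datum F R s \<longleftrightarrow>
     (\<forall>e\<in>Ix F 1. bij_betw (s e) (R (fc F 1 1 e)) (R (fc F 1 0 e))) \<and>
     (\<forall>i\<in>Ix F 0. \<forall>r\<in>R i. s (dg F 0 0 i) r = r) \<and>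
     (\<forall>w\<in>Ix F 2. \<forall>r\<in>R (fc F 1 1 (fc F 2 2 w)).
        s (fc F 2 1 w) r = s (fc F 2 0 w) (s (fc F 2 2 w) r))"

definition consistent ::
  "('s, 'o, 'a) sfam \<Rightarrow> ('s \<Rightarrow> 'u set) \<Rightarrow> ('s \<Rightarrow> 'u \<Rightarrow> 'u) \<Rightarrow> bool" where
  "consistent F R s \<longleftrightarrow>
     (\<forall>e\<in>Ix F 1. \<forall>t\<in>Ix F 1. fc F 1 1 e = fc F 1 1 t \<and> fc F 1 0 e = fc F 1 0 t \<and>
        (\<exists>f \<in> hom E (Cp F 1 e) (Cp F 1 t).
           cfc F 1 1 t \<cdot> f = cfc F 1 1 e \<and> cfc F 1 0 t \<cdot> f = cfc F 1 0 e) \<longrightarrow>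
        (\<forall>r\<in>R (fc F 1 1 e). s e r = s t r))"

text \<open>The conditions on the transpose of sigma e, from the component at e to the exponential, are
  written for its uncurried form, the first projection of sigma e.\<close>

definition first_proj ::
  "('s, 'o, 'a) sfam \<Rightarrow> ('s \<Rightarrow> 'u set) \<Rightarrow> ('s \<Rightarrow> 'a) \<Rightarrow> 's \<Rightarrow> 'a" where
  "first_proj F R \<sigma> e = p1 E (gs E (R (fc F 1 0 e))) (Cp F 1 (ixop F 1 e)) \<cdot> \<sigma> e"

definition H_descent_datum ::
  "('s, 'o, 'a) sfam \<Rightarrow> ('s \<Rightarrow> 'u set) \<Rightarrow> ('s \<Rightarrow> 'a) \<Rightarrow> bool" where
  "H_descent_datum F R \<sigma> \<longleftrightarrow>
     (\<forall>e\<in>Ix F 1. let i = fc F 1 1 e; j = fc F 1 0 e in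
        iso E (\<sigma> e) \<and>
        \<sigma> e \<in> hom E (prd E (gs E (R i)) (Cp F 1 e)) (prd E (gs E (R j)) (Cp F 1 (ixop F 1 e))) \<and>
        p2 E (gs E (R j)) (Cp F 1 (ixop F 1 e)) \<cdot> \<sigma> e
          = cpop F 1 e \<cdot> p2 E (gs E (R i)) (Cp F 1 e)) \<and>
     (\<forall>i\<in>Ix F 0. first_proj F R \<sigma> (dg F 0 0 i) \<cdot> pmap E (Idt E (gs E (R i))) (cdg F 0 0 i)
        = p1 E (gs E (R i)) (Cp F 0 i)) \<and>
     (\<forall>w\<in>Ix F 2. let i = fc F 1 1 (fc F 2 2 w) in
        first_proj F R \<sigma> (fc F 2 0 w) \<cdot>
          pair E (first_proj F R \<sigma> (fc F 2 2 w) \<cdot> pmap E (Idt E (gs E (R i))) (cfc F 2 2 w))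
                 (cfc F 2 0 w \<cdot> p2 E (gs E (R i)) (Cp F 2 w))
        = first_proj F R \<sigma> (fc F 2 1 w) \<cdot> pmap E (Idt E (gs E (R i))) (cfc F 2 1 w))"

text \<open>The arrow written sigma with indices j, i in the literature is \<sigma> [i, j].\<close>

definition U_descent_datum ::
  "'u set \<Rightarrow> ('u \<Rightarrow> 'o) \<Rightarrow> ('u \<Rightarrow> 'u set) \<Rightarrow> ('u list \<Rightarrow> 'a) \<Rightarrow> bool" where
  "U_descent_datum I U R \<sigma> \<longleftrightarrow> H_descent_datum (cech I U) (R \<circ> hd) \<sigma>"

definition corresponding_datum ::
  "'u set \<Rightarrow> ('u \<Rightarrow> 'o) \<Rightarrow> ('s \<Rightarrow> 'u) \<Rightarrow> ('s, 'o, 'a) sfam \<Rightarrow> ('u \<Rightarrow> 'u set) \<Rightarrow>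
   ('u list \<Rightarrow> 'a) \<Rightarrow> 's \<Rightarrow> 'a" where
  "corresponding_datum I U v F R \<sigma> e =
     pair E (first_proj (cech I U) (R \<circ> hd) \<sigma> (cech_ix v F 1 e) \<cdot>
               pmap E (Idt E (gs E (R (v (fc F 1 1 e))))) (cech_cp F 1 e))
            (cpop F 1 e \<cdot> p2 E (gs E (R (v (fc F 1 1 e)))) (Cp F 1 e))"

definition constant_datum ::
  "('s, 'o, 'a) sfam \<Rightarrow> ('s \<Rightarrow> 'u set) \<Rightarrow> ('s \<Rightarrow> 'u \<Rightarrow> 'u) \<Rightarrow> 's \<Rightarrow> 'a" where
  "constant_datum F R s e =
     pmap E (gsmap E (R (fc F 1 1 e)) (R (fc F 1 0 e)) (s e)) (cpop F 1 e)"


section \<open>Locally constant objects and covering projections\<close>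

definition trivialization ::
  "'u set \<Rightarrow> ('u \<Rightarrow> 'o) \<Rightarrow> 'o \<Rightarrow> ('u \<Rightarrow> 'u set) \<Rightarrow> ('u \<Rightarrow> 'a) \<Rightarrow> bool" where
  "trivialization I U X R \<theta> \<longleftrightarrow> X \<in> Ob E \<and>
     (\<forall>i\<in>I. small TYPE('u) (R i) \<and> iso E (\<theta> i) \<and>
        \<theta> i \<in> hom E (prd E (gs E (R i)) (U i)) (prd E X (U i)) \<and>
        p2 E X (U i) \<cdot> \<theta> i = p2 E (gs E (R i)) (U i))"

text \<open>X ~ (R, \<sigma>); the associativity isomorphisms are explicit.\<close>

definition locally_constant ::
  "'u set \<Rightarrow> ('u \<Rightarrow> 'o) \<Rightarrow> 'o \<Rightarrow> ('u \<Rightarrow> 'u set) \<Rightarrow> ('u list \<Rightarrow> 'a) \<Rightarrow> bool" where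
  "locally_constant I U X R \<sigma> \<longleftrightarrow> U_descent_datum I U R \<sigma> \<and>
     (\<exists>\<theta>. trivialization I U X R \<theta> \<and>
        (\<forall>i j. [i, j] \<in> Ix (cech I U) 1 \<longrightarrow>
           pmap E (\<theta> j) (Idt E (U i)) \<cdot> assoc E (gs E (R j)) (U j) (U i) \<cdot> \<sigma> [i, j]
           = assoc E X (U j) (U i) \<cdot> pmap E (Idt E X) (swap E (U i) (U j)) \<cdot>
             assoc_inv E X (U i) (U j) \<cdot>
             pmap E (\<theta> i) (Idt E (U j)) \<cdot> assoc E (gs E (R i)) (U i) (U j)))"

definition action_span ::
  "('u \<Rightarrow> 'o) \<Rightarrow> ('u \<Rightarrow> 'u set) \<Rightarrow> ('u list \<Rightarrow> 'a) \<Rightarrow> 'u \<Rightarrow> 'u \<Rightarrow> 'o \<Rightarrow> 'a \<Rightarrow> 'a \<Rightarrow> bool" where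
  "action_span U R \<sigma> i j V x y \<longleftrightarrow>
     V \<in> Ob E \<and> \<not> initial E V \<and> x \<in> hom E V (U i) \<and> y \<in> hom E V (U j) \<and>
     (\<exists>s. bij_betw s (R i) (R j) \<and>
        \<sigma> [i, j] \<cdot> pmap E (Idt E (gs E (R i))) (pair E x y)
        = pmap E (Idt E (gs E (R j))) (pair E y x) \<cdot>
          pmap E (gsmap E (R i) (R j) s) (Idt E V))"

definition covering_projection ::
  "'u set \<Rightarrow> ('u \<Rightarrow> 'o) \<Rightarrow> 'o \<Rightarrow> ('u \<Rightarrow> 'u set) \<Rightarrow> ('u list \<Rightarrow> 'a) \<Rightarrow> bool" where
  "covering_projection I U X R \<sigma> \<longleftrightarrow> locally_constant I U X R \<sigma> \<and>
     (\<forall>i j. [i, j] \<in> Ix (cech I U) 1 \<longrightarrow>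
        epi_family E (prd E (U i) (U j)) {pair E x y | V x y. action_span U R \<sigma> i j V x y})"


section \<open>The 0-span refinement\<close>

definition admissible ::
  "'u set \<Rightarrow> ('u \<Rightarrow> 'o) \<Rightarrow> 'o set \<Rightarrow> 'o set \<Rightarrow> bool" where
  \<comment> \<open>closure under isomorphism is within the small set K of objects\<close>
  "admissible I U K C \<longleftrightarrow> K \<subseteq> Ob E \<and> small TYPE('u) K \<and> C \<subseteq> K \<and>
     (\<forall>A\<in>C. \<not> initial E A) \<and> (\<forall>A\<in>C. \<forall>B\<in>K. isomorphic E A B \<longrightarrow> B \<in> C) \<and> (\<forall>i\<in>I. U i \<in> C)"

end

definition nonempty_subsets :: "nat \<Rightarrow> nat set set"
  where "nonempty_subsets n = Pow {..n} - {{}}"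

text \<open>An n-span is (is, D, d) with indices is, objects D A, and structure maps d A B from D A to D B
  for B a subset of A; all are undefined outside their domain, so that equality of n-spans is
  equality of functors with indices.\<close>

type_synonym ('u, 'o, 'a) span = "'u list \<times> (nat set \<Rightarrow> 'o) \<times> (nat set \<Rightarrow> nat set \<Rightarrow> 'a)"

definition spans ::
  "('o, 'a) cat \<Rightarrow> 'u set \<Rightarrow> ('u \<Rightarrow> 'o) \<Rightarrow> 'o set \<Rightarrow> nat \<Rightarrow> ('u, 'o, 'a) span set" where
  "spans E I U C n = {(is, D, d).
     length is = Suc n \<and> set is \<subseteq> I \<and>
     D \<in> nonempty_subsets n \<rightarrow>\<^sub>E C \<and>
     (\<forall>k\<le>n. D {k} = U (is ! k)) \<and>
     (\<forall>A\<in>nonempty_subsets n. \<forall>B\<in>nonempty_subsets n. B \<subseteq> A \<longrightarrow> d A B \<in> hom E (D A) (D B)) \<and>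
     (\<forall>A B. \<not> (A \<in> nonempty_subsets n \<and> B \<in> nonempty_subsets n \<and> B \<subseteq> A) \<longrightarrow> d A B = undefined) \<and>
     (\<forall>A\<in>nonempty_subsets n. d A A = Idt E (D A)) \<and>
     (\<forall>A\<in>nonempty_subsets n. \<forall>B\<in>nonempty_subsets n. \<forall>B'\<in>nonempty_subsets n.
        B \<subseteq> A \<and> B' \<subseteq> B \<longrightarrow> d B B' \<cdot>\<^bsub>E\<^esub> d A B = d A B')}"

definition span_reindex ::
  "nat \<Rightarrow> (nat \<Rightarrow> nat) \<Rightarrow> ('u, 'o, 'a) span \<Rightarrow> ('u, 'o, 'a) span" where
  \<comment> \<open>restriction along A \<mapsto> \<alpha> ` A, for \<alpha> from [m]\<close>
  "span_reindex m \<alpha> = (\<lambda>(is, D, d).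
     (map (\<lambda>k. is ! \<alpha> k) [0..<Suc m],
      (\<lambda>A. if A \<in> nonempty_subsets m then D (\<alpha> ` A) else undefined),
      (\<lambda>A B. if A \<in> nonempty_subsets m \<and> B \<in> nonempty_subsets m \<and> B \<subseteq> A
             then d (\<alpha> ` A) (\<alpha> ` B) else undefined)))"

definition zero_span_family ::
  "('o, 'a) cat \<Rightarrow> 'u set \<Rightarrow> ('u \<Rightarrow> 'o) \<Rightarrow> 'o set \<Rightarrow> (('u, 'o, 'a) span, 'o, 'a) sfam" where
  "zero_span_family E I U C =
    \<lparr> Ix = spans E I U C,
      ixmap = (\<lambda>n \<alpha>. span_reindex (length \<alpha> - 1) (\<lambda>k. \<alpha> ! k)),
      Cp = (\<lambda>n (is, D, d). D {..n}),
      cpmap = (\<lambda>n \<alpha> (is, D, d). d {..n} (set \<alpha>)),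
      ixop = (\<lambda>n. span_reindex n (\<lambda>k. n - k)),
      cpop = (\<lambda>n (is, D, d). Idt E (D {..n})) \<rparr>"

definition span_vertex :: "('u, 'o, 'a) span \<Rightarrow> 'u"
  where "span_vertex = (\<lambda>(is, D, d). hd is)"

end

theory Submission
  imports Defs
begin

text \<open>A locally connected topos has a small set of generators \<open>V\<close> that are connected in the strong
  sense that every map from \<open>V\<close> to a small coproduct factors through one summand; so every map from
  \<open>V\<close> to a constant object is constant, and a \<open>U\<close>-descent datum \<open>\<sigma>\<close> is the same as a coherent
  system of bijections \<open>R\<^sub>i \<rightarrow> R\<^sub>j\<close>, one for each pair of elements \<open>V \<rightarrow> U\<^sub>i\<close>, \<open>V \<rightarrow> U\<^sub>j\<close>, which does
  not change under restriction along \<open>V' \<rightarrow> V\<close>.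

  Hence every span \<open>U\<^sub>i \<leftarrow> V \<rightarrow> U\<^sub>j\<close> with connected apex is an action span for \<open>\<sigma>\<close>. The spans of all
  dimensions built from the \<open>U\<^sub>i\<close> and these generators, restricted to those all of whose edges are
  action spans, form a refinement of the required kind: a matching family over \<open>V\<close> is filled by the
  span with \<open>V\<close> as its value at the top, and condition G is witnessed by reindexing along
  \<open>0, 1, 0\<close>. When the \<open>U\<^sub>i\<close> are connected, no restriction on the edges is needed.

  Conversely, let \<open>s\<close> be a consistent descent datum on a refinement. Condition G and
  consistency give \<open>s (\<ell>\<^sup>o\<^sup>p) \<circ> s \<ell> = id\<close>. Two edges with elements over the same pair of elements
  of \<open>U\<^sub>i\<close> and \<open>U\<^sub>j\<close> act alike: locally, the first, the opposite of the second and a degenerate edge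
  bound a triangle. Therefore the \<open>s \<ell>\<close> glue,
  along the epimorphic family of the \<open>(H\<^sub>1)\<^sub>\<ell> \<rightarrow> U\<^sub>i \<times> U\<^sub>j\<close>, to a \<open>U\<close>-descent datum, and \<open>X\<close> is the
  quotient of \<open>\<Sum>\<^sub>i \<gamma>\<^sup>*R\<^sub>i \<times> U\<^sub>i\<close> by the equivalence relation that it generates.\<close>

section \<open>Small sets\<close>

text \<open>In a topos given by Giraud's axioms, epimorphisms lift elements only locally, and the
  maps into exponentials occur here uncurried. So equations between arrows are tested on elements
  whose stage is a generator, arrows are built by gluing along epimorphic families, and a descent
  datum is handled through the functions \<open>act\<close>. As \<open>act\<close> does not change
  under restriction, an identity between such functions may be checked on one member of a cover of
  the stage; there is one because connected stages are not initial. The generators are the fibres of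
  the unit from X to \<open>\<gamma>\<^sup>*P\<close>: the map recording in which summand an element
  of a fibre lands, extended by a constant, factors through P. The obstacle in the first claim is
  that the \<open>U\<^sub>i\<close> may be disconnected, so a span with apex
  \<open>U\<^sub>i\<close> may act non-constantly. The condition on edges must still admit
  degenerate edges, whose apex is such a \<open>U\<^sub>i\<close>, and be stable under maps that are
  not monotone, since the witness of condition G is one. Spans moreover lie outside the universe
  type over which the claim quantifies, so their simplices are relabelled, the vertices becoming I
  itself.\<close>

lemma small_cong_itself: "small (u :: 'u itself) K \<longleftrightarrow> small TYPE('u) K"
  by (simp add: small_def)

lemma small_lepoll: "small u B \<Longrightarrow> A \<lesssim> B \<Longrightarrow> small u A"
  unfolding small_def by (rule lesspoll_trans1)

lemma small_subset: "small u B \<Longrightarrow> A \<subseteq> B \<Longrightarrow> small u A"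
  by (rule small_lepoll[OF _ subset_imp_lepoll])

lemma small_image: "small u A \<Longrightarrow> small u (f ` A)"
  by (rule small_lepoll[OF _ image_lepoll])

lemma small_inj_on: "inj_on f A \<Longrightarrow> f ` A \<subseteq> B \<Longrightarrow> small u B \<Longrightarrow> small u A"
  by (meson small_lepoll lepoll_def)

lemma small_finite: "universe u \<Longrightarrow> finite A \<Longrightarrow> small u A"
  unfolding small_def universe_def by (simp add: finite_lesspoll_infinite)

lemma small_encode:
  assumes "small (u :: 'u itself) A"
  obtains f :: "'s \<Rightarrow> 'u" where "inj_on f A"
  using assms unfolding small_def lesspoll_def lepoll_def by auto

lemma universe_UN:
  fixes A :: "'u \<Rightarrow> 'u set"
  assumes "universe (u :: 'u itself)" "small u K" "\<And>k. k \<in> K \<Longrightarrow> small u (A k)"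
  shows "small u (\<Union>k\<in>K. A k)"
proof -
  have "\<forall>(K :: 'u set) (A :: 'u \<Rightarrow> 'u set).
      small u K \<and> (\<forall>k\<in>K. small u (A k)) \<longrightarrow> small u (\<Union>k\<in>K. A k)"
    using assms(1) unfolding universe_def by (elim conjE)
  from this[rule_format, of K A] show ?thesis using assms(2,3) by simp
qed

text \<open>An infinite cardinal equals its own square. The pairing of codes obtained from it makes
  disjoint unions small.\<close>

lemma ex_inj_pair:
  includes cardinal_syntax
  assumes "universe (u :: 'u itself)"
  shows "\<exists>f :: 'u \<times> 'u \<Rightarrow> 'u. inj f"
proof -
  have "infinite (UNIV :: 'u set)" using assms by (simp add: universe_def)
  then have "|UNIV \<times> UNIV :: ('u \<times> 'u) set| \<le>o |UNIV :: 'u set|"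
    using card_of_Times_same_infinite ordIso_imp_ordLeq by blast
  then show ?thesis by (metis UNIV_Times_UNIV card_of_ordLeq)
qed

text \<open>The closure of the universe under unions concerns subsets of the type \<open>'u\<close>.
  A disjoint union of sets of other types is coded there by pairing the code \<open>f k\<close> of
  the index with a code \<open>g k a\<close> of the element.\<close>

lemma small_Sigma:
  fixes A :: "'s \<Rightarrow> 't set"
  assumes u: "universe (u :: 'u itself)" and K: "small u K" and A: "\<And>k. k \<in> K \<Longrightarrow> small u (A k)"
  shows "small u (Sigma K A)"
proof -
  obtain p :: "'u \<times> 'u \<Rightarrow> 'u" where p: "inj p" using ex_inj_pair[OF u] by blast
  obtain f :: "'s \<Rightarrow> 'u" where f: "inj_on f K" using small_encode[OF K] .
  have "\<exists>g :: 't \<Rightarrow> 'u. inj_on g (A k)" if "k \<in> K" for k using small_encode[OF A[OF that]] by blast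
  then obtain g :: "'s \<Rightarrow> 't \<Rightarrow> 'u" where g: "\<And>k. k \<in> K \<Longrightarrow> inj_on (g k) (A k)" by metis
  \<comment> \<open>The codes of the summand whose index has code \<open>x\<close>.\<close>
  let ?A = "\<lambda>x. (\<lambda>a. p (x, g (inv_into K f x) a)) ` A (inv_into K f x)"
  have small: "small u (\<Union>x\<in>f ` K. ?A x)"
  proof -
    have "small u (f ` K)" by (rule small_image[OF K])
    moreover have "small u (?A x)" if "x \<in> f ` K" for x
      by (rule small_image[OF A]) (use that in \<open>simp add: inv_into_into\<close>)
    ultimately show ?thesis by (intro universe_UN[OF u]) auto
  qed
  show ?thesis
  proof (rule small_inj_on[OF _ _ small])
    show "inj_on (\<lambda>(k, a). p (f k, g k a)) (Sigma K A)"
    proof (rule inj_onI, clarify)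
      fix k a l b
      assume k: "k \<in> K" "l \<in> K" and a: "a \<in> A k" "b \<in> A l" and "p (f k, g k a) = p (f l, g l b)"
      then have "f k = f l" "g k a = g l b" using p by (auto dest: injD)
      moreover from this have "k = l" using f k by (meson inj_onD)
      ultimately show "k = l \<and> a = b" using g k a by (metis inj_onD)
    qed
    show "(\<lambda>(k, a). p (f k, g k a)) ` Sigma K A \<subseteq> (\<Union>x\<in>f ` K. ?A x)"
      using f by (auto intro!: image_eqI)
  qed
qed

lemma small_UN:
  assumes "universe u" "small u K" "\<And>k. k \<in> K \<Longrightarrow> small u (A k)"
  shows "small u (\<Union>k\<in>K. A k)"
proof -
  have "(\<Union>k\<in>K. A k) \<subseteq> snd ` Sigma K A"
  proof clarify
    fix k x assume "k \<in> K" "x \<in> A k"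
    then show "x \<in> snd ` Sigma K A" by (intro image_eqI[of _ _ "(k, x)"]) auto
  qed
  moreover have "small u (snd ` Sigma K A)" by (intro small_image small_Sigma assms)
  ultimately show ?thesis by (rule small_subset[rotated])
qed

lemma small_Times: "universe u \<Longrightarrow> small u A \<Longrightarrow> small u B \<Longrightarrow> small u (A \<times> B)"
  using small_Sigma[of u A "\<lambda>_. B"] by simp

lemma small_PiE:
  assumes u: "universe u" and "finite J" and "\<And>j. j \<in> J \<Longrightarrow> small u (B j)"
  shows "small u (Pi\<^sub>E J B)"
  using assms(2,3)
proof (induction J)
  case empty
  then show ?case by (simp add: small_finite[OF u])
next
  case (insert x J)
  then show ?case
    by (simp add: PiE_insert_eq small_image small_Times[OF u])
qed

lemma small_lists:
  assumes u: "universe u" and A: "small u A"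
  shows "small u {xs. length xs = n \<and> set xs \<subseteq> A}"
proof (rule small_inj_on[OF _ _ small_PiE[OF u, of "{..<n}" "\<lambda>_. A"]])
  show "inj_on (\<lambda>xs. \<lambda>k\<in>{..<n}. xs ! k) {xs. length xs = n \<and> set xs \<subseteq> A}"
  proof (rule inj_onI)
    fix xs ys
    assume l: "xs \<in> {xs. length xs = n \<and> set xs \<subseteq> A}" "ys \<in> {xs. length xs = n \<and> set xs \<subseteq> A}"
    assume eq: "(\<lambda>k\<in>{..<n}. xs ! k) = (\<lambda>k\<in>{..<n}. ys ! k)"
    have "xs ! k = ys ! k" if "k < n" for k using fun_cong[OF eq, of k] that by simp
    then show "xs = ys" using l by (auto intro: nth_equalityI)
  qed
  show "(\<lambda>xs. \<lambda>k\<in>{..<n}. xs ! k) ` {xs. length xs = n \<and> set xs \<subseteq> A} \<subseteq> {..<n} \<rightarrow>\<^sub>E A"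
    by (auto simp: PiE_iff subset_iff)
qed (use A in auto)


section \<open>Equational reasoning in a category\<close>

text \<open>All typing conditions are kept in terms of \<open>Ar\<close>, \<open>Src\<close> and \<open>Tgt\<close>, so that the simplifier
  can discharge them without guessing objects.\<close>

locale base_category =
  fixes E :: "('o, 'a) cat" (structure)
  assumes category: "category E"
begin

lemma hom_iff [simp]: "f \<in> hom E A B \<longleftrightarrow> f \<in> Ar E \<and> Src E f = A \<and> Tgt E f = B"
  by (auto simp: hom_def)

lemma Src_Ob [simp]: "f \<in> Ar E \<Longrightarrow> Src E f \<in> Ob E"
  and Tgt_Ob [simp]: "f \<in> Ar E \<Longrightarrow> Tgt E f \<in> Ob E"
  using category by (auto simp: category_def)

lemma Idt_type [simp]:
  assumes "A \<in> Ob E"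
  shows "Idt E A \<in> Ar E" "Src E (Idt E A) = A" "Tgt E (Idt E A) = A"
  using category assms by (auto simp: category_def)

lemma Cmp_type [simp]:
  assumes "f \<in> Ar E" "g \<in> Ar E" "Tgt E f = Src E g"
  shows "g \<cdot> f \<in> Ar E" "Src E (g \<cdot> f) = Src E f" "Tgt E (g \<cdot> f) = Tgt E g"
proof -
  have "\<forall>A B C f g. f \<in> hom E A B \<and> g \<in> hom E B C \<longrightarrow> g \<cdot> f \<in> hom E A C"
    using category unfolding category_def by blast
  then have "g \<cdot> f \<in> hom E (Src E f) (Tgt E g)" using assms by (metis hom_iff)
  then show "g \<cdot> f \<in> Ar E" "Src E (g \<cdot> f) = Src E f" "Tgt E (g \<cdot> f) = Tgt E g" by auto
qed

lemma Cmp_Idt [simp]: "f \<in> Ar E \<Longrightarrow> Src E f = A \<Longrightarrow> f \<cdot> Idt E A = f"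
  and Idt_Cmp [simp]: "f \<in> Ar E \<Longrightarrow> Tgt E f = A \<Longrightarrow> Idt E A \<cdot> f = f"
  using category unfolding category_def by (metis hom_iff)+

lemma Cmp_assoc [simp]:
  assumes "f \<in> Ar E" "g \<in> Ar E" "h \<in> Ar E" "Tgt E f = Src E g" "Tgt E g = Src E h"
  shows "(h \<cdot> g) \<cdot> f = h \<cdot> (g \<cdot> f)"
proof -
  have "\<forall>A B C D f g h. f \<in> hom E A B \<and> g \<in> hom E B C \<and> h \<in> hom E C D \<longrightarrow>
        (h \<cdot> g) \<cdot> f = h \<cdot> (g \<cdot> f)"
    using category unfolding category_def by blast
  then show ?thesis using assms by (metis hom_iff)
qed

lemma Cmp_eq_Cmp:
  assumes "g \<cdot> f = g' \<cdot> f'" "f \<in> Ar E" "g \<in> Ar E" "Tgt E f = Src E g" "f' \<in> Ar E" "g' \<in> Ar E"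
    "Tgt E f' = Src E g'" "h \<in> Ar E" "Tgt E h = Src E f" "Tgt E h = Src E f'"
  shows "g \<cdot> (f \<cdot> h) = g' \<cdot> (f' \<cdot> h)"
  using assms by (metis Cmp_assoc)

lemma isoI:
  assumes "f \<in> hom E A B" "g \<in> hom E B A" "g \<cdot> f = Idt E A" "f \<cdot> g = Idt E B"
  shows "iso E f"
  using assms unfolding iso_def by auto

lemma isoE:
  assumes "iso E f"
  obtains g where "f \<in> Ar E" "g \<in> hom E (Tgt E f) (Src E f)" "g \<cdot> f = Idt E (Src E f)"
    "f \<cdot> g = Idt E (Tgt E f)"
  using assms unfolding iso_def by auto

lemma iso_Idt: "A \<in> Ob E \<Longrightarrow> iso E (Idt E A)"
  by (rule isoI[of _ A A "Idt E A"]) auto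

lemma monicD: "monic E f \<Longrightarrow> g \<in> Ar E \<Longrightarrow> h \<in> Ar E \<Longrightarrow> Tgt E g = Src E f \<Longrightarrow> Tgt E h = Src E f
    \<Longrightarrow> f \<cdot> g = f \<cdot> h \<Longrightarrow> g = h"
  unfolding monic_def
proof (clarify)
  assume "g \<in> Ar E" "h \<in> Ar E" "Tgt E g = Src E f" "Tgt E h = Src E f" "f \<cdot> g = f \<cdot> h" "f \<in> Ar E"
    and *: "\<forall>A. \<forall>g\<in>hom E A (Src E f). \<forall>h\<in>hom E A (Src E f). f \<cdot> g = f \<cdot> h \<longrightarrow> g = h"
  \<comment> \<open>The definition of \<open>monic\<close> compares arrows with a common source;
    equality of the composites forces the sources to agree.\<close>
  moreover from this have "Src E g = Src E h" by (metis Cmp_type(2))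
  ultimately show "g = h" by auto
qed

lemma epi_familyD:
  assumes "epi_family E B F" "g \<in> Ar E" "h \<in> Ar E" "Src E g = B" "Src E h = B" "Tgt E g = Tgt E h"
    "\<And>f. f \<in> F \<Longrightarrow> g \<cdot> f = h \<cdot> f"
  shows "g = h"
  using assms unfolding epi_family_def by (metis (full_types) hom_iff)

lemma epi_iff_epi_family: "epi E f \<longleftrightarrow> f \<in> Ar E \<and> epi_family E (Tgt E f) {f}"
  unfolding epi_def epi_family_def by auto

lemma epi_family_mono:
  assumes "epi_family E B F" "F \<subseteq> F'" "\<And>f. f \<in> F' \<Longrightarrow> f \<in> Ar E \<and> Tgt E f = B"
  shows "epi_family E B F'"
  using assms unfolding epi_family_def by blast

lemma initial_unique:
  assumes "initial E Z" "f \<in> Ar E" "g \<in> Ar E" "Src E f = Z" "Src E g = Z" "Tgt E f = Tgt E g"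
  shows "f = g"
proof -
  have "\<exists>!f. f \<in> hom E Z (Tgt E g)" using assms by (auto simp: initial_def simp del: hom_iff)
  then show ?thesis using assms by (metis hom_iff)
qed

lemma terminal_unique:
  assumes "terminal E Z" "f \<in> Ar E" "g \<in> Ar E" "Tgt E f = Z" "Tgt E g = Z" "Src E f = Src E g"
  shows "f = g"
proof -
  have "\<exists>!f. f \<in> hom E (Src E g) Z" using assms by (auto simp: terminal_def simp del: hom_iff)
  then show ?thesis using assms by (metis hom_iff)
qed

lemma is_pullbackD:
  assumes "is_pullback E f g P p q"
  shows "f \<in> Ar E" "g \<in> Ar E" "Tgt E f = Tgt E g" "p \<in> Ar E" "q \<in> Ar E" "Src E p = P" "Src E q = P"
    "Tgt E p = Src E f" "Tgt E q = Src E g" "f \<cdot> p = g \<cdot> q"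
  using assms by (auto simp: is_pullback_def)

lemma is_pullback_ex:
  assumes "is_pullback E f g P p q" "x \<in> Ar E" "y \<in> Ar E" "Tgt E x = Src E f" "Tgt E y = Src E g"
    "Src E x = Src E y" "f \<cdot> x = g \<cdot> y"
  obtains h where "h \<in> Ar E" "Src E h = Src E x" "Tgt E h = P" "p \<cdot> h = x" "q \<cdot> h = y"
proof -
  have "\<exists>!h. h \<in> hom E (Src E x) P \<and> p \<cdot> h = x \<and> q \<cdot> h = y"
    using assms by (simp add: is_pullback_def)
  then show ?thesis using that by auto
qed

lemma is_pullback_unique:
  assumes P: "is_pullback E f g P p q" and h: "h \<in> Ar E" "h' \<in> Ar E" "Tgt E h = P" "Tgt E h' = P"
    "Src E h = Src E h'" "p \<cdot> h = p \<cdot> h'" "q \<cdot> h = q \<cdot> h'"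
  shows "h = h'"
proof -
  note [simp] = is_pullbackD(4-9)[OF P]
  have ty: "p \<cdot> h \<in> hom E (Src E h) (Src E f)" "q \<cdot> h \<in> hom E (Src E h) (Src E g)"
    using h by auto
  moreover have "f \<cdot> (p \<cdot> h) = g \<cdot> (q \<cdot> h)"
    by (rule Cmp_eq_Cmp) (use is_pullbackD[OF P] h in auto)
  ultimately have "\<exists>!k. k \<in> hom E (Src E h) P \<and> p \<cdot> k = p \<cdot> h \<and> q \<cdot> k = q \<cdot> h"
    using P unfolding is_pullback_def by blast
  then show ?thesis using h by (metis hom_iff)
qed

lemma is_coproductD:
  assumes "is_coproduct E K A Q \<iota>"
  shows "Q \<in> Ob E" "k \<in> K \<Longrightarrow> \<iota> k \<in> Ar E" "k \<in> K \<Longrightarrow> Src E (\<iota> k) = A k" "k \<in> K \<Longrightarrow> Tgt E (\<iota> k) = Q"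
    "k \<in> K \<Longrightarrow> A k \<in> Ob E"
  using assms by (auto simp: is_coproduct_def dest: bspec) (metis Src_Ob)

lemma is_coproduct_univ:
  assumes "is_coproduct E K A Q \<iota>" "C \<in> Ob E" "\<forall>k\<in>K. f k \<in> hom E (A k) C"
  shows "\<exists>!h. h \<in> hom E Q C \<and> (\<forall>k\<in>K. h \<cdot> \<iota> k = f k)"
proof -
  have "\<forall>C\<in>Ob E. \<forall>f. (\<forall>k\<in>K. f k \<in> hom E (A k) C) \<longrightarrow>
      (\<exists>!h. h \<in> hom E Q C \<and> (\<forall>k\<in>K. h \<cdot> \<iota> k = f k))"
    using assms(1) unfolding is_coproduct_def by (elim conjE)
  from bspec[OF this assms(2), THEN spec, THEN mp, OF assms(3)] show ?thesis .
qed

lemma is_coproduct_unique: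
  assumes Q: "is_coproduct E K A Q \<iota>" and h: "h \<in> Ar E" "h' \<in> Ar E" "Src E h = Q" "Src E h' = Q"
    "Tgt E h = Tgt E h'" "\<And>k. k \<in> K \<Longrightarrow> h \<cdot> \<iota> k = h' \<cdot> \<iota> k"
  shows "h = h'"
proof -
  note [simp] = is_coproductD[OF Q]
  have "Tgt E h \<in> Ob E" "\<forall>k\<in>K. h \<cdot> \<iota> k \<in> hom E (A k) (Tgt E h)" using h by auto
  then have "\<exists>!g. g \<in> hom E Q (Tgt E h) \<and> (\<forall>k\<in>K. g \<cdot> \<iota> k = h \<cdot> \<iota> k)"
    by (rule is_coproduct_univ[OF Q])
  then show ?thesis using h by (metis hom_iff)
qed

lemma is_coproduct_reindex:
  assumes f: "bij_betw f K K'" and Q: "is_coproduct E K' A Q \<iota>"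
  shows "is_coproduct E K (A \<circ> f) Q (\<iota> \<circ> f)"
proof -
  note [simp] = is_coproductD[OF Q]
  have fK: "f k \<in> K'" if "k \<in> K" for k using f that by (auto simp: bij_betw_def)
  have inv: "inv_into K f k' \<in> K" "f (inv_into K f k') = k'" if "k' \<in> K'" for k'
    using f that by (auto simp: bij_betw_def inv_into_into f_inv_into_f)
  have ex: "\<exists>!h. h \<in> hom E Q C \<and> (\<forall>k\<in>K. h \<cdot> (\<iota> \<circ> f) k = g k)"
    if C: "C \<in> Ob E" and g: "\<forall>k\<in>K. g k \<in> hom E ((A \<circ> f) k) C" for C g
  proof -
    have "g (inv_into K f k) \<in> hom E (A k) C" if "k \<in> K'" for k
      using bspec[OF g inv(1)[OF that]] inv(2)[OF that] by simp
    then have "\<forall>k\<in>K'. g (inv_into K f k) \<in> hom E (A k) C" ..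
    from is_coproduct_univ[OF Q C this]
    obtain h where h: "h \<in> hom E Q C" "\<forall>k\<in>K'. h \<cdot> \<iota> k = g (inv_into K f k)" by blast
    have hf: "h \<cdot> \<iota> (f k) = g k" if "k \<in> K" for k
      using h(2) fK[OF that] f that by (simp add: bij_betw_def)
    have "h' = h" if h': "h' \<in> hom E Q C" "\<forall>k\<in>K. h' \<cdot> \<iota> (f k) = g k" for h'
    proof (rule is_coproduct_unique[OF Q])
      show "h' \<cdot> \<iota> k = h \<cdot> \<iota> k" if "k \<in> K'" for k
        using inv[OF that] h'(2) hf by metis
    qed (use h h' in auto)
    moreover have "\<forall>k\<in>K. h \<cdot> (\<iota> \<circ> f) k = g k" using hf by simp
    ultimately show ?thesis using h(1) unfolding comp_apply by blast
  qed
  show ?thesis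
    using ex unfolding is_coproduct_def by (auto simp: fK)
qed

end

section \<open>Giraud toposes\<close>

locale giraud_topos = base_category E for E :: "('o, 'a) cat" (structure) +
  fixes u :: "'u itself"
  assumes universe: "universe u" and topos: "grothendieck_topos E u"
begin

lemmas giraud = topos[unfolded grothendieck_topos_def]

lemma small_hom: "A \<in> Ob E \<Longrightarrow> B \<in> Ob E \<Longrightarrow> small u (hom E A B)"
  using giraud by (elim conjE) (rule bspec, erule bspec)

lemma terminal_one: "terminal E (one E)"
  unfolding one_def using giraud by (elim conjE) (erule someI_ex)

lemma pullback_ex:
  assumes "f \<in> Ar E" "g \<in> Ar E" "Tgt E f = Tgt E g"
  obtains P p q where "is_pullback E f g P p q"
proof -
  have "\<forall>f\<in>Ar E. \<forall>g\<in>Ar E. Tgt E f = Tgt E g \<longrightarrow> (\<exists>P p q. is_pullback E f g P p q)"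
    using giraud by (elim conjE)
  then show ?thesis using assms that by blast
qed

lemma one_Ob [simp]: "one E \<in> Ob E"
  using terminal_one by (simp add: terminal_def)

lemma bang_type [simp]:
  assumes "A \<in> Ob E"
  shows "bang E A \<in> Ar E" "Src E (bang E A) = A" "Tgt E (bang E A) = one E"
proof -
  have "\<exists>!f. f \<in> hom E A (one E)" using terminal_one assms by (simp only: terminal_def)
  then have "bang E A \<in> hom E A (one E)" unfolding bang_def by (rule theI')
  then show "bang E A \<in> Ar E" "Src E (bang E A) = A" "Tgt E (bang E A) = one E" by auto
qed

lemma one_unique:
  "f \<in> Ar E \<Longrightarrow> g \<in> Ar E \<Longrightarrow> Tgt E f = one E \<Longrightarrow> Tgt E g = one E \<Longrightarrow> Src E f = Src E g \<Longrightarrow> f = g"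
  by (rule terminal_unique[OF terminal_one])

lemma bang_Cmp [simp]: "f \<in> Ar E \<Longrightarrow> Tgt E f = A \<Longrightarrow> bang E A \<cdot> f = bang E (Src E f)"
  by (rule one_unique) auto


subsection \<open>Binary products\<close>

text \<open>Giraud's axioms give pullbacks and a terminal object. All maps to the terminal object
  agree, so a pullback over it is a product, and the choice in \<open>product_choice\<close> is
  meaningful.\<close>

lemma is_product_prd:
  assumes A: "A \<in> Ob E" and B: "B \<in> Ob E"
  shows "is_product E A B (prd E A B) (p1 E A B) (p2 E A B)"
proof -
  obtain P p q where P: "is_pullback E (bang E A) (bang E B) P p q"
    using pullback_ex[of "bang E A" "bang E B"] A B by auto
  have "is_product E A B P p q"
    unfolding is_product_def
  proof (intro conjI allI ballI)
    show "p \<in> hom E P A" "q \<in> hom E P B" using is_pullbackD[OF P] A B by auto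
    fix C f g assume "f \<in> hom E C A" "g \<in> hom E C B"
    moreover from this have "bang E A \<cdot> f = bang E B \<cdot> g" using A B by auto
    ultimately show "\<exists>!h. h \<in> hom E C P \<and> p \<cdot> h = f \<and> q \<cdot> h = g"
      using P A B unfolding is_pullback_def by simp
  qed
  then have "\<exists>x. case x of (P, p, q) \<Rightarrow> is_product E A B P p q" by auto
  then have "case product_choice E A B of (P, p, q) \<Rightarrow> is_product E A B P p q"
    unfolding product_choice_def by (rule someI_ex)
  then show ?thesis unfolding prd_def p1_def p2_def by (simp add: case_prod_unfold)
qed

lemma prd_type [simp]:
  assumes "A \<in> Ob E" "B \<in> Ob E"
  shows "prd E A B \<in> Ob E" "p1 E A B \<in> Ar E" "Src E (p1 E A B) = prd E A B" "Tgt E (p1 E A B) = A"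
    "p2 E A B \<in> Ar E" "Src E (p2 E A B) = prd E A B" "Tgt E (p2 E A B) = B"
proof -
  have "p1 E A B \<in> hom E (prd E A B) A" "p2 E A B \<in> hom E (prd E A B) B"
    using is_product_prd[OF assms] by (simp_all only: is_product_def)
  then show "p1 E A B \<in> Ar E" "Src E (p1 E A B) = prd E A B" "Tgt E (p1 E A B) = A"
    "p2 E A B \<in> Ar E" "Src E (p2 E A B) = prd E A B" "Tgt E (p2 E A B) = B"
    by simp_all
  then show "prd E A B \<in> Ob E" using Src_Ob by metis
qed

lemma pair_ex1:
  assumes "f \<in> Ar E" "g \<in> Ar E" "Src E f = Src E g" "Tgt E f = A" "Tgt E g = B"
  shows "\<exists>!h. h \<in> hom E (Src E f) (prd E A B) \<and> p1 E A B \<cdot> h = f \<and> p2 E A B \<cdot> h = g"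
proof -
  have "A \<in> Ob E" "B \<in> Ob E" using assms by auto
  from is_product_prd[OF this] show ?thesis using assms unfolding is_product_def by simp
qed

lemma pair_type [simp]:
  assumes "f \<in> Ar E" "g \<in> Ar E" "Src E f = Src E g"
  shows "pair E f g \<in> Ar E" "Src E (pair E f g) = Src E f"
    "Tgt E (pair E f g) = prd E (Tgt E f) (Tgt E g)"
  using theI'[OF pair_ex1[OF assms refl refl], folded pair_def] by auto

lemma pair_proj [simp]:
  assumes "f \<in> Ar E" "g \<in> Ar E" "Src E f = Src E g" "Tgt E f = A" "Tgt E g = B"
  shows "p1 E A B \<cdot> pair E f g = f" "p2 E A B \<cdot> pair E f g = g"
  using theI'[OF pair_ex1[OF assms(1-3) refl refl], folded pair_def] assms(4,5) by auto

lemma prd_eqI: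
  assumes "h \<in> Ar E" "h' \<in> Ar E" "Tgt E h = prd E A B" "Tgt E h' = prd E A B" "Src E h = Src E h'"
    "A \<in> Ob E" "B \<in> Ob E" "p1 E A B \<cdot> h = p1 E A B \<cdot> h'" "p2 E A B \<cdot> h = p2 E A B \<cdot> h'"
  shows "h = h'"
proof -
  have "\<exists>!k. k \<in> hom E (Src E (p1 E A B \<cdot> h)) (prd E A B) \<and>
      p1 E A B \<cdot> k = p1 E A B \<cdot> h \<and> p2 E A B \<cdot> k = p2 E A B \<cdot> h"
    by (rule pair_ex1) (use assms in auto)
  moreover have "Src E (p1 E A B \<cdot> h) = Src E h" using assms by simp
  ultimately show ?thesis using assms(1-5,8,9) by (auto simp del: Cmp_type)
qed

lemma pair_Cmp [simp]:
  assumes "f \<in> Ar E" "g \<in> Ar E" "Src E f = Src E g" "h \<in> Ar E" "Tgt E h = Src E g"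
  shows "pair E f g \<cdot> h = pair E (f \<cdot> h) (g \<cdot> h)"
proof (rule prd_eqI[where A = "Tgt E f" and B = "Tgt E g"])
  show "p1 E (Tgt E f) (Tgt E g) \<cdot> (pair E f g \<cdot> h) = p1 E (Tgt E f) (Tgt E g) \<cdot> pair E (f \<cdot> h) (g \<cdot> h)"
    using assms by (subst Cmp_assoc[symmetric]) auto
  show "p2 E (Tgt E f) (Tgt E g) \<cdot> (pair E f g \<cdot> h) = p2 E (Tgt E f) (Tgt E g) \<cdot> pair E (f \<cdot> h) (g \<cdot> h)"
    using assms by (subst Cmp_assoc[symmetric]) auto
qed (use assms in auto)

lemma pair_eta [simp]:
  assumes "h \<in> Ar E" "Tgt E h = prd E A B" "A \<in> Ob E" "B \<in> Ob E"
  shows "pair E (p1 E A B \<cdot> h) (p2 E A B \<cdot> h) = h"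
  by (rule prd_eqI[of _ _ A B]) (use assms in auto)

lemma pair_eq_iff:
  assumes "f \<in> Ar E" "g \<in> Ar E" "Src E f = Src E g" "f' \<in> Ar E" "g' \<in> Ar E" "Src E f' = Src E g'"
    "Tgt E f = Tgt E f'" "Tgt E g = Tgt E g'"
  shows "pair E f g = pair E f' g' \<longleftrightarrow> f = f' \<and> g = g'"
  using pair_proj[of f g "Tgt E f" "Tgt E g"] pair_proj[of f' g' "Tgt E f" "Tgt E g"] assms by metis

lemma prd_cases:
  assumes "h \<in> Ar E" "Tgt E h = prd E A B" "A \<in> Ob E" "B \<in> Ob E"
  obtains f g where "f \<in> Ar E" "g \<in> Ar E" "Src E h = Src E f" "Src E g = Src E f" "Tgt E f = A"
    "Tgt E g = B" "h = pair E f g"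
  by (rule that[of "p1 E A B \<cdot> h" "p2 E A B \<cdot> h"]) (use assms in auto)

lemma pmap_type [simp]:
  assumes "f \<in> Ar E" "g \<in> Ar E"
  shows "pmap E f g \<in> Ar E" "Src E (pmap E f g) = prd E (Src E f) (Src E g)"
    "Tgt E (pmap E f g) = prd E (Tgt E f) (Tgt E g)"
  using assms by (auto simp: pmap_def)

lemma pmap_pair [simp]:
  assumes "f \<in> Ar E" "g \<in> Ar E" "x \<in> Ar E" "y \<in> Ar E" "Tgt E x = Src E f" "Tgt E y = Src E g"
    "Src E x = Src E y"
  shows "pmap E f g \<cdot> pair E x y = pair E (f \<cdot> x) (g \<cdot> y)"
  using assms by (simp add: pmap_def)

lemma swap_type [simp]:
  assumes "A \<in> Ob E" "B \<in> Ob E"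
  shows "swap E A B \<in> Ar E" "Src E (swap E A B) = prd E A B" "Tgt E (swap E A B) = prd E B A"
  using assms by (auto simp: swap_def)

lemma swap_pair [simp]:
  assumes "x \<in> Ar E" "y \<in> Ar E" "Src E x = Src E y" "Tgt E x = A" "Tgt E y = B"
  shows "swap E A B \<cdot> pair E x y = pair E y x"
proof -
  have "A \<in> Ob E" "B \<in> Ob E" using assms by auto
  then show ?thesis using assms by (simp add: swap_def)
qed

lemma assoc_type [simp]:
  assumes "A \<in> Ob E" "B \<in> Ob E" "C \<in> Ob E"
  shows "assoc E A B C \<in> Ar E" "Src E (assoc E A B C) = prd E A (prd E B C)"
    "Tgt E (assoc E A B C) = prd E (prd E A B) C"
    "assoc_inv E A B C \<in> Ar E" "Src E (assoc_inv E A B C) = prd E (prd E A B) C"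
    "Tgt E (assoc_inv E A B C) = prd E A (prd E B C)"
  using assms by (auto simp: assoc_def assoc_inv_def)

lemma assoc_pair [simp]:
  assumes "x \<in> Ar E" "y \<in> Ar E" "z \<in> Ar E" "Src E x = Src E y" "Src E y = Src E z"
    "Tgt E x = A" "Tgt E y = B" "Tgt E z = C"
  shows "assoc E A B C \<cdot> pair E x (pair E y z) = pair E (pair E x y) z"
    "assoc_inv E A B C \<cdot> pair E (pair E x y) z = pair E x (pair E y z)"
proof -
  have "A \<in> Ob E" "B \<in> Ob E" "C \<in> Ob E" using assms by auto
  then show "assoc E A B C \<cdot> pair E x (pair E y z) = pair E (pair E x y) z"
    "assoc_inv E A B C \<cdot> pair E (pair E x y) z = pair E x (pair E y z)"
    using assms by (simp_all add: assoc_def assoc_inv_def)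
qed


subsection \<open>Small coproducts\<close>

text \<open>The axioms provide coproducts over subsets of \<open>'u\<close> only. A small index set
  of any type is encoded there, and the coproduct is carried back along the bijection with its
  codes.\<close>

lemma coproduct_ex:
  assumes K: "small u (K :: 's set)" and A: "\<forall>k\<in>K. A k \<in> Ob E"
  shows "\<exists>Q \<iota>. is_coproduct E K A Q \<iota>"
proof -
  obtain f :: "'s \<Rightarrow> 'u" where f: "inj_on f K" using small_encode[OF K] .
  have "\<forall>k\<in>f ` K. (A \<circ> inv_into K f) k \<in> Ob E" using A f by simp
  moreover have "\<forall>(K :: 'u set) A. small u K \<and> (\<forall>k\<in>K. A k \<in> Ob E) \<longrightarrow> (\<exists>Q \<iota>. is_coproduct E K A Q \<iota>)"
    using giraud by (elim conjE)
  ultimately obtain Q \<iota> where "is_coproduct E (f ` K) (A \<circ> inv_into K f) Q \<iota>"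
    using small_image[OF K] by blast
  then have "is_coproduct E K (A \<circ> inv_into K f \<circ> f) Q (\<iota> \<circ> f)"
    by (rule is_coproduct_reindex[OF inj_on_imp_bij_betw[OF f]])
  \<comment> \<open>A coproduct reads its family on K only, where \<open>inv_into\<close> undoes
    \<open>f\<close>.\<close>
  moreover have "is_coproduct E K A Q \<iota>'" if "is_coproduct E K (A \<circ> inv_into K f \<circ> f) Q \<iota>'" for \<iota>'
    using that f unfolding is_coproduct_def by simp
  ultimately show ?thesis by blast
qed

lemma is_coproduct_coprod:
  assumes "small u K" "\<forall>k\<in>K. A k \<in> Ob E"
  shows "is_coproduct E K A (coprod E K A) (incl E K A)"
proof -
  have "\<exists>x. case x of (Q, \<iota>) \<Rightarrow> is_coproduct E K A Q \<iota>" using coproduct_ex[OF assms] by auto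
  then have "case coproduct_choice E K A of (Q, \<iota>) \<Rightarrow> is_coproduct E K A Q \<iota>"
    unfolding coproduct_choice_def by (rule someI_ex)
  then show ?thesis unfolding coprod_def incl_def by (simp add: case_prod_unfold)
qed

lemma coprod_type [simp]:
  assumes "small u K" "\<forall>k\<in>K. A k \<in> Ob E"
  shows "coprod E K A \<in> Ob E" "k \<in> K \<Longrightarrow> incl E K A k \<in> Ar E" "k \<in> K \<Longrightarrow> Src E (incl E K A k) = A k"
    "k \<in> K \<Longrightarrow> Tgt E (incl E K A k) = coprod E K A"
  using is_coproductD[OF is_coproduct_coprod[OF assms]] by auto

lemma cotuple_hom:
  assumes "small u K" "C \<in> Ob E" "\<forall>k\<in>K. f k \<in> hom E (A k) C"
  shows "cotuple E K A C f \<in> hom E (coprod E K A) C \<and> (\<forall>k\<in>K. cotuple E K A C f \<cdot> incl E K A k = f k)"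
proof -
  have "\<forall>k\<in>K. A k \<in> Ob E" using assms(3) by (metis hom_iff Src_Ob)
  from is_coproduct_univ[OF is_coproduct_coprod[OF assms(1) this] assms(2,3)]
  show ?thesis unfolding cotuple_def by (rule theI')
qed

lemma cotuple_type [simp]:
  assumes "small u K" "C \<in> Ob E" "\<forall>k\<in>K. f k \<in> Ar E \<and> Src E (f k) = A k \<and> Tgt E (f k) = C"
  shows "cotuple E K A C f \<in> Ar E" "Src E (cotuple E K A C f) = coprod E K A"
    "Tgt E (cotuple E K A C f) = C"
    "k \<in> K \<Longrightarrow> cotuple E K A C f \<cdot> incl E K A k = f k"
  using cotuple_hom[of K C f A] assms by auto

lemma giraud_coproduct:
  assumes "small u (K :: 'u set)" "\<forall>k\<in>K. A k \<in> Ob E" "is_coproduct E K A Q \<iota>"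
  shows "\<forall>k\<in>K. monic E (\<iota> k)"
    "\<forall>k\<in>K. \<forall>l\<in>K. k \<noteq> l \<longrightarrow> (\<forall>P p q. is_pullback E (\<iota> k) (\<iota> l) P p q \<longrightarrow> initial E P)"
    "\<forall>f\<in>Ar E. \<forall>B j x. Tgt E f = Q \<and> (\<forall>k\<in>K. is_pullback E f (\<iota> k) (B k) (j k) (x k)) \<longrightarrow>
           is_coproduct E K B (Src E f) j"
proof -
  have "\<forall>(K :: 'u set) A Q \<iota>. small u K \<and> (\<forall>k\<in>K. A k \<in> Ob E) \<and> is_coproduct E K A Q \<iota> \<longrightarrow>
        (\<forall>k\<in>K. monic E (\<iota> k)) \<and>
        (\<forall>k\<in>K. \<forall>l\<in>K. k \<noteq> l \<longrightarrow> (\<forall>P p q. is_pullback E (\<iota> k) (\<iota> l) P p q \<longrightarrow> initial E P)) \<and>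
        (\<forall>f\<in>Ar E. \<forall>B j x. Tgt E f = Q \<and> (\<forall>k\<in>K. is_pullback E f (\<iota> k) (B k) (j k) (x k)) \<longrightarrow>
           is_coproduct E K B (Src E f) j)"
    using giraud by (elim conjE)
  note * = this[THEN spec, THEN spec, THEN spec, THEN spec, THEN mp, of K A Q \<iota>]
  show "\<forall>k\<in>K. monic E (\<iota> k)"
    "\<forall>k\<in>K. \<forall>l\<in>K. k \<noteq> l \<longrightarrow> (\<forall>P p q. is_pullback E (\<iota> k) (\<iota> l) P p q \<longrightarrow> initial E P)"
    "\<forall>f\<in>Ar E. \<forall>B j x. Tgt E f = Q \<and> (\<forall>k\<in>K. is_pullback E f (\<iota> k) (B k) (j k) (x k)) \<longrightarrow>
           is_coproduct E K B (Src E f) j"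
    by (rule * [THEN conjunct1] * [THEN conjunct2, THEN conjunct1] * [THEN conjunct2, THEN conjunct2],
        use assms in simp)+
qed

text \<open>The other axioms on coproducts also speak of index sets in \<open>'u\<close>. Moving a
  given coproduct to the set of codes makes them available for every small index set.\<close>

lemma coproduct_transport:
  assumes K: "small u (K :: 's set)" and Q: "is_coproduct E K A Q \<iota>"
  obtains f :: "'s \<Rightarrow> 'u" and g where "bij_betw f K (f ` K)" "\<And>k. k \<in> K \<Longrightarrow> g (f k) = k"
    "small u (f ` K)" "\<forall>k\<in>f ` K. (A \<circ> g) k \<in> Ob E" "is_coproduct E (f ` K) (A \<circ> g) Q (\<iota> \<circ> g)"
proof -
  obtain f :: "'s \<Rightarrow> 'u" where f: "inj_on f K" using small_encode[OF K] .
  have "bij_betw (inv_into K f) (f ` K) K"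
    by (rule bij_betw_inv_into[OF inj_on_imp_bij_betw[OF f]])
  from is_coproduct_reindex[OF this Q] show ?thesis
    using that[of f "inv_into K f"] f is_coproductD(5)[OF Q] K
    by (simp add: inj_on_imp_bij_betw small_image)
qed

lemma coproduct_monic:
  assumes "small u K" "is_coproduct E K A Q \<iota>" "k \<in> K"
  shows "monic E (\<iota> k)"
proof -
  obtain f :: "_ \<Rightarrow> 'u" and g where f: "\<And>k. k \<in> K \<Longrightarrow> g (f k) = k"
    "small u (f ` K)" "\<forall>k\<in>f ` K. (A \<circ> g) k \<in> Ob E" "is_coproduct E (f ` K) (A \<circ> g) Q (\<iota> \<circ> g)"
    using coproduct_transport[OF assms(1,2)] by metis
  from giraud_coproduct(1)[OF f(2-4)] have "monic E ((\<iota> \<circ> g) (f k))" using assms(3) by blast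
  then show ?thesis using f(1)[OF assms(3)] by simp
qed

lemma coproduct_disjoint:
  assumes "small u K" "is_coproduct E K A Q \<iota>" "k \<in> K" "l \<in> K" "k \<noteq> l"
    and "is_pullback E (\<iota> k) (\<iota> l) P p q"
  shows "initial E P"
proof -
  obtain f :: "_ \<Rightarrow> 'u" and g where f: "\<And>k. k \<in> K \<Longrightarrow> g (f k) = k"
    "small u (f ` K)" "\<forall>k\<in>f ` K. (A \<circ> g) k \<in> Ob E" "is_coproduct E (f ` K) (A \<circ> g) Q (\<iota> \<circ> g)"
    using coproduct_transport[OF assms(1,2)] by metis
  have "f k \<noteq> f l" using f(1) assms(3-5) by metis
  with giraud_coproduct(2)[OF f(2-4), rule_format, of "f k" "f l" P p q]
  show ?thesis using f(1) assms(3-6) by simp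
qed

lemma coproduct_stable:
  assumes K: "small u K" and Q: "is_coproduct E K A Q \<iota>" and h: "h \<in> Ar E" "Tgt E h = Q"
    and B: "\<And>k. k \<in> K \<Longrightarrow> is_pullback E h (\<iota> k) (B k) (j k) (x k)"
  shows "is_coproduct E K B (Src E h) j"
proof -
  obtain f :: "_ \<Rightarrow> 'u" and g where bij: "bij_betw f K (f ` K)" and f: "\<And>k. k \<in> K \<Longrightarrow> g (f k) = k"
    "small u (f ` K)" "\<forall>k\<in>f ` K. (A \<circ> g) k \<in> Ob E" "is_coproduct E (f ` K) (A \<circ> g) Q (\<iota> \<circ> g)"
    using coproduct_transport[OF assms(1,2)] by metis
  have "is_coproduct E (f ` K) (B \<circ> g) (Src E h) (j \<circ> g)"
    by (rule giraud_coproduct(3)[OF f(2-4), rule_format, of h "B \<circ> g" "j \<circ> g" "x \<circ> g"])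
      (use h B f(1) in auto)
  from is_coproduct_reindex[OF bij this]
  show ?thesis using f(1) unfolding is_coproduct_def by simp
qed

text \<open>The initial object is the empty coproduct, and stability of coproducts under pullback,
  for an empty index set, says that every object over it is an empty coproduct too.\<close>

lemma strict_initial:
  assumes Z: "initial E Z" and x: "x \<in> Ar E" "Tgt E x = Z"
  shows "initial E (Src E x)"
proof -
  have ini: "initial E Y \<longleftrightarrow> is_coproduct E ({} :: 'u set) undefined Y undefined" for Y
    unfolding initial_def is_coproduct_def by auto
  have "is_coproduct E ({} :: 'u set) undefined (Src E x) undefined"
    by (rule coproduct_stable[OF _ _ x]) (use Z ini small_finite[OF universe] in auto)
  then show ?thesis using ini by simp
qed


subsection \<open>Epimorphisms\<close>

lemma equivalence_relation_exact:
  assumes "equivalence_relation E r s"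
  obtains q where "exact_fork E r s q"
proof -
  have "\<forall>r s. equivalence_relation E r s \<longrightarrow> (\<exists>q. exact_fork E r s q)"
    using giraud by (elim conjE)
  then show ?thesis using assms that by blast
qed

lemma is_coequalizerD:
  assumes "is_coequalizer E f g q"
  shows "f \<in> Ar E" "g \<in> Ar E" "Src E g = Src E f" "Tgt E g = Tgt E f" "q \<in> Ar E" "Src E q = Tgt E f"
    "q \<cdot> f = q \<cdot> g"
  using assms by (auto simp: is_coequalizer_def)

lemma is_coequalizer_univ:
  assumes "is_coequalizer E f g q" "x \<in> Ar E" "Src E x = Tgt E f" "x \<cdot> f = x \<cdot> g"
  shows "\<exists>!h. h \<in> hom E (Tgt E q) (Tgt E x) \<and> h \<cdot> q = x"
  using assms unfolding is_coequalizer_def by simp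

lemma is_coequalizer_epi:
  assumes q: "is_coequalizer E f g q"
  shows "epi E q"
  unfolding epi_def
proof (intro conjI allI ballI impI)
  note [simp] = is_coequalizerD(1-6)[OF q]
  show "q \<in> Ar E" by simp
  fix C x y assume x: "x \<in> hom E (Tgt E q) C" and y: "y \<in> hom E (Tgt E q) C" and eq: "x \<cdot> q = y \<cdot> q"
  have "(x \<cdot> q) \<cdot> f = (x \<cdot> q) \<cdot> g" using x is_coequalizerD(7)[OF q] by simp
  then have "\<exists>!h. h \<in> hom E (Tgt E q) (Tgt E (x \<cdot> q)) \<and> h \<cdot> q = x \<cdot> q"
    by (intro is_coequalizer_univ[OF q]) (use x in auto)
  then show "x = y" using x y eq by auto
qed

text \<open>Some pair \<open>f\<close>, \<open>g\<close> has \<open>q\<close> as coequalizer. It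
  factors through the kernel pair by \<open>m\<close>, so a map that coequalizes the kernel pair
  also coequalizes \<open>f\<close> and \<open>g\<close>.\<close>

lemma epi_kernel_pair:
  assumes e: "epi E q" and R: "is_pullback E q q R r s"
  shows "exact_fork E r s q"
proof -
  have "\<forall>q. epi E q \<longrightarrow> (\<exists>f g. is_coequalizer E f g q)" using giraud by (elim conjE)
  then obtain f g where fg: "is_coequalizer E f g q" using e by blast
  note [simp] = is_coequalizerD(1-6)[OF fg] is_pullbackD(4-9)[OF R]
  obtain m where m: "m \<in> Ar E" "Src E m = Src E f" "Tgt E m = R" "r \<cdot> m = f" "s \<cdot> m = g"
    by (rule is_pullback_ex[OF R, of f g]) (use is_coequalizerD(7)[OF fg] in auto)
  have "is_coequalizer E r s q"
    unfolding is_coequalizer_def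
  proof (intro conjI allI ballI impI)
    show "q \<cdot> r = q \<cdot> s" by (rule is_pullbackD(10)[OF R])
    fix C x assume x: "x \<in> hom E (Tgt E r) C" and eq: "x \<cdot> r = x \<cdot> s"
    have "x \<cdot> f = x \<cdot> g"
      unfolding m(4)[symmetric] m(5)[symmetric] by (rule Cmp_eq_Cmp[OF eq]) (use x m in auto)
    then show "\<exists>!h. h \<in> hom E (Tgt E q) C \<and> h \<cdot> q = x"
      using is_coequalizer_univ[OF fg, of x] x by simp
  qed auto
  then show ?thesis using R by (simp add: exact_fork_def)
qed

text \<open>An epimorphism and its kernel pair form an exact fork; exact forks are stable, and the
  fork pulled back along \<open>b\<close> ends in \<open>q'\<close>.\<close>

lemma epi_pullback:
  assumes e: "epi E q" and P: "is_pullback E q b P a q'"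
  shows "epi E q'"
proof -
  note [simp] = is_pullbackD(1-9)[OF P]
  obtain R r s where R: "is_pullback E q q R r s" using pullback_ex[of q q] by auto
  note [simp] = is_pullbackD(4-9)[OF R]
  note ex = epi_kernel_pair[OF e R]
  have "\<forall>r s q. exact_fork E r s q \<longrightarrow> stably_exact_fork E r s q"
    using giraud by (elim conjE)
  then have st: "stably_exact_fork E r s q" using ex by blast
  \<comment> \<open>The pulled-back fork: \<open>R'\<close> lies over \<open>P\<close> by the maps
    \<open>r'\<close> and \<open>s'\<close> induced by \<open>r \<cdot> b'\<close> and
    \<open>s \<cdot> b'\<close>, which have the same image under \<open>q\<close>.\<close>
  obtain R' b' c where R': "is_pullback E (q \<cdot> r) b R' b' c" using pullback_ex[of "q \<cdot> r" b] by auto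
  note D = is_pullbackD(4-10)[OF R']
  note [simp] = D(1-6)
  have sq: "q \<cdot> (s \<cdot> b') = q \<cdot> (r \<cdot> b')"
    by (rule Cmp_eq_Cmp) (use is_pullbackD(10)[OF R] in auto)
  obtain r' where r': "r' \<in> Ar E" "Src E r' = Src E (r \<cdot> b')" "Tgt E r' = P" "a \<cdot> r' = r \<cdot> b'" "q' \<cdot> r' = c"
    by (rule is_pullback_ex[OF P, of "r \<cdot> b'" c]) (use D(7) in auto)
  obtain s' where s': "s' \<in> Ar E" "Src E s' = Src E (s \<cdot> b')" "Tgt E s' = P" "a \<cdot> s' = s \<cdot> b'" "q' \<cdot> s' = c"
    by (rule is_pullback_ex[OF P, of "s \<cdot> b'" c]) (use D(7) sq in auto)
  have "\<forall>g A' a q' R' b c r' s'.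
        is_pullback E q g A' a q' \<and> is_pullback E (q \<cdot> r) g R' b c \<and>
        r' \<in> hom E R' A' \<and> a \<cdot> r' = r \<cdot> b \<and> q' \<cdot> r' = c \<and>
        s' \<in> hom E R' A' \<and> a \<cdot> s' = s \<cdot> b \<and> q' \<cdot> s' = c \<longrightarrow> exact_fork E r' s' q'"
    using st unfolding stably_exact_fork_def by (rule conjunct2)
  from this[rule_format, of b P a q' R' b' c r' s'] have "exact_fork E r' s' q'"
    using P R' r' s' by simp
  then show ?thesis unfolding exact_fork_def using is_coequalizer_epi by blast
qed

text \<open>Turns an epimorphic family into a single epimorphism, to which kernel pairs and
  pullbacks apply.\<close>

lemma epi_family_cotuple:
  assumes K: "small u K" and B: "B \<in> Ob E" and f: "\<forall>k\<in>K. f k \<in> Ar E \<and> Src E (f k) = A k \<and> Tgt E (f k) = B"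
    and e: "epi_family E B (f ` K)"
  shows "epi E (cotuple E K A B f)"
  unfolding epi_def
proof (intro conjI allI ballI impI)
  have A: "\<forall>k\<in>K. A k \<in> Ob E" using f Src_Ob by metis
  note [simp] = cotuple_type[OF K B f] coprod_type[OF K A] 
  show "cotuple E K A B f \<in> Ar E" by simp
  fix C g h assume g: "g \<in> hom E (Tgt E (cotuple E K A B f)) C" and h: "h \<in> hom E (Tgt E (cotuple E K A B f)) C"
    and eq: "g \<cdot> cotuple E K A B f = h \<cdot> cotuple E K A B f"
  show "g = h"
  proof (rule epi_familyD[OF e])
    fix x assume "x \<in> f ` K"
    then obtain k where k: "k \<in> K" "x = f k" by auto
    have "g \<cdot> (cotuple E K A B f \<cdot> incl E K A k) = h \<cdot> (cotuple E K A B f \<cdot> incl E K A k)"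
      by (rule Cmp_eq_Cmp[OF eq]) (use g h k in auto)
    then show "g \<cdot> x = h \<cdot> x" using k by simp
  qed (use g h in auto)
qed


subsection \<open>Constant objects\<close>

text \<open>The element of \<open>gs E S\<close> at stage V with constant value s. Over a connected
  generator there are no others, by \<open>const_cases\<close>.\<close>

definition const :: "'s set \<Rightarrow> 'o \<Rightarrow> 's \<Rightarrow> 'a" where
  "const S V s = incl E S (\<lambda>_. one E) s \<cdot> bang E V"

lemma gs_Ob [simp]: "small u S \<Longrightarrow> gs E S \<in> Ob E"
  by (simp add: gs_def)

lemma const_type [simp]:
  assumes "small u S" "s \<in> S" "V \<in> Ob E"
  shows "const S V s \<in> Ar E" "Src E (const S V s) = V" "Tgt E (const S V s) = gs E S"
  using assms by (auto simp: const_def gs_def)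

lemma const_Cmp [simp]:
  assumes "small u S" "s \<in> S" "f \<in> Ar E" "Tgt E f = V"
  shows "const S V s \<cdot> f = const S (Src E f) s"
proof -
  have "V \<in> Ob E" using assms by auto
  then show ?thesis using assms by (simp add: const_def)
qed

lemma gsmap_type [simp]:
  assumes "small u S" "small u T" "\<forall>s\<in>S. f s \<in> T"
  shows "gsmap E S T f \<in> Ar E" "Src E (gsmap E S T f) = gs E S" "Tgt E (gsmap E S T f) = gs E T"
  using assms by (auto simp: gsmap_def gs_def)

lemma gsmap_const [simp]:
  assumes "small u S" "small u T" "\<forall>s\<in>S. f s \<in> T" "s \<in> S" "V \<in> Ob E"
  shows "gsmap E S T f \<cdot> const S V s = const T V (f s)"
proof -
  have "(gsmap E S T f \<cdot> incl E S (\<lambda>_. one E) s) \<cdot> bang E V = const T V (f s)"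
    using assms by (simp add: gsmap_def const_def gs_def del: Cmp_assoc)
  moreover have "(gsmap E S T f \<cdot> incl E S (\<lambda>_. one E) s) \<cdot> bang E V = gsmap E S T f \<cdot> const S V s"
    using assms by (subst Cmp_assoc) (auto simp: const_def gs_def[symmetric])
  ultimately show ?thesis by simp
qed

end

section \<open>Connected objects and generators\<close>

context giraud_topos
begin

text \<open>If two distinct constants agree, V maps to the pullback of two distinct injections. That
  pullback is initial by disjointness, and initial objects are strict.\<close>

lemma const_eq_imp_initial:
  assumes S: "small u S" and s: "s \<in> S" "s' \<in> S" "s \<noteq> s'" and V: "V \<in> Ob E"
    and eq: "const S V s = const S V s'"
  shows "initial E V"
proof -
  have one: "\<forall>k\<in>S. one E \<in> Ob E" by simp
  note Q = is_coproduct_coprod[OF S one]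
  note [simp] = coprod_type[OF S one]
  obtain P p q where P: "is_pullback E (incl E S (\<lambda>_. one E) s) (incl E S (\<lambda>_. one E) s') P p q"
    using pullback_ex[of "incl E S (\<lambda>_. one E) s" "incl E S (\<lambda>_. one E) s'"] s by auto
  have P0: "initial E P" by (rule coproduct_disjoint[OF S Q s P])
  obtain h where "h \<in> Ar E" "Src E h = Src E (bang E V)" "Tgt E h = P"
    by (rule is_pullback_ex[OF P, of "bang E V" "bang E V"]) (use s V eq in \<open>auto simp: const_def\<close>)
  then show ?thesis using strict_initial[OF P0, of h] V by simp
qed

lemma initial_coproduct:
  assumes Q: "is_coproduct E K A Q \<iota>" and A: "\<And>k. k \<in> K \<Longrightarrow> initial E (A k)"
  shows "initial E Q"
  unfolding initial_def
proof (intro conjI ballI)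
  note [simp] = is_coproductD(1-4)[OF Q]
  show "Q \<in> Ob E" by simp
  fix C assume C: "C \<in> Ob E"
  have "\<forall>k\<in>K. \<exists>f. f \<in> hom E (A k) C" using A C unfolding initial_def by blast
  then obtain f where "\<forall>k\<in>K. f k \<in> hom E (A k) C" by metis
  from is_coproduct_univ[OF Q C this] obtain h where h: "h \<in> hom E Q C" by blast
  moreover have "h' = h" if "h' \<in> hom E Q C" for h'
    by (rule is_coproduct_unique[OF Q], use h that in simp_all)
      (rule initial_unique[OF A], use h that in simp_all)
  ultimately show "\<exists>!f. f \<in> hom E Q C" by blast
qed

text \<open>The identity of \<open>A k\<close> and the unique maps out of the initial summands
  assemble to a map back to \<open>A k\<close>. Connectedness arguments end here: once all other
  summands are initial, a map factors through the remaining one.\<close>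

lemma coproduct_single_section:
  assumes Q: "is_coproduct E K A Q \<iota>" and k: "k \<in> K"
    and A: "\<And>l. l \<in> K \<Longrightarrow> l \<noteq> k \<Longrightarrow> initial E (A l)"
  obtains h where "h \<in> hom E Q (A k)" "\<iota> k \<cdot> h = Idt E Q"
proof -
  note [simp] = is_coproductD(1-4)[OF Q]
  have Ak: "A k \<in> Ob E" by (rule is_coproductD(5)[OF Q k])
  have "\<forall>l\<in>K. \<exists>f. f \<in> hom E (A l) (A k)"
  proof
    fix l assume l: "l \<in> K"
    show "\<exists>f. f \<in> hom E (A l) (A k)"
    proof (cases "l = k")
      case True
      then show ?thesis using Ak by (intro exI[of _ "Idt E (A k)"]) simp
    next
      case False
      then show ?thesis using A[OF l] Ak unfolding initial_def by blast
    qed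
  qed
  then obtain f where f: "\<forall>l\<in>K. f l \<in> hom E (A l) (A k)" by metis
  define g where "g = f(k := Idt E (A k))"
  have "\<forall>l\<in>K. g l \<in> hom E (A l) (A k)" using f Ak by (simp add: g_def)
  from is_coproduct_univ[OF Q Ak this]
  obtain h where h: "h \<in> hom E Q (A k)" "\<forall>l\<in>K. h \<cdot> \<iota> l = g l" by blast
  have hk: "h \<cdot> \<iota> k = Idt E (A k)" using h(2) k by (simp add: g_def)
  have "\<iota> k \<cdot> h = Idt E Q"
  proof (rule is_coproduct_unique[OF Q])
    fix l assume l: "l \<in> K"
    show "(\<iota> k \<cdot> h) \<cdot> \<iota> l = Idt E Q \<cdot> \<iota> l"
    proof (cases "l = k")
      case True
      then show ?thesis using h k hk by simp
    next
      case False
      show ?thesis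
        by (rule initial_unique[OF A[OF l False]]) (use h(1) k l in auto)
    qed
  qed (use h k in auto)
  with h that show thesis by blast
qed

text \<open>\<open>connected_object\<close> only concerns decompositions into two summands.\<close>

definition conn :: "'o \<Rightarrow> bool" where
  "conn V \<longleftrightarrow> V \<in> Ob E \<and> \<not> initial E V \<and>
     (\<forall>(K :: 'u set) A Q \<iota> x. small u K \<and> is_coproduct E K A Q \<iota> \<and> x \<in> hom E V Q \<longrightarrow>
        (\<exists>k\<in>K. \<exists>y\<in>hom E V (A k). \<iota> k \<cdot> y = x))"

lemma conn_coproduct:
  assumes V: "conn V" and K: "small u K" and Q: "is_coproduct E K A Q \<iota>"
    and x: "x \<in> Ar E" "Src E x = V" "Tgt E x = Q"
  obtains k y where "k \<in> K" "y \<in> hom E V (A k)" "\<iota> k \<cdot> y = x"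
proof -
  obtain f :: "_ \<Rightarrow> 'u" and g where f: "\<And>k. k \<in> K \<Longrightarrow> g (f k) = k"
    "small u (f ` K)" "is_coproduct E (f ` K) (A \<circ> g) Q (\<iota> \<circ> g)"
    using coproduct_transport[OF K Q] by metis
  have "\<forall>(K :: 'u set) A Q \<iota> x. small u K \<and> is_coproduct E K A Q \<iota> \<and> x \<in> hom E V Q \<longrightarrow>
        (\<exists>k\<in>K. \<exists>y\<in>hom E V (A k). \<iota> k \<cdot> y = x)"
    using V unfolding conn_def by (elim conjE)
  from this[THEN spec, THEN spec, THEN spec, THEN spec, THEN spec, THEN mp, of "f ` K" "A \<circ> g" Q "\<iota> \<circ> g" x]
  have "\<exists>k\<in>f ` K. \<exists>y\<in>hom E V ((A \<circ> g) k). (\<iota> \<circ> g) k \<cdot> y = x"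
    using f(2,3) x by simp
  then obtain k y where k: "k \<in> K" and "y \<in> hom E V ((A \<circ> g) (f k))" "(\<iota> \<circ> g) (f k) \<cdot> y = x" by blast
  then show ?thesis using f(1)[OF k] that[OF k, of y] by simp
qed

text \<open>A common value of two different injections would map V to their pullback, which is
  initial; within one summand the injection is monic.\<close>

lemma conn_coproduct_unique:
  assumes V: "conn V" and K: "small u K" and Q: "is_coproduct E K A Q \<iota>" and k: "k \<in> K" "l \<in> K"
    and y: "y \<in> hom E V (A k)" "z \<in> hom E V (A l)" and eq: "\<iota> k \<cdot> y = \<iota> l \<cdot> z"
  shows "k = l \<and> y = z"
proof -
  note [simp] = is_coproductD(1-4)[OF Q]
  have "k = l"
  proof (rule ccontr)
    assume "k \<noteq> l"
    obtain P p q where P: "is_pullback E (\<iota> k) (\<iota> l) P p q"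
      using pullback_ex[of "\<iota> k" "\<iota> l"] k by auto
    note P0 = coproduct_disjoint[OF K Q k \<open>k \<noteq> l\<close> P]
    obtain h where "h \<in> Ar E" "Src E h = Src E y" "Tgt E h = P"
      by (rule is_pullback_ex[OF P, of y z]) (use k y eq in auto)
    then have "initial E V" using strict_initial[OF P0, of h] y by simp
    then show False using V by (simp add: conn_def)
  qed
  moreover have "y = z"
    by (rule monicD[OF coproduct_monic[OF K Q k(1)]]) (use y eq k \<open>k = l\<close> in auto)
  ultimately show ?thesis by simp
qed

lemma small_pair: "small u {a, b}"
  by (rule small_finite[OF universe]) simp

text \<open>Pulling the coproduct back along \<open>x\<close> decomposes V. Some summand
  \<open>B k\<close> is not initial, connectedness makes all the others initial together, so V is
  carried by \<open>B k\<close> and \<open>x\<close> factors through \<open>A k\<close>.\<close>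

lemma connected_object_conn:
  assumes V: "connected_object E V"
  shows "conn V"
  unfolding conn_def
proof (intro conjI allI impI)
  show "V \<in> Ob E" "\<not> initial E V" using V by (simp_all add: connected_object_def)
  fix K :: "'u set" and A Q \<iota> x
  assume "small u K \<and> is_coproduct E K A Q \<iota> \<and> x \<in> hom E V Q"
  then have K: "small u K" and Q: "is_coproduct E K A Q \<iota>" and x: "x \<in> hom E V Q" by blast+
  note [simp] = is_coproductD(1-4)[OF Q]
  have "\<exists>B j y. is_pullback E x (\<iota> k) B j y" if "k \<in> K" for k
    using pullback_ex[of x "\<iota> k"] x that by (metis hom_iff is_coproductD(2,4)[OF Q])
  then obtain B j y where P: "\<And>k. k \<in> K \<Longrightarrow> is_pullback E x (\<iota> k) (B k) (j k) (y k)" by metis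
  have B: "is_coproduct E K B V j"
    using coproduct_stable[OF K Q, of x B j y] x P by simp
  note [simp] = is_coproductD[OF B]
  obtain k where k: "k \<in> K" "\<not> initial E (B k)"
    using initial_coproduct[OF B] V unfolding connected_object_def by blast
  \<comment> \<open>All summands other than \<open>B k\<close> taken together, so that V becomes a
    coproduct of two objects.\<close>
  define R where "R = coprod E (K - {k}) B"
  define r where "r = cotuple E (K - {k}) B V j"
  have K': "small u (K - {k})" by (rule small_subset[OF K]) auto
  have BO: "\<forall>l\<in>K - {k}. B l \<in> Ob E" and jty: "\<forall>l\<in>K - {k}. j l \<in> Ar E \<and> Src E (j l) = B l \<and> Tgt E (j l) = V"
    by auto
  have r: "r \<in> hom E R V" "\<And>l. l \<in> K - {k} \<Longrightarrow> r \<cdot> incl E (K - {k}) B l = j l"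
    unfolding r_def R_def using cotuple_type[OF K' \<open>V \<in> Ob E\<close> jty] by auto
  note R = is_coproduct_coprod[OF K' BO, folded R_def]
  note [simp] = is_coproductD(1-4)[OF R]
  let ?A = "\<lambda>b. if b then B k else R" and ?j = "\<lambda>b. if b then j k else r"
  have co: "is_coproduct E (UNIV :: bool set) ?A V ?j"
    unfolding is_coproduct_def
  proof (intro conjI ballI allI impI)
    show "V \<in> Ob E" by fact
    fix b show "?j b \<in> hom E (?A b) V" using r k by auto
  next
    fix C f assume C: "C \<in> Ob E" and f: "\<forall>b\<in>UNIV. f b \<in> hom E (?A b) C"
    have fT: "f True \<in> hom E (B k) C" and fF: "f False \<in> hom E R C" using f by auto
    define g where "g l = (if l = k then f True else f False \<cdot> incl E (K - {k}) B l)" for l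
    have "\<forall>l\<in>K. g l \<in> hom E (B l) C"
      using fT fF by (auto simp: g_def)
    from is_coproduct_univ[OF B C this]
    obtain h where h: "h \<in> hom E V C" "\<forall>l\<in>K. h \<cdot> j l = g l" by blast
    have hr: "h \<cdot> r = f False"
    proof (rule is_coproduct_unique[OF R])
      fix l assume l: "l \<in> K - {k}"
      have "(h \<cdot> r) \<cdot> incl E (K - {k}) B l = h \<cdot> j l" using r l h by simp
      then show "(h \<cdot> r) \<cdot> incl E (K - {k}) B l = f False \<cdot> incl E (K - {k}) B l"
        using h l by (simp add: g_def)
    qed (use h r fF in auto)
    have "h' = h" if h': "h' \<in> hom E V C" "h' \<cdot> j k = f True" "h' \<cdot> r = f False" for h'
    proof (rule is_coproduct_unique[OF B])
      fix l assume l: "l \<in> K"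
      show "h' \<cdot> j l = h \<cdot> j l"
      proof (cases "l = k")
        case False
        have "h' \<cdot> (r \<cdot> incl E (K - {k}) B l) = h \<cdot> (r \<cdot> incl E (K - {k}) B l)"
          by (rule Cmp_eq_Cmp) (use h'(1,3) hr h r l False in auto)
        then show ?thesis using r l False by simp
      qed (use h k h' in \<open>simp add: g_def\<close>)
    qed (use h h' in auto)
    note uniq = this
    show "\<exists>!h. h \<in> hom E V C \<and> (\<forall>b\<in>UNIV. h \<cdot> ?j b = f b)"
    proof (rule ex1I[of _ h])
      have "h \<cdot> ?j b = f b" for b using h(2) hr k by (cases b) (simp_all add: g_def)
      then show "h \<in> hom E V C \<and> (\<forall>b\<in>UNIV. h \<cdot> ?j b = f b)" using h(1) by blast
      fix h' assume h': "h' \<in> hom E V C \<and> (\<forall>b\<in>UNIV. h' \<cdot> ?j b = f b)"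
      have "h' \<cdot> ?j b = f b" for b using h' by blast
      from this[of True] this[of False] show "h' = h" using h' by (intro uniq) simp_all
    qed
  qed
  \<comment> \<open>Of the two summands \<open>B k\<close> is not initial, so the remainder
    is.\<close>
  then have "initial E R" using V k unfolding connected_object_def by fastforce
  then obtain h where h: "h \<in> hom E V (B k)" "j k \<cdot> h = Idt E V"
    using coproduct_single_section[OF co, of True] by auto
  note [simp] = is_pullbackD(4-9)[OF P[OF k(1)]]
  have "\<iota> k \<cdot> (y k \<cdot> h) = x \<cdot> (j k \<cdot> h)"
    by (rule Cmp_eq_Cmp[OF is_pullbackD(10)[OF P[OF k(1)], symmetric]]) (use h k x in auto)
  then show "\<exists>k\<in>K. \<exists>y\<in>hom E V (A k). \<iota> k \<cdot> y = x"
    using h x k by (intro bexI[of _ k] bexI[of _ "y k \<cdot> h"]) auto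
qed

text \<open>A map from X to a constant object is given by a function on P, hence is constant on each
  fibre \<open>C p\<close>. Applied to the map that records the summand in which \<open>x\<close>
  lands, this shows that \<open>x\<close> stays in one summand.\<close>

lemma component_conn:
  fixes P :: "'u set"
  assumes X: "X \<in> Ob E" and P: "small u P" and \<eta>: "\<eta> \<in> hom E X (gs E P)"
    and univ: "\<And>(S :: 'u set) f. small u S \<Longrightarrow> f \<in> hom E X (gs E S) \<Longrightarrow>
           \<exists>!g. g \<in> P \<rightarrow>\<^sub>E S \<and> f = gsmap E P S g \<cdot> \<eta>"
    and C: "is_coproduct E P C X j" and j: "\<And>p. p \<in> P \<Longrightarrow> \<eta> \<cdot> j p = const P (C p) p"
    and p: "p \<in> P"
  shows "conn (C p)"
  unfolding conn_def
proof (intro conjI allI impI)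
  note [simp] = is_coproductD[OF C] p P
  show "C p \<in> Ob E" by simp
  show n0: "\<not> initial E (C p)"
  proof
    assume i: "initial E (C p)"
    have "infinite (UNIV :: 'u set)" using universe by (simp add: universe_def)
    then obtain a b :: 'u where "a \<noteq> b" by (metis ex_new_if_finite finite.emptyI finite_insert insertCI)
    define S where "S = {a, b}"
    have [simp]: "small u S" unfolding S_def by (rule small_pair)
    \<comment> \<open>Two functions on P that differ only at \<open>p\<close>. If the fibre over
      \<open>p\<close> were initial, they would induce the same map on X, against the uniqueness in
      the universal property.\<close>
    define g1 where "g1 = (\<lambda>x\<in>P. a)"
    define g2 where "g2 = (\<lambda>x\<in>P. if x = p then b else a)"
    have g: "g1 \<in> P \<rightarrow>\<^sub>E S" "g2 \<in> P \<rightarrow>\<^sub>E S" "\<forall>s\<in>P. g1 s \<in> S" "\<forall>s\<in>P. g2 s \<in> S"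
      by (auto simp: g1_def g2_def S_def)
    have "gsmap E P S g1 \<cdot> \<eta> = gsmap E P S g2 \<cdot> \<eta>"
    proof (rule is_coproduct_unique[OF C])
      fix q assume q: "q \<in> P"
      show "(gsmap E P S g1 \<cdot> \<eta>) \<cdot> j q = (gsmap E P S g2 \<cdot> \<eta>) \<cdot> j q"
      proof (cases "q = p")
        case True
        show ?thesis by (rule initial_unique[OF i]) (use True q \<eta> g in auto)
      next
        case False
        then have "g1 q = g2 q" using q by (simp add: g1_def g2_def)
        then show ?thesis using q \<eta> g j by simp
      qed
    qed (use \<eta> g in auto)
    moreover have "\<exists>!g. g \<in> P \<rightarrow>\<^sub>E S \<and> gsmap E P S g1 \<cdot> \<eta> = gsmap E P S g \<cdot> \<eta>"
      by (rule univ) (use \<eta> g in auto)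
    ultimately have "g1 = g2" using g by blast
    then have "g1 p = g2 p" by simp
    then show False using \<open>a \<noteq> b\<close> by (simp add: g1_def g2_def)
  qed
  fix K :: "'u set" and A Q \<iota> x
  assume "small u K \<and> is_coproduct E K A Q \<iota> \<and> x \<in> hom E (C p) Q"
  then have K [simp]: "small u K" and Q: "is_coproduct E K A Q \<iota>" and x: "x \<in> hom E (C p) Q" by blast+
  note [simp] = is_coproductD(1-4)[OF Q]
  have AO: "A k \<in> Ob E" if "k \<in> K" for k by (rule is_coproductD(5)[OF Q that])
  have "K \<noteq> {}"
  proof
    assume "K = {}"
    then have "initial E Q" using initial_coproduct[OF Q] by simp
    then show False using n0 strict_initial[of Q x] x by simp
  qed
  then obtain k0 where k0: "k0 \<in> K" by blast
  \<comment> \<open>\<open>\<kappa>\<close> labels each element of Q with the index of its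
    summand.\<close>
  have "\<forall>k\<in>K. const K (A k) k \<in> hom E (A k) (gs E K)" using AO by simp
  from is_coproduct_univ[OF Q gs_Ob[OF K] this]
  obtain \<kappa> where \<kappa>: "\<kappa> \<in> hom E Q (gs E K)" "\<forall>k\<in>K. \<kappa> \<cdot> \<iota> k = const K (A k) k" by blast
  define f0 where "f0 q = (if q = p then \<kappa> \<cdot> x else const K (C q) k0)" for q
  have "\<forall>q\<in>P. f0 q \<in> hom E (C q) (gs E K)" using \<kappa> x k0 by (simp add: f0_def)
  from is_coproduct_univ[OF C gs_Ob[OF K] this]
  obtain f where f: "f \<in> hom E X (gs E K)" "\<forall>q\<in>P. f \<cdot> j q = f0 q" by blast
  obtain g where g: "g \<in> P \<rightarrow>\<^sub>E K" "f = gsmap E P K g \<cdot> \<eta>" using univ[OF K f(1)] by blast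
  have gK: "\<forall>q\<in>P. g q \<in> K" using g(1) by auto
  define k where "k = g p"
  have k: "k \<in> K" using gK by (simp add: k_def)
  have "(gsmap E P K g \<cdot> \<eta>) \<cdot> j p = const K (C p) k"
    using \<eta> gK j by (simp add: k_def)
  then have \<kappa>x: "\<kappa> \<cdot> x = const K (C p) k" using f(2) g(2) by (simp add: f0_def)
  have "\<exists>B i y. is_pullback E x (\<iota> k) B i y" if "k \<in> K" for k
    using pullback_ex[of x "\<iota> k"] x that by (metis hom_iff is_coproductD(2,4)[OF Q])
  then obtain B i y where PB: "\<And>k. k \<in> K \<Longrightarrow> is_pullback E x (\<iota> k) (B k) (i k) (y k)" by metis
  have B: "is_coproduct E K B (C p) i"
    using coproduct_stable[OF K Q, of x B i y] x PB by simp
  note [simp] = is_coproductD[OF B]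
  \<comment> \<open>Over \<open>B l\<close> the label is \<open>l\<close> by construction and
    \<open>k\<close> because \<open>\<kappa> \<cdot> x\<close> is constant; distinct constants agree
    only over an initial object.\<close>
  have "initial E (B l)" if l: "l \<in> K" "l \<noteq> k" for l
  proof (rule const_eq_imp_initial[OF K l(1) k l(2)])
    note [simp] = is_pullbackD(4-9)[OF PB[OF l(1)]]
    have "const K (B l) l = (\<kappa> \<cdot> \<iota> l) \<cdot> y l" using \<kappa> l by (simp del: Cmp_assoc)
    also have "\<dots> = \<kappa> \<cdot> (x \<cdot> i l)" using \<kappa>(1) l is_pullbackD(10)[OF PB[OF l(1)]] by simp
    also have "\<dots> = (\<kappa> \<cdot> x) \<cdot> i l" using \<kappa>(1) l x by simp
    also have "\<dots> = const K (B l) k" using l k x by (simp add: \<kappa>x)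
    finally show "const K (B l) l = const K (B l) k" .
  qed (use l in auto)
  then obtain h where h: "h \<in> hom E (C p) (B k)" "i k \<cdot> h = Idt E (C p)"
    using coproduct_single_section[OF B k] by blast
  note [simp] = is_pullbackD(4-9)[OF PB[OF k]]
  have "\<iota> k \<cdot> (y k \<cdot> h) = x \<cdot> (i k \<cdot> h)"
    by (rule Cmp_eq_Cmp[OF is_pullbackD(10)[OF PB[OF k], symmetric]]) (use h k x in auto)
  then show "\<exists>k\<in>K. \<exists>y\<in>hom E (C p) (A k). \<iota> k \<cdot> y = x"
    using h x k by (intro bexI[of _ k] bexI[of _ "y k \<cdot> h"]) auto
qed

section \<open>A small generating set of connected objects\<close>

lemma generatingD:
  assumes "generating E G" "f \<in> Ar E" "g \<in> Ar E" "Src E f = Src E g" "Tgt E f = Tgt E g"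
    and "\<And>x. x \<in> Ar E \<Longrightarrow> Src E x \<in> G \<Longrightarrow> Tgt E x = Src E f \<Longrightarrow> f \<cdot> x = g \<cdot> x"
  shows "f = g"
  using assms unfolding generating_def by (metis hom_iff)

text \<open>The fibres of the unit \<open>\<eta>\<close> over the points of P have X as their
  coproduct, so a map out of X is determined by its restrictions to them, and replacing every
  generator by its fibres keeps the set generating.\<close>

lemma ex_conn_generators:
  assumes lc: "locally_connected E u"
  obtains G where "small u G" "generating E G" "\<And>V. V \<in> G \<Longrightarrow> conn V"
proof -
  obtain G0 where G0: "small u G0" "generating E G0" using giraud by (elim conjE exE)
  have G0O: "\<And>X. X \<in> G0 \<Longrightarrow> X \<in> Ob E" using G0(2) by (auto simp: generating_def)
  have "\<exists>P C j. small u (P :: 'u set) \<and> is_coproduct E P C X j \<and> (\<forall>p\<in>P. conn (C p))"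
    if X: "X \<in> G0" for X
  proof -
    have XO: "X \<in> Ob E" using G0O[OF X] .
    obtain P :: "'u set" and \<eta> where \<eta>: "\<eta> \<in> hom E X (gs E P)" and P: "small u P"
      and univ: "\<forall>S :: 'u set. small u S \<longrightarrow> (\<forall>f \<in> hom E X (gs E S).
           \<exists>!g. g \<in> P \<rightarrow>\<^sub>E S \<and> f = gsmap E P S g \<cdot> \<eta>)"
      using lc[unfolded locally_connected_def, THEN bspec, OF XO] by (elim exE bexE conjE)
    have one: "\<forall>k\<in>P. one E \<in> Ob E" by simp
    note Q = is_coproduct_coprod[OF P one, folded gs_def]
    note [simp] = is_coproductD[OF Q]
    have "\<exists>B j y. is_pullback E \<eta> (incl E P (\<lambda>_. one E) p) B j y" if "p \<in> P" for p
      using pullback_ex[of \<eta> "incl E P (\<lambda>_. one E) p"] \<eta> that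
      by (metis hom_iff is_coproductD(2,4)[OF Q])
    then obtain C j y where PB: "\<And>p. p \<in> P \<Longrightarrow> is_pullback E \<eta> (incl E P (\<lambda>_. one E) p) (C p) (j p) (y p)"
      by metis
    have C: "is_coproduct E P C X j"
      using coproduct_stable[OF P Q, of \<eta> C j y] \<eta> PB by simp
    have j: "\<eta> \<cdot> j p = const P (C p) p" if p: "p \<in> P" for p
    proof -
      note [simp] = is_pullbackD(4-9)[OF PB[OF p]]
      have "y p = bang E (C p)" by (rule one_unique) (use p is_coproductD(5)[OF C p] in auto)
      then show ?thesis using is_pullbackD(10)[OF PB[OF p]] by (simp add: const_def)
    qed
    have "conn (C p)" if "p \<in> P" for p
    proof (rule component_conn[OF XO P \<eta> _ C])
      show "\<exists>!g. g \<in> P \<rightarrow>\<^sub>E S \<and> f = gsmap E P S g \<cdot> \<eta>"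
        if "small u S" "f \<in> hom E X (gs E S)" for S :: "'u set" and f
        using univ[THEN spec, THEN mp, OF that(1)] that(2) by (rule bspec)
    qed (fact j that)+
    then show ?thesis using P C by blast
  qed
  then obtain P :: "'o \<Rightarrow> 'u set" and C j where P: "\<And>X. X \<in> G0 \<Longrightarrow> small u (P X)"
    and C: "\<And>X. X \<in> G0 \<Longrightarrow> is_coproduct E (P X) (C X) X (j X)"
    and conn: "\<And>X p. X \<in> G0 \<Longrightarrow> p \<in> P X \<Longrightarrow> conn (C X p)"
    by metis
  define G where "G = (\<Union>X\<in>G0. C X ` P X)"
  show thesis
  proof (rule that)
    show "small u G" unfolding G_def by (intro small_UN[OF universe G0(1)] small_image P)
    show "conn V" if "V \<in> G" for V using that conn by (auto simp: G_def)
    show "generating E G"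
      unfolding generating_def
    proof (intro conjI allI ballI impI)
      show "G \<subseteq> Ob E" using conn by (auto simp: G_def conn_def)
      fix A B f g assume f: "f \<in> hom E A B" and g: "g \<in> hom E A B"
        and eq: "\<forall>V\<in>G. \<forall>c\<in>hom E V A. f \<cdot> c = g \<cdot> c"
      show "f = g"
      proof (rule generatingD[OF G0(2)])
        fix x assume x: "x \<in> Ar E" "Src E x \<in> G0" "Tgt E x = Src E f"
        note co = C[OF x(2)]
        note [simp] = is_coproductD[OF co]
        show "f \<cdot> x = g \<cdot> x"
        proof (rule is_coproduct_unique[OF co])
          fix p assume p: "p \<in> P (Src E x)"
          then have "C (Src E x) p \<in> G" using x by (auto simp: G_def)
          then have "f \<cdot> (x \<cdot> j (Src E x) p) = g \<cdot> (x \<cdot> j (Src E x) p)"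
            using eq x f p by auto
          then show "(f \<cdot> x) \<cdot> j (Src E x) p = (g \<cdot> x) \<cdot> j (Src E x) p"
            using f g x p by simp
        qed (use f g x in auto)
      qed (use f g in auto)
    qed
  qed
qed

end

section \<open>Generalized elements over connected generators\<close>

locale connected_generators = giraud_topos E u
  for E :: "('o, 'a) cat" (structure) and u :: "'u itself" +
  fixes G :: "'o set"
  assumes small_G: "small u G" and generating_G: "generating E G"
    and conn_G: "V \<in> G \<Longrightarrow> conn V"
begin

lemma small_finite' [simp]: "finite A \<Longrightarrow> small u A"
  by (rule small_finite[OF universe])

lemma G_Ob [simp]: "V \<in> G \<Longrightarrow> V \<in> Ob E"
  using conn_G by (simp add: conn_def)

lemma G_not_initial: "V \<in> G \<Longrightarrow> \<not> initial E V"
  using conn_G by (simp add: conn_def)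

lemmas eqI = generatingD[OF generating_G]

text \<open>Maps that agree on F agree on each element \<open>b\<close> after restriction along a
  cover of its stage, hence on \<open>b\<close>. Generators are in general not projective, so lifts
  through F are asked for only after such a restriction.\<close>

lemma epi_familyI:
  assumes "B \<in> Ob E" "\<And>f. f \<in> F \<Longrightarrow> f \<in> Ar E \<and> Tgt E f = B"
    and "\<And>b. b \<in> Ar E \<Longrightarrow> Src E b \<in> G \<Longrightarrow> Tgt E b = B \<Longrightarrow>
      epi_family E (Src E b) {c. c \<in> Ar E \<and> Src E c \<in> G \<and> Tgt E c = Src E b \<and>
        (\<exists>f\<in>F. \<exists>y\<in>Ar E. Tgt E y = Src E f \<and> Src E y = Src E c \<and> f \<cdot> y = b \<cdot> c)}"
  shows "epi_family E B F"
  unfolding epi_family_def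
proof (intro conjI ballI allI impI)
  fix C g h assume g: "g \<in> hom E B C" and h: "h \<in> hom E B C" and eq: "\<forall>f\<in>F. g \<cdot> f = h \<cdot> f"
  show "g = h"
  proof (rule eqI)
    fix b assume b: "b \<in> Ar E" "Src E b \<in> G" "Tgt E b = Src E g"
    show "g \<cdot> b = h \<cdot> b"
    proof (rule epi_familyD[OF assms(3)[of b]])
      fix c assume "c \<in> {c. c \<in> Ar E \<and> Src E c \<in> G \<and> Tgt E c = Src E b \<and>
        (\<exists>f\<in>F. \<exists>y\<in>Ar E. Tgt E y = Src E f \<and> Src E y = Src E c \<and> f \<cdot> y = b \<cdot> c)}"
      then obtain f y where c: "c \<in> Ar E" "Tgt E c = Src E b"
        and y: "f \<in> F" "y \<in> Ar E" "Tgt E y = Src E f" "Src E y = Src E c" "f \<cdot> y = b \<cdot> c" by blast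
      have "g \<cdot> (f \<cdot> y) = h \<cdot> (f \<cdot> y)"
        by (rule Cmp_eq_Cmp) (use eq y assms(2) g h in auto)
      then show "(g \<cdot> b) \<cdot> c = (h \<cdot> b) \<cdot> c" using y b c g h by simp
    qed (use b g h in auto)
  qed (use g h in auto)
qed (use assms(2) in blast)+

text \<open>Epimorphic families are effective, because an epimorphism is the coequalizer of its
  kernel pair. Compatibility is tested at generators only, where an element of the coproduct of the
  sources lies in one of them.\<close>

lemma glue:
  assumes K: "small u K" and B: "B \<in> Ob E" and C: "C \<in> Ob E"
    and f: "\<forall>k\<in>K. f k \<in> Ar E \<and> Tgt E (f k) = B"
    and g: "\<forall>k\<in>K. g k \<in> Ar E \<and> Src E (g k) = Src E (f k) \<and> Tgt E (g k) = C"
    and e: "epi_family E B (f ` K)"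
    and compat: "\<And>k l x y. k \<in> K \<Longrightarrow> l \<in> K \<Longrightarrow> x \<in> Ar E \<Longrightarrow> y \<in> Ar E \<Longrightarrow> Src E x \<in> G \<Longrightarrow>
      Src E y = Src E x \<Longrightarrow> Tgt E x = Src E (f k) \<Longrightarrow> Tgt E y = Src E (f l) \<Longrightarrow>
      f k \<cdot> x = f l \<cdot> y \<Longrightarrow> g k \<cdot> x = g l \<cdot> y"
  obtains h where "h \<in> hom E B C" "\<And>k. k \<in> K \<Longrightarrow> h \<cdot> f k = g k"
proof -
  define A where "A k = Src E (f k)" for k
  have f': "\<forall>k\<in>K. f k \<in> Ar E \<and> Src E (f k) = A k \<and> Tgt E (f k) = B"
    and g': "\<forall>k\<in>K. g k \<in> Ar E \<and> Src E (g k) = A k \<and> Tgt E (g k) = C" using f g by (auto simp: A_def)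
  have A: "\<forall>k\<in>K. A k \<in> Ob E" using f Src_Ob by (simp add: A_def)
  define q p where "q = cotuple E K A B f" and "p = cotuple E K A C g"
  note [simp] = cotuple_type[OF K B f', folded q_def] cotuple_type[OF K C g', folded p_def] 
  note [simp] = coprod_type[OF K A]
  obtain R r s where R: "is_pullback E q q R r s" using pullback_ex[of q q] by auto
  note [simp] = is_pullbackD(4-9)[OF R]
  have "exact_fork E r s q"
    unfolding q_def by (rule epi_kernel_pair[OF epi_family_cotuple[OF K B f' e]]) (use R q_def in simp)
  then have q: "is_coequalizer E r s q" by (simp add: exact_fork_def)
  have "p \<cdot> r = p \<cdot> s"
  proof (rule eqI)
    fix z assume z: "z \<in> Ar E" "Src E z \<in> G" "Tgt E z = Src E (p \<cdot> r)"
    note Q = is_coproduct_coprod[OF K A]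
    \<comment> \<open>An element of the kernel pair is a pair of elements of the coproduct; at a
      connected stage each lies in one summand.\<close>
    obtain k x where k: "k \<in> K" and x: "x \<in> hom E (Src E z) (A k)" "incl E K A k \<cdot> x = r \<cdot> z"
      by (rule conn_coproduct[OF conn_G[OF z(2)] K Q, of "r \<cdot> z"]) (use z in auto)
    obtain l y where l: "l \<in> K" and y: "y \<in> hom E (Src E z) (A l)" "incl E K A l \<cdot> y = s \<cdot> z"
      by (rule conn_coproduct[OF conn_G[OF z(2)] K Q, of "s \<cdot> z"]) (use z in auto)
    have "f k \<cdot> x = (q \<cdot> incl E K A k) \<cdot> x" using k by simp
    also have "\<dots> = q \<cdot> (r \<cdot> z)" by (subst Cmp_assoc) (use k x in auto)
    also have "\<dots> = q \<cdot> (s \<cdot> z)" by (rule Cmp_eq_Cmp[OF is_pullbackD(10)[OF R]]) (use z in auto)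
    also have "\<dots> = (q \<cdot> incl E K A l) \<cdot> y" by (subst Cmp_assoc) (use l y in auto)
    also have "\<dots> = f l \<cdot> y" using l by simp
    finally have eq: "f k \<cdot> x = f l \<cdot> y" .
    have "(p \<cdot> r) \<cdot> z = p \<cdot> (r \<cdot> z)" using z by simp
    also have "\<dots> = (p \<cdot> incl E K A k) \<cdot> x" by (subst Cmp_assoc) (use k x in auto)
    also have "\<dots> = g k \<cdot> x" using k by simp
    also have "\<dots> = g l \<cdot> y" by (rule compat) (use k l x y z eq in \<open>auto simp: A_def\<close>)
    also have "\<dots> = (p \<cdot> incl E K A l) \<cdot> y" using l by simp
    also have "\<dots> = p \<cdot> (s \<cdot> z)" by (subst Cmp_assoc) (use l y in auto)
    also have "\<dots> = (p \<cdot> s) \<cdot> z" using z by simp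
    finally show "(p \<cdot> r) \<cdot> z = (p \<cdot> s) \<cdot> z" .
  qed auto
  then obtain h where h: "h \<in> hom E B C" "h \<cdot> q = p"
    using is_coequalizer_univ[OF q, of p] by auto
  have "h \<cdot> f k = g k" if k: "k \<in> K" for k
  proof -
    have "(h \<cdot> q) \<cdot> incl E K A k = p \<cdot> incl E K A k" using h by simp
    then show ?thesis using h(1) k by simp
  qed
  with h that show thesis by blast
qed

text \<open>If A has no elements, the empty family is epimorphic on it, and gluing along that family
  gives exactly one map to every object. The other direction is strictness of initial
  objects.\<close>

lemma initial_iff:
  assumes A: "A \<in> Ob E"
  shows "initial E A \<longleftrightarrow> \<not> (\<exists>x\<in>Ar E. Src E x \<in> G \<and> Tgt E x = A)"
proof
  assume "initial E A"
  then show "\<not> (\<exists>x\<in>Ar E. Src E x \<in> G \<and> Tgt E x = A)"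
    using strict_initial G_not_initial by blast
next
  assume no: "\<not> (\<exists>x\<in>Ar E. Src E x \<in> G \<and> Tgt E x = A)"
  show "initial E A"
    unfolding initial_def
  proof (intro conjI ballI)
    fix C assume C: "C \<in> Ob E"
    have e: "epi_family E A {}" by (rule epi_familyI) (use A no in auto)
    obtain h where h: "h \<in> hom E A C"
      by (rule glue[of "{} :: 'u set" A C undefined undefined])
        (use A C e in auto)
    moreover have "h' = h" if "h' \<in> hom E A C" for h'
      by (rule epi_familyD[OF e]) (use h that in auto)
    ultimately show "\<exists>!h. h \<in> hom E A C" by blast
  qed fact
qed

text \<open>Gluing along an empty family would give exactly one map from V to every object. The
  lemma supplies the single restriction of a stage on which an identity between functions is
  checked.\<close>

lemma epi_family_nonempty:
  assumes "epi_family E V F" "V \<in> G"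
  shows "F \<noteq> {}"
proof
  assume "F = {}"
  then have e: "epi_family E V {}" using assms by simp
  have "initial E V"
    unfolding initial_def
  proof (intro conjI ballI)
    fix C assume C: "C \<in> Ob E"
    obtain h where h: "h \<in> hom E V C"
      by (rule glue[of "{} :: 'u set" V C undefined undefined])
        (use assms C e in auto)
    moreover have "h' = h" if "h' \<in> hom E V C" for h'
      by (rule epi_familyD[OF e]) (use h that in auto)
    ultimately show "\<exists>!h. h \<in> hom E V C" by blast
  qed (use assms in simp)
  then show False using G_not_initial assms by blast
qed

text \<open>The converse of \<open>epi_familyI\<close>, resting on stability of epimorphisms: the
  map from the coproduct of the family is pulled back along \<open>b\<close>, and an element of the
  pullback at a generator passes through one member of the family.\<close>

lemma epi_family_lift:
  assumes K: "small u K" and f: "\<forall>k\<in>K. f k \<in> Ar E \<and> Tgt E (f k) = B" and e: "epi_family E B (f ` K)"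
    and b: "b \<in> Ar E" "Tgt E b = B"
  shows "epi_family E (Src E b) {c. c \<in> Ar E \<and> Src E c \<in> G \<and> Tgt E c = Src E b \<and>
    (\<exists>k\<in>K. \<exists>y\<in>Ar E. Src E y = Src E c \<and> Tgt E y = Src E (f k) \<and> f k \<cdot> y = b \<cdot> c)}"
  (is "epi_family E _ ?F")
  unfolding epi_family_def
proof (intro conjI ballI allI impI)
  define A where "A k = Src E (f k)" for k
  have f': "\<forall>k\<in>K. f k \<in> Ar E \<and> Src E (f k) = A k \<and> Tgt E (f k) = B" using f by (auto simp: A_def)
  have A: "\<forall>k\<in>K. A k \<in> Ob E" using f Src_Ob by (simp add: A_def)
  have B: "B \<in> Ob E" using b by auto
  define q where "q = cotuple E K A B f"
  note [simp] = cotuple_type[OF K B f', folded q_def] coprod_type[OF K A]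
  have q: "epi E q" unfolding q_def by (rule epi_family_cotuple[OF K B f' e])
  obtain P p r where P: "is_pullback E q b P p r" using pullback_ex[of q b] b by auto
  note [simp] = is_pullbackD(4-9)[OF P]
  have r: "epi E r" by (rule epi_pullback[OF q P])
  fix C g h assume g: "g \<in> hom E (Src E b) C" and h: "h \<in> hom E (Src E b) C"
    and eq: "\<forall>c\<in>?F. g \<cdot> c = h \<cdot> c"
  have "g \<cdot> r = h \<cdot> r"
  proof (rule eqI)
    fix z assume z: "z \<in> Ar E" "Src E z \<in> G" "Tgt E z = Src E (g \<cdot> r)"
    have z3: "Tgt E z = P" using z(3) g by simp
    obtain k x where k: "k \<in> K" and x: "x \<in> hom E (Src E z) (A k)" "incl E K A k \<cdot> x = p \<cdot> z"
      by (rule conn_coproduct[OF conn_G[OF z(2)] K is_coproduct_coprod[OF K A], of "p \<cdot> z"])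
        (use z z3 in auto)
    have "f k \<cdot> x = (q \<cdot> incl E K A k) \<cdot> x" using k by simp
    also have "\<dots> = q \<cdot> (p \<cdot> z)" by (subst Cmp_assoc) (use k x in auto)
    also have "\<dots> = b \<cdot> (r \<cdot> z)" by (rule Cmp_eq_Cmp[OF is_pullbackD(10)[OF P]]) (use z z3 b in auto)
    finally have "r \<cdot> z \<in> ?F" using z z3 k x(1) by (auto simp: A_def)
    then show "(g \<cdot> r) \<cdot> z = (h \<cdot> r) \<cdot> z" using eq g h z z3 by simp
  qed (use g h in auto)
  then show "g = h" using r g h unfolding epi_def by auto
qed auto

lemma epi_lift:
  assumes q: "epi E q" and b: "b \<in> Ar E" "Tgt E b = Tgt E q"
  shows "epi_family E (Src E b) {c. c \<in> Ar E \<and> Src E c \<in> G \<and> Tgt E c = Src E b \<and>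
    (\<exists>y\<in>Ar E. Src E y = Src E c \<and> Tgt E y = Src E q \<and> q \<cdot> y = b \<cdot> c)}"
  using epi_family_lift[of "{undefined :: 'u}" "\<lambda>_. q" "Tgt E q" b] q b
  by (simp add: epi_iff_epi_family)

text \<open>Local surjectivity makes \<open>f\<close> by itself an epimorphic family, and
  injectivity on elements is the compatibility under which the identity glues along it; the glued
  map is the inverse.\<close>

lemma iso_if_bijective:
  assumes f: "f \<in> Ar E"
    and inj: "\<And>x y. x \<in> Ar E \<Longrightarrow> y \<in> Ar E \<Longrightarrow> Src E x \<in> G \<Longrightarrow> Src E y = Src E x \<Longrightarrow> Tgt E x = Src E f
      \<Longrightarrow> Tgt E y = Src E f \<Longrightarrow> f \<cdot> x = f \<cdot> y \<Longrightarrow> x = y"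
    and surj: "\<And>b. b \<in> Ar E \<Longrightarrow> Src E b \<in> G \<Longrightarrow> Tgt E b = Tgt E f \<Longrightarrow>
      epi_family E (Src E b) {c. c \<in> Ar E \<and> Src E c \<in> G \<and> Tgt E c = Src E b \<and>
        (\<exists>y\<in>Ar E. Tgt E y = Src E f \<and> Src E y = Src E c \<and> f \<cdot> y = b \<cdot> c)}"
  shows "iso E f"
proof -
  have e: "epi_family E (Tgt E f) {f}" by (rule epi_familyI) (use f surj in auto)
  obtain h where h: "h \<in> hom E (Tgt E f) (Src E f)"
    "\<And>k. k \<in> {undefined :: 'u} \<Longrightarrow> h \<cdot> f = Idt E (Src E f)"
    by (rule glue[of "{undefined :: 'u}" "Tgt E f" "Src E f" "\<lambda>_. f" "\<lambda>_. Idt E (Src E f)"])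
      (use f e inj in auto)
  have hf: "h \<cdot> f = Idt E (Src E f)" using h(2) by simp
  have "f \<cdot> h = Idt E (Tgt E f)"
    by (rule epi_familyD[OF e]) (use f h(1) hf in auto)
  then show ?thesis using isoI[of f "Src E f" "Tgt E f" h] f h hf by auto
qed

text \<open>A factorisation is chosen on each element of the source separately. Joint monicity of
  \<open>r\<close> and \<open>s\<close> makes the choices compatible, so they glue.\<close>

lemma jointly_monic_factor:
  assumes r: "r \<in> Ar E" "s \<in> Ar E" "Src E s = Src E r"
    and mono: "\<And>x y. x \<in> Ar E \<Longrightarrow> y \<in> Ar E \<Longrightarrow> Src E x \<in> G \<Longrightarrow> Src E y = Src E x \<Longrightarrow> Tgt E x = Src E r
      \<Longrightarrow> Tgt E y = Src E r \<Longrightarrow> r \<cdot> x = r \<cdot> y \<Longrightarrow> s \<cdot> x = s \<cdot> y \<Longrightarrow> x = y"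
    and f: "f \<in> Ar E" "g \<in> Ar E" "Src E g = Src E f" "Tgt E f = Tgt E r" "Tgt E g = Tgt E s"
    and ex: "\<And>x. x \<in> Ar E \<Longrightarrow> Src E x \<in> G \<Longrightarrow> Tgt E x = Src E f \<Longrightarrow>
      \<exists>z\<in>Ar E. Src E z = Src E x \<and> Tgt E z = Src E r \<and> r \<cdot> z = f \<cdot> x \<and> s \<cdot> z = g \<cdot> x"
  obtains m where "m \<in> hom E (Src E f) (Src E r)" "r \<cdot> m = f" "s \<cdot> m = g"
proof -
  define A where "A = Src E f"
  \<comment> \<open>All elements of A at generators; they form an epimorphic family because G is
    generating.\<close>
  define K where "K = (\<Union>V\<in>G. hom E V A)"
  have A: "A \<in> Ob E" using f by (simp add: A_def)
  have K: "small u K" unfolding K_def by (intro small_UN universe small_G small_hom) (use A in auto)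
  have KI: "x \<in> K \<longleftrightarrow> x \<in> Ar E \<and> Src E x \<in> G \<and> Tgt E x = A" for x by (auto simp: K_def)
  have "\<forall>x\<in>K. \<exists>z. z \<in> Ar E \<and> Src E z = Src E x \<and> Tgt E z = Src E r \<and> r \<cdot> z = f \<cdot> x \<and> s \<cdot> z = g \<cdot> x"
  proof
    fix x assume "x \<in> K"
    then have "x \<in> Ar E" "Src E x \<in> G" "Tgt E x = Src E f" by (simp_all add: KI A_def)
    from ex[OF this] show "\<exists>z. z \<in> Ar E \<and> Src E z = Src E x \<and> Tgt E z = Src E r \<and> r \<cdot> z = f \<cdot> x \<and> s \<cdot> z = g \<cdot> x"
      by blast
  qed
  then obtain z where z: "\<forall>x\<in>K. z x \<in> Ar E \<and> Src E (z x) = Src E x \<and> Tgt E (z x) = Src E r \<and>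
      r \<cdot> z x = f \<cdot> x \<and> s \<cdot> z x = g \<cdot> x" by metis
  have e: "epi_family E A K"
    unfolding epi_family_def
  proof (intro conjI ballI allI impI)
    fix C x y assume "x \<in> hom E A C" "y \<in> hom E A C" "\<forall>f\<in>K. x \<cdot> f = y \<cdot> f"
    then show "x = y" by (intro eqI[of x y]) (simp_all add: KI)
  qed (simp_all add: KI)
  obtain m where m: "m \<in> hom E A (Src E r)" "\<And>x. x \<in> K \<Longrightarrow> m \<cdot> x = z x"
  proof (rule glue[OF K A, of "Src E r" "\<lambda>x. x" z])
    fix k l x y
    assume k: "k \<in> K" "l \<in> K" and x: "x \<in> Ar E" "y \<in> Ar E" "Src E x \<in> G" "Src E y = Src E x"
      "Tgt E x = Src E k" "Tgt E y = Src E l" and eq: "k \<cdot> x = l \<cdot> y"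
    have [simp]: "k \<in> Ar E" "l \<in> Ar E" "Tgt E k = A" "Tgt E l = A" "Src E f = A" "Src E g = A"
      using k f by (auto simp: KI A_def)
    show "z k \<cdot> x = z l \<cdot> y"
    proof (rule mono)
      note zk = z[THEN bspec, OF k(1)] and zl = z[THEN bspec, OF k(2)]
      have "r \<cdot> (z k \<cdot> x) = f \<cdot> (k \<cdot> x)"
        by (rule Cmp_eq_Cmp) (use zk k x f r in auto)
      also have "\<dots> = r \<cdot> (z l \<cdot> y)"
        unfolding eq by (rule Cmp_eq_Cmp[symmetric]) (use zl k x f r in auto)
      finally show "r \<cdot> (z k \<cdot> x) = r \<cdot> (z l \<cdot> y)" .
      have "s \<cdot> (z k \<cdot> x) = g \<cdot> (k \<cdot> x)"
        by (rule Cmp_eq_Cmp) (use zk k x f r in auto)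
      also have "\<dots> = s \<cdot> (z l \<cdot> y)"
        unfolding eq by (rule Cmp_eq_Cmp[symmetric]) (use zl k x f r in auto)
      finally show "s \<cdot> (z k \<cdot> x) = s \<cdot> (z l \<cdot> y)" .
    qed (use z k x in auto)
  qed (use r z e in \<open>auto simp: KI\<close>)
  show thesis
  proof (rule that)
    show "m \<in> hom E (Src E f) (Src E r)" using m by (simp add: A_def)
    show "r \<cdot> m = f"
    proof (rule eqI)
      fix x assume x: "x \<in> Ar E" "Src E x \<in> G" "Tgt E x = Src E (r \<cdot> m)"
      then have "x \<in> K" using m r by (simp add: KI)
      then show "(r \<cdot> m) \<cdot> x = f \<cdot> x" using m z x r by simp
    qed (use r m f A_def in auto)
    show "s \<cdot> m = g"
    proof (rule eqI)
      fix x assume x: "x \<in> Ar E" "Src E x \<in> G" "Tgt E x = Src E (s \<cdot> m)"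
      then have "x \<in> K" using m r by (simp add: KI)
      then show "(s \<cdot> m) \<cdot> x = g \<cdot> x" using m z x r by simp
    qed (use r m f A_def in auto)
  qed
qed

lemma const_cases:
  assumes "small u S" "x \<in> Ar E" "Src E x \<in> G" "Tgt E x = gs E S"
  obtains s where "s \<in> S" "x = const S (Src E x) s"
proof -
  have one: "\<forall>k\<in>S. one E \<in> Ob E" by simp
  obtain s y where s: "s \<in> S" and y: "y \<in> hom E (Src E x) (one E)" "incl E S (\<lambda>_. one E) s \<cdot> y = x"
    by (rule conn_coproduct[OF conn_G[OF assms(3)] assms(1) is_coproduct_coprod[OF assms(1) one], of x])
      (use assms in \<open>simp_all add: gs_def\<close>)
  have "y = bang E (Src E x)" by (rule one_unique) (use y assms in auto)
  then show ?thesis using that[OF s] y by (simp add: const_def)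
qed

lemma const_inj:
  assumes "small u S" "s \<in> S" "t \<in> S" "V \<in> G" "const S V s = const S V t"
  shows "s = t"
  using const_eq_imp_initial[OF assms(1-3) _ G_Ob[OF assms(4)] assms(5)] G_not_initial[OF assms(4)]
  by blast

lemma gs_prd_cases:
  assumes "small u S" "A \<in> Ob E" "x \<in> Ar E" "Src E x \<in> G" "Tgt E x = prd E (gs E S) A"
  obtains s a where "s \<in> S" "a \<in> Ar E" "Src E x = Src E a" "Tgt E a = A"
    "x = pair E (const S (Src E a) s) a"
proof -
  obtain f g where fg: "f \<in> Ar E" "g \<in> Ar E" "Src E x = Src E f" "Src E g = Src E f"
    "Tgt E f = gs E S" "Tgt E g = A" "x = pair E f g"
    by (rule prd_cases[OF assms(3,5) gs_Ob[OF assms(1)] assms(2)])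
  have "Src E f \<in> G" using fg(3) assms(4) by simp
  from const_cases[OF assms(1) fg(1) this fg(5)]
  obtain s where "s \<in> S" "f = const S (Src E f) s" .
  then show ?thesis using that[of s g] fg by metis
qed

end

section \<open>Descent data on the Cech family\<close>

lemma coface_simps [simp]:
  "coface (Suc 0) (Suc 0) = [0]" "coface (Suc 0) 0 = [Suc 0]"
  "coface 2 2 = [0, Suc 0]" "coface 2 0 = [Suc 0, 2]" "coface 2 (Suc 0) = [0, 2]"
  "codegen 0 0 = [0, 0]"
  by (simp_all add: coface_def codegen_def upt_conv_Cons numeral_2_eq_2)

lemma lproj_two: "lproj E U [i, j, k] 2 = (Idt E (U k) \<cdot>\<^bsub>E\<^esub> p2 E (U j) (U k)) \<cdot>\<^bsub>E\<^esub> p2 E (U i) (prd E (U j) (U k))"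
  by (simp add: numeral_2_eq_2)

lemma cech_one:
  "fc (cech E I U) (Suc 0) (Suc 0) [i, j] = [i]" "fc (cech E I U) (Suc 0) 0 [i, j] = [j]"
  "Cp (cech E I U) n is = lprd E U is"
  by (simp_all add: fc_def cech_def)

lemma cech_two:
  "fc (cech E I U) 2 2 [i, j, k] = [i, j]" "fc (cech E I U) 2 0 [i, j, k] = [j, k]"
  "fc (cech E I U) 2 (Suc 0) [i, j, k] = [i, k]"
  "cfc (cech E I U) 2 2 [i, j, k] = ltuple E (map (lproj E U [i, j, k]) [0, Suc 0])"
  "cfc (cech E I U) 2 0 [i, j, k] = ltuple E (map (lproj E U [i, j, k]) [Suc 0, 2])"
  "cfc (cech E I U) 2 (Suc 0) [i, j, k] = ltuple E (map (lproj E U [i, j, k]) [0, 2])"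
  by (simp_all add: fc_def cfc_def cech_def)

locale cech_cover = connected_generators E u G
  for E :: "('o, 'a) cat" (structure) and u :: "'u itself" and G :: "'o set" +
  fixes I :: "'u set" and U :: "'u \<Rightarrow> 'o" and R :: "'u \<Rightarrow> 'u set"
  assumes cover: "cover E I U" and small_R [simp]: "i \<in> I \<Longrightarrow> small u (R i)"
begin

lemma small_I: "small u I"
  using cover small_cong_itself[of u I] by (simp add: cover_def)

lemma U_Ob [simp]: "i \<in> I \<Longrightarrow> U i \<in> Ob E"
  and U_not_initial: "i \<in> I \<Longrightarrow> \<not> initial E (U i)"
  using cover unfolding cover_def by blast+

abbreviation adj :: "'u \<Rightarrow> 'u \<Rightarrow> bool" where
  "adj i j \<equiv> [i, j] \<in> Ix (cech E I U) 1"

definition elt :: "'u \<Rightarrow> 'a \<Rightarrow> bool" where [simp]: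
  "elt i x \<longleftrightarrow> i \<in> I \<and> x \<in> Ar E \<and> Src E x \<in> G \<and> Tgt E x = U i"

lemma adjD: "adj i j \<Longrightarrow> i \<in> I" "adj i j \<Longrightarrow> j \<in> I"
  by (auto simp: cech_def)

lemma adj_iff: "adj i j \<longleftrightarrow> (\<exists>x y. elt i x \<and> elt j y \<and> Src E y = Src E x)"
proof
  assume ij: "adj i j"
  then have "\<not> initial E (prd E (U i) (U j))" "prd E (U i) (U j) \<in> Ob E"
    using adjD[OF ij] by (auto simp: cech_def)
  then obtain z where z: "z \<in> Ar E" "Src E z \<in> G" "Tgt E z = prd E (U i) (U j)"
    using initial_iff by blast
  obtain x y where "x \<in> Ar E" "y \<in> Ar E" "Src E z = Src E x" "Src E y = Src E x" "Tgt E x = U i"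
    "Tgt E y = U j" "z = pair E x y"
    by (rule prd_cases[OF z(1,3) U_Ob[OF adjD(1)[OF ij]] U_Ob[OF adjD(2)[OF ij]]])
  then show "\<exists>x y. elt i x \<and> elt j y \<and> Src E y = Src E x"
    using z adjD[OF ij] by (intro exI[of _ x] exI[of _ y]) (simp add: elt_def)
next
  assume "\<exists>x y. elt i x \<and> elt j y \<and> Src E y = Src E x"
  then obtain x y where xy: "elt i x" "elt j y" "Src E y = Src E x" by blast
  have "\<not> initial E (prd E (U i) (U j))"
    by (subst initial_iff) (use xy in \<open>auto intro!: bexI[of _ "pair E x y"]\<close>)
  then show "adj i j" using xy by (auto simp: cech_def)
qed

lemma adjI: "elt i x \<Longrightarrow> elt j y \<Longrightarrow> Src E y = Src E x \<Longrightarrow> adj i j"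
  using adj_iff by blast

lemma adj_sym: "adj i j \<Longrightarrow> adj j i"
  using adj_iff by metis

text \<open>Elements of a constant object over a connected generator are constant, so there \<open>\<phi>\<close> acts as
  a function between the index sets (junk outside \<open>R i\<close> and off common domains in \<open>G\<close>).\<close>

definition act :: "('u \<Rightarrow> 'u \<Rightarrow> 'a) \<Rightarrow> 'u \<Rightarrow> 'u \<Rightarrow> 'a \<Rightarrow> 'a \<Rightarrow> 'u \<Rightarrow> 'u" where
  "act \<phi> i j x y r = (THE r'. r' \<in> R j \<and>
     \<phi> i j \<cdot> pair E (const (R i) (Src E x) r) (pair E x y) = const (R j) (Src E x) r')"

text \<open>The family of first projections of a descent datum: \<open>\<phi> i j\<close> is the
  uncurried form of a map from \<open>U i \<times> U j\<close> to the exponential of the constant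
  objects on \<open>R j\<close> and \<open>R i\<close>.\<close>

definition transport_map :: "('u \<Rightarrow> 'u \<Rightarrow> 'a) \<Rightarrow> bool" where
  "transport_map \<phi> \<longleftrightarrow>
     (\<forall>i j. adj i j \<longrightarrow> \<phi> i j \<in> hom E (prd E (gs E (R i)) (prd E (U i) (U j))) (gs E (R j)))"

lemma transport_mapD:
  assumes "transport_map \<phi>" "adj i j"
  shows "\<phi> i j \<in> Ar E" "Src E (\<phi> i j) = prd E (gs E (R i)) (prd E (U i) (U j))"
    "Tgt E (\<phi> i j) = gs E (R j)"
  using assms by (auto simp: transport_map_def)

lemma act_eqI:
  assumes "elt i x" "elt j y" "r' \<in> R j"
    "\<phi> i j \<cdot> pair E (const (R i) (Src E x) r) (pair E x y) = const (R j) (Src E x) r'"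
  shows "act \<phi> i j x y r = r'"
  unfolding act_def
proof (rule the_equality)
  fix s assume s: "s \<in> R j \<and> \<phi> i j \<cdot> pair E (const (R i) (Src E x) r) (pair E x y) = const (R j) (Src E x) s"
  show "s = r'" by (rule const_inj[of "R j" _ _ "Src E x"]) (use s assms in simp_all)
qed (use assms in simp)

lemma act_spec:
  assumes \<phi>: "transport_map \<phi>" and x: "elt i x" and y: "elt j y" "Src E y = Src E x" and r: "r \<in> R i"
  shows "act \<phi> i j x y r \<in> R j"
    "\<phi> i j \<cdot> pair E (const (R i) (Src E x) r) (pair E x y) = const (R j) (Src E x) (act \<phi> i j x y r)"
proof -
  note \<phi>' [simp] = transport_mapD[OF \<phi> adjI[OF x y]]
  let ?z = "\<phi> i j \<cdot> pair E (const (R i) (Src E x) r) (pair E x y)"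
  have z: "?z \<in> Ar E" "Src E ?z = Src E x" "Tgt E ?z = gs E (R j)" using x y r by simp_all
  obtain r' where r': "r' \<in> R j" "?z = const (R j) (Src E ?z) r'"
    by (rule const_cases[of "R j" ?z]) (use x y r in simp_all)
  then have eq: "?z = const (R j) (Src E x) r'" using z by simp
  have "act \<phi> i j x y r = r'" by (rule act_eqI[where \<phi> = \<phi>, OF x y(1) r'(1) eq])
  with r' eq show "act \<phi> i j x y r \<in> R j" "?z = const (R j) (Src E x) (act \<phi> i j x y r)" by simp_all
qed

text \<open>Restriction carries a constant to the constant with the same value. Hence an identity
  between values of \<open>act\<close> may be proved after any one restriction of the stage, which
  is how local existence is exploited later.\<close>

lemma act_Cmp:
  assumes \<phi>: "transport_map \<phi>" and x: "elt i x" and y: "elt j y" "Src E y = Src E x" and r: "r \<in> R i"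
    and c: "c \<in> Ar E" "Src E c \<in> G" "Tgt E c = Src E x"
  shows "act \<phi> i j (x \<cdot> c) (y \<cdot> c) r = act \<phi> i j x y r"
proof (rule act_eqI)
  note \<phi>' [simp] = transport_mapD[OF \<phi> adjI[OF x y]]
  show "elt i (x \<cdot> c)" "elt j (y \<cdot> c)" using x y c by (simp_all add: elt_def)
  show "act \<phi> i j x y r \<in> R j" by (rule act_spec[OF \<phi> x y r])
  have "(\<phi> i j \<cdot> pair E (const (R i) (Src E x) r) (pair E x y)) \<cdot> c =
      const (R j) (Src E x) (act \<phi> i j x y r) \<cdot> c"
    by (simp only: act_spec(2)[OF \<phi> x y r])
  then show "\<phi> i j \<cdot> pair E (const (R i) (Src E (x \<cdot> c)) r) (pair E (x \<cdot> c) (y \<cdot> c)) =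
      const (R j) (Src E (x \<cdot> c)) (act \<phi> i j x y r)"
    using x y r c act_spec(1)[OF \<phi> x y r] by simp
qed

text \<open>The unit and cocycle conditions read at connected stages, where they become identities
  between functions of index sets. \<open>U_descent_datumD\<close> and
  \<open>coherent_U_descent_datum\<close> give the two directions of the equivalence with descent
  data.\<close>

definition coherent :: "('u \<Rightarrow> 'u \<Rightarrow> 'a) \<Rightarrow> bool" where
  "coherent \<phi> \<longleftrightarrow> transport_map \<phi> \<and>
     (\<forall>i x r. elt i x \<and> r \<in> R i \<longrightarrow> act \<phi> i i x x r = r) \<and>
     (\<forall>i j k x y z r. elt i x \<and> elt j y \<and> elt k z \<and> Src E y = Src E x \<and> Src E z = Src E x \<and> r \<in> R i \<longrightarrow>
        act \<phi> j k y z (act \<phi> i j x y r) = act \<phi> i k x z r)"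

lemma coherentD:
  assumes "coherent \<phi>"
  shows "transport_map \<phi>" "elt i x \<Longrightarrow> r \<in> R i \<Longrightarrow> act \<phi> i i x x r = r"
    "elt i x \<Longrightarrow> elt j y \<Longrightarrow> elt k z \<Longrightarrow> Src E y = Src E x \<Longrightarrow> Src E z = Src E x \<Longrightarrow> r \<in> R i \<Longrightarrow>
      act \<phi> j k y z (act \<phi> i j x y r) = act \<phi> i k x z r"
  using assms unfolding coherent_def by blast+

lemma act_inverse:
  assumes "coherent \<phi>" "elt i x" "elt j y" "Src E y = Src E x" "r \<in> R i"
  shows "act \<phi> j i y x (act \<phi> i j x y r) = r"
  using coherentD(3)[OF assms(1-3,2,4) _ assms(5)] coherentD(2)[OF assms(1,2,5)] by simp

lemma act_bij:
  assumes \<phi>: "coherent \<phi>" and x: "elt i x" and y: "elt j y" "Src E y = Src E x"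
  shows "bij_betw (act \<phi> i j x y) (R i) (R j)"
proof (rule bij_betw_byWitness[where f' = "act \<phi> j i y x"])
  show "\<forall>r\<in>R i. act \<phi> j i y x (act \<phi> i j x y r) = r" using act_inverse[OF \<phi> x y] by blast
  show "\<forall>r\<in>R j. act \<phi> i j x y (act \<phi> j i y x r) = r" using act_inverse[OF \<phi> y(1) x] y by simp
  show "act \<phi> i j x y ` R i \<subseteq> R j" using act_spec(1)[OF coherentD(1)[OF \<phi>] x y] by blast
  show "act \<phi> j i y x ` R j \<subseteq> R i" using act_spec(1)[OF coherentD(1)[OF \<phi>] y(1) x] y by auto
qed

lemma transport_cases:
  assumes "i \<in> I" "j \<in> I" "z \<in> Ar E" "Src E z \<in> G" "Tgt E z = prd E (gs E (R i)) (prd E (U i) (U j))"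
  obtains r x y where "r \<in> R i" "elt i x" "elt j y" "Src E z = Src E x" "Src E y = Src E x"
    "z = pair E (const (R i) (Src E x) r) (pair E x y)"
proof -
  have UU: "prd E (U i) (U j) \<in> Ob E" using assms by simp
  obtain r a where r: "r \<in> R i" and a: "a \<in> Ar E" "Src E z = Src E a" "Tgt E a = prd E (U i) (U j)"
    and z: "z = pair E (const (R i) (Src E a) r) a"
    by (rule gs_prd_cases[OF small_R[OF assms(1)] UU assms(3-5)])
  obtain x y where "x \<in> Ar E" "y \<in> Ar E" "Src E a = Src E x" "Src E y = Src E x"
    "Tgt E x = U i" "Tgt E y = U j" "a = pair E x y"
    by (rule prd_cases[OF a(1,3) U_Ob[OF assms(1)] U_Ob[OF assms(2)]])
  with that[OF r, of x y] z a(2) assms(1,2,4) show thesis by simp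
qed

text \<open>A descent datum is determined by its first projection; the second component, forced to
  be the swap of the base, is restored here.\<close>

definition datum :: "('u \<Rightarrow> 'u \<Rightarrow> 'a) \<Rightarrow> 'u list \<Rightarrow> 'a" where
  "datum \<phi> = (\<lambda>e. let i = e ! 0; j = e ! 1 in
     pair E (\<phi> i j) (swap E (U i) (U j) \<cdot> p2 E (gs E (R i)) (prd E (U i) (U j))))"

lemma datum_type:
  assumes "transport_map \<phi>" "adj i j"
  shows "datum \<phi> [i, j] \<in> Ar E" "Src E (datum \<phi> [i, j]) = prd E (gs E (R i)) (prd E (U i) (U j))"
    "Tgt E (datum \<phi> [i, j]) = prd E (gs E (R j)) (prd E (U j) (U i))"
  using transport_mapD[OF assms] adjD[OF assms(2)] by (simp_all add: datum_def)

lemma datum_pair: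
  assumes \<phi>: "transport_map \<phi>" and x: "elt i x" and y: "elt j y" "Src E y = Src E x" and r: "r \<in> R i"
  shows "datum \<phi> [i, j] \<cdot> pair E (const (R i) (Src E x) r) (pair E x y)
    = pair E (const (R j) (Src E x) (act \<phi> i j x y r)) (pair E y x)"
proof -
  note \<phi>' [simp] = transport_mapD[OF \<phi> adjI[OF x y]]
  show ?thesis using x y r by (simp add: datum_def act_spec(2)[OF \<phi> x y r])
qed

abbreviation first :: "('u list \<Rightarrow> 'a) \<Rightarrow> 'u \<Rightarrow> 'u \<Rightarrow> 'a" where
  "first \<sigma> i j \<equiv> first_proj E (cech E I U) (R \<circ> hd) \<sigma> [i, j]"

lemma first_eq: "first \<sigma> i j = p1 E (gs E (R j)) (prd E (U j) (U i)) \<cdot> \<sigma> [i, j]"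
  by (simp add: first_proj_def fc_def cech_def)

lemma first_datum: "transport_map \<phi> \<Longrightarrow> adj i j \<Longrightarrow> first (datum \<phi>) i j = \<phi> i j"
  using transport_mapD[of \<phi> i j] adjD[of i j] by (simp add: first_eq datum_def)

text \<open>The defining diagrams are evaluated on an element of the constant object together with
  points of the cover at a connected stage. Both sides are then constants, and a constant determines
  its value.\<close>

lemma U_descent_datumD:
  assumes \<sigma>: "U_descent_datum E I U R \<sigma>"
  shows "coherent (first \<sigma>)" "adj i j \<Longrightarrow> \<sigma> [i, j] = datum (first \<sigma>) [i, j]"
proof -
  note H = \<sigma>[unfolded U_descent_datum_def H_descent_datum_def]
  have ty: "\<sigma> [i, j] \<in> hom E (prd E (gs E (R i)) (prd E (U i) (U j))) (prd E (gs E (R j)) (prd E (U j) (U i)))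
      \<and> p2 E (gs E (R j)) (prd E (U j) (U i)) \<cdot> \<sigma> [i, j] = swap E (U i) (U j) \<cdot> p2 E (gs E (R i)) (prd E (U i) (U j))"
    if ij: "adj i j" for i j
    using H[THEN conjunct1, THEN bspec, OF ij] adjD[OF ij]
    by (simp add: Let_def fc_def cech_def swap_def)
  have tm: "transport_map (first \<sigma>)"
    unfolding transport_map_def
  proof (intro allI impI)
    fix i j assume ij: "adj i j"
    show "first \<sigma> i j \<in> hom E (prd E (gs E (R i)) (prd E (U i) (U j))) (gs E (R j))"
      using ty[OF ij] adjD[OF ij] by (simp add: first_eq)
  qed
  show eq: "\<sigma> [i, j] = datum (first \<sigma>) [i, j]" if ij: "adj i j" for i j
    using ty[OF ij] adjD[OF ij] pair_eta[of "\<sigma> [i, j]" "gs E (R j)" "prd E (U j) (U i)"]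
    by (simp add: datum_def first_eq)
  show "coherent (first \<sigma>)"
    unfolding coherent_def
  proof (intro conjI allI impI)
    show "transport_map (first \<sigma>)" by (rule tm)
    fix i x r assume "elt i x \<and> r \<in> R i"
    then have x: "elt i x" and r: "r \<in> R i" by auto
    note [simp] = transport_mapD[OF tm adjI[OF x x refl]]
    have "[i] \<in> Ix (cech E I U) 0" using x U_not_initial by (simp add: cech_def)
    from H[THEN conjunct2, THEN conjunct1, THEN bspec, OF this]
    have "first \<sigma> i i \<cdot> pmap E (Idt E (gs E (R i))) (pair E (Idt E (U i)) (Idt E (U i)))
        = p1 E (gs E (R i)) (U i)"
      by (simp add: dg_def cdg_def cech_def)
    then have "(first \<sigma> i i \<cdot> pmap E (Idt E (gs E (R i))) (pair E (Idt E (U i)) (Idt E (U i)))) \<cdot>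
        pair E (const (R i) (Src E x) r) x
        = p1 E (gs E (R i)) (U i) \<cdot> pair E (const (R i) (Src E x) r) x" by simp
    then have "first \<sigma> i i \<cdot> pair E (const (R i) (Src E x) r) (pair E x x) = const (R i) (Src E x) r"
      using x r by simp
    then show "act (first \<sigma>) i i x x r = r" by (rule act_eqI[where \<phi> = "first \<sigma>", OF x x r])
  next
    fix i j k x y z r
    assume "elt i x \<and> elt j y \<and> elt k z \<and> Src E y = Src E x \<and> Src E z = Src E x \<and> r \<in> R i"
    then have x: "elt i x" and y: "elt j y" "Src E y = Src E x" and z: "elt k z" "Src E z = Src E x"
      and r: "r \<in> R i" by auto
    have yz: "Src E z = Src E y" using y z by simp
    note [simp] = transport_mapD[OF tm adjI[OF x y]] transport_mapD[OF tm adjI[OF x z]]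
      transport_mapD[OF tm adjI[OF y(1) z(1) yz]]
    \<comment> \<open>Only triples with non-empty product are 2-simplices of the Cech family; the
      points \<open>x\<close>, \<open>y\<close>, \<open>z\<close> form an element of that
      product.\<close>
    have "\<not> initial E (prd E (U i) (prd E (U j) (U k)))"
      by (subst initial_iff) (use x y z in \<open>auto intro!: bexI[of _ "pair E x (pair E y z)"]\<close>)
    then have "[i, j, k] \<in> Ix (cech E I U) 2" using x y z by (simp add: cech_def)
    note H3 = H[THEN conjunct2, THEN conjunct2, THEN bspec, OF this]
    let ?P = "prd E (U i) (prd E (U j) (U k))"
    define a where "a = p1 E (U i) (prd E (U j) (U k))"
    define b where "b = p1 E (U j) (U k) \<cdot> p2 E (U i) (prd E (U j) (U k))"
    define c where "c = p2 E (U j) (U k) \<cdot> p2 E (U i) (prd E (U j) (U k))"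
    let ?t = "pair E (const (R i) (Src E x) r) (pair E x (pair E y z))"
    have [simp]: "a \<in> Ar E" "Src E a = ?P" "Tgt E a = U i" "b \<in> Ar E" "Src E b = ?P" "Tgt E b = U j"
      "c \<in> Ar E" "Src E c = ?P" "Tgt E c = U k"
      "a \<cdot> pair E x (pair E y z) = x" "b \<cdot> pair E x (pair E y z) = y" "c \<cdot> pair E x (pair E y z) = z"
      using x y z by (simp_all add: a_def b_def c_def)
    have "first \<sigma> j k \<cdot> pair E (first \<sigma> i j \<cdot> pmap E (Idt E (gs E (R i))) (pair E a b))
                               (pair E b c \<cdot> p2 E (gs E (R i)) ?P)
        = first \<sigma> i k \<cdot> pmap E (Idt E (gs E (R i))) (pair E a c)"
      using H3 x y z by (simp add: Let_def cech_two cech_one lproj_two a_def b_def c_def)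
    then have "(first \<sigma> j k \<cdot> pair E (first \<sigma> i j \<cdot> pmap E (Idt E (gs E (R i))) (pair E a b))
                               (pair E b c \<cdot> p2 E (gs E (R i)) ?P)) \<cdot> ?t
        = (first \<sigma> i k \<cdot> pmap E (Idt E (gs E (R i))) (pair E a c)) \<cdot> ?t" by simp
    then have "first \<sigma> j k \<cdot> pair E (first \<sigma> i j \<cdot> pair E (const (R i) (Src E x) r) (pair E x y)) (pair E y z)
        = first \<sigma> i k \<cdot> pair E (const (R i) (Src E x) r) (pair E x z)"
      using x y z r by simp
    then have "first \<sigma> j k \<cdot> pair E (const (R j) (Src E y) (act (first \<sigma>) i j x y r)) (pair E y z)
        = const (R k) (Src E y) (act (first \<sigma>) i k x z r)"
      using act_spec(2)[OF tm x y r] act_spec(2)[OF tm x z r] y by simp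
    then show "act (first \<sigma>) j k y z (act (first \<sigma>) i j x y r) = act (first \<sigma>) i k x z r"
      by (rule act_eqI[OF y(1) z(1) act_spec(1)[OF tm x z r]])
  qed
qed

lemma datum_inverse:
  assumes \<phi>: "coherent \<phi>" and ij: "adj i j"
  shows "datum \<phi> [j, i] \<cdot> datum \<phi> [i, j] = Idt E (prd E (gs E (R i)) (prd E (U i) (U j)))"
proof -
  note tm = coherentD(1)[OF \<phi>]
  have ji: "adj j i" using ij by (rule adj_sym)
  note [simp] = datum_type[OF tm ij] datum_type[OF tm ji]
  show ?thesis
  proof (rule eqI)
    fix z assume z: "z \<in> Ar E" "Src E z \<in> G" "Tgt E z = Src E (datum \<phi> [j, i] \<cdot> datum \<phi> [i, j])"
    then have z3: "Tgt E z = prd E (gs E (R i)) (prd E (U i) (U j))" by simp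
    obtain r x y where r: "r \<in> R i" and x: "elt i x" and y: "elt j y" and xy: "Src E z = Src E x" "Src E y = Src E x"
      and zz: "z = pair E (const (R i) (Src E x) r) (pair E x y)"
      by (rule transport_cases[OF adjD[OF ij] z(1,2) z3])
    have xy': "Src E x = Src E y" "Src E y = Src E x" using xy(2) by simp_all
    have "datum \<phi> [j, i] \<cdot> (datum \<phi> [i, j] \<cdot> pair E (const (R i) (Src E x) r) (pair E x y))
        = datum \<phi> [j, i] \<cdot> pair E (const (R j) (Src E y) (act \<phi> i j x y r)) (pair E y x)"
      using datum_pair[OF tm x y xy'(2) r] xy(2) by simp
    also have "\<dots> = pair E (const (R i) (Src E x) r) (pair E x y)"
      using datum_pair[OF tm y x xy'(1) act_spec(1)[OF tm x y xy'(2) r]] act_inverse[OF \<phi> x y xy'(2) r] xy(2) by simp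
    finally have "datum \<phi> [j, i] \<cdot> (datum \<phi> [i, j] \<cdot> z) = z" unfolding zz .
    then show "(datum \<phi> [j, i] \<cdot> datum \<phi> [i, j]) \<cdot> z = Idt E (prd E (gs E (R i)) (prd E (U i) (U j))) \<cdot> z"
      using z z3 by simp
  qed (use adjD[OF ij] in simp_all)
qed

text \<open>Each required equation between arrows out of a product with \<open>gs E (R i)\<close> is
  tested on elements at generators. Such an element is a constant paired with points, and the
  equation becomes one between values of \<open>act\<close>.\<close>

lemma coherent_U_descent_datum:
  assumes \<phi>: "coherent \<phi>"
  shows "U_descent_datum E I U R (datum \<phi>)"
  unfolding U_descent_datum_def H_descent_datum_def
proof (intro conjI ballI)
  note tm = coherentD(1)[OF \<phi>]
  fix e assume "e \<in> Ix (cech E I U) 1"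
  moreover from this obtain i j where e: "e = [i, j]" by (auto simp: cech_def length_Suc_conv)
  ultimately have ij: "adj i j" by simp
  have ji: "adj j i" using ij by (rule adj_sym)
  have "iso E (datum \<phi> [i, j])"
    by (rule isoI[OF _ _ datum_inverse[OF \<phi> ij] datum_inverse[OF \<phi> ji]])
      (use datum_type[OF tm ij] datum_type[OF tm ji] in simp_all)
  then show "let i = fc (cech E I U) 1 1 e; j = fc (cech E I U) 1 0 e in
        iso E (datum \<phi> e) \<and>
        datum \<phi> e \<in> hom E (prd E (gs E ((R \<circ> hd) i)) (Cp (cech E I U) 1 e))
          (prd E (gs E ((R \<circ> hd) j)) (Cp (cech E I U) 1 (ixop (cech E I U) 1 e))) \<and>
        p2 E (gs E ((R \<circ> hd) j)) (Cp (cech E I U) 1 (ixop (cech E I U) 1 e)) \<cdot> datum \<phi> e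
          = cpop (cech E I U) 1 e \<cdot> p2 E (gs E ((R \<circ> hd) i)) (Cp (cech E I U) 1 e)"
    using datum_type[OF tm ij] transport_mapD[OF tm ij] adjD[OF ij]
    by (simp add: e Let_def fc_def cech_def swap_def datum_def)
next
  note tm = coherentD(1)[OF \<phi>]
  fix w assume "w \<in> Ix (cech E I U) 0"
  then obtain i where w: "w = [i]" and i: "i \<in> I" by (auto simp: cech_def length_Suc_conv)
  \<comment> \<open>The type of \<open>\<phi> i i\<close> is known only for adjacent indices; a
    point of the non-empty \<open>U i\<close> makes \<open>i\<close> adjacent to itself.\<close>
  obtain x0 where "elt i x0" using U_not_initial[OF i] initial_iff[OF U_Ob[OF i]] i by (auto simp: elt_def)
  note ii = adjI[OF this this refl]
  note [simp] = transport_mapD[OF tm ii]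
  have "\<phi> i i \<cdot> pmap E (Idt E (gs E (R i))) (pair E (Idt E (U i)) (Idt E (U i))) = p1 E (gs E (R i)) (U i)"
  proof (rule eqI)
    fix z assume z: "z \<in> Ar E" "Src E z \<in> G"
      "Tgt E z = Src E (\<phi> i i \<cdot> pmap E (Idt E (gs E (R i))) (pair E (Idt E (U i)) (Idt E (U i))))"
    then have z3: "Tgt E z = prd E (gs E (R i)) (U i)" using i by simp
    obtain r x where r: "r \<in> R i" and x: "x \<in> Ar E" "Src E z = Src E x" "Tgt E x = U i"
      and zz: "z = pair E (const (R i) (Src E x) r) x"
      by (rule gs_prd_cases[OF small_R[OF i] U_Ob[OF i] z(1,2) z3])
    have ex: "elt i x" using x z i by (simp add: elt_def)
    have "\<phi> i i \<cdot> pair E (const (R i) (Src E x) r) (pair E x x) = const (R i) (Src E x) r"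
      using act_spec(2)[OF tm ex ex refl r] coherentD(2)[OF \<phi> ex r] by simp
    then have "(\<phi> i i \<cdot> pmap E (Idt E (gs E (R i))) (pair E (Idt E (U i)) (Idt E (U i)))) \<cdot>
         pair E (const (R i) (Src E x) r) x = p1 E (gs E (R i)) (U i) \<cdot> pair E (const (R i) (Src E x) r) x"
      using ex r by simp
    then show "(\<phi> i i \<cdot> pmap E (Idt E (gs E (R i))) (pair E (Idt E (U i)) (Idt E (U i)))) \<cdot> z
        = p1 E (gs E (R i)) (U i) \<cdot> z"
      unfolding zz .
  qed (use i in simp_all)
  then show "first_proj E (cech E I U) (R \<circ> hd) (datum \<phi>) (dg (cech E I U) 0 0 w) \<cdot>
      pmap E (Idt E (gs E ((R \<circ> hd) w))) (cdg (cech E I U) 0 0 w)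
      = p1 E (gs E ((R \<circ> hd) w)) (Cp (cech E I U) 0 w)"
    using first_datum[OF tm ii] by (simp add: w dg_def cdg_def cech_def)
next
  note tm = coherentD(1)[OF \<phi>]
  fix w assume "w \<in> Ix (cech E I U) 2"
  then obtain i j k where w: "w = [i, j, k]" and i [simp]: "i \<in> I" and j [simp]: "j \<in> I" and k [simp]: "k \<in> I"
    and ni: "\<not> initial E (prd E (U i) (prd E (U j) (U k)))"
    by (auto simp: cech_def length_Suc_conv numeral_2_eq_2)
  let ?P = "prd E (U i) (prd E (U j) (U k))"
  have PO [simp]: "?P \<in> Ob E" by simp
  have cs: "\<exists>x y z. elt i x \<and> elt j y \<and> elt k z \<and> Src E t = Src E x \<and> Src E y = Src E x \<and> Src E z = Src E x \<and>
      t = pair E x (pair E y z)" if t: "t \<in> Ar E" "Src E t \<in> G" "Tgt E t = ?P" for t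
  proof -
    obtain x t' where x: "x \<in> Ar E" "t' \<in> Ar E" "Src E t = Src E x" "Src E t' = Src E x" "Tgt E x = U i"
      "Tgt E t' = prd E (U j) (U k)" "t = pair E x t'"
      by (rule prd_cases[OF t(1,3) U_Ob[OF i]]) simp
    obtain y z where "y \<in> Ar E" "z \<in> Ar E" "Src E t' = Src E y" "Src E z = Src E y" "Tgt E y = U j"
      "Tgt E z = U k" "t' = pair E y z"
      by (rule prd_cases[OF x(2,6) U_Ob[OF j] U_Ob[OF k]])
    with x t show ?thesis by (intro exI[of _ x] exI[of _ y] exI[of _ z]) (simp add: elt_def)
  qed
  obtain t0 where t0: "t0 \<in> Ar E" "Src E t0 \<in> G" "Tgt E t0 = ?P"
    using ni by (auto simp: initial_iff)
  from cs[OF t0] obtain x0 y0 z0 where e0: "elt i x0" "elt j y0" "elt k z0"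
    "Src E y0 = Src E x0" "Src E z0 = Src E x0" by blast
  have ij: "adj i j" and ik: "adj i k" and jk: "adj j k"
    using adjI[OF e0(1,2)] adjI[OF e0(1,3)] adjI[OF e0(2,3)] e0(4,5) by metis+
  note [simp] = transport_mapD[OF tm ij] transport_mapD[OF tm ik] transport_mapD[OF tm jk]
  define a where "a = p1 E (U i) (prd E (U j) (U k))"
  define b where "b = p1 E (U j) (U k) \<cdot> p2 E (U i) (prd E (U j) (U k))"
  define c where "c = p2 E (U j) (U k) \<cdot> p2 E (U i) (prd E (U j) (U k))"
  have [simp]: "a \<in> Ar E" "Src E a = ?P" "Tgt E a = U i" "b \<in> Ar E" "Src E b = ?P" "Tgt E b = U j"
    "c \<in> Ar E" "Src E c = ?P" "Tgt E c = U k"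
    by (simp_all add: a_def b_def c_def)
  let ?l = "\<phi> j k \<cdot> pair E (\<phi> i j \<cdot> pmap E (Idt E (gs E (R i))) (pair E a b))
                               (pair E b c \<cdot> p2 E (gs E (R i)) ?P)"
  let ?r = "\<phi> i k \<cdot> pmap E (Idt E (gs E (R i))) (pair E a c)"
  have "?l = ?r"
  proof (rule eqI)
    fix z assume z: "z \<in> Ar E" "Src E z \<in> G" "Tgt E z = Src E ?l"
    then have z3: "Tgt E z = prd E (gs E (R i)) ?P" by simp
    obtain r t where r: "r \<in> R i" and t: "t \<in> Ar E" "Src E z = Src E t" "Tgt E t = ?P"
      and zz: "z = pair E (const (R i) (Src E t) r) t"
      by (rule gs_prd_cases[OF small_R[OF i] PO z(1,2) z3])
    obtain x y z' where x: "elt i x" and y: "elt j y" and z': "elt k z'" and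
      s: "Src E t = Src E x" "Src E y = Src E x" "Src E z' = Src E x" and tt: "t = pair E x (pair E y z')"
      using cs[OF t(1) _ t(3)] t(2) z(2) by auto
    have xyz: "Src E y = Src E x" "Src E z' = Src E x" "Src E z' = Src E y" using s(2,3) by simp_all
    have [simp]: "a \<cdot> pair E x (pair E y z') = x" "b \<cdot> pair E x (pair E y z') = y" "c \<cdot> pair E x (pair E y z') = z'"
      using x y z' xyz by (simp_all add: a_def b_def c_def)
    let ?t = "pair E (const (R i) (Src E x) r) (pair E x (pair E y z'))"
    have "?l \<cdot> ?t = \<phi> j k \<cdot> pair E (\<phi> i j \<cdot> pair E (const (R i) (Src E x) r) (pair E x y)) (pair E y z')"
      using x y z' xyz r by simp
    also have "\<dots> = \<phi> j k \<cdot> pair E (const (R j) (Src E y) (act \<phi> i j x y r)) (pair E y z')"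
      using act_spec(2)[OF tm x y xyz(1) r] xyz by simp
    also have "\<dots> = const (R k) (Src E y) (act \<phi> j k y z' (act \<phi> i j x y r))"
      by (rule act_spec(2)[OF tm y z' xyz(3) act_spec(1)[OF tm x y xyz(1) r]])
    also have "\<dots> = const (R k) (Src E x) (act \<phi> i k x z' r)"
      using coherentD(3)[OF \<phi> x y z' xyz(1,2) r] xyz by simp
    also have "\<dots> = ?r \<cdot> ?t"
      using x y z' xyz r act_spec(2)[OF tm x z' xyz(2) r] by simp
    finally have "?l \<cdot> ?t = ?r \<cdot> ?t" .
    moreover have "z = ?t" using zz unfolding s(1) unfolding tt .
    ultimately show "?l \<cdot> z = ?r \<cdot> z" by simp
  qed simp_all
  then show "let i = fc (cech E I U) 1 1 (fc (cech E I U) 2 2 w) in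
      first_proj E (cech E I U) (R \<circ> hd) (datum \<phi>) (fc (cech E I U) 2 0 w) \<cdot>
          pair E (first_proj E (cech E I U) (R \<circ> hd) (datum \<phi>) (fc (cech E I U) 2 2 w) \<cdot>
                    pmap E (Idt E (gs E ((R \<circ> hd) i))) (cfc (cech E I U) 2 2 w))
                 (cfc (cech E I U) 2 0 w \<cdot> p2 E (gs E ((R \<circ> hd) i)) (Cp (cech E I U) 2 w))
        = first_proj E (cech E I U) (R \<circ> hd) (datum \<phi>) (fc (cech E I U) 2 1 w) \<cdot>
            pmap E (Idt E (gs E ((R \<circ> hd) i))) (cfc (cech E I U) 2 1 w)"
    using first_datum[OF tm ij] first_datum[OF tm ik] first_datum[OF tm jk]
    by (simp add: w Let_def cech_two cech_one lproj_two a_def b_def c_def)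
qed

end

section \<open>Descent of locally constant objects\<close>

context cech_cover
begin

text \<open>The element of X named by \<open>r\<close> over the point \<open>x\<close> of
  \<open>U i\<close>. For fixed \<open>x\<close> these names correspond bijectively to the elements
  of X at the stage of \<open>x\<close>, by \<open>val_inj\<close> and
  \<open>val_surj\<close>.\<close>

definition val :: "'o \<Rightarrow> ('u \<Rightarrow> 'a) \<Rightarrow> 'u \<Rightarrow> 'u \<Rightarrow> 'a \<Rightarrow> 'a" where
  "val X \<theta> i r x = p1 E X (U i) \<cdot> (\<theta> i \<cdot> pair E (const (R i) (Src E x) r) x)"

lemma trivializationD:
  assumes "trivialization E I U X R \<theta>" "i \<in> I"
  shows "X \<in> Ob E" "iso E (\<theta> i)" "\<theta> i \<in> Ar E" "Src E (\<theta> i) = prd E (gs E (R i)) (U i)"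
    "Tgt E (\<theta> i) = prd E X (U i)" "p2 E X (U i) \<cdot> \<theta> i = p2 E (gs E (R i)) (U i)"
  using assms by (auto simp: trivialization_def)

lemma val_type:
  assumes "trivialization E I U X R \<theta>" "elt i x" "r \<in> R i"
  shows "val X \<theta> i r x \<in> Ar E" "Src E (val X \<theta> i r x) = Src E x" "Tgt E (val X \<theta> i r x) = X"
    "\<theta> i \<cdot> pair E (const (R i) (Src E x) r) x = pair E (val X \<theta> i r x) x"
proof -
  note i [simp] = assms(2)[unfolded elt_def, THEN conjunct1]
  note [simp] = trivializationD[OF assms(1) i]
  show "val X \<theta> i r x \<in> Ar E" "Src E (val X \<theta> i r x) = Src E x" "Tgt E (val X \<theta> i r x) = X"
    using assms(2,3) by (simp_all add: val_def)
  have "p2 E X (U i) \<cdot> (\<theta> i \<cdot> pair E (const (R i) (Src E x) r) x)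
      = (p2 E X (U i) \<cdot> \<theta> i) \<cdot> pair E (const (R i) (Src E x) r) x"
    by (rule Cmp_assoc[symmetric]) (use assms(2,3) in simp_all)
  also have "\<dots> = x" using assms(2,3) by simp
  finally have 2: "p2 E X (U i) \<cdot> (\<theta> i \<cdot> pair E (const (R i) (Src E x) r) x) = x" .
  show "\<theta> i \<cdot> pair E (const (R i) (Src E x) r) x = pair E (val X \<theta> i r x) x"
    using pair_eta[of "\<theta> i \<cdot> pair E (const (R i) (Src E x) r) x" X "U i"] assms(2,3)
    by (simp add: 2 val_def)
qed

lemma val_inj:
  assumes "trivialization E I U X R \<theta>" "elt i x" "r \<in> R i" "s \<in> R i" "val X \<theta> i r x = val X \<theta> i s x"
  shows "r = s"
proof -
  note i = assms(2)[unfolded elt_def, THEN conjunct1]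
  note [simp] = i trivializationD(1-5)[OF assms(1) i]
  obtain g where g: "g \<in> hom E (Tgt E (\<theta> i)) (Src E (\<theta> i))" "g \<cdot> \<theta> i = Idt E (Src E (\<theta> i))"
    using isoE[OF trivializationD(2)[OF assms(1) i]] by metis
  have "\<theta> i \<cdot> pair E (const (R i) (Src E x) r) x = \<theta> i \<cdot> pair E (const (R i) (Src E x) s) x"
    using val_type(4)[OF assms(1-3)] val_type(4)[OF assms(1,2,4)] assms(5) by simp
  then have "(g \<cdot> \<theta> i) \<cdot> pair E (const (R i) (Src E x) r) x = (g \<cdot> \<theta> i) \<cdot> pair E (const (R i) (Src E x) s) x"
    using assms(2-4) g(1) by simp
  then have "pair E (const (R i) (Src E x) r) x = pair E (const (R i) (Src E x) s) x"
    using assms(2-4) unfolding g(2) by simp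
  then have "const (R i) (Src E x) r = const (R i) (Src E x) s"
    using pair_proj(1)[of "const (R i) (Src E x) r" x] pair_proj(1)[of "const (R i) (Src E x) s" x] assms(2-4)
    by (metis G_Ob const_type elt_def i small_R)
  then show ?thesis by (rule const_inj[OF small_R[OF i] assms(3,4), rotated]) (use assms(2) in simp)
qed

lemma val_surj:
  assumes "trivialization E I U X R \<theta>" "elt i x" "z \<in> Ar E" "Tgt E z = X" "Src E z = Src E x"
  obtains r where "r \<in> R i" "z = val X \<theta> i r x"
proof -
  note i = assms(2)[unfolded elt_def, THEN conjunct1]
  note [simp] = i trivializationD(1-5)[OF assms(1) i]
  obtain g where g: "g \<in> hom E (Tgt E (\<theta> i)) (Src E (\<theta> i))" "\<theta> i \<cdot> g = Idt E (Tgt E (\<theta> i))"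
    using isoE[OF trivializationD(2)[OF assms(1) i]] by metis
  let ?w = "g \<cdot> pair E z x"
  have w: "?w \<in> Ar E" "Src E ?w \<in> G" "Tgt E ?w = prd E (gs E (R i)) (U i)" "Src E ?w = Src E x"
    using g(1) assms by simp_all
  obtain r a where r: "r \<in> R i" and a: "a \<in> Ar E" "Src E ?w = Src E a" "Tgt E a = U i"
    "?w = pair E (const (R i) (Src E a) r) a"
    by (rule gs_prd_cases[OF small_R[OF i] U_Ob[OF i] w(1-3)])
  have ea: "elt i a" using a(1-3) w(2) i by simp
  have "(\<theta> i \<cdot> g) \<cdot> pair E z x = \<theta> i \<cdot> ?w"
    by (rule Cmp_assoc) (use g(1) assms in simp_all)
  then have "\<theta> i \<cdot> pair E (const (R i) (Src E a) r) a = pair E z x" using g assms a(4) by simp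
  then have "pair E (val X \<theta> i r a) a = pair E z x" using val_type(4)[OF assms(1) ea r] by simp
  then have "val X \<theta> i r a = z \<and> a = x"
    by (rule iffD1[OF pair_eq_iff, rotated -1])
      (use val_type(1-3)[OF assms(1) ea r] assms(2-5) a(1-3) w(4) in simp_all)
  then show thesis using that[OF r] by blast
qed

text \<open>On an element given by \<open>r\<close>, \<open>x\<close>, \<open>y\<close> both
  composites end in \<open>((_, y), x)\<close>. Only the component in X can differ: it is the value
  of the transported \<open>r\<close> over \<open>y\<close> on one side and that of \<open>r\<close>
  over \<open>x\<close> on the other.\<close>

lemma transition_iff:
  assumes \<theta>: "trivialization E I U X R \<theta>" and \<phi>: "transport_map \<phi>" and ij: "adj i j"
  shows "pmap E (\<theta> j) (Idt E (U i)) \<cdot> assoc E (gs E (R j)) (U j) (U i) \<cdot> datum \<phi> [i, j]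
           = assoc E X (U j) (U i) \<cdot> pmap E (Idt E X) (swap E (U i) (U j)) \<cdot>
             assoc_inv E X (U i) (U j) \<cdot>
             pmap E (\<theta> i) (Idt E (U j)) \<cdot> assoc E (gs E (R i)) (U i) (U j)
    \<longleftrightarrow> (\<forall>x y r. elt i x \<and> elt j y \<and> Src E y = Src E x \<and> r \<in> R i \<longrightarrow>
          val X \<theta> j (act \<phi> i j x y r) y = val X \<theta> i r x)"
    (is "?L = ?R \<longleftrightarrow> _")
proof -
  note i = adjD(1)[OF ij] and j = adjD(2)[OF ij]
  note [simp] = i j trivializationD(1,3-5)[OF \<theta> i] trivializationD(3-5)[OF \<theta> j] datum_type[OF \<phi> ij]
  have L: "?L \<cdot> pair E (const (R i) (Src E x) r) (pair E x y) = pair E (pair E (val X \<theta> j (act \<phi> i j x y r) y) y) x"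
    and R: "?R \<cdot> pair E (const (R i) (Src E x) r) (pair E x y) = pair E (pair E (val X \<theta> i r x) y) x"
    if x: "elt i x" and y: "elt j y" "Src E y = Src E x" and r: "r \<in> R i" for x y r
  proof -
    note a [simp] = act_spec(1)[OF \<phi> x y r]
    note [simp] = val_type(1-3)[OF \<theta> x r] val_type(1-3)[OF \<theta> y(1) a]
    have [simp]: "\<theta> i \<cdot> pair E (const (R i) (Src E x) r) x = pair E (val X \<theta> i r x) x"
      by (rule val_type(4)[OF \<theta> x r])
    have [simp]: "\<theta> j \<cdot> pair E (const (R j) (Src E x) (act \<phi> i j x y r)) y = pair E (val X \<theta> j (act \<phi> i j x y r) y) y"
      using val_type(4)[OF \<theta> y(1) a] y(2) by simp
    have [simp]: "datum \<phi> [i, j] \<cdot> pair E (const (R i) (Src E x) r) (pair E x y)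
      = pair E (const (R j) (Src E x) (act \<phi> i j x y r)) (pair E y x)"
      by (rule datum_pair[OF \<phi> x y r])
    show "?L \<cdot> pair E (const (R i) (Src E x) r) (pair E x y) = pair E (pair E (val X \<theta> j (act \<phi> i j x y r) y) y) x"
      using x y r by simp
    show "?R \<cdot> pair E (const (R i) (Src E x) r) (pair E x y) = pair E (pair E (val X \<theta> i r x) y) x"
      using x y r by simp
  qed
  show ?thesis
  proof
    assume eq: "?L = ?R"
    show "\<forall>x y r. elt i x \<and> elt j y \<and> Src E y = Src E x \<and> r \<in> R i \<longrightarrow>
          val X \<theta> j (act \<phi> i j x y r) y = val X \<theta> i r x"
    proof (intro allI impI)
      fix x y r assume "elt i x \<and> elt j y \<and> Src E y = Src E x \<and> r \<in> R i"
      then have x: "elt i x" and y: "elt j y" "Src E y = Src E x" and r: "r \<in> R i" by auto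
      note a = act_spec(1)[OF \<phi> x y r]
      note v = val_type(1-3)[OF \<theta> x r] val_type(1-3)[OF \<theta> y(1) a]
      have "pair E (pair E (val X \<theta> j (act \<phi> i j x y r) y) y) x = pair E (pair E (val X \<theta> i r x) y) x"
        using L[OF x y r] R[OF x y r] eq by metis
      then have "pair E (val X \<theta> j (act \<phi> i j x y r) y) y = pair E (val X \<theta> i r x) y"
        by (subst (asm) pair_eq_iff) (use v x y in simp_all)
      then show "val X \<theta> j (act \<phi> i j x y r) y = val X \<theta> i r x"
        by (subst (asm) pair_eq_iff) (use v x y in simp_all)
    qed
  next
    assume eq: "\<forall>x y r. elt i x \<and> elt j y \<and> Src E y = Src E x \<and> r \<in> R i \<longrightarrow>
          val X \<theta> j (act \<phi> i j x y r) y = val X \<theta> i r x"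
    show "?L = ?R"
    proof (rule eqI)
      fix z assume z: "z \<in> Ar E" "Src E z \<in> G" "Tgt E z = Src E ?L"
      then have z3: "Tgt E z = prd E (gs E (R i)) (prd E (U i) (U j))" by simp
      obtain r x y where r: "r \<in> R i" and x: "elt i x" and y: "elt j y" "Src E y = Src E x"
        and zz: "z = pair E (const (R i) (Src E x) r) (pair E x y)"
        by (rule transport_cases[OF i j z(1,2) z3])
      show "?L \<cdot> z = ?R \<cdot> z"
        unfolding zz L[OF x y r] R[OF x y r] using eq x y r by simp
    qed simp_all
  qed
qed

text \<open>In terms of names of elements of X, the square relating \<open>\<sigma>\<close> and
  \<open>\<theta>\<close> says just that \<open>r\<close> over \<open>x\<close> and its transport
  over \<open>y\<close> name the same element.\<close>

lemma locally_constant_transition: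
  assumes "U_descent_datum E I U R \<sigma>"
  shows "locally_constant E I U X R \<sigma> \<longleftrightarrow>
    (\<exists>\<theta>. trivialization E I U X R \<theta> \<and> (\<forall>i j x y r. elt i x \<and> elt j y \<and> Src E y = Src E x \<and> r \<in> R i \<longrightarrow>
        val X \<theta> j (act (first \<sigma>) i j x y r) y = val X \<theta> i r x))"
proof -
  note co = U_descent_datumD(1)[OF assms]
  have eq: "(\<forall>i j. adj i j \<longrightarrow>
           pmap E (\<theta> j) (Idt E (U i)) \<cdot> assoc E (gs E (R j)) (U j) (U i) \<cdot> \<sigma> [i, j]
           = assoc E X (U j) (U i) \<cdot> pmap E (Idt E X) (swap E (U i) (U j)) \<cdot>
             assoc_inv E X (U i) (U j) \<cdot>
             pmap E (\<theta> i) (Idt E (U j)) \<cdot> assoc E (gs E (R i)) (U i) (U j)) \<longleftrightarrow>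
      (\<forall>i j x y r. elt i x \<and> elt j y \<and> Src E y = Src E x \<and> r \<in> R i \<longrightarrow>
        val X \<theta> j (act (first \<sigma>) i j x y r) y = val X \<theta> i r x)" (is "?l \<longleftrightarrow> ?r")
    if \<theta>: "trivialization E I U X R \<theta>" for \<theta>
  proof
    assume l: ?l
    show ?r
    proof (intro allI impI)
      fix i j x y r assume xy: "elt i x \<and> elt j y \<and> Src E y = Src E x \<and> r \<in> R i"
      then have ij: "adj i j" using adjI by blast
      note l[rule_format, OF ij, unfolded U_descent_datumD(2)[OF assms ij]]
      from this[unfolded transition_iff[OF \<theta> coherentD(1)[OF co] ij]]
      show "val X \<theta> j (act (first \<sigma>) i j x y r) y = val X \<theta> i r x" using xy by blast
    qed
  next
    assume r: ?r
    show ?l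
    proof (intro allI impI, goal_cases)
      case (1 i j)
      show ?case
        unfolding U_descent_datumD(2)[OF assms 1] transition_iff[OF \<theta> coherentD(1)[OF co] 1]
        using r by blast
    qed
  qed
  show ?thesis
    unfolding locally_constant_def using assms eq by blast
qed

section \<open>Maps out of a locally constant object, and its uniqueness\<close>

lemma epi_family_U: "epi_family E (one E) ((\<lambda>i. bang E (U i)) ` I)"
  unfolding epi_family_def
proof (intro conjI ballI allI impI)
  have U: "\<forall>i\<in>I. U i \<in> Ob E" by simp
  note [simp] = coprod_type[OF small_I U]
  have e: "epi E (bang E (coprod E I U))" using cover by (simp add: cover_def)
  fix C g h assume g: "g \<in> hom E (one E) C" and h: "h \<in> hom E (one E) C"
    and eq: "\<forall>f\<in>(\<lambda>i. bang E (U i)) ` I. g \<cdot> f = h \<cdot> f"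
  have "g \<cdot> bang E (coprod E I U) = h \<cdot> bang E (coprod E I U)"
  proof (rule is_coproduct_unique[OF is_coproduct_coprod[OF small_I U]])
    fix i assume i: "i \<in> I"
    then show "(g \<cdot> bang E (coprod E I U)) \<cdot> incl E I U i = (h \<cdot> bang E (coprod E I U)) \<cdot> incl E I U i"
      using g h eq by simp
  qed (use g h in simp_all)
  then show "g = h" using e g h unfolding epi_def by simp
qed auto

text \<open>As the \<open>U i\<close> cover the terminal object, each stage is covered by stages at
  which some \<open>U i\<close> has a point; there the elements of X are known through the
  trivialization.\<close>

lemma cover_lift:
  assumes "V \<in> Ob E"
  shows "epi_family E V {c. c \<in> Ar E \<and> Src E c \<in> G \<and> Tgt E c = V \<and>
    (\<exists>i\<in>I. \<exists>y\<in>Ar E. Src E y = Src E c \<and> Tgt E y = U i)}"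
proof -
  have "epi_family E (Src E (bang E V)) {c. c \<in> Ar E \<and> Src E c \<in> G \<and> Tgt E c = Src E (bang E V) \<and>
    (\<exists>i\<in>I. \<exists>y\<in>Ar E. Src E y = Src E c \<and> Tgt E y = Src E (bang E (U i)) \<and> bang E (U i) \<cdot> y = bang E V \<cdot> c)}"
    by (rule epi_family_lift[OF small_I _ epi_family_U]) (use assms in simp_all)
  then have "epi_family E V {c. c \<in> Ar E \<and> Src E c \<in> G \<and> Tgt E c = V \<and>
    (\<exists>i\<in>I. \<exists>y\<in>Ar E. Src E y = Src E c \<and> Tgt E y = Src E (bang E (U i)) \<and> bang E (U i) \<cdot> y = bang E V \<cdot> c)}"
    using assms by simp
  then show ?thesis by (rule epi_family_mono) auto
qed

text \<open>X is covered by the \<open>\<gamma>\<^sup>*R\<^sub>i \<times> U\<^sub>i\<close>. Two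
  names of one element of X are related by \<open>act\<close>, hence name one element of Y as well,
  and so the maps into Y glue.\<close>

lemma locally_constant_map:
  assumes \<phi>: "coherent \<phi>" and \<theta>: "trivialization E I U X R \<theta>" and \<theta>': "trivialization E I U Y R \<theta>'"
    and X: "\<And>i j x y r. elt i x \<Longrightarrow> elt j y \<Longrightarrow> Src E y = Src E x \<Longrightarrow> r \<in> R i \<Longrightarrow>
        val X \<theta> j (act \<phi> i j x y r) y = val X \<theta> i r x"
    and Y: "\<And>i j x y r. elt i x \<Longrightarrow> elt j y \<Longrightarrow> Src E y = Src E x \<Longrightarrow> r \<in> R i \<Longrightarrow>
        val Y \<theta>' j (act \<phi> i j x y r) y = val Y \<theta>' i r x"
  obtains h where "h \<in> hom E X Y" "\<And>i r x. elt i x \<Longrightarrow> r \<in> R i \<Longrightarrow> h \<cdot> val X \<theta> i r x = val Y \<theta>' i r x"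
proof -
  have XO: "X \<in> Ob E" and YO: "Y \<in> Ob E" using \<theta> \<theta>' by (simp_all add: trivialization_def)
  define f where "f i = p1 E X (U i) \<cdot> \<theta> i" for i
  define g where "g i = p1 E Y (U i) \<cdot> \<theta>' i" for i
  have fv: "f i \<cdot> pair E (const (R i) (Src E x) r) x = val X \<theta> i r x"
    and gv: "g i \<cdot> pair E (const (R i) (Src E x) r) x = val Y \<theta>' i r x" if x: "elt i x" "r \<in> R i" for i x r
  proof -
    have i: "i \<in> I" using x by simp
    show "f i \<cdot> pair E (const (R i) (Src E x) r) x = val X \<theta> i r x"
      and "g i \<cdot> pair E (const (R i) (Src E x) r) x = val Y \<theta>' i r x"
      unfolding f_def g_def val_def
      by (rule Cmp_assoc; use trivializationD[OF \<theta> i] trivializationD[OF \<theta>' i] x in simp)+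
  qed
  have fty: "\<forall>i\<in>I. f i \<in> Ar E \<and> Src E (f i) = prd E (gs E (R i)) (U i) \<and> Tgt E (f i) = X"
    and gty: "\<forall>i\<in>I. g i \<in> Ar E \<and> Src E (g i) = prd E (gs E (R i)) (U i) \<and> Tgt E (g i) = Y"
    using trivializationD[OF \<theta>] trivializationD[OF \<theta>'] by (simp_all add: f_def g_def)
  have e: "epi_family E X (f ` I)"
  proof (rule epi_familyI)
    fix b assume b: "b \<in> Ar E" "Src E b \<in> G" "Tgt E b = X"
    show "epi_family E (Src E b) {c. c \<in> Ar E \<and> Src E c \<in> G \<and> Tgt E c = Src E b \<and>
        (\<exists>f\<in>f ` I. \<exists>y\<in>Ar E. Tgt E y = Src E f \<and> Src E y = Src E c \<and> f \<cdot> y = b \<cdot> c)}"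
    proof (rule epi_family_mono[OF cover_lift])
      show "{c. c \<in> Ar E \<and> Src E c \<in> G \<and> Tgt E c = Src E b \<and>
          (\<exists>i\<in>I. \<exists>y\<in>Ar E. Src E y = Src E c \<and> Tgt E y = U i)}
        \<subseteq> {c. c \<in> Ar E \<and> Src E c \<in> G \<and> Tgt E c = Src E b \<and>
        (\<exists>f\<in>f ` I. \<exists>y\<in>Ar E. Tgt E y = Src E f \<and> Src E y = Src E c \<and> f \<cdot> y = b \<cdot> c)}"
      proof clarify
        fix c i y assume c: "c \<in> Ar E" "Src E c \<in> G" "Tgt E c = Src E b" and i: "i \<in> I"
          and y: "y \<in> Ar E" "Src E y = Src E c" "Tgt E y = U i"
        have y': "elt i y" using y c i by simp
        obtain r where r: "r \<in> R i" "b \<cdot> c = val X \<theta> i r y"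
          by (rule val_surj[OF \<theta> y', of "b \<cdot> c"]) (use b c y in simp_all)
        show "\<exists>f\<in>f ` I. \<exists>y\<in>Ar E. Tgt E y = Src E f \<and> Src E y = Src E c \<and> f \<cdot> y = b \<cdot> c"
        proof (intro bexI conjI)
          show "f i \<cdot> pair E (const (R i) (Src E y) r) y = b \<cdot> c" using fv[OF y' r(1)] r(2) by simp
        qed (use y' y r fty i in \<open>simp_all\<close>)
      qed
    qed (use b in auto)
  qed (use XO fty in auto)
  obtain h where h: "h \<in> hom E X Y" "\<And>i. i \<in> I \<Longrightarrow> h \<cdot> f i = g i"
  proof (rule glue[OF small_I XO YO, of f g])
    fix i j x y
    assume i: "i \<in> I" and j: "j \<in> I" and x: "x \<in> Ar E" "y \<in> Ar E" "Src E x \<in> G" "Src E y = Src E x"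
      "Tgt E x = Src E (f i)" "Tgt E y = Src E (f j)" and eq: "f i \<cdot> x = f j \<cdot> y"
    have x5: "Tgt E x = prd E (gs E (R i)) (U i)" and y5: "Tgt E y = prd E (gs E (R j)) (U j)" using x fty i j by simp_all
    have y4: "Src E y \<in> G" using x by simp
    obtain r a where r: "r \<in> R i" and a: "a \<in> Ar E" "Src E x = Src E a" "Tgt E a = U i"
      and xx: "x = pair E (const (R i) (Src E a) r) a"
      by (rule gs_prd_cases[OF small_R[OF i] U_Ob[OF i] x(1,3) x5])
    obtain s b where s: "s \<in> R j" and b: "b \<in> Ar E" "Src E y = Src E b" "Tgt E b = U j"
      and yy: "y = pair E (const (R j) (Src E b) s) b"
      by (rule gs_prd_cases[OF small_R[OF j] U_Ob[OF j] x(2) y4 y5])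
    have ea: "elt i a" and eb: "elt j b" and ab: "Src E b = Src E a" using a(1-3) b(1-3) x(3,4) i j by simp_all
    have "val X \<theta> i r a = val X \<theta> j s b" using eq fv[OF ea r] fv[OF eb s] unfolding xx yy by simp
    then have "val X \<theta> j (act \<phi> i j a b r) b = val X \<theta> j s b" using X[OF ea eb ab r] by simp
    \<comment> \<open>The first name has been transported to the point \<open>b\<close>, over which
      distinct labels name distinct elements.\<close>
    then have "act \<phi> i j a b r = s"
      by (rule val_inj[OF \<theta> eb act_spec(1)[OF coherentD(1)[OF \<phi>] ea eb ab r] s])
    then have "val Y \<theta>' i r a = val Y \<theta>' j s b" using Y[OF ea eb ab r] by simp
    then show "g i \<cdot> x = g j \<cdot> y" using gv[OF ea r] gv[OF eb s] unfolding xx yy by simp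
  qed (use fty gty e in auto)
  have "h \<cdot> val X \<theta> i r x = val Y \<theta>' i r x" if x: "elt i x" "r \<in> R i" for i r x
  proof -
    have i: "i \<in> I" using x by simp
    have "h \<cdot> val X \<theta> i r x = (h \<cdot> f i) \<cdot> pair E (const (R i) (Src E x) r) x"
      unfolding fv[OF x, symmetric] by (rule Cmp_assoc[symmetric]) (use h(1) fty i x in simp_all)
    then show ?thesis using h(2)[OF i] gv[OF x] by simp
  qed
  with h(1) that show thesis by blast
qed

lemma trivialization_eqI:
  assumes \<theta>: "trivialization E I U X R \<theta>" and h: "h \<in> Ar E" "h' \<in> Ar E" "Src E h = X" "Src E h' = X"
    "Tgt E h = Tgt E h'" and eq: "\<And>i r x. elt i x \<Longrightarrow> r \<in> R i \<Longrightarrow> h \<cdot> val X \<theta> i r x = h' \<cdot> val X \<theta> i r x"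
  shows "h = h'"
proof (rule eqI)
  fix b assume b: "b \<in> Ar E" "Src E b \<in> G" "Tgt E b = Src E h"
  show "h \<cdot> b = h' \<cdot> b"
  proof (rule epi_familyD[OF cover_lift[of "Src E b"]])
    fix c assume "c \<in> {c. c \<in> Ar E \<and> Src E c \<in> G \<and> Tgt E c = Src E b \<and>
          (\<exists>i\<in>I. \<exists>y\<in>Ar E. Src E y = Src E c \<and> Tgt E y = U i)}"
    then obtain i y where c: "c \<in> Ar E" "Src E c \<in> G" "Tgt E c = Src E b" and i: "i \<in> I"
          and y: "y \<in> Ar E" "Src E y = Src E c" "Tgt E y = U i" by blast
    have y': "elt i y" using y c i by simp
    obtain r where r: "r \<in> R i" "b \<cdot> c = val X \<theta> i r y"
      by (rule val_surj[OF \<theta> y', of "b \<cdot> c"]) (use b c y h in simp_all)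
    show "(h \<cdot> b) \<cdot> c = (h' \<cdot> b) \<cdot> c" using eq[OF y' r(1)] r(2) h b c by simp
  qed (use h b in simp_all)
qed (use h in simp_all)

lemma locally_constant_unique:
  assumes X: "locally_constant E I U X R \<sigma>" and Y: "locally_constant E I U Y R \<sigma>"
  shows "isomorphic E X Y"
proof -
  have \<sigma>: "U_descent_datum E I U R \<sigma>" using X by (simp add: locally_constant_def)
  note co = U_descent_datumD(1)[OF \<sigma>]
  obtain \<theta> where \<theta>: "trivialization E I U X R \<theta>" and XX: "\<And>i j x y r. elt i x \<Longrightarrow> elt j y \<Longrightarrow> Src E y = Src E x \<Longrightarrow> r \<in> R i \<Longrightarrow>
        val X \<theta> j (act (first \<sigma>) i j x y r) y = val X \<theta> i r x"
    using X unfolding locally_constant_transition[OF \<sigma>] by blast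
  obtain \<theta>' where \<theta>': "trivialization E I U Y R \<theta>'" and YY: "\<And>i j x y r. elt i x \<Longrightarrow> elt j y \<Longrightarrow> Src E y = Src E x \<Longrightarrow> r \<in> R i \<Longrightarrow>
        val Y \<theta>' j (act (first \<sigma>) i j x y r) y = val Y \<theta>' i r x"
    using Y unfolding locally_constant_transition[OF \<sigma>] by blast
  obtain f where f: "f \<in> hom E X Y" "\<And>i r x. elt i x \<Longrightarrow> r \<in> R i \<Longrightarrow> f \<cdot> val X \<theta> i r x = val Y \<theta>' i r x"
    using locally_constant_map[OF co \<theta> \<theta>' XX YY] by blast
  obtain g where g: "g \<in> hom E Y X" "\<And>i r x. elt i x \<Longrightarrow> r \<in> R i \<Longrightarrow> g \<cdot> val Y \<theta>' i r x = val X \<theta> i r x"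
    using locally_constant_map[OF co \<theta>' \<theta> YY XX] by blast
  have XO: "X \<in> Ob E" and YO: "Y \<in> Ob E" using \<theta> \<theta>' by (simp_all add: trivialization_def)
  have "g \<cdot> f = Idt E X"
  proof (rule trivialization_eqI[OF \<theta>])
    fix i r x assume x: "elt i x" "r \<in> R i"
    show "(g \<cdot> f) \<cdot> val X \<theta> i r x = Idt E X \<cdot> val X \<theta> i r x"
      using f g x val_type(1-3)[OF \<theta> x] XO by simp
  qed (use f g XO in simp_all)
  moreover have "f \<cdot> g = Idt E Y"
  proof (rule trivialization_eqI[OF \<theta>'])
    fix i r x assume x: "elt i x" "r \<in> R i"
    show "(f \<cdot> g) \<cdot> val Y \<theta>' i r x = Idt E Y \<cdot> val Y \<theta>' i r x"
      using f g x val_type(1-3)[OF \<theta>' x] YO by simp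
  qed (use f g YO in simp_all)
  ultimately have "iso E f" by (intro isoI[OF f(1) g(1)])
  then show ?thesis unfolding isomorphic_def using f(1) by blast
qed

end

section \<open>Existence of the descended object as a quotient by an internal equivalence
  relation\<close>

context cech_cover
begin

text \<open>\<open>glued\<close> is the coproduct of the \<open>\<gamma>\<^sup>*R\<^sub>i \<times> U\<^sub>i\<close>, and \<open>rel\<close> the coproduct of the
  \<open>\<gamma>\<^sup>*R\<^sub>i \<times> U\<^sub>i \<times> U\<^sub>j\<close>, regarded as an equivalence relation on it.\<close>

definition fibre :: "'u \<Rightarrow> 'o" where
  "fibre i = prd E (gs E (R i)) (U i)"

definition glued :: "'o" where
  "glued = coprod E I fibre"

definition point :: "'u \<Rightarrow> 'u \<Rightarrow> 'a \<Rightarrow> 'a" where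
  "point i r x = incl E I fibre i \<cdot> pair E (const (R i) (Src E x) r) x"

definition pairs :: "('u \<times> 'u) set" where
  "pairs = {(i, j). adj i j}"

definition rel_fibre :: "'u \<times> 'u \<Rightarrow> 'o" where
  "rel_fibre = (\<lambda>(i, j). prd E (gs E (R i)) (prd E (U i) (U j)))"

definition rel :: "'o" where
  "rel = coprod E pairs rel_fibre"

definition rel_point :: "'u \<Rightarrow> 'u \<Rightarrow> 'u \<Rightarrow> 'a \<Rightarrow> 'a \<Rightarrow> 'a" where
  "rel_point i j r x y = incl E pairs rel_fibre (i, j) \<cdot> pair E (const (R i) (Src E x) r) (pair E x y)"

definition rel_src :: "'a" where
  "rel_src = cotuple E pairs rel_fibre glued (\<lambda>(i, j). incl E I fibre i \<cdot>
     pair E (p1 E (gs E (R i)) (prd E (U i) (U j))) (p1 E (U i) (U j) \<cdot> p2 E (gs E (R i)) (prd E (U i) (U j))))"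

text \<open>An element \<open>(r, x, y)\<close> of \<open>rel\<close> has the ends
  \<open>(r, x)\<close>, given by \<open>rel_src\<close>, and
  \<open>(act \<phi> i j x y r, y)\<close>, given by \<open>rel_tgt\<close>: the two points that
  descent has to identify.\<close>

definition rel_tgt :: "('u \<Rightarrow> 'u \<Rightarrow> 'a) \<Rightarrow> 'a" where
  "rel_tgt \<phi> = cotuple E pairs rel_fibre glued (\<lambda>(i, j). incl E I fibre j \<cdot>
     pair E (\<phi> i j) (p2 E (U i) (U j) \<cdot> p2 E (gs E (R i)) (prd E (U i) (U j))))"

lemma fibre_Ob: "\<forall>i\<in>I. fibre i \<in> Ob E"
  by (simp add: fibre_def)

lemmas glued_coproduct = is_coproduct_coprod[OF small_I fibre_Ob, folded glued_def]

lemma glued_type [simp]: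
  "glued \<in> Ob E" "i \<in> I \<Longrightarrow> incl E I fibre i \<in> Ar E"
  "i \<in> I \<Longrightarrow> Src E (incl E I fibre i) = prd E (gs E (R i)) (U i)"
  "i \<in> I \<Longrightarrow> Tgt E (incl E I fibre i) = glued"
  using is_coproductD[OF glued_coproduct] by (simp_all add: fibre_def[of i])

lemma small_pairs: "small u pairs"
proof (rule small_subset[OF small_Times[OF universe small_I small_I]])
  show "pairs \<subseteq> I \<times> I" using adjD by (auto simp: pairs_def)
qed

lemma rel_fibre_Ob: "\<forall>p\<in>pairs. rel_fibre p \<in> Ob E"
proof (clarify)
  fix i j assume "(i, j) \<in> pairs"
  then have "i \<in> I" "j \<in> I" using adjD by (auto simp: pairs_def)
  then show "rel_fibre (i, j) \<in> Ob E" by (simp add: rel_fibre_def)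
qed

lemmas rel_coproduct = is_coproduct_coprod[OF small_pairs rel_fibre_Ob, folded rel_def]

lemma rel_type:
  "rel \<in> Ob E" "adj i j \<Longrightarrow> incl E pairs rel_fibre (i, j) \<in> Ar E"
  "adj i j \<Longrightarrow> Src E (incl E pairs rel_fibre (i, j)) = prd E (gs E (R i)) (prd E (U i) (U j))"
  "adj i j \<Longrightarrow> Tgt E (incl E pairs rel_fibre (i, j)) = rel"
  using is_coproductD[OF rel_coproduct] by (simp_all add: rel_fibre_def pairs_def)

lemma point_type:
  assumes "elt i x" "r \<in> R i"
  shows "point i r x \<in> Ar E" "Src E (point i r x) = Src E x" "Tgt E (point i r x) = glued"
  using assms by (simp_all add: point_def)

lemma point_cases:
  assumes "z \<in> Ar E" "Src E z \<in> G" "Tgt E z = glued"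
  obtains i r x where "elt i x" "r \<in> R i" "Src E z = Src E x" "z = point i r x"
proof -
  obtain i y where i: "i \<in> I" and y: "y \<in> hom E (Src E z) (fibre i)" "incl E I fibre i \<cdot> y = z"
    by (rule conn_coproduct[OF conn_G[OF assms(2)] small_I glued_coproduct assms(1) refl assms(3)])
  have y3: "y \<in> Ar E" "Src E y \<in> G" "Tgt E y = prd E (gs E (R i)) (U i)" "Src E z = Src E y"
    using y(1) assms(2) by (auto simp: fibre_def)
  obtain r a where r: "r \<in> R i" and a: "a \<in> Ar E" "Src E y = Src E a" "Tgt E a = U i"
      and yy: "y = pair E (const (R i) (Src E a) r) a"
    by (rule gs_prd_cases[OF small_R[OF i] U_Ob[OF i] y3(1-3)])
  have "elt i a" using i a y3(2) by simp
  moreover have "z = point i r a" unfolding point_def yy[symmetric] by (rule y(2)[symmetric])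
  moreover have "Src E z = Src E a" using y3(4) a(2) by simp
  ultimately show thesis using that r by blast
qed

lemma point_inj:
  assumes x: "elt i x" "r \<in> R i" and y: "elt j y" "s \<in> R j" and "Src E y = Src E x"
    and eq: "point i r x = point j s y"
  shows "i = j \<and> r = s \<and> x = y"
proof -
  have conn: "conn (Src E x)" using x by (simp add: conn_G)
  have "i = j \<and> pair E (const (R i) (Src E x) r) x = pair E (const (R j) (Src E y) s) y"
    by (rule conn_coproduct_unique[OF conn small_I glued_coproduct _ _ _ _ eq[unfolded point_def]])
      (use x y assms(5) in \<open>simp_all add: fibre_def\<close>)
  then have ij: "i = j" and "pair E (const (R i) (Src E x) r) x = pair E (const (R i) (Src E x) s) y"
    using assms(5) by auto
  from this(2) have c: "const (R i) (Src E x) r = const (R i) (Src E x) s \<and> x = y"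
    by (rule iffD1[OF pair_eq_iff, rotated -1]) (use x y ij assms(5) in simp_all)
  have "r = s"
    by (rule const_inj[OF _ _ _ _ conjunct1[OF c]]) (use x y ij in simp_all)
  with c ij show ?thesis by simp
qed

lemma rel_point_type:
  assumes "elt i x" "elt j y" "Src E y = Src E x" "r \<in> R i"
  shows "rel_point i j r x y \<in> Ar E" "Src E (rel_point i j r x y) = Src E x"
    "Tgt E (rel_point i j r x y) = rel"
  using assms rel_type[OF] adjI[OF assms(1-3)] by (simp_all add: rel_point_def)

lemma rel_cases:
  assumes "z \<in> Ar E" "Src E z \<in> G" "Tgt E z = rel"
  obtains i j r x y where "elt i x" "elt j y" "Src E y = Src E x" "r \<in> R i" "Src E z = Src E x"
    "z = rel_point i j r x y"
proof -
  obtain p w where p: "p \<in> pairs" and w: "w \<in> hom E (Src E z) (rel_fibre p)" "incl E pairs rel_fibre p \<cdot> w = z"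
    by (rule conn_coproduct[OF conn_G[OF assms(2)] small_pairs rel_coproduct assms(1) refl assms(3)])
  obtain i j where ij: "p = (i, j)" by fastforce
  have adj: "adj i j" using p unfolding ij by (simp only: pairs_def mem_Collect_eq prod.case)
  have w3: "w \<in> Ar E" "Src E w \<in> G" "Tgt E w = prd E (gs E (R i)) (prd E (U i) (U j))" "Src E z = Src E w"
    using w(1) assms(2) ij by (auto simp: rel_fibre_def)
  obtain r x y where r: "r \<in> R i" "elt i x" "elt j y" "Src E w = Src E x" "Src E y = Src E x"
    "w = pair E (const (R i) (Src E x) r) (pair E x y)"
    by (rule transport_cases[OF adjD[OF adj] w3(1-3)])
  have "z = rel_point i j r x y" unfolding rel_point_def r(6)[symmetric] by (rule w(2)[symmetric, unfolded ij])
  then show thesis using that[OF r(2,3,5,1)] w3(4) r(4) by simp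
qed

lemma rel_src_cotuple:
  "rel_src \<in> Ar E" "Src E rel_src = rel" "Tgt E rel_src = glued"
  "adj i j \<Longrightarrow> rel_src \<cdot> incl E pairs rel_fibre (i, j) = incl E I fibre i \<cdot>
     pair E (p1 E (gs E (R i)) (prd E (U i) (U j))) (p1 E (U i) (U j) \<cdot> p2 E (gs E (R i)) (prd E (U i) (U j)))"
proof -
  let ?f = "\<lambda>(i, j). incl E I fibre i \<cdot>
     pair E (p1 E (gs E (R i)) (prd E (U i) (U j))) (p1 E (U i) (U j) \<cdot> p2 E (gs E (R i)) (prd E (U i) (U j)))"
  have f: "\<forall>p\<in>pairs. ?f p \<in> Ar E \<and> Src E (?f p) = rel_fibre p \<and> Tgt E (?f p) = glued"
  proof
    fix p assume "p \<in> pairs"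
    then obtain i j where p: "p = (i, j)" and "i \<in> I" "j \<in> I" using adjD by (auto simp: pairs_def)
    then show "?f p \<in> Ar E \<and> Src E (?f p) = rel_fibre p \<and> Tgt E (?f p) = glued"
      by (simp add: rel_fibre_def)
  qed
  note ct = cotuple_type[OF small_pairs glued_type(1) f, folded rel_src_def rel_def]
  show "rel_src \<in> Ar E" "Src E rel_src = rel" "Tgt E rel_src = glued"
    by (rule ct(1-3))+
  show "rel_src \<cdot> incl E pairs rel_fibre (i, j) = incl E I fibre i \<cdot>
     pair E (p1 E (gs E (R i)) (prd E (U i) (U j))) (p1 E (U i) (U j) \<cdot> p2 E (gs E (R i)) (prd E (U i) (U j)))"
    if "adj i j" using ct(4)[of "(i, j)"] that by (simp add: pairs_def)
qed

lemmas rel_src_type = rel_src_cotuple(1-3)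

lemma rel_src_point:
  assumes x: "elt i x" and y: "elt j y" "Src E y = Src E x" and r: "r \<in> R i"
  shows "rel_src \<cdot> rel_point i j r x y = point i r x"
proof -
  note a = adjI[OF x y]
  have "rel_src \<cdot> rel_point i j r x y = (rel_src \<cdot> incl E pairs rel_fibre (i, j)) \<cdot> pair E (const (R i) (Src E x) r) (pair E x y)"
    unfolding rel_point_def by (rule Cmp_assoc[symmetric]) (use rel_type(2-4)[OF a] rel_src_type x y r in simp_all)
  also have "\<dots> = point i r x"
    unfolding rel_src_cotuple(4)[OF a] using x y r by (simp add: point_def)
  finally show ?thesis .
qed

lemma rel_tgt_cotuple:
  assumes \<phi>: "transport_map \<phi>"
  shows "rel_tgt \<phi> \<in> Ar E" "Src E (rel_tgt \<phi>) = rel" "Tgt E (rel_tgt \<phi>) = glued"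
  "adj i j \<Longrightarrow> rel_tgt \<phi> \<cdot> incl E pairs rel_fibre (i, j) = incl E I fibre j \<cdot>
     pair E (\<phi> i j) (p2 E (U i) (U j) \<cdot> p2 E (gs E (R i)) (prd E (U i) (U j)))"
proof -
  let ?f = "\<lambda>(i, j). incl E I fibre j \<cdot>
     pair E (\<phi> i j) (p2 E (U i) (U j) \<cdot> p2 E (gs E (R i)) (prd E (U i) (U j)))"
  have f: "\<forall>p\<in>pairs. ?f p \<in> Ar E \<and> Src E (?f p) = rel_fibre p \<and> Tgt E (?f p) = glued"
  proof
    fix p assume "p \<in> pairs"
    then obtain i j where p: "p = (i, j)" and a: "adj i j" by (auto simp: pairs_def)
    show "?f p \<in> Ar E \<and> Src E (?f p) = rel_fibre p \<and> Tgt E (?f p) = glued"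
      unfolding p using adjD[OF a] transport_mapD[OF \<phi> a] by (simp add: rel_fibre_def)
  qed
  note ct = cotuple_type[OF small_pairs glued_type(1) f, folded rel_tgt_def rel_def]
  show "rel_tgt \<phi> \<in> Ar E" "Src E (rel_tgt \<phi>) = rel" "Tgt E (rel_tgt \<phi>) = glued"
    by (rule ct(1-3))+
  show "rel_tgt \<phi> \<cdot> incl E pairs rel_fibre (i, j) = incl E I fibre j \<cdot>
     pair E (\<phi> i j) (p2 E (U i) (U j) \<cdot> p2 E (gs E (R i)) (prd E (U i) (U j)))"
    if "adj i j" using ct(4)[of "(i, j)"] that by (simp add: pairs_def)
qed

lemmas rel_tgt_type = rel_tgt_cotuple(1-3)

lemma rel_tgt_point:
  assumes \<phi>: "transport_map \<phi>" and x: "elt i x" and y: "elt j y" "Src E y = Src E x" and r: "r \<in> R i"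
  shows "rel_tgt \<phi> \<cdot> rel_point i j r x y = point j (act \<phi> i j x y r) y"
proof -
  note a = adjI[OF x y]
  have "rel_tgt \<phi> \<cdot> rel_point i j r x y = (rel_tgt \<phi> \<cdot> incl E pairs rel_fibre (i, j)) \<cdot> pair E (const (R i) (Src E x) r) (pair E x y)"
    unfolding rel_point_def
    by (rule Cmp_assoc[symmetric]) (use rel_type(2-4)[OF a] rel_tgt_type[OF \<phi>] x y r in simp_all)
  also have "\<dots> = point j (act \<phi> i j x y r) y"
    unfolding rel_tgt_cotuple(4)[OF \<phi> a]
    using x y r transport_mapD[OF \<phi> a] act_spec[OF \<phi> x y r] by (simp add: point_def)
  finally show ?thesis .
qed

text \<open>The ends of \<open>(r, x, y)\<close> contain \<open>r\<close>, \<open>x\<close> and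
  \<open>y\<close>, and an element of a coproduct at a connected stage determines its summand. So
  the two maps to \<open>glued\<close> are jointly monic on elements.\<close>

lemma rel_point_inj:
  assumes \<phi>: "transport_map \<phi>" and z: "z \<in> Ar E" "w \<in> Ar E" "Src E z \<in> G" "Src E w = Src E z"
    "Tgt E z = rel" "Tgt E w = rel" and eq: "rel_src \<cdot> z = rel_src \<cdot> w" "rel_tgt \<phi> \<cdot> z = rel_tgt \<phi> \<cdot> w"
  shows "z = w"
proof -
  obtain i j r x y where x: "elt i x" and y: "elt j y" "Src E y = Src E x" and r: "r \<in> R i"
    and zx: "Src E z = Src E x" and zz: "z = rel_point i j r x y"
    by (rule rel_cases[OF z(1,3,5)])
  have w3: "Src E w \<in> G" using z by simp
  obtain i' j' r' x' y' where x': "elt i' x'" and y': "elt j' y'" "Src E y' = Src E x'" and r': "r' \<in> R i'"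
    and wx: "Src E w = Src E x'" and ww: "w = rel_point i' j' r' x' y'"
    by (rule rel_cases[OF z(2) w3 z(6)])
  have xx: "Src E x' = Src E x" using zx wx z(4) by simp
  have "point i r x = point i' r' x'" using eq(1) rel_src_point[OF x y r] rel_src_point[OF x' y' r'] zz ww by simp
  then have 1: "i = i' \<and> r = r' \<and> x = x'" by (rule point_inj[OF x r x' r' xx])
  have "point j (act \<phi> i j x y r) y = point j' (act \<phi> i' j' x' y' r') y'"
    using eq(2) rel_tgt_point[OF \<phi> x y r] rel_tgt_point[OF \<phi> x' y' r'] zz ww by simp
  then have "j = j' \<and> act \<phi> i j x y r = act \<phi> i' j' x' y' r' \<and> y = y'"
    by (rule point_inj[OF y(1) act_spec(1)[OF \<phi> x y r] y'(1) act_spec(1)[OF \<phi> x' y' r'], rotated])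
      (use xx y y' in simp)
  with 1 show ?thesis using zz ww by simp
qed

text \<open>The three laws are those of \<open>act\<close>: the unit law gives reflexivity,
  \<open>act_inverse\<close> symmetry, and the cocycle law transitivity. As elements of
  \<open>rel\<close> are determined by their ends, the witnessing maps need only be found on
  elements.\<close>

lemma rel_equivalence:
  assumes co: "coherent \<phi>"
  shows "equivalence_relation E rel_src (rel_tgt \<phi>)"
  unfolding equivalence_relation_def
proof (intro conjI allI ballI impI)
  note \<phi> = coherentD(1)[OF co]
  note [simp] = rel_src_type rel_tgt_type[OF \<phi>] rel_type(1)
  show "rel_src \<in> Ar E" "rel_tgt \<phi> \<in> hom E (Src E rel_src) (Tgt E rel_src)" by simp_all
  show "x = y" if x: "x \<in> hom E C (Src E rel_src)" and y: "y \<in> hom E C (Src E rel_src)"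
    and eq: "rel_src \<cdot> x = rel_src \<cdot> y \<and> rel_tgt \<phi> \<cdot> x = rel_tgt \<phi> \<cdot> y" for C x y
  proof (rule eqI)
    fix c assume c: "c \<in> Ar E" "Src E c \<in> G" "Tgt E c = Src E x"
    show "x \<cdot> c = y \<cdot> c"
    proof (rule rel_point_inj[OF \<phi>])
      show "rel_src \<cdot> (x \<cdot> c) = rel_src \<cdot> (y \<cdot> c)"
        by (rule Cmp_eq_Cmp) (use x y c eq in auto)
      show "rel_tgt \<phi> \<cdot> (x \<cdot> c) = rel_tgt \<phi> \<cdot> (y \<cdot> c)"
        by (rule Cmp_eq_Cmp) (use x y c eq in auto)
    qed (use x y c in simp_all)
  qed (use x y in simp_all)
  \<comment> \<open>A pair of maps into \<open>glued\<close> factors through \<open>rel\<close> once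
    it does so on elements; each of the three laws is such a factorisation.\<close>
  have fac: "\<exists>m. m \<in> hom E (Src E f) rel \<and> rel_src \<cdot> m = f \<and> rel_tgt \<phi> \<cdot> m = g"
    if f: "f \<in> Ar E" "g \<in> Ar E" "Src E g = Src E f" "Tgt E f = glued" "Tgt E g = glued"
      and ex: "\<And>x. x \<in> Ar E \<Longrightarrow> Src E x \<in> G \<Longrightarrow> Tgt E x = Src E f \<Longrightarrow>
      \<exists>z\<in>Ar E. Src E z = Src E x \<and> Tgt E z = rel \<and> rel_src \<cdot> z = f \<cdot> x \<and> rel_tgt \<phi> \<cdot> z = g \<cdot> x" for f g
  proof (rule jointly_monic_factor[of rel_src "rel_tgt \<phi>" f g])
    fix x y assume a: "x \<in> Ar E" "y \<in> Ar E" "Src E x \<in> G" "Src E y = Src E x" "Tgt E x = Src E rel_src"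
      "Tgt E y = Src E rel_src" "rel_src \<cdot> x = rel_src \<cdot> y" "rel_tgt \<phi> \<cdot> x = rel_tgt \<phi> \<cdot> y"
    show "x = y" using a unfolding rel_src_type(2) by (rule rel_point_inj[OF \<phi>])
  next
    fix m assume "m \<in> hom E (Src E f) (Src E rel_src)" "rel_src \<cdot> m = f" "rel_tgt \<phi> \<cdot> m = g"
    then show "\<exists>m. m \<in> hom E (Src E f) rel \<and> rel_src \<cdot> m = f \<and> rel_tgt \<phi> \<cdot> m = g" by auto
  qed (use f ex in simp_all)
  have "\<exists>d. d \<in> hom E (Src E (Idt E glued)) rel \<and> rel_src \<cdot> d = Idt E glued \<and> rel_tgt \<phi> \<cdot> d = Idt E glued"
  proof (rule fac)
    fix x assume x: "x \<in> Ar E" "Src E x \<in> G" "Tgt E x = Src E (Idt E glued)"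
    then have x3: "Tgt E x = glued" by simp
    obtain i r a where a: "elt i a" "r \<in> R i" "Src E x = Src E a" "x = point i r a"
      by (rule point_cases[OF x(1,2) x3])
    show "\<exists>z\<in>Ar E. Src E z = Src E x \<and> Tgt E z = rel \<and> rel_src \<cdot> z = Idt E glued \<cdot> x \<and> rel_tgt \<phi> \<cdot> z = Idt E glued \<cdot> x"
      using rel_point_type[OF a(1,1) refl a(2)] rel_src_point[OF a(1,1) refl a(2)]
        rel_tgt_point[OF \<phi> a(1,1) refl a(2)] coherentD(2)[OF co a(1,2)] a(3,4) point_type[OF a(1,2)]
      by (intro bexI[of _ "rel_point i i r a a"]) simp_all
  qed simp_all
  then show "\<exists>d\<in>hom E (Tgt E rel_src) (Src E rel_src).
      rel_src \<cdot> d = Idt E (Tgt E rel_src) \<and> rel_tgt \<phi> \<cdot> d = Idt E (Tgt E rel_src)" by auto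
  have "\<exists>t. t \<in> hom E (Src E (rel_tgt \<phi>)) rel \<and> rel_src \<cdot> t = rel_tgt \<phi> \<and> rel_tgt \<phi> \<cdot> t = rel_src"
  proof (rule fac)
    fix z assume z: "z \<in> Ar E" "Src E z \<in> G" "Tgt E z = Src E (rel_tgt \<phi>)"
    then have z3: "Tgt E z = rel" by simp
    obtain i j r x y where x: "elt i x" and y: "elt j y" "Src E y = Src E x" and r: "r \<in> R i"
      and zx: "Src E z = Src E x" and zz: "z = rel_point i j r x y"
      by (rule rel_cases[OF z(1,2) z3])
    note a = act_spec(1)[OF \<phi> x y r]
    show "\<exists>w\<in>Ar E. Src E w = Src E z \<and> Tgt E w = rel \<and> rel_src \<cdot> w = rel_tgt \<phi> \<cdot> z \<and> rel_tgt \<phi> \<cdot> w = rel_src \<cdot> z"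
      using rel_point_type[OF y(1) x y(2)[symmetric] a] rel_src_point[OF y(1) x y(2)[symmetric] a]
        rel_tgt_point[OF \<phi> y(1) x y(2)[symmetric] a] act_inverse[OF co x y r] rel_src_point[OF x y r]
        rel_tgt_point[OF \<phi> x y r] zx zz y(2)
      by (intro bexI[of _ "rel_point j i (act \<phi> i j x y r) y x"]) simp_all
  qed simp_all
  then show "\<exists>t\<in>hom E (Src E rel_src) (Src E rel_src). rel_src \<cdot> t = rel_tgt \<phi> \<and> rel_tgt \<phi> \<cdot> t = rel_src" by auto
  fix P p q assume P: "is_pullback E (rel_tgt \<phi>) rel_src P p q"
  note [simp] = is_pullbackD(4-9)[OF P]
  have "\<exists>t. t \<in> hom E (Src E (rel_src \<cdot> p)) rel \<and> rel_src \<cdot> t = rel_src \<cdot> p \<and> rel_tgt \<phi> \<cdot> t = rel_tgt \<phi> \<cdot> q"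
  proof (rule fac)
    fix c assume c: "c \<in> Ar E" "Src E c \<in> G" "Tgt E c = Src E (rel_src \<cdot> p)"
    then have cP: "Tgt E c = P" by simp
    have pc: "p \<cdot> c \<in> Ar E" "Src E (p \<cdot> c) \<in> G" "Tgt E (p \<cdot> c) = rel" "Src E (p \<cdot> c) = Src E c"
      and qc: "q \<cdot> c \<in> Ar E" "Src E (q \<cdot> c) \<in> G" "Tgt E (q \<cdot> c) = rel" "Src E (q \<cdot> c) = Src E c"
      using c cP by simp_all
    obtain i j r x y where x: "elt i x" and y: "elt j y" "Src E y = Src E x" and r: "r \<in> R i"
      and zx: "Src E (p \<cdot> c) = Src E x" and zz: "p \<cdot> c = rel_point i j r x y"
      by (rule rel_cases[OF pc(1-3)])
    obtain j' k s y' z where y': "elt j' y'" and z: "elt k z" "Src E z = Src E y'" and s: "s \<in> R j'"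
      and zx': "Src E (q \<cdot> c) = Src E y'" and zz': "q \<cdot> c = rel_point j' k s y' z"
      by (rule rel_cases[OF qc(1-3)])
    note a = act_spec(1)[OF \<phi> x y r]
    have "rel_tgt \<phi> \<cdot> (p \<cdot> c) = rel_src \<cdot> (q \<cdot> c)"
      by (rule Cmp_eq_Cmp[OF is_pullbackD(10)[OF P]]) (use c in simp_all)
    then have "point j (act \<phi> i j x y r) y = point j' s y'"
      unfolding zz zz' rel_tgt_point[OF \<phi> x y r] rel_src_point[OF y' z s] .
    moreover have "Src E y' = Src E y" using zx zx' y(2) pc(4) qc(4) by simp
    \<comment> \<open>Composability says that the target of the first triple is the source of the
      second; a point of \<open>glued\<close> has only one index, label and base point.\<close>
    ultimately have e: "j = j' \<and> act \<phi> i j x y r = s \<and> y = y'"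
      by (intro point_inj[OF y(1) a y' s])
    have zx2: "Src E z = Src E x" using z(2) e y(2) by simp
    have "act \<phi> i k x z r = act \<phi> j' k y' z s"
      using coherentD(3)[OF co x y(1) z(1) y(2) zx2 r] e by metis
    then show "\<exists>w\<in>Ar E. Src E w = Src E c \<and> Tgt E w = rel \<and> rel_src \<cdot> w = (rel_src \<cdot> p) \<cdot> c \<and>
        rel_tgt \<phi> \<cdot> w = (rel_tgt \<phi> \<cdot> q) \<cdot> c"
      using rel_point_type[OF x z(1) zx2 r] rel_src_point[OF x z(1) zx2 r] rel_tgt_point[OF \<phi> x z(1) zx2 r]
        rel_src_point[OF x y r] rel_tgt_point[OF \<phi> y' z s] zx zz zz' pc(4) c cP
      by (intro bexI[of _ "rel_point i k r x z"]) simp_all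
  qed simp_all
  then show "\<exists>t\<in>hom E P (Src E rel_src). rel_src \<cdot> t = rel_src \<cdot> p \<and> rel_tgt \<phi> \<cdot> t = rel_tgt \<phi> \<cdot> q" by auto
qed

text \<open>\<open>\<theta> i\<close> sends \<open>(r, x)\<close> to its class, paired with
  \<open>x\<close>. It is injective because two labels over the same \<open>x\<close> are related
  only by the unit law, and locally surjective because every class has a local
  representative.\<close>

lemma descent_object:
  assumes co: "coherent \<phi>"
  obtains X where "locally_constant E I U X R (datum \<phi>)"
proof -
  note \<phi> = coherentD(1)[OF co]
  note [simp] = rel_src_type rel_tgt_type[OF \<phi>] rel_type(1)
  obtain q where q: "exact_fork E rel_src (rel_tgt \<phi>) q"
    using equivalence_relation_exact[OF rel_equivalence[OF co]] .
  then have ce: "is_coequalizer E rel_src (rel_tgt \<phi>) q" and pb: "is_pullback E q q rel rel_src (rel_tgt \<phi>)"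
    by (simp_all add: exact_fork_def)
  have qe: "epi E q" by (rule is_coequalizer_epi[OF ce])
  have [simp]: "q \<in> Ar E" "Src E q = glued" using is_coequalizerD[OF ce] by simp_all
  define X where "X = Tgt E q"
  have [simp]: "Tgt E q = X" "X \<in> Ob E" by (auto simp: X_def)
  have q_rel: "q \<cdot> point i r x = q \<cdot> point j (act \<phi> i j x y r) y"
    if "elt i x" "elt j y" "Src E y = Src E x" "r \<in> R i" for i j x y r
  proof -
    have "q \<cdot> (rel_src \<cdot> rel_point i j r x y) = q \<cdot> (rel_tgt \<phi> \<cdot> rel_point i j r x y)"
      by (rule Cmp_eq_Cmp[OF is_pullbackD(10)[OF pb]]) (use rel_point_type[OF that] in simp_all)
    then show ?thesis unfolding rel_src_point[OF that] rel_tgt_point[OF \<phi> that] .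
  qed
  \<comment> \<open>Effectiveness: \<open>rel\<close> is the kernel pair of \<open>q\<close>, so
    points with the same class are the two ends of an element of \<open>rel\<close>.\<close>
  have q_inj: "act \<phi> i j x y r = s"
    if x: "elt i x" "r \<in> R i" and y: "elt j y" "s \<in> R j" and xy: "Src E y = Src E x"
      and eq: "q \<cdot> point i r x = q \<cdot> point j s y" for i j r s x y
  proof -
    obtain h where h: "h \<in> Ar E" "Src E h = Src E (point i r x)" "Tgt E h = rel"
      "rel_src \<cdot> h = point i r x" "rel_tgt \<phi> \<cdot> h = point j s y"
      by (rule is_pullback_ex[OF pb, of "point i r x" "point j s y"])
        (use point_type[OF x] point_type[OF y] xy eq in simp_all)
    have h2: "Src E h \<in> G" using h(2) point_type(2)[OF x] x by simp
    obtain i' j' r' x' y' where x': "elt i' x'" and y': "elt j' y'" "Src E y' = Src E x'" and r': "r' \<in> R i'"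
      and zx: "Src E h = Src E x'" and hh: "h = rel_point i' j' r' x' y'"
      by (rule rel_cases[OF h(1) h2 h(3)])
    have x'x: "Src E x' = Src E x" using zx h(2) point_type(2)[OF x] by simp
    have "point i r x = point i' r' x'" using h(4) unfolding hh rel_src_point[OF x' y' r'] by simp
    then have 1: "i = i' \<and> r = r' \<and> x = x'" by (rule point_inj[OF x x' r' x'x])
    have "point j' (act \<phi> i' j' x' y' r') y' = point j s y" using h(5) unfolding hh rel_tgt_point[OF \<phi> x' y' r'] .
    then have "j' = j \<and> act \<phi> i' j' x' y' r' = s \<and> y' = y"
      by (rule point_inj[OF y'(1) act_spec(1)[OF \<phi> x' y' r'] y, rotated]) (use x'x xy y' in simp)
    with 1 show ?thesis by blast
  qed
  define \<theta> where "\<theta> i = pair E (q \<cdot> incl E I fibre i) (p2 E (gs E (R i)) (U i))" for i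
  have \<theta>ty: "\<theta> i \<in> Ar E" "Src E (\<theta> i) = prd E (gs E (R i)) (U i)" "Tgt E (\<theta> i) = prd E X (U i)"
    "p2 E X (U i) \<cdot> \<theta> i = p2 E (gs E (R i)) (U i)" if i: "i \<in> I" for i
    using i by (simp_all add: \<theta>_def)
  have \<theta>pt: "\<theta> i \<cdot> pair E (const (R i) (Src E x) r) x = pair E (q \<cdot> point i r x) x" if x: "elt i x" "r \<in> R i" for i r x
    using x by (simp add: \<theta>_def point_def)
  have "iso E (\<theta> i)" if i: "i \<in> I" for i
  proof (rule iso_if_bijective)
    note [simp] = i \<theta>ty[OF i]
    show "\<theta> i \<in> Ar E" by simp
    fix x y assume x: "x \<in> Ar E" "y \<in> Ar E" "Src E x \<in> G" "Src E y = Src E x" "Tgt E x = Src E (\<theta> i)"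
      "Tgt E y = Src E (\<theta> i)" "\<theta> i \<cdot> x = \<theta> i \<cdot> y"
    then have x5: "Tgt E x = prd E (gs E (R i)) (U i)" and y5: "Src E y \<in> G" "Tgt E y = prd E (gs E (R i)) (U i)" by simp_all
    obtain r a where r: "r \<in> R i" and a: "a \<in> Ar E" "Src E x = Src E a" "Tgt E a = U i"
      and xx: "x = pair E (const (R i) (Src E a) r) a"
      by (rule gs_prd_cases[OF small_R[OF i] U_Ob[OF i] x(1,3) x5])
    obtain s b where s: "s \<in> R i" and b: "b \<in> Ar E" "Src E y = Src E b" "Tgt E b = U i"
      and yy: "y = pair E (const (R i) (Src E b) s) b"
      by (rule gs_prd_cases[OF small_R[OF i] U_Ob[OF i] x(2) y5])
    have ea: "elt i a" and eb: "elt i b" and ab: "Src E b = Src E a" using a(1-3) b(1-3) x(3,4) i by simp_all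
    have "pair E (q \<cdot> point i r a) a = pair E (q \<cdot> point i s b) b"
      using x(7) unfolding xx yy \<theta>pt[OF ea r] \<theta>pt[OF eb s] .
    then have "q \<cdot> point i r a = q \<cdot> point i s b \<and> a = b"
      (is "?e \<and> _") by (rule iffD1[OF pair_eq_iff, rotated -1])
        (use point_type[OF ea r] point_type[OF eb s] ea eb ab in simp_all)
    then have e: ?e and ab': "a = b" by blast+
    show "x = y" using q_inj[OF ea r eb s ab e] coherentD(2)[OF co ea r] xx yy unfolding ab' by simp
  next
    note [simp] = i \<theta>ty[OF i]
    fix b assume b: "b \<in> Ar E" "Src E b \<in> G" "Tgt E b = Tgt E (\<theta> i)"
    then have b3: "Tgt E b = prd E X (U i)" by simp
    obtain x y where x: "x \<in> Ar E" and y: "y \<in> Ar E" "Src E y = Src E x" and s: "Src E b = Src E x"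
      and t: "Tgt E x = X" "Tgt E y = U i" and bb: "b = pair E x y"
      by (rule prd_cases[OF b(1) b3 \<open>X \<in> Ob E\<close> U_Ob[OF i]])
    have ey: "elt i y" using y t s b i by simp
    have "epi_family E (Src E x) {c. c \<in> Ar E \<and> Src E c \<in> G \<and> Tgt E c = Src E x \<and>
        (\<exists>y\<in>Ar E. Src E y = Src E c \<and> Tgt E y = Src E q \<and> q \<cdot> y = x \<cdot> c)}"
      by (rule epi_lift[OF qe]) (use x t in simp_all)
    then show "epi_family E (Src E b) {c. c \<in> Ar E \<and> Src E c \<in> G \<and> Tgt E c = Src E b \<and>
        (\<exists>y\<in>Ar E. Tgt E y = Src E (\<theta> i) \<and> Src E y = Src E c \<and> \<theta> i \<cdot> y = b \<cdot> c)}"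
      unfolding s
    proof (rule epi_family_mono)
      show "{c. c \<in> Ar E \<and> Src E c \<in> G \<and> Tgt E c = Src E x \<and>
          (\<exists>y\<in>Ar E. Src E y = Src E c \<and> Tgt E y = Src E q \<and> q \<cdot> y = x \<cdot> c)}
        \<subseteq> {c. c \<in> Ar E \<and> Src E c \<in> G \<and> Tgt E c = Src E x \<and>
        (\<exists>y\<in>Ar E. Tgt E y = Src E (\<theta> i) \<and> Src E y = Src E c \<and> \<theta> i \<cdot> y = b \<cdot> c)}"
      proof clarify
        fix c w assume c: "c \<in> Ar E" "Src E c \<in> G" "Tgt E c = Src E x"
          and w: "w \<in> Ar E" "Src E w = Src E c" "Tgt E w = Src E q" "q \<cdot> w = x \<cdot> c"
        then have w2: "Src E w \<in> G" "Tgt E w = glued" by simp_all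
        \<comment> \<open>A local representative of the class lies over some \<open>U j\<close>; the
          action moves it to the required point \<open>y \<cdot> c\<close> of \<open>U i\<close>
          without changing its class.\<close>
        obtain j r v where v: "elt j v" and r: "r \<in> R j" and wv: "Src E w = Src E v" and ww: "w = point j r v"
          by (rule point_cases[OF w(1) w2])
        have yc: "elt i (y \<cdot> c)" "Src E (y \<cdot> c) = Src E v" using y c i t w(2) wv by simp_all
        note a = act_spec(1)[OF \<phi> v yc r]
        have "\<theta> i \<cdot> pair E (const (R i) (Src E (y \<cdot> c)) (act \<phi> j i v (y \<cdot> c) r)) (y \<cdot> c)
            = pair E (q \<cdot> w) (y \<cdot> c)"
          unfolding \<theta>pt[OF yc(1) a] q_rel[OF v yc r, symmetric] ww ..
        also have "\<dots> = b \<cdot> c" unfolding w(4) bb using x y c t by simp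
        finally have eq: "\<theta> i \<cdot> pair E (const (R i) (Src E (y \<cdot> c)) (act \<phi> j i v (y \<cdot> c) r)) (y \<cdot> c) = b \<cdot> c" .
        show "\<exists>y\<in>Ar E. Tgt E y = Src E (\<theta> i) \<and> Src E y = Src E c \<and> \<theta> i \<cdot> y = b \<cdot> c"
        proof (intro bexI conjI)
          show "\<theta> i \<cdot> pair E (const (R i) (Src E (y \<cdot> c)) (act \<phi> j i v (y \<cdot> c) r)) (y \<cdot> c) = b \<cdot> c" by (rule eq)
        qed (use yc a w(2) wv in simp_all)
      qed
    qed auto
  qed
  then have triv: "trivialization E I U X R \<theta>"
    using \<theta>ty small_R unfolding trivialization_def by (simp add: small_cong_itself[of u, symmetric])
  have val: "val X \<theta> i r x = q \<cdot> point i r x" if x: "elt i x" "r \<in> R i" for i r x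
    unfolding val_def \<theta>pt[OF x] using x point_type[OF x] by simp
  have "locally_constant E I U X R (datum \<phi>)"
    unfolding locally_constant_transition[OF coherent_U_descent_datum[OF co]]
  proof (intro exI conjI allI impI)
    show "trivialization E I U X R \<theta>" by (rule triv)
    fix i j x y r assume "elt i x \<and> elt j y \<and> Src E y = Src E x \<and> r \<in> R i"
    then have x: "elt i x" and y: "elt j y" "Src E y = Src E x" and r: "r \<in> R i" by auto
    have "act (first (datum \<phi>)) i j x y r = act \<phi> i j x y r"
      unfolding act_def first_datum[OF \<phi> adjI[OF x y]] ..
    then show "val X \<theta> j (act (first (datum \<phi>)) i j x y r) y = val X \<theta> i r x"
      using val[OF x r] val[OF y(1) act_spec(1)[OF \<phi> x y r]] q_rel[OF x y r] by simp
  qed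
  then show thesis by (rule that)
qed

end

section \<open>Finite limits\<close>

context giraud_topos
begin

lemma finite_product:
  assumes "finite J" "\<forall>j\<in>J. A j \<in> Ob E"
  shows "\<exists>P \<pi>. P \<in> Ob E \<and> (\<forall>j\<in>J. \<pi> j \<in> hom E P (A j)) \<and>
    (\<forall>C\<in>Ob E. \<forall>c. (\<forall>j\<in>J. c j \<in> hom E C (A j)) \<longrightarrow>
      (\<exists>!h. h \<in> hom E C P \<and> (\<forall>j\<in>J. \<pi> j \<cdot> h = c j)))"
  using assms
proof (induction J)
  case empty
  have "\<exists>!h. h \<in> hom E C (one E)" if "C \<in> Ob E" for C
    using terminal_one that by (simp only: terminal_def)
  then show ?case by (intro exI[of _ "one E"]) auto
next
  case (insert x J)
  have "\<forall>j\<in>J. A j \<in> Ob E" using insert(4) by blast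
  from insert(3)[OF this] obtain P \<pi> where P: "P \<in> Ob E" "\<forall>j\<in>J. \<pi> j \<in> hom E P (A j)"
    and univ': "\<forall>C\<in>Ob E. \<forall>c. (\<forall>j\<in>J. c j \<in> hom E C (A j)) \<longrightarrow>
      (\<exists>!h. h \<in> hom E C P \<and> (\<forall>j\<in>J. \<pi> j \<cdot> h = c j))" by (elim exE conjE)
  note univ = univ'[THEN bspec, THEN spec, THEN mp]
  have x: "A x \<in> Ob E" using insert by simp
  define \<pi>' where "\<pi>' j = (if j = x then p1 E (A x) P else \<pi> j \<cdot> p2 E (A x) P)" for j
  show ?case
  proof (intro exI[of _ "prd E (A x) P"] exI[of _ \<pi>'] conjI ballI allI impI)
    show "prd E (A x) P \<in> Ob E" using x P by simp
    show "\<pi>' j \<in> hom E (prd E (A x) P) (A j)" if "j \<in> insert x J" for j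
      using that x P by (auto simp: \<pi>'_def)
    fix C c assume C: "C \<in> Ob E" and c: "\<forall>j\<in>insert x J. c j \<in> hom E C (A j)"
    then have cJ: "\<forall>j\<in>J. c j \<in> hom E C (A j)" and cx: "c x \<in> hom E C (A x)" by blast+
    obtain h where h: "h \<in> hom E C P" "\<forall>j\<in>J. \<pi> j \<cdot> h = c j" using univ[OF C cJ] by blast
    have neq: "j \<noteq> x" if "j \<in> J" for j using that insert by auto
    show "\<exists>!h. h \<in> hom E C (prd E (A x) P) \<and> (\<forall>j\<in>insert x J. \<pi>' j \<cdot> h = c j)"
    proof (rule ex1I[of _ "pair E (c x) h"])
      show "pair E (c x) h \<in> hom E C (prd E (A x) P) \<and> (\<forall>j\<in>insert x J. \<pi>' j \<cdot> pair E (c x) h = c j)"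
        using h cx x P neq by (auto simp: \<pi>'_def)
      fix k assume k: "k \<in> hom E C (prd E (A x) P) \<and> (\<forall>j\<in>insert x J. \<pi>' j \<cdot> k = c j)"
      have "\<forall>j\<in>J. \<pi> j \<cdot> (p2 E (A x) P \<cdot> k) = c j"
      proof
        fix j assume j: "j \<in> J"
        then have "(\<pi> j \<cdot> p2 E (A x) P) \<cdot> k = c j" using conjunct2[OF k, THEN bspec, of j] j neq[OF j] by (simp add: \<pi>'_def)
        then show "\<pi> j \<cdot> (p2 E (A x) P \<cdot> k) = c j" using j P x k by simp
      qed
      moreover have "p2 E (A x) P \<cdot> k \<in> hom E C P" using k x P by simp
      ultimately have "p2 E (A x) P \<cdot> k = h" using univ[OF C cJ] h by blast
      moreover have "p1 E (A x) P \<cdot> k = c x" using k by (simp add: \<pi>'_def)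
      ultimately show "k = pair E (c x) h" using pair_eta[of k "A x" P] k x P by simp
    qed
  qed
qed

text \<open>Starting from the finite product, the arrows of the diagram are imposed one at a time,
  each by an equalizer.\<close>

lemma finite_limit:
  assumes "finite D" and J: "finite J" and A: "\<forall>j\<in>J. A j \<in> Ob E"
    and "\<forall>(i, j, a)\<in>D. i \<in> J \<and> j \<in> J \<and> a \<in> hom E (A i) (A j)"
  shows "\<exists>L \<pi>. L \<in> Ob E \<and> (\<forall>j\<in>J. \<pi> j \<in> hom E L (A j)) \<and> (\<forall>(i, j, a)\<in>D. a \<cdot> \<pi> i = \<pi> j) \<and>
    (\<forall>C\<in>Ob E. \<forall>c. (\<forall>j\<in>J. c j \<in> hom E C (A j)) \<and> (\<forall>(i, j, a)\<in>D. a \<cdot> c i = c j) \<longrightarrow>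
      (\<exists>!h. h \<in> hom E C L \<and> (\<forall>j\<in>J. \<pi> j \<cdot> h = c j)))"
  using assms(1,4)
proof (induction D)
  case empty
  then show ?case using finite_product[OF J A] by simp
next
  case (insert d D)
  then obtain L \<pi> where L: "L \<in> Ob E" and \<pi>: "\<forall>j\<in>J. \<pi> j \<in> hom E L (A j)" "\<forall>(i, j, a)\<in>D. a \<cdot> \<pi> i = \<pi> j"
    and univ: "\<forall>C\<in>Ob E. \<forall>c. (\<forall>j\<in>J. c j \<in> hom E C (A j)) \<and> (\<forall>(i, j, a)\<in>D. a \<cdot> c i = c j) \<longrightarrow>
      (\<exists>!h. h \<in> hom E C L \<and> (\<forall>j\<in>J. \<pi> j \<cdot> h = c j))" by auto
  obtain i0 j0 a0 where d: "d = (i0, j0, a0)" by (cases d)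
  have d': "i0 \<in> J" "j0 \<in> J" "a0 \<in> hom E (A i0) (A j0)" using insert(4) d by auto
  have DJ: "i \<in> J \<and> j \<in> J \<and> a \<in> hom E (A i) (A j)" if "(i, j, a) \<in> D" for i j a
    using insert(4) that by auto
  have [simp]: "\<pi> i0 \<in> hom E L (A i0)" "\<pi> j0 \<in> hom E L (A j0)" using \<pi>(1) d' by blast+
  \<comment> \<open>\<open>f\<close> and \<open>g\<close> are the graphs of the two maps to
    \<open>A j0\<close> that have to agree. The first coordinates force the legs of their pullback
    to be equal, so it is the equalizer.\<close>
  define f where "f = pair E (Idt E L) (a0 \<cdot> \<pi> i0)"
  define g where "g = pair E (Idt E L) (\<pi> j0)"
  have f: "f \<in> hom E L (prd E L (A j0))" and g: "g \<in> hom E L (prd E L (A j0))"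
    using L d'(3) \<open>\<pi> i0 \<in> hom E L (A i0)\<close> \<open>\<pi> j0 \<in> hom E L (A j0)\<close> by (auto simp: f_def g_def)
  obtain Q p q where Q: "is_pullback E f g Q p q"
    using pullback_ex[of f g] f g by auto
  have Qf: "f \<cdot> x = pair E x (a0 \<cdot> (\<pi> i0 \<cdot> x))" and Qg: "g \<cdot> x = pair E x (\<pi> j0 \<cdot> x)"
    if "x \<in> Ar E" "Tgt E x = L" for x
    using that L d'(3) \<open>\<pi> i0 \<in> hom E L (A i0)\<close> \<open>\<pi> j0 \<in> hom E L (A j0)\<close> by (auto simp: f_def g_def)
  have p: "p \<in> Ar E" "Src E p = Q" "Tgt E p = L" and q: "q \<in> Ar E" "Src E q = Q" "Tgt E q = L"
    using is_pullbackD[OF Q] f g by auto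
  have "pair E p (a0 \<cdot> (\<pi> i0 \<cdot> p)) = pair E q (\<pi> j0 \<cdot> q)"
    using is_pullbackD(10)[OF Q] Qf[OF p(1,3)] Qg[OF q(1,3)] by simp
  then have pq: "p = q \<and> a0 \<cdot> (\<pi> i0 \<cdot> p) = \<pi> j0 \<cdot> q"
    by (rule iffD1[OF pair_eq_iff, rotated -1])
      (use p q d' \<open>\<pi> i0 \<in> hom E L (A i0)\<close> \<open>\<pi> j0 \<in> hom E L (A j0)\<close> in auto)
  show ?case
  proof (intro exI[of _ Q] exI[of _ "\<lambda>j. \<pi> j \<cdot> p"] conjI ballI allI impI)
    show "Q \<in> Ob E" using p by auto
    show "\<pi> j \<cdot> p \<in> hom E Q (A j)" if "j \<in> J" for j using \<pi>(1) p that by auto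
    show "case e of (i, j, a) \<Rightarrow> a \<cdot> (\<pi> i \<cdot> p) = \<pi> j \<cdot> p" if e: "e \<in> insert d D" for e
    proof (cases "e = d")
      case True
      then show ?thesis using pq d by auto
    next
      case False
      obtain i j a where e': "e = (i, j, a)" by (cases e)
      then have "(i, j, a) \<in> D" using e False by simp
      moreover from this have "a \<cdot> \<pi> i = \<pi> j" using \<pi>(2) by auto
      moreover have "\<pi> i \<in> hom E L (A i)" using DJ[OF calculation(1)] \<pi>(1) by blast
      ultimately show ?thesis using DJ[of i j a] p e' Cmp_assoc[of p "\<pi> i" a] by auto
    qed
    fix C c assume C: "C \<in> Ob E" and c: "(\<forall>j\<in>J. c j \<in> hom E C (A j)) \<and> (\<forall>(i, j, a)\<in>insert d D. a \<cdot> c i = c j)"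
    then have cJ: "\<forall>j\<in>J. c j \<in> hom E C (A j)" and cD: "\<forall>(i, j, a)\<in>D. a \<cdot> c i = c j" and cd: "a0 \<cdot> c i0 = c j0"
      using d by auto
    have ex1: "\<exists>!h. h \<in> hom E C L \<and> (\<forall>j\<in>J. \<pi> j \<cdot> h = c j)" using univ C cJ cD by blast
    then obtain h where h: "h \<in> hom E C L" "\<forall>j\<in>J. \<pi> j \<cdot> h = c j" by blast
    obtain k where k: "k \<in> Ar E" "Src E k = C" "Tgt E k = Q" "p \<cdot> k = h"
    proof (rule is_pullback_ex[OF Q, of h h])
      show "f \<cdot> h = g \<cdot> h" using Qf[of h] Qg[of h] h d' cd by simp
    qed (use h f g in auto)
    show "\<exists>!h. h \<in> hom E C Q \<and> (\<forall>j\<in>J. (\<pi> j \<cdot> p) \<cdot> h = c j)"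
    proof (rule ex1I[of _ k])
      have pk: "(\<pi> j \<cdot> p) \<cdot> x = \<pi> j \<cdot> (p \<cdot> x)" if "j \<in> J" "x \<in> hom E C Q" for j x
        by (rule Cmp_assoc) (use that \<pi>(1) p in auto)
      show "k \<in> hom E C Q \<and> (\<forall>j\<in>J. (\<pi> j \<cdot> p) \<cdot> k = c j)"
        using k h(2) pk by simp
      fix l assume l: "l \<in> hom E C Q \<and> (\<forall>j\<in>J. (\<pi> j \<cdot> p) \<cdot> l = c j)"
      then have "\<forall>j\<in>J. \<pi> j \<cdot> (p \<cdot> l) = c j" using pk by metis
      moreover have "p \<cdot> l \<in> hom E C L" using l p by simp
      ultimately have "p \<cdot> l = p \<cdot> k" using ex1 h k by blast
      then have e: "p \<cdot> l = p \<cdot> k" .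
      then have "q \<cdot> l = q \<cdot> k" unfolding conjunct1[OF pq] .
      with e show "l = k" by (rule is_pullback_unique[OF Q, rotated -2]) (use l k in simp_all)
    qed
  qed
qed

end

section \<open>Elements of simplicial families\<close>

lemma finite_monotone_map: "finite {\<alpha>. \<exists>m<k. monotone_map m k \<alpha>}"
  by (rule finite_subset[OF _ finite_lists_length_le[of "{..k}" k]]) (auto simp: monotone_map_def)

lemma monotone_map_mcomp:
  assumes "monotone_map m n \<alpha>" "monotone_map l m \<beta>"
  shows "monotone_map l n (mcomp \<alpha> \<beta>)"
  unfolding monotone_map_def
proof (intro conjI)
  have b: "\<beta> ! k \<le> m" if "k < length \<beta>" for k
  proof -
    have "\<beta> ! k \<in> set \<beta>" using that by simp
    then show ?thesis using assms(2) unfolding monotone_map_def by blast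
  qed
  show "length (mcomp \<alpha> \<beta>) = Suc l" using assms(2) by (simp add: monotone_map_def mcomp_def)
  show "set (mcomp \<alpha> \<beta>) \<subseteq> {..n}"
  proof
    fix x assume "x \<in> set (mcomp \<alpha> \<beta>)"
    then obtain k where "k \<in> set \<beta>" "x = \<alpha> ! k" by (auto simp: mcomp_def)
    then have "x \<in> set \<alpha>" using assms by (auto simp: monotone_map_def intro!: nth_mem)
    then show "x \<in> {..n}" using assms(1) by (auto simp: monotone_map_def)
  qed
  show "sorted (mcomp \<alpha> \<beta>)"
    unfolding mcomp_def sorted_iff_nth_mono
  proof (intro allI impI)
    fix i j assume ij: "i \<le> j" "j < length (map ((!) \<alpha>) \<beta>)"
    then have "\<beta> ! i \<le> \<beta> ! j" using assms(2) by (auto simp: monotone_map_def sorted_iff_nth_mono)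
    moreover have "\<beta> ! j < length \<alpha>" using b[of j] ij assms(1) by (simp add: monotone_map_def)
    ultimately have "\<alpha> ! (\<beta> ! i) \<le> \<alpha> ! (\<beta> ! j)"
      using assms(1) by (auto simp: monotone_map_def sorted_iff_nth_mono)
    then show "map ((!) \<alpha>) \<beta> ! i \<le> map ((!) \<alpha>) \<beta> ! j" using ij by simp
  qed
qed

context connected_generators
begin

text \<open>As \<open>V\<close> is connected, \<open>emb\<close> identifies \<open>sel F V n\<close> with the maps from \<open>V\<close> to the total object
  of the \<open>n\<close>-simplices, so the family is handled as a presheaf of simplicial sets.\<close>

definition sel :: "('s, 'o, 'a) sfam \<Rightarrow> 'o \<Rightarrow> nat \<Rightarrow> ('s \<times> 'a) set" where
  "sel F V n = {(w, x). w \<in> Ix F n \<and> x \<in> Ar E \<and> Src E x = V \<and> Tgt E x = Cp F n w}"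

definition sact :: "('s, 'o, 'a) sfam \<Rightarrow> nat \<Rightarrow> nat list \<Rightarrow> 's \<times> 'a \<Rightarrow> 's \<times> 'a" where
  "sact F n \<alpha> y = (ixmap F n \<alpha> (fst y), cpmap F n \<alpha> (fst y) \<cdot> snd y)"

definition emb :: "('s, 'o, 'a) sfam \<Rightarrow> nat \<Rightarrow> 's \<times> 'a \<Rightarrow> 'a" where
  "emb F n y = incl E (Ix F n) (Cp F n) (fst y) \<cdot> snd y"

definition pull :: "'s \<times> 'a \<Rightarrow> 'a \<Rightarrow> 's \<times> 'a" where
  "pull y c = (fst y, snd y \<cdot> c)"

text \<open>An element over V of the (k - 1)-coskeleton in degree k, with every map to a total
  object replaced by the simplex and the component map that it comes from.\<close>

definition matching :: "('s, 'o, 'a) sfam \<Rightarrow> 'o \<Rightarrow> nat \<Rightarrow> (nat list \<Rightarrow> 's \<times> 'a) \<Rightarrow> bool" where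
  "matching F V k Y \<longleftrightarrow>
     (\<forall>m \<alpha>. m < k \<and> monotone_map m k \<alpha> \<longrightarrow> Y \<alpha> \<in> sel F V m) \<and>
     (\<forall>l m \<alpha> \<beta>. l < k \<and> m < k \<and> monotone_map m k \<alpha> \<and> monotone_map l m \<beta> \<longrightarrow>
        sact F m \<beta> (Y \<alpha>) = Y (mcomp \<alpha> \<beta>))"

lemma simplicial_familyD:
  assumes F: "simplicial_family E TYPE('u) F"
  shows "small u (Ix F n)" 
    "w \<in> Ix F n \<Longrightarrow> monotone_map m n \<alpha> \<Longrightarrow> ixmap F n \<alpha> w \<in> Ix F m"
    "w \<in> Ix F n \<Longrightarrow> ixmap F n [0..<Suc n] w = w"
    "w \<in> Ix F n \<Longrightarrow> monotone_map m n \<alpha> \<Longrightarrow> monotone_map l m \<beta> \<Longrightarrow>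
       ixmap F m \<beta> (ixmap F n \<alpha> w) = ixmap F n (mcomp \<alpha> \<beta>) w"
    "w \<in> Ix F n \<Longrightarrow> Cp F n w \<in> Ob E"
    "w \<in> Ix F n \<Longrightarrow> \<not> initial E (Cp F n w)"
    "w \<in> Ix F n \<Longrightarrow> monotone_map m n \<alpha> \<Longrightarrow> cpmap F n \<alpha> w \<in> hom E (Cp F n w) (Cp F m (ixmap F n \<alpha> w))"
    "w \<in> Ix F n \<Longrightarrow> cpmap F n [0..<Suc n] w = Idt E (Cp F n w)"
    "w \<in> Ix F n \<Longrightarrow> monotone_map m n \<alpha> \<Longrightarrow> monotone_map l m \<beta> \<Longrightarrow>
       cpmap F m \<beta> (ixmap F n \<alpha> w) \<cdot> cpmap F n \<alpha> w = cpmap F n (mcomp \<alpha> \<beta>) w"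
proof -
  note d = F[unfolded simplicial_family_def simplicial_set_def]
  show "small u (Ix F n)" unfolding small_cong_itself[of u "Ix F n"] by (rule d[THEN conjunct1, THEN spec])
  show "w \<in> Ix F n \<Longrightarrow> monotone_map m n \<alpha> \<Longrightarrow> ixmap F n \<alpha> w \<in> Ix F m"
    by (rule d[THEN conjunct2, THEN conjunct1, THEN conjunct1, THEN spec, THEN spec, THEN spec, THEN mp,
          THEN funcset_mem])
  show "w \<in> Ix F n \<Longrightarrow> ixmap F n [0..<Suc n] w = w" using d by blast
  show "w \<in> Ix F n \<Longrightarrow> monotone_map m n \<alpha> \<Longrightarrow> monotone_map l m \<beta> \<Longrightarrow>
       ixmap F m \<beta> (ixmap F n \<alpha> w) = ixmap F n (mcomp \<alpha> \<beta>) w"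
    using d[THEN conjunct2, THEN conjunct1, THEN conjunct2, THEN conjunct2] by simp
  show "w \<in> Ix F n \<Longrightarrow> Cp F n w \<in> Ob E" "w \<in> Ix F n \<Longrightarrow> \<not> initial E (Cp F n w)" using d by blast+
  show "w \<in> Ix F n \<Longrightarrow> monotone_map m n \<alpha> \<Longrightarrow> cpmap F n \<alpha> w \<in> hom E (Cp F n w) (Cp F m (ixmap F n \<alpha> w))"
    using d by blast
  show "w \<in> Ix F n \<Longrightarrow> cpmap F n [0..<Suc n] w = Idt E (Cp F n w)" using d by blast
  show "w \<in> Ix F n \<Longrightarrow> monotone_map m n \<alpha> \<Longrightarrow> monotone_map l m \<beta> \<Longrightarrow>
       cpmap F m \<beta> (ixmap F n \<alpha> w) \<cdot> cpmap F n \<alpha> w = cpmap F n (mcomp \<alpha> \<beta>) w" using d by blast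
qed

lemma selD:
  assumes "y \<in> sel F V n"
  shows "fst y \<in> Ix F n" "snd y \<in> Ar E" "Src E (snd y) = V" "Tgt E (snd y) = Cp F n (fst y)"
  using assms by (auto simp: sel_def)

context
  fixes F :: "('s, 'o, 'a) sfam"
  assumes F: "simplicial_family E TYPE('u) F"
begin

lemma sact_sel:
  assumes "y \<in> sel F V n" "monotone_map m n \<alpha>"
  shows "sact F n \<alpha> y \<in> sel F V m"
  using simplicial_familyD(2,7)[OF F selD(1)[OF assms(1)] assms(2)] selD[OF assms(1)]
  by (simp add: sel_def sact_def)

lemma sact_mcomp:
  assumes "y \<in> sel F V n" "monotone_map m n \<alpha>" "monotone_map l m \<beta>"
  shows "sact F m \<beta> (sact F n \<alpha> y) = sact F n (mcomp \<alpha> \<beta>) y"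
proof -
  note y = selD[OF assms(1)]
  note a = simplicial_familyD(2,7)[OF F y(1) assms(2)]
  note b = simplicial_familyD(7)[OF F a(1) assms(3)]
  have "cpmap F m \<beta> (ixmap F n \<alpha> (fst y)) \<cdot> (cpmap F n \<alpha> (fst y) \<cdot> snd y)
      = (cpmap F m \<beta> (ixmap F n \<alpha> (fst y)) \<cdot> cpmap F n \<alpha> (fst y)) \<cdot> snd y"
    by (rule Cmp_assoc[symmetric]) (use a b y in simp_all)
  then show ?thesis
    unfolding simplicial_familyD(9)[OF F y(1) assms(2,3)]
    using simplicial_familyD(4)[OF F y(1) assms(2,3)] by (simp add: sact_def)
qed

lemma sact_id: "y \<in> sel F V n \<Longrightarrow> sact F n [0..<Suc n] y = y"
  using simplicial_familyD(3,8)[OF F selD(1)] selD[of y F V n]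
  by (simp add: sact_def del: upt_Suc)

lemma sact_pull:
  assumes "y \<in> sel F V n" "monotone_map m n \<alpha>" "c \<in> Ar E" "Tgt E c = V"
  shows "sact F n \<alpha> (pull y c) = pull (sact F n \<alpha> y) c"
  using simplicial_familyD(7)[OF F selD(1)[OF assms(1)] assms(2)] selD[OF assms(1)] assms(3,4)
  by (simp add: sact_def pull_def)

lemma pull_sel: "y \<in> sel F V n \<Longrightarrow> c \<in> Ar E \<Longrightarrow> Tgt E c = V \<Longrightarrow> pull y c \<in> sel F (Src E c) n"
  by (simp add: sel_def pull_def case_prod_unfold)

lemma Cp_Ob: "\<forall>w\<in>Ix F n. Cp F n w \<in> Ob E"
  using simplicial_familyD(5)[OF F] by blast

lemmas tot_coproduct = is_coproduct_coprod[OF simplicial_familyD(1)[OF F] Cp_Ob, folded tot_def]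

lemma emb_type:
  assumes "y \<in> sel F V n"
  shows "emb F n y \<in> Ar E" "Src E (emb F n y) = V" "Tgt E (emb F n y) = tot E F n"
  using is_coproductD(2-4)[OF tot_coproduct selD(1)[OF assms]] selD[OF assms] by (simp_all add: emb_def)

lemma emb_pull:
  assumes "y \<in> sel F V n" "c \<in> Ar E" "Tgt E c = V"
  shows "emb F n (pull y c) = emb F n y \<cdot> c"
  using is_coproductD(2-4)[OF tot_coproduct selD(1)[OF assms(1)]] selD[OF assms(1)] assms(2,3)
  by (simp add: emb_def pull_def)

lemma emb_cases:
  assumes "z \<in> Ar E" "Src E z \<in> G" "Tgt E z = tot E F n"
  obtains y where "y \<in> sel F (Src E z) n" "z = emb F n y"
proof -
  obtain w x where w: "w \<in> Ix F n" "x \<in> hom E (Src E z) (Cp F n w)" "incl E (Ix F n) (Cp F n) w \<cdot> x = z"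
    by (rule conn_coproduct[OF conn_G[OF assms(2)] simplicial_familyD(1)[OF F] tot_coproduct assms(1) refl assms(3)])
  show thesis by (rule that[of "(w, x)"]) (use w in \<open>simp_all add: sel_def emb_def\<close>)
qed

lemma emb_inj:
  assumes "y \<in> sel F V n" "z \<in> sel F V n" "V \<in> G" "emb F n y = emb F n z"
  shows "y = z"
proof -
  note y = selD[OF assms(1)] and z = selD[OF assms(2)]
  have "fst y = fst z \<and> snd y = snd z"
    by (rule conn_coproduct_unique[OF conn_G[OF assms(3)] simplicial_familyD(1)[OF F] tot_coproduct y(1) z(1) _ _
        assms(4)[unfolded emb_def]]) (use y z in simp_all)
  then show ?thesis by (simp add: prod_eq_iff)
qed

lemma totmap_type:
  assumes "monotone_map m n \<alpha>"
  shows "totmap E F m n \<alpha> \<in> Ar E" "Src E (totmap E F m n \<alpha>) = tot E F n" "Tgt E (totmap E F m n \<alpha>) = tot E F m"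
    "w \<in> Ix F n \<Longrightarrow> totmap E F m n \<alpha> \<cdot> incl E (Ix F n) (Cp F n) w
       = incl E (Ix F m) (Cp F m) (ixmap F n \<alpha> w) \<cdot> cpmap F n \<alpha> w"
proof -
  let ?f = "\<lambda>w. incl E (Ix F m) (Cp F m) (ixmap F n \<alpha> w) \<cdot> cpmap F n \<alpha> w"
  have f: "\<forall>w\<in>Ix F n. ?f w \<in> Ar E \<and> Src E (?f w) = Cp F n w \<and> Tgt E (?f w) = tot E F m"
  proof
    fix w assume w: "w \<in> Ix F n"
    note a = simplicial_familyD(2,7)[OF F w assms]
    show "?f w \<in> Ar E \<and> Src E (?f w) = Cp F n w \<and> Tgt E (?f w) = tot E F m"
      using is_coproductD(2-4)[OF tot_coproduct a(1)] a by simp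
  qed
  note ct = cotuple_type[OF simplicial_familyD(1)[OF F] is_coproductD(1)[OF tot_coproduct] f,
      folded tot_def totmap_def[of E F m n \<alpha>]]
  show "totmap E F m n \<alpha> \<in> Ar E" "Src E (totmap E F m n \<alpha>) = tot E F n" "Tgt E (totmap E F m n \<alpha>) = tot E F m"
    by (rule ct(1-3))+
  show "w \<in> Ix F n \<Longrightarrow> totmap E F m n \<alpha> \<cdot> incl E (Ix F n) (Cp F n) w
       = incl E (Ix F m) (Cp F m) (ixmap F n \<alpha> w) \<cdot> cpmap F n \<alpha> w" by (rule ct(4))
qed

lemma totmap_emb:
  assumes "y \<in> sel F V n" "monotone_map m n \<alpha>"
  shows "totmap E F m n \<alpha> \<cdot> emb F n y = emb F m (sact F n \<alpha> y)"
proof -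
  note y = selD[OF assms(1)]
  note a = simplicial_familyD(2,7)[OF F y(1) assms(2)]
  note t = totmap_type[OF assms(2)]
  have "totmap E F m n \<alpha> \<cdot> emb F n y = (totmap E F m n \<alpha> \<cdot> incl E (Ix F n) (Cp F n) (fst y)) \<cdot> snd y"
    unfolding emb_def
    by (rule Cmp_assoc[symmetric]) (use y t is_coproductD(2-4)[OF tot_coproduct y(1)] in simp_all)
  also have "\<dots> = emb F m (sact F n \<alpha> y)"
    unfolding t(4)[OF y(1)] emb_def sact_def
    using y a is_coproductD(2-4)[OF tot_coproduct a(1)] by simp
  finally show ?thesis .
qed

section \<open>The hypercover condition in terms of elements\<close>

lemma is_cosk_iff:
  "is_cosk E F k L \<pi> \<longleftrightarrow> L \<in> Ob E \<and>
     (\<forall>m \<alpha>. m < k \<and> monotone_map m k \<alpha> \<longrightarrow> \<pi> \<alpha> \<in> hom E L (tot E F m)) \<and>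
     (\<forall>l m \<alpha> \<beta>. l < k \<and> m < k \<and> monotone_map m k \<alpha> \<and> monotone_map l m \<beta> \<longrightarrow>
           totmap E F l m \<beta> \<cdot> \<pi> \<alpha> = \<pi> (mcomp \<alpha> \<beta>)) \<and>
     (\<forall>C\<in>Ob E. \<forall>c. (\<forall>m \<alpha>. m < k \<and> monotone_map m k \<alpha> \<longrightarrow> c \<alpha> \<in> hom E C (tot E F m)) \<and>
        (\<forall>l m \<alpha> \<beta>. l < k \<and> m < k \<and> monotone_map m k \<alpha> \<and> monotone_map l m \<beta> \<longrightarrow>
           totmap E F l m \<beta> \<cdot> c \<alpha> = c (mcomp \<alpha> \<beta>)) \<longrightarrow>
        (\<exists>!h. h \<in> hom E C L \<and> (\<forall>m \<alpha>. m < k \<and> monotone_map m k \<alpha> \<longrightarrow> \<pi> \<alpha> \<cdot> h = c \<alpha>)))"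
  unfolding is_cosk_def Let_def by (simp only: conj_assoc)

text \<open>A matching family is an element of the coskeleton L at V. It lifts locally along the
  epimorphism \<open>h\<close>, and \<open>emb\<close>, being injective at connected stages,
  translates the lifts back into simplices.\<close>

lemma hypercover_lift:
  assumes L: "is_cosk E F k L \<pi>" and h: "h \<in> hom E (tot E F k) L" "epi E h"
    "\<And>m \<alpha>. m < k \<Longrightarrow> monotone_map m k \<alpha> \<Longrightarrow> \<pi> \<alpha> \<cdot> h = totmap E F m k \<alpha>"
    and V: "V \<in> G" and Y: "matching F V k Y"
  shows "epi_family E V {c. c \<in> Ar E \<and> Src E c \<in> G \<and> Tgt E c = V \<and>
    (\<exists>y\<in>sel F (Src E c) k. \<forall>m \<alpha>. m < k \<and> monotone_map m k \<alpha> \<longrightarrow> sact F k \<alpha> y = pull (Y \<alpha>) c)}"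
proof -
  note L' = L[unfolded is_cosk_iff]
  have Ysel: "Y \<alpha> \<in> sel F V m" if "m < k" "monotone_map m k \<alpha>" for m \<alpha>
    using Y that by (simp add: matching_def)
  \<comment> \<open>A map from [m] is a list of m + 1 values, so its degree is the length minus
    one.\<close>
  define c where "c \<alpha> = emb F (length \<alpha> - 1) (Y \<alpha>)" for \<alpha>
  have c: "c \<alpha> = emb F m (Y \<alpha>)" if "monotone_map m k \<alpha>" for m \<alpha>
    using that by (simp add: c_def monotone_map_def)
  have "\<exists>!h. h \<in> hom E V L \<and> (\<forall>m \<alpha>. m < k \<and> monotone_map m k \<alpha> \<longrightarrow> \<pi> \<alpha> \<cdot> h = c \<alpha>)"
  proof (rule L'[THEN conjunct2, THEN conjunct2, THEN conjunct2, THEN bspec, THEN spec, THEN mp], rule G_Ob[OF V],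
      intro conjI allI impI)
    fix m \<alpha> assume a: "m < k \<and> monotone_map m k \<alpha>"
    then show "c \<alpha> \<in> hom E V (tot E F m)" using emb_type[OF Ysel] c[of m \<alpha>] by simp
  next
    fix l m \<alpha> \<beta> assume a: "l < k \<and> m < k \<and> monotone_map m k \<alpha> \<and> monotone_map l m \<beta>"
    then have "totmap E F l m \<beta> \<cdot> c \<alpha> = emb F l (sact F m \<beta> (Y \<alpha>))" using c[of m \<alpha>] totmap_emb[OF Ysel] by simp
    also have "sact F m \<beta> (Y \<alpha>) = Y (mcomp \<alpha> \<beta>)" using Y a unfolding matching_def by blast
    also have "emb F l (Y (mcomp \<alpha> \<beta>)) = c (mcomp \<alpha> \<beta>)"
      using c[OF monotone_map_mcomp[of m k \<alpha> l \<beta>]] a by simp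
    finally show "totmap E F l m \<beta> \<cdot> c \<alpha> = c (mcomp \<alpha> \<beta>)" .
  qed
  then obtain b where b: "b \<in> hom E V L" "\<And>m \<alpha>. m < k \<Longrightarrow> monotone_map m k \<alpha> \<Longrightarrow> \<pi> \<alpha> \<cdot> b = c \<alpha>" by blast
  have "epi_family E (Src E b) {c. c \<in> Ar E \<and> Src E c \<in> G \<and> Tgt E c = Src E b \<and>
    (\<exists>y\<in>Ar E. Src E y = Src E c \<and> Tgt E y = Src E h \<and> h \<cdot> y = b \<cdot> c)}"
    by (rule epi_lift[OF h(2)]) (use b h in simp_all)
  then have "epi_family E V {c. c \<in> Ar E \<and> Src E c \<in> G \<and> Tgt E c = Src E b \<and>
    (\<exists>y\<in>Ar E. Src E y = Src E c \<and> Tgt E y = Src E h \<and> h \<cdot> y = b \<cdot> c)}" using b by simp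
  then show ?thesis
  proof (rule epi_family_mono)
    show "{c. c \<in> Ar E \<and> Src E c \<in> G \<and> Tgt E c = Src E b \<and>
        (\<exists>y\<in>Ar E. Src E y = Src E c \<and> Tgt E y = Src E h \<and> h \<cdot> y = b \<cdot> c)}
      \<subseteq> {c. c \<in> Ar E \<and> Src E c \<in> G \<and> Tgt E c = V \<and>
      (\<exists>y\<in>sel F (Src E c) k. \<forall>m \<alpha>. m < k \<and> monotone_map m k \<alpha> \<longrightarrow> sact F k \<alpha> y = pull (Y \<alpha>) c)}"
    proof clarify
      fix d z assume d: "d \<in> Ar E" "Src E d \<in> G" "Tgt E d = Src E b"
        and z: "z \<in> Ar E" "Src E z = Src E d" "Tgt E z = Src E h" "h \<cdot> z = b \<cdot> d"
      have dV: "Tgt E d = V" using d b by simp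
      have z': "Src E z \<in> G" "Tgt E z = tot E F k" using d z h by simp_all
      obtain y where y: "y \<in> sel F (Src E z) k" "z = emb F k y" by (rule emb_cases[OF z(1) z'])
      have "sact F k \<alpha> y = pull (Y \<alpha>) d" if m: "m < k" "monotone_map m k \<alpha>" for m \<alpha>
      proof (rule emb_inj)
        show "sact F k \<alpha> y \<in> sel F (Src E d) m" using sact_sel[OF y(1) m(2)] z by simp
        show "pull (Y \<alpha>) d \<in> sel F (Src E d) m" by (rule pull_sel[OF Ysel[OF m] d(1) dV])
        show "Src E d \<in> G" by (rule d)
        have pa: "\<pi> \<alpha> \<in> hom E L (tot E F m)" using L' m by blast
        have "emb F m (sact F k \<alpha> y) = totmap E F m k \<alpha> \<cdot> z" using totmap_emb[OF y(1) m(2)] y(2) by simp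
        also have "\<dots> = (\<pi> \<alpha> \<cdot> h) \<cdot> z" unfolding h(3)[OF m] ..
        also have "\<dots> = \<pi> \<alpha> \<cdot> (b \<cdot> d)" using pa h(1) z by simp
        also have "\<dots> = (\<pi> \<alpha> \<cdot> b) \<cdot> d" using pa b(1) d by simp
        also have "\<dots> = emb F m (pull (Y \<alpha>) d)" unfolding b(2)[OF m] c[OF m(2)]
          by (rule emb_pull[OF Ysel[OF m] d(1) dV, symmetric])
        finally show "emb F m (sact F k \<alpha> y) = emb F m (pull (Y \<alpha>) d)" .
      qed
      then show "Tgt E d = V \<and> (\<exists>y\<in>sel F (Src E d) k. \<forall>m \<alpha>. m < k \<and> monotone_map m k \<alpha> \<longrightarrow> sact F k \<alpha> y = pull (Y \<alpha>) d)"
        using y(1) z(2) dV by auto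
    qed
  qed auto
qed

text \<open>The coskeleton exists as a finite limit, since only finitely many monotone maps reach
  [k] from degrees below k. Its elements at generators are matching families, so fillers make the
  comparison map surjective on elements, hence epi.\<close>

lemma cosk_epi_if_fillers:
  assumes fill: "\<And>V Y. V \<in> G \<Longrightarrow> matching F V k Y \<Longrightarrow>
      \<exists>y\<in>sel F V k. \<forall>m \<alpha>. m < k \<and> monotone_map m k \<alpha> \<longrightarrow> sact F k \<alpha> y = Y \<alpha>"
  shows "\<exists>L \<pi> h. is_cosk E F k L \<pi> \<and> h \<in> hom E (tot E F k) L \<and>
        (\<forall>m \<alpha>. m < k \<and> monotone_map m k \<alpha> \<longrightarrow> \<pi> \<alpha> \<cdot> h = totmap E F m k \<alpha>) \<and> epi E h"
proof -
  define J where "J = {\<alpha>. \<exists>m<k. monotone_map m k \<alpha>}"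
  define A where "A \<alpha> = tot E F (length \<alpha> - 1)" for \<alpha> :: "nat list"
  \<comment> \<open>The arrows of the diagram whose limit is the coskeleton, leading from
    \<open>\<alpha>\<close> to its composite with \<open>\<beta>\<close>; the degrees are read off
    from the lengths of the lists.\<close>
  define D where "D = (\<lambda>(\<alpha>, \<beta>). (\<alpha>, mcomp \<alpha> \<beta>, totmap E F (length \<beta> - 1) (length \<alpha> - 1) \<beta>)) `
    {(\<alpha>, \<beta>). \<exists>l m. l < k \<and> m < k \<and> monotone_map m k \<alpha> \<and> monotone_map l m \<beta>}"
  have J: "finite J" unfolding J_def by (rule finite_monotone_map)
  have len: "length \<alpha> - 1 = m" if "monotone_map m n \<alpha>" for m n \<alpha> using that by (simp add: monotone_map_def)
  have AO: "\<forall>\<alpha>\<in>J. A \<alpha> \<in> Ob E" using is_coproductD(1)[OF tot_coproduct] by (simp add: A_def)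
  have "finite {(\<alpha>, \<beta>). \<exists>l m. l < k \<and> m < k \<and> monotone_map m k \<alpha> \<and> monotone_map l m \<beta>}"
  proof (rule finite_subset)
    show "{(\<alpha>, \<beta>). \<exists>l m. l < k \<and> m < k \<and> monotone_map m k \<alpha> \<and> monotone_map l m \<beta>}
      \<subseteq> J \<times> {\<beta>. set \<beta> \<subseteq> {..k} \<and> length \<beta> \<le> k}"
      by (fastforce simp: J_def monotone_map_def)
    show "finite (J \<times> {\<beta>. set \<beta> \<subseteq> {..k} \<and> length \<beta> \<le> k})"
      using J finite_lists_length_le[of "{..k}" k] by simp
  qed
  then have Dfin: "finite D" by (simp add: D_def)
  have DI: "(\<alpha>, mcomp \<alpha> \<beta>, totmap E F l m \<beta>) \<in> D"
    if "l < k" "m < k" "monotone_map m k \<alpha>" "monotone_map l m \<beta>" for l m \<alpha> \<beta>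
    unfolding D_def using that len[OF that(3)] len[OF that(4)] by (intro image_eqI[of _ _ "(\<alpha>, \<beta>)"]) auto
  have DE: "\<exists>l m \<beta>. d = (fst d, mcomp (fst d) \<beta>, totmap E F l m \<beta>) \<and> l < k \<and> m < k \<and> monotone_map m k (fst d) \<and> monotone_map l m \<beta>"
    if "d \<in> D" for d
  proof -
    from that obtain \<alpha> \<beta> l m where a: "d = (\<alpha>, mcomp \<alpha> \<beta>, totmap E F (length \<beta> - 1) (length \<alpha> - 1) \<beta>)"
      and b: "l < k" "m < k" "monotone_map m k \<alpha>" "monotone_map l m \<beta>" unfolding D_def by auto
    show ?thesis unfolding a len[OF b(3)] len[OF b(4)] fst_conv using b by blast
  qed
  have Dty: "\<forall>(\<alpha>, \<gamma>, a)\<in>D. \<alpha> \<in> J \<and> \<gamma> \<in> J \<and> a \<in> hom E (A \<alpha>) (A \<gamma>)"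
  proof
    fix d assume "d \<in> D"
    then obtain l m \<beta> where d: "d = (fst d, mcomp (fst d) \<beta>, totmap E F l m \<beta>)"
      and lm: "l < k" "m < k" and mm: "monotone_map m k (fst d)" "monotone_map l m \<beta>" using DE by blast
    note mc = monotone_map_mcomp[OF mm]
    show "case d of (\<alpha>, \<gamma>, a) \<Rightarrow> \<alpha> \<in> J \<and> \<gamma> \<in> J \<and> a \<in> hom E (A \<alpha>) (A \<gamma>)"
      by (subst d) (use lm mm mc totmap_type[OF mm(2)] len[OF mm(1)] len[OF mc] in \<open>auto simp: J_def A_def\<close>)
  qed
  obtain L \<pi> where L: "L \<in> Ob E" "\<forall>\<alpha>\<in>J. \<pi> \<alpha> \<in> hom E L (A \<alpha>)" "\<forall>(\<alpha>, \<gamma>, a)\<in>D. a \<cdot> \<pi> \<alpha> = \<pi> \<gamma>"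
    and univ: "\<forall>C\<in>Ob E. \<forall>c. (\<forall>j\<in>J. c j \<in> hom E C (A j)) \<and> (\<forall>(i, j, a)\<in>D. a \<cdot> c i = c j) \<longrightarrow>
      (\<exists>!h. h \<in> hom E C L \<and> (\<forall>j\<in>J. \<pi> j \<cdot> h = c j))"
    using finite_limit[OF Dfin J AO Dty] by (elim exE conjE)
  have cone: "(\<forall>m \<alpha>. m < k \<and> monotone_map m k \<alpha> \<longrightarrow> c \<alpha> \<in> hom E C (tot E F m)) \<longleftrightarrow> (\<forall>\<alpha>\<in>J. c \<alpha> \<in> hom E C (A \<alpha>))" for c C
    by (auto simp: J_def A_def monotone_map_def)
  have cone': "(\<forall>l m \<alpha> \<beta>. l < k \<and> m < k \<and> monotone_map m k \<alpha> \<and> monotone_map l m \<beta> \<longrightarrow>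
           totmap E F l m \<beta> \<cdot> c \<alpha> = c (mcomp \<alpha> \<beta>)) \<longleftrightarrow> (\<forall>(\<alpha>, \<gamma>, a)\<in>D. a \<cdot> c \<alpha> = c \<gamma>)" for c
  proof
    assume l: "\<forall>l m \<alpha> \<beta>. l < k \<and> m < k \<and> monotone_map m k \<alpha> \<and> monotone_map l m \<beta> \<longrightarrow>
           totmap E F l m \<beta> \<cdot> c \<alpha> = c (mcomp \<alpha> \<beta>)"
    show "\<forall>(\<alpha>, \<gamma>, a)\<in>D. a \<cdot> c \<alpha> = c \<gamma>"
    proof
      fix d assume "d \<in> D"
      then obtain l m \<beta> where d: "d = (fst d, mcomp (fst d) \<beta>, totmap E F l m \<beta>)"
        and lm: "l < k" "m < k" and mm: "monotone_map m k (fst d)" "monotone_map l m \<beta>" using DE by blast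
      show "case d of (\<alpha>, \<gamma>, a) \<Rightarrow> a \<cdot> c \<alpha> = c \<gamma>"
        by (subst d) (use l lm mm in auto)
    qed
  next
    assume r: "\<forall>(\<alpha>, \<gamma>, a)\<in>D. a \<cdot> c \<alpha> = c \<gamma>"
    show "\<forall>l m \<alpha> \<beta>. l < k \<and> m < k \<and> monotone_map m k \<alpha> \<and> monotone_map l m \<beta> \<longrightarrow>
           totmap E F l m \<beta> \<cdot> c \<alpha> = c (mcomp \<alpha> \<beta>)"
    proof (intro allI impI)
      fix l m \<alpha> \<beta> assume a: "l < k \<and> m < k \<and> monotone_map m k \<alpha> \<and> monotone_map l m \<beta>"
      then have "(\<alpha>, mcomp \<alpha> \<beta>, totmap E F l m \<beta>) \<in> D" by (intro DI) blast+
      from bspec[OF r this] show "totmap E F l m \<beta> \<cdot> c \<alpha> = c (mcomp \<alpha> \<beta>)" by simp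
    qed
  qed
  have eqJ: "(\<forall>m \<alpha>. m < k \<and> monotone_map m k \<alpha> \<longrightarrow> P \<alpha>) \<longleftrightarrow> (\<forall>\<alpha>\<in>J. P \<alpha>)" for P
    by (auto simp: J_def)
  have cosk: "is_cosk E F k L \<pi>"
    unfolding is_cosk_iff cone cone' eqJ using L univ by blast
  define t where "t \<alpha> = totmap E F (length \<alpha> - 1) k \<alpha>" for \<alpha>
  have t: "t \<alpha> = totmap E F m k \<alpha>" if "monotone_map m k \<alpha>" for m \<alpha> using len[OF that] by (simp add: t_def)
  have tot_eqI: "f = g" if "f \<in> Ar E" "g \<in> Ar E" "Src E f = tot E F n" "Src E g = tot E F n" "Tgt E f = Tgt E g"
    "\<And>V y. V \<in> G \<Longrightarrow> y \<in> sel F V n \<Longrightarrow> f \<cdot> emb F n y = g \<cdot> emb F n y" for f g n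
  proof (rule eqI)
    fix x assume x: "x \<in> Ar E" "Src E x \<in> G" "Tgt E x = Src E f"
    then have x3: "Tgt E x = tot E F n" using that by simp
    obtain y where "y \<in> sel F (Src E x) n" "x = emb F n y" by (rule emb_cases[OF x(1,2) x3])
    then show "f \<cdot> x = g \<cdot> x" using that(6)[of "Src E x" y] x by simp
  qed (use that in simp_all)
  have "\<forall>\<alpha>\<in>J. t \<alpha> \<in> hom E (tot E F k) (A \<alpha>)"
    unfolding cone[symmetric]
  proof (intro allI impI)
    fix m \<alpha> assume "m < k \<and> monotone_map m k \<alpha>"
    then have a: "monotone_map m k \<alpha>" by blast
    show "t \<alpha> \<in> hom E (tot E F k) (tot E F m)" unfolding t[OF a] using totmap_type(1-3)[OF a] by simp
  qed
  moreover have "\<forall>(\<alpha>, \<gamma>, a)\<in>D. a \<cdot> t \<alpha> = t \<gamma>"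
    unfolding cone'[symmetric]
  proof (intro allI impI)
    fix l m \<alpha> \<beta> assume a: "l < k \<and> m < k \<and> monotone_map m k \<alpha> \<and> monotone_map l m \<beta>"
    then have mm: "monotone_map m k \<alpha>" "monotone_map l m \<beta>" by auto
    note mc = monotone_map_mcomp[OF mm]
    show "totmap E F l m \<beta> \<cdot> t \<alpha> = t (mcomp \<alpha> \<beta>)"
      unfolding t[OF mm(1)] t[OF mc]
    proof (rule tot_eqI)
      fix V y assume y: "V \<in> G" "y \<in> sel F V k"
      have "(totmap E F l m \<beta> \<cdot> totmap E F m k \<alpha>) \<cdot> emb F k y = totmap E F l m \<beta> \<cdot> (totmap E F m k \<alpha> \<cdot> emb F k y)"
        by (rule Cmp_assoc) (use totmap_type(1-3)[OF mm(1)] totmap_type(1-3)[OF mm(2)] emb_type[OF y(2)] in simp_all)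
      then show "(totmap E F l m \<beta> \<cdot> totmap E F m k \<alpha>) \<cdot> emb F k y = totmap E F l k (mcomp \<alpha> \<beta>) \<cdot> emb F k y"
        unfolding totmap_emb[OF y(2) mm(1)] totmap_emb[OF sact_sel[OF y(2) mm(1)] mm(2)] totmap_emb[OF y(2) mc]
          sact_mcomp[OF y(2) mm] .
    qed (use totmap_type(1-3)[OF mm(1)] totmap_type(1-3)[OF mm(2)] totmap_type(1-3)[OF mc] in simp_all)
  qed
  ultimately obtain h where h: "h \<in> hom E (tot E F k) L" "\<forall>\<alpha>\<in>J. \<pi> \<alpha> \<cdot> h = t \<alpha>"
    using univ is_coproductD(1)[OF tot_coproduct, of k] by blast
  have hm: "\<pi> \<alpha> \<cdot> h = totmap E F m k \<alpha>" if "m < k" "monotone_map m k \<alpha>" for m \<alpha>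
    using h(2) that t[OF that(2)] by (auto simp: J_def)
  have "epi E h"
    unfolding epi_iff_epi_family
  proof (intro conjI)
    show "h \<in> Ar E" using h by simp
    have "g = g'" if g: "g \<in> hom E L C" "g' \<in> hom E L C" and eq: "g \<cdot> h = g' \<cdot> h" for C g g'
    proof (rule eqI)
      fix b assume b: "b \<in> Ar E" "Src E b \<in> G" "Tgt E b = Src E g"
      then have bL: "Tgt E b = L" using g by simp
      \<comment> \<open>At the connected stage of \<open>b\<close> each coordinate of
        \<open>b\<close> comes from one simplex; these simplices will form the matching family to be
        filled.\<close>
      have "\<exists>y. y \<in> sel F (Src E b) (length \<alpha> - 1) \<and> \<pi> \<alpha> \<cdot> b = emb F (length \<alpha> - 1) y" if \<alpha>: "\<alpha> \<in> J" for \<alpha>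
      proof -
        have "\<pi> \<alpha> \<in> hom E L (A \<alpha>)" using L \<alpha> by blast
        then have z: "\<pi> \<alpha> \<cdot> b \<in> Ar E" "Src E (\<pi> \<alpha> \<cdot> b) = Src E b" "Tgt E (\<pi> \<alpha> \<cdot> b) = tot E F (length \<alpha> - 1)"
          using b bL by (simp_all add: A_def)
        then have "Src E (\<pi> \<alpha> \<cdot> b) \<in> G" using b by simp
        from emb_cases[OF z(1) this z(3)] show ?thesis using z(2) by metis
      qed
      then obtain Y where Y: "\<And>\<alpha>. \<alpha> \<in> J \<Longrightarrow> Y \<alpha> \<in> sel F (Src E b) (length \<alpha> - 1) \<and> \<pi> \<alpha> \<cdot> b = emb F (length \<alpha> - 1) (Y \<alpha>)"
        by metis
      have Ym: "Y \<alpha> \<in> sel F (Src E b) m" "\<pi> \<alpha> \<cdot> b = emb F m (Y \<alpha>)" if "m < k" "monotone_map m k \<alpha>" for m \<alpha>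
        using Y[of \<alpha>] that len[OF that(2)] by (auto simp: J_def)
      have "matching F (Src E b) k Y"
        unfolding matching_def
      proof (intro conjI allI impI)
        show "Y \<alpha> \<in> sel F (Src E b) m" if "m < k \<and> monotone_map m k \<alpha>" for m \<alpha> using Ym that by blast
        fix l m \<alpha> \<beta> assume a: "l < k \<and> m < k \<and> monotone_map m k \<alpha> \<and> monotone_map l m \<beta>"
        then have mm: "monotone_map m k \<alpha>" "monotone_map l m \<beta>" and lm: "l < k" "m < k" by auto
        note mc = monotone_map_mcomp[OF mm]
        have pa: "\<pi> \<alpha> \<in> hom E L (tot E F m)" using cosk lm mm unfolding is_cosk_iff by blast
        show "sact F m \<beta> (Y \<alpha>) = Y (mcomp \<alpha> \<beta>)"
        proof (rule emb_inj[OF sact_sel[OF Ym(1)[OF lm(2) mm(1)] mm(2)] Ym(1)[OF lm(1) mc] b(2)])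
          have "emb F l (sact F m \<beta> (Y \<alpha>)) = totmap E F l m \<beta> \<cdot> (\<pi> \<alpha> \<cdot> b)"
            unfolding Ym(2)[OF lm(2) mm(1)] using totmap_emb[OF Ym(1)[OF lm(2) mm(1)] mm(2)] by simp
          also have "\<dots> = (totmap E F l m \<beta> \<cdot> \<pi> \<alpha>) \<cdot> b"
            by (rule Cmp_assoc[symmetric]) (use totmap_type(1-3)[OF mm(2)] pa b bL in simp_all)
          also have "totmap E F l m \<beta> \<cdot> \<pi> \<alpha> = \<pi> (mcomp \<alpha> \<beta>)" using cosk a unfolding is_cosk_iff by blast
          finally show "emb F l (sact F m \<beta> (Y \<alpha>)) = emb F l (Y (mcomp \<alpha> \<beta>))" using Ym(2)[OF lm(1) mc] by simp
        qed
      qed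
      from fill[OF b(2) this] obtain y where y: "y \<in> sel F (Src E b) k"
        "\<And>m \<alpha>. m < k \<Longrightarrow> monotone_map m k \<alpha> \<Longrightarrow> sact F k \<alpha> y = Y \<alpha>" by blast
      note ey = emb_type[OF y(1)]
      have "\<forall>\<alpha>\<in>J. \<pi> \<alpha> \<cdot> (h \<cdot> emb F k y) = \<pi> \<alpha> \<cdot> b"
        unfolding eqJ[symmetric]
      proof (intro allI impI)
        fix m \<alpha> assume "m < k \<and> monotone_map m k \<alpha>"
        then have m: "m < k" "monotone_map m k \<alpha>" by auto
        have pa: "\<pi> \<alpha> \<in> hom E L (tot E F m)" using cosk m unfolding is_cosk_iff by blast
        have "\<pi> \<alpha> \<cdot> (h \<cdot> emb F k y) = (\<pi> \<alpha> \<cdot> h) \<cdot> emb F k y"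
          by (rule Cmp_assoc[symmetric]) (use pa h(1) ey in simp_all)
        then show "\<pi> \<alpha> \<cdot> (h \<cdot> emb F k y) = \<pi> \<alpha> \<cdot> b"
          unfolding hm[OF m] totmap_emb[OF y(1) m(2)] y(2)[OF m] Ym(2)[OF m] .
      qed
      moreover have hy: "h \<cdot> emb F k y \<in> hom E (Src E b) L" using h(1) ey by simp
      moreover have "\<exists>!f. f \<in> hom E (Src E b) L \<and> (\<forall>\<alpha>\<in>J. \<pi> \<alpha> \<cdot> f = \<pi> \<alpha> \<cdot> b)"
      proof (rule univ[THEN bspec, THEN spec, THEN mp], goal_cases)
        case 1
        show ?case using b by simp
      next
        case 2
        have "\<forall>\<alpha>\<in>J. \<pi> \<alpha> \<cdot> b \<in> hom E (Src E b) (A \<alpha>)"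
        proof
          fix \<alpha> assume "\<alpha> \<in> J"
          then have "\<pi> \<alpha> \<in> hom E L (A \<alpha>)" using L by blast
          then show "\<pi> \<alpha> \<cdot> b \<in> hom E (Src E b) (A \<alpha>)" using b bL by simp
        qed
        moreover have "\<forall>(\<alpha>, \<gamma>, a)\<in>D. a \<cdot> (\<pi> \<alpha> \<cdot> b) = \<pi> \<gamma> \<cdot> b"
        proof clarify
          fix \<alpha> \<gamma> a assume d: "(\<alpha>, \<gamma>, a) \<in> D"
          then have "\<alpha> \<in> J" "a \<in> hom E (A \<alpha>) (A \<gamma>)" and e: "a \<cdot> \<pi> \<alpha> = \<pi> \<gamma>" using Dty L(3) by blast+
          moreover from this have "\<pi> \<alpha> \<in> hom E L (A \<alpha>)" using L by blast
          ultimately show "a \<cdot> (\<pi> \<alpha> \<cdot> b) = \<pi> \<gamma> \<cdot> b" unfolding e[symmetric]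
            by (subst Cmp_assoc) (use b bL in simp_all)
        qed
        ultimately show ?case by blast
      qed
      moreover have "b \<in> hom E (Src E b) L" using b bL by simp
      ultimately have hb: "h \<cdot> emb F k y = b" by blast
      have "g \<cdot> (h \<cdot> emb F k y) = g' \<cdot> (h \<cdot> emb F k y)"
        by (rule Cmp_eq_Cmp[OF eq]) (use g h(1) ey in simp_all)
      then show "g \<cdot> b = g' \<cdot> b" unfolding hb .
    qed (use g in simp_all)
    then show "epi_family E (Tgt E h) {h}" unfolding epi_family_def using h(1) by simp
  qed
  with cosk h(1) hm show ?thesis by blast
qed

end

end

section \<open>Edges of a hypercover refinement\<close>

lemma monotone_map_0: "monotone_map 0 n \<alpha> \<longleftrightarrow> (\<exists>a\<le>n. \<alpha> = [a])"
  by (auto simp: monotone_map_def length_Suc_conv)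

lemma monotone_map_1: "monotone_map (Suc 0) n \<alpha> \<longleftrightarrow> (\<exists>a b. a \<le> b \<and> b \<le> n \<and> \<alpha> = [a, b])"
  by (auto simp: monotone_map_def length_Suc_conv)

context connected_generators
begin

definition vtx :: "('s, 'o, 'a) sfam \<Rightarrow> nat \<Rightarrow> 's \<times> 'a \<Rightarrow> 's \<times> 'a" where
  "vtx F k y = sact F (Suc 0) [k] y"

definition degen :: "('s, 'o, 'a) sfam \<Rightarrow> 's \<times> 'a \<Rightarrow> 's \<times> 'a" where
  "degen F y = sact F 0 [0, 0] y"

context
  fixes F :: "('s, 'o, 'a) sfam"
  assumes F: "simplicial_family E TYPE('u) F"
begin

lemma vtx_sel: "y \<in> sel F V (Suc 0) \<Longrightarrow> k \<le> Suc 0 \<Longrightarrow> vtx F k y \<in> sel F V 0"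
  unfolding vtx_def by (rule sact_sel[OF F]) (simp_all add: monotone_map_0)

lemma degen_sel: "y \<in> sel F V 0 \<Longrightarrow> degen F y \<in> sel F V (Suc 0)"
  unfolding degen_def by (rule sact_sel[OF F]) (simp_all add: monotone_map_1)

lemma vtx_degen:
  assumes "y \<in> sel F V 0" "k \<le> Suc 0"
  shows "vtx F k (degen F y) = y"
proof -
  have "vtx F k (degen F y) = sact F 0 (mcomp [0, 0] [k]) y"
    unfolding vtx_def degen_def
    by (rule sact_mcomp[where l = 0, OF F assms(1)]) (use assms(2) in \<open>simp_all add: monotone_map_0 monotone_map_1\<close>)
  also have "mcomp [0, 0] [k] = [0..<Suc 0]" using assms(2) by (cases k) (simp_all add: mcomp_def)
  finally show ?thesis using sact_id[OF F assms(1)] by simp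
qed

lemma vtx_pull:
  "y \<in> sel F V (Suc 0) \<Longrightarrow> k \<le> Suc 0 \<Longrightarrow> c \<in> Ar E \<Longrightarrow> Tgt E c = V \<Longrightarrow> vtx F k (pull y c) = pull (vtx F k y) c"
  unfolding vtx_def by (rule sact_pull[where m = 0, OF F]) (simp_all add: monotone_map_0)

text \<open>In degree 1 only vertices are matched, and the only endomap of [0] is the identity, so
  any two points form a matching family; \<open>[0]\<close> stands for the source.\<close>

lemma edge_matching:
  assumes "a \<in> sel F V 0" "b \<in> sel F V 0"
  shows "matching F V (Suc 0) (\<lambda>\<alpha>. if \<alpha> = [0] then a else b)"
  unfolding matching_def
proof (intro conjI allI impI)
  fix m \<alpha> assume "m < Suc 0 \<and> monotone_map m (Suc 0) \<alpha>"
  then show "(if \<alpha> = [0] then a else b) \<in> sel F V m" using assms by auto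
next
  fix l m \<alpha> \<beta> assume "l < Suc 0 \<and> m < Suc 0 \<and> monotone_map m (Suc 0) \<alpha> \<and> monotone_map l m \<beta>"
  then have m: "m = 0" "l = 0" and "monotone_map 0 (Suc 0) \<alpha>" "monotone_map 0 0 \<beta>" by auto
  then obtain i where \<alpha>: "\<alpha> = [i]" "i \<le> Suc 0" and \<beta>: "\<beta> = [0]" by (auto simp: monotone_map_0)
  have "sact F 0 [0] y = y" if "y \<in> sel F V 0" for y using sact_id[OF F that] by simp
  then show "sact F m \<beta> (if \<alpha> = [0] then a else b) = (if mcomp \<alpha> \<beta> = [0] then a else b)"
    using assms by (simp add: m \<alpha> \<beta> mcomp_def)
qed

text \<open>The maps from [1] to [2] include the constant ones, so a matching family has to contain,
  besides the boundary of a triangle, the degenerate edges at its vertices. Lists of length 1 are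
  the vertices.\<close>

lemma triangle_matching:
  assumes v: "\<And>a. a \<le> 2 \<Longrightarrow> v a \<in> sel F V 0"
    and e: "\<And>a b. a < b \<Longrightarrow> b \<le> 2 \<Longrightarrow> e a b \<in> sel F V (Suc 0)"
    and e0: "\<And>a b. a < b \<Longrightarrow> b \<le> 2 \<Longrightarrow> vtx F 0 (e a b) = v a"
    and e1: "\<And>a b. a < b \<Longrightarrow> b \<le> 2 \<Longrightarrow> vtx F (Suc 0) (e a b) = v b"
  shows "matching F V 2 (\<lambda>\<alpha>. if length \<alpha> = 1 then v (hd \<alpha>) else
    if \<alpha> ! 0 = \<alpha> ! 1 then degen F (v (hd \<alpha>)) else e (\<alpha> ! 0) (\<alpha> ! 1))" (is "matching F V 2 ?Y")
  unfolding matching_def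
proof (intro conjI allI impI)
  have Y0: "?Y [a] = v a" for a by simp
  have Y1: "?Y [a, b] = (if a = b then degen F (v a) else e a b)" for a b by simp
  have Ysel: "?Y [a, b] \<in> sel F V (Suc 0)" and Yv: "vtx F 0 (?Y [a, b]) = v a" "vtx F (Suc 0) (?Y [a, b]) = v b"
    if "a \<le> b" "b \<le> 2" for a b
    using that v[of a] e[of a b] e0[of a b] e1[of a b] degen_sel[of "v a"] vtx_degen[of "v a"] by (auto simp: Y1)
  have id: "sact F n [0..<Suc n] y = y" if "y \<in> sel F V n" for n y by (rule sact_id[OF F that])
  show "?Y \<alpha> \<in> sel F V m" if "m < 2 \<and> monotone_map m 2 \<alpha>" for m \<alpha>
  proof (cases "m = 0")
    case True
    with that obtain a where "\<alpha> = [a]" "a \<le> 2" by (auto simp: monotone_map_0)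
    then show ?thesis using v True by simp
  next
    case False
    with that have m: "m = Suc 0" by simp
    with that obtain a b where "\<alpha> = [a, b]" "a \<le> b" "b \<le> 2" by (auto simp: monotone_map_1)
    then show ?thesis using Ysel m by blast
  qed
  fix l m \<alpha> \<beta> assume a: "l < 2 \<and> m < 2 \<and> monotone_map m 2 \<alpha> \<and> monotone_map l m \<beta>"
  show "sact F m \<beta> (?Y \<alpha>) = ?Y (mcomp \<alpha> \<beta>)"
  proof (cases "m = 0")
    case True
    with a obtain i where \<alpha>: "\<alpha> = [i]" "i \<le> 2" by (auto simp: monotone_map_0)
    show ?thesis
    proof (cases "l = 0")
      case True
      then have "\<beta> = [0]" using a \<open>m = 0\<close> by (auto simp: monotone_map_0)
      then show ?thesis using id[OF v[OF \<alpha>(2)]] \<alpha> \<open>m = 0\<close> by (simp add: mcomp_def)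
    next
      case False
      then have "l = Suc 0" using a by simp
      then have "\<beta> = [0, 0]" using a \<open>m = 0\<close> by (auto simp: monotone_map_1)
      then show ?thesis using \<alpha> \<open>m = 0\<close> by (simp add: mcomp_def degen_def)
    qed
  next
    case False
    with a have m: "m = Suc 0" by simp
    with a obtain i j where \<alpha>: "\<alpha> = [i, j]" "i \<le> j" "j \<le> 2" by (auto simp: monotone_map_1)
    show ?thesis
    proof (cases "l = 0")
      case True
      then obtain k where "\<beta> = [k]" "k \<le> Suc 0" using a m by (auto simp: monotone_map_0)
      then show ?thesis using Yv[OF \<alpha>(2,3)] unfolding m \<alpha>(1) vtx_def
        by (cases k) (simp_all add: mcomp_def)
    next
      case False
      then have "l = Suc 0" using a by simp
      then obtain p q where \<beta>: "\<beta> = [p, q]" "p \<le> q" "q \<le> Suc 0" using a m by (auto simp: monotone_map_1)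
      \<comment> \<open>The monotone endomaps of [1] are the two constants and the identity.\<close>
      have pq: "(p = 0 \<and> q = 0) \<or> (p = 0 \<and> q = Suc 0) \<or> (p = Suc 0 \<and> q = Suc 0)" using \<beta> by auto
      have deg: "sact F (Suc 0) [k, k] y = degen F (vtx F k y)" if "y \<in> sel F V (Suc 0)" "k \<le> Suc 0" for y k
      proof -
        have "degen F (vtx F k y) = sact F (Suc 0) (mcomp [k] [0, 0]) y"
          unfolding vtx_def degen_def
          by (rule sact_mcomp[where l = "Suc 0", OF F that(1)]) (use that(2) in \<open>simp_all add: monotone_map_0 monotone_map_1\<close>)
        then show ?thesis by (simp add: mcomp_def)
      qed
      note ys = Ysel[OF \<alpha>(2,3)] and yv = Yv[OF \<alpha>(2,3)]
      have "sact F (Suc 0) [0, 0] (?Y [i, j]) = ?Y [i, i]" using deg[OF ys, of 0] yv by (simp add: Y1)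
      moreover have "sact F (Suc 0) [Suc 0, Suc 0] (?Y [i, j]) = ?Y [j, j]"
        using deg[OF ys, of "Suc 0"] yv by (simp add: Y1)
      moreover have "sact F (Suc 0) [0, Suc 0] (?Y [i, j]) = ?Y [i, j]" using id[OF ys] by (simp add: upt_conv_Cons)
      ultimately show ?thesis using pq unfolding m \<alpha>(1) \<beta>(1) by (auto simp: mcomp_def)
    qed
  qed
qed

end

end

section \<open>Descent data on a refinement\<close>

lemma fc_eq:
  "fc F 1 1 e = ixmap F 1 [0] e" "fc F 1 0 e = ixmap F 1 [1] e"
  "fc F 2 2 w = ixmap F 2 [0, 1] w" "fc F 2 0 w = ixmap F 2 [1, 2] w" "fc F 2 1 w = ixmap F 2 [0, 2] w"
  "dg F 0 0 i = ixmap F 0 [0, 0] i"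
  and cfc_eq:
  "cfc F 1 1 e = cpmap F 1 [0] e" "cfc F 1 0 e = cpmap F 1 [1] e"
  "cfc F 2 2 w = cpmap F 2 [0, 1] w" "cfc F 2 0 w = cpmap F 2 [1, 2] w" "cfc F 2 1 w = cpmap F 2 [0, 2] w"
  "cdg F 0 0 i = cpmap F 0 [0, 0] i"
  by (simp_all add: fc_def dg_def cfc_def cdg_def)

context cech_cover
begin

context
  fixes F :: "('s, 'o, 'a) sfam" and v :: "'s \<Rightarrow> 'u"
  assumes F: "simplicial_family E TYPE('u) F" and v: "bij_betw v (Ix F 0) I"
    and F0: "\<And>i. i \<in> Ix F 0 \<Longrightarrow> Cp F 0 i = U (v i)" and dual: "self_dual E F"
begin

lemma v_I: "i \<in> Ix F 0 \<Longrightarrow> v i \<in> I"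
  using v by (auto simp: bij_betw_def)

lemma sel_elt: "y \<in> sel F V 0 \<Longrightarrow> V \<in> G \<Longrightarrow> elt (v (fst y)) (snd y)"
  using selD[of y F V 0] F0 v_I by simp

lemma vtx_elt:
  assumes "y \<in> sel F V 1" "V \<in> G"
  shows "elt (v (fst (vtx F 0 y))) (snd (vtx F 0 y))" "elt (v (fst (vtx F 1 y))) (snd (vtx F 1 y))"
    "Src E (snd (vtx F 0 y)) = V" "Src E (snd (vtx F 1 y)) = V"
proof -
  note a = vtx_sel[OF F assms(1)[unfolded One_nat_def], of 0]
    and b = vtx_sel[OF F assms(1)[unfolded One_nat_def], of 1]
  show "elt (v (fst (vtx F 0 y))) (snd (vtx F 0 y))" by (rule sel_elt[OF a assms(2)]) simp
  show "elt (v (fst (vtx F 1 y))) (snd (vtx F 1 y))" by (rule sel_elt[OF b assms(2)]) simp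
  show "Src E (snd (vtx F 0 y)) = V" "Src E (snd (vtx F 1 y)) = V"
    using selD(3)[OF a] selD(3)[OF b] by simp_all
qed

lemma fc_I:
  assumes "e \<in> Ix F 1"
  shows "ixmap F 1 [0] e \<in> Ix F 0" "ixmap F 1 [1] e \<in> Ix F 0"
    "cpmap F 1 [0] e \<in> hom E (Cp F 1 e) (U (v (ixmap F 1 [0] e)))"
    "cpmap F 1 [1] e \<in> hom E (Cp F 1 e) (U (v (ixmap F 1 [1] e)))"
proof -
  have m: "monotone_map 0 1 [0]" "monotone_map 0 1 [1]" by (simp_all add: monotone_map_0)
  show i: "ixmap F 1 [0] e \<in> Ix F 0" "ixmap F 1 [1] e \<in> Ix F 0"
    by (rule simplicial_familyD(2)[OF F assms m(1)] simplicial_familyD(2)[OF F assms m(2)])+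
  show "cpmap F 1 [0] e \<in> hom E (Cp F 1 e) (U (v (ixmap F 1 [0] e)))"
    "cpmap F 1 [1] e \<in> hom E (Cp F 1 e) (U (v (ixmap F 1 [1] e)))"
    using simplicial_familyD(7)[OF F assms m(1)] simplicial_familyD(7)[OF F assms m(2)] F0 i by simp_all
qed

lemma cpop_type:
  assumes "w \<in> Ix F n"
  shows "cpop F n w \<in> hom E (Cp F n w) (Cp F n (ixop F n w))"
  using dual assms unfolding self_dual_def by blast

lemma edge_sel:
  assumes "e \<in> Ix F 1"
  obtains V x where "V \<in> G" "(e, x) \<in> sel F V 1"
proof -
  obtain x where "x \<in> Ar E" "Src E x \<in> G" "Tgt E x = Cp F 1 e"
    using simplicial_familyD(6)[OF F assms] initial_iff[OF simplicial_familyD(5)[OF F assms]] by blast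
  then show thesis using that[of "Src E x" x] assms by (simp add: sel_def)
qed

lemma vtx_pair: "vtx F k (e, x) = (ixmap F 1 [k] e, cpmap F 1 [k] e \<cdot> x)"
  by (simp add: vtx_def sact_def)

text \<open>Both arrows have the same second component. On an element \<open>(r, x)\<close> their
  first components are constants, one with value given by \<open>act\<close> at the end points of
  \<open>x\<close>, the other with value \<open>s e r\<close>.\<close>

lemma corresponding_eq_constant:
  assumes \<sigma>: "U_descent_datum E I U R \<sigma>" and e: "e \<in> Ix F 1"
    and s: "\<forall>r\<in>R (v (ixmap F 1 [0] e)). s e r \<in> R (v (ixmap F 1 [1] e))"
  shows "corresponding_datum E I U v F R \<sigma> e = constant_datum E F (R \<circ> v) s e \<longleftrightarrow>
    (\<forall>V\<in>G. \<forall>x. (e, x) \<in> sel F V 1 \<longrightarrow> (\<forall>r\<in>R (v (ixmap F 1 [0] e)).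
      act (first \<sigma>) (v (ixmap F 1 [0] e)) (v (ixmap F 1 [1] e)) (cpmap F 1 [0] e \<cdot> x) (cpmap F 1 [1] e \<cdot> x) r = s e r))"
proof -
  define i where "i = v (ixmap F 1 [0] e)"
  define j where "j = v (ixmap F 1 [1] e)"
  define d1 where "d1 = cpmap F 1 [0] e"
  define d0 where "d0 = cpmap F 1 [1] e"
  let ?C = "Cp F 1 e"
  note co = U_descent_datumD(1)[OF \<sigma>]
  note \<phi> = coherentD(1)[OF co]
  have i: "i \<in> I" and j: "j \<in> I" using fc_I[OF e] v_I by (simp_all add: i_def j_def)
  have d: "d1 \<in> hom E ?C (U i)" "d0 \<in> hom E ?C (U j)" using fc_I[OF e] by (simp_all add: i_def j_def d1_def d0_def)
  have C: "?C \<in> Ob E" by (rule simplicial_familyD(5)[OF F e])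
  have op: "cpop F 1 e \<in> Ar E" "Src E (cpop F 1 e) = ?C" using cpop_type[OF e] by simp_all
  have el: "elt i (d1 \<cdot> x)" "elt j (d0 \<cdot> x)" "Src E (d0 \<cdot> x) = Src E (d1 \<cdot> x)" "Src E (d1 \<cdot> x) = Src E x"
    if "x \<in> Ar E" "Src E x \<in> G" "Tgt E x = ?C" for x
    using that d i j by simp_all
  obtain V x0 where "V \<in> G" "(e, x0) \<in> sel F V 1" by (rule edge_sel[OF e])
  then have adj: "adj i j" using adjI[OF el(1-3)[of x0]] by (simp add: sel_def)
  note \<phi>ty = transport_mapD[OF \<phi> adj]
  have s': "\<forall>r\<in>R i. s e r \<in> R j" using s by (simp add: i_def j_def)
  have ix: "cech_ix v F 1 e = [i, j]" by (simp add: cech_ix_def i_def j_def upt_conv_Cons)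
  have cp: "cech_cp E F 1 e = pair E d1 d0" by (simp add: cech_cp_def d1_def d0_def upt_conv_Cons)
  let ?l = "pair E (first \<sigma> i j \<cdot> pmap E (Idt E (gs E (R i))) (pair E d1 d0)) (cpop F 1 e \<cdot> p2 E (gs E (R i)) ?C)"
  let ?r = "pmap E (gsmap E (R i) (R j) (s e)) (cpop F 1 e)"
  have l: "corresponding_datum E I U v F R \<sigma> e = ?l"
    unfolding corresponding_datum_def ix cp fc_eq i_def[symmetric] ..
  have r: "constant_datum E F (R \<circ> v) s e = ?r"
    unfolding constant_datum_def fc_eq comp_apply i_def[symmetric] j_def[symmetric] ..
  have ty: "?l \<in> Ar E" "Src E ?l = prd E (gs E (R i)) ?C" "Tgt E ?l = prd E (gs E (R j)) (Tgt E (cpop F 1 e))"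
    "?r \<in> Ar E" "Src E ?r = prd E (gs E (R i)) ?C" "Tgt E ?r = prd E (gs E (R j)) (Tgt E (cpop F 1 e))"
    using i j d C op \<phi>ty s' by simp_all
  have lz: "?l \<cdot> pair E (const (R i) (Src E x) r) x = pair E (const (R j) (Src E x) (act (first \<sigma>) i j (d1 \<cdot> x) (d0 \<cdot> x) r)) (cpop F 1 e \<cdot> x)"
    and rz: "?r \<cdot> pair E (const (R i) (Src E x) r) x = pair E (const (R j) (Src E x) (s e r)) (cpop F 1 e \<cdot> x)"
    if x: "x \<in> Ar E" "Src E x \<in> G" "Tgt E x = ?C" and r: "r \<in> R i" for x r
    using act_spec(2)[OF \<phi> el(1-3)[OF x] r] el(4)[OF x] i j d C op \<phi>ty s' x r by simp_all
  have "?l = ?r \<longleftrightarrow> (\<forall>V\<in>G. \<forall>x. (e, x) \<in> sel F V 1 \<longrightarrow> (\<forall>r\<in>R i. act (first \<sigma>) i j (d1 \<cdot> x) (d0 \<cdot> x) r = s e r))"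
  proof
    assume eq: "?l = ?r"
    show "\<forall>V\<in>G. \<forall>x. (e, x) \<in> sel F V 1 \<longrightarrow> (\<forall>r\<in>R i. act (first \<sigma>) i j (d1 \<cdot> x) (d0 \<cdot> x) r = s e r)"
    proof (intro ballI allI impI)
      fix V x r assume V: "V \<in> G" and "(e, x) \<in> sel F V 1" and r: "r \<in> R i"
      then have x: "x \<in> Ar E" "Src E x \<in> G" "Tgt E x = ?C" by (simp_all add: sel_def)
      note a = act_spec(1)[OF \<phi> el(1-3)[OF x] r]
      have "pair E (const (R j) (Src E x) (act (first \<sigma>) i j (d1 \<cdot> x) (d0 \<cdot> x) r)) (cpop F 1 e \<cdot> x)
          = pair E (const (R j) (Src E x) (s e r)) (cpop F 1 e \<cdot> x)"
        using lz[OF x r] rz[OF x r] eq by metis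
      then have c: "const (R j) (Src E x) (act (first \<sigma>) i j (d1 \<cdot> x) (d0 \<cdot> x) r) = const (R j) (Src E x) (s e r)
          \<and> cpop F 1 e \<cdot> x = cpop F 1 e \<cdot> x"
        by (rule iffD1[OF pair_eq_iff, rotated -1]) (use x op a s' r j in simp_all)
      show "act (first \<sigma>) i j (d1 \<cdot> x) (d0 \<cdot> x) r = s e r"
        by (rule const_inj[OF small_R[OF j] a _ x(2) conjunct1[OF c]]) (use s' r in blast)
    qed
  next
    assume eq: "\<forall>V\<in>G. \<forall>x. (e, x) \<in> sel F V 1 \<longrightarrow> (\<forall>r\<in>R i. act (first \<sigma>) i j (d1 \<cdot> x) (d0 \<cdot> x) r = s e r)"
    show "?l = ?r"
    proof (rule eqI)
      fix z assume z: "z \<in> Ar E" "Src E z \<in> G" "Tgt E z = Src E ?l"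
      then have z3: "Tgt E z = prd E (gs E (R i)) ?C" using ty by simp
      obtain r x where r: "r \<in> R i" and x: "x \<in> Ar E" "Src E z = Src E x" "Tgt E x = ?C"
        and zz: "z = pair E (const (R i) (Src E x) r) x"
        by (rule gs_prd_cases[OF small_R[OF i] C z(1,2) z3])
      have x2: "Src E x \<in> G" using z x by simp
      have "(e, x) \<in> sel F (Src E x) 1" using e x by (simp add: sel_def)
      then have "act (first \<sigma>) i j (d1 \<cdot> x) (d0 \<cdot> x) r = s e r" using eq x2 r by blast
      then show "?l \<cdot> z = ?r \<cdot> z" unfolding zz lz[OF x(1) x2 x(3) r] rz[OF x(1) x2 x(3) r] by simp
    qed (simp_all only: ty)
  qed
  then show ?thesis unfolding l r unfolding i_def j_def d1_def d0_def .
qed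

text \<open>If over each edge the action does not depend on the element of the component, its common
  value is \<open>s e\<close>. Every law of a descent datum is then verified at a single element of
  the component concerned, which exists as components are not empty.\<close>

lemma S_datum_exists:
  assumes \<sigma>: "U_descent_datum E I U R \<sigma>"
    and ex: "\<And>e. e \<in> Ix F 1 \<Longrightarrow> \<exists>s. \<forall>V\<in>G. \<forall>x. (e, x) \<in> sel F V 1 \<longrightarrow> (\<forall>r\<in>R (v (ixmap F 1 [0] e)).
      act (first \<sigma>) (v (ixmap F 1 [0] e)) (v (ixmap F 1 [1] e)) (cpmap F 1 [0] e \<cdot> x) (cpmap F 1 [1] e \<cdot> x) r = s r)"
  shows "\<exists>s. S_descent_datum F (R \<circ> v) s \<and> consistent E F (R \<circ> v) s \<and>
    (\<forall>e\<in>Ix F 1. corresponding_datum E I U v F R \<sigma> e = constant_datum E F (R \<circ> v) s e)"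
proof -
  define \<phi> where "\<phi> = first \<sigma>"
  have co: "coherent \<phi>" unfolding \<phi>_def by (rule U_descent_datumD(1)[OF \<sigma>])
  note tm = coherentD(1)[OF co]
  from ex obtain s where s0: "\<And>e V x r. e \<in> Ix F 1 \<Longrightarrow> V \<in> G \<Longrightarrow> (e, x) \<in> sel F V 1 \<Longrightarrow> r \<in> R (v (ixmap F 1 [0] e)) \<Longrightarrow>
      act \<phi> (v (ixmap F 1 [0] e)) (v (ixmap F 1 [1] e)) (cpmap F 1 [0] e \<cdot> x) (cpmap F 1 [1] e \<cdot> x) r = s e r"
    unfolding \<phi>_def by metis
  have s: "act \<phi> (v (fst (vtx F 0 y))) (v (fst (vtx F 1 y))) (snd (vtx F 0 y)) (snd (vtx F 1 y)) r = s (fst y) r"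
    if "y \<in> sel F V 1" "V \<in> G" "r \<in> R (v (fst (vtx F 0 y)))" for y V r
    using s0[of "fst y" V "snd y" r] that vtx_pair[of _ "fst y" "snd y"] selD(1)[OF that(1)] by simp
  have bij: "bij_betw (s e) (R (v (ixmap F 1 [0] e))) (R (v (ixmap F 1 [1] e)))" if e: "e \<in> Ix F 1" for e
  proof -
    obtain V x where V: "V \<in> G" and x: "(e, x) \<in> sel F V 1" by (rule edge_sel[OF e])
    note y = vtx_elt[OF x V, unfolded vtx_pair fst_conv snd_conv]
    have b: "bij_betw (act \<phi> (v (ixmap F 1 [0] e)) (v (ixmap F 1 [1] e)) (cpmap F 1 [0] e \<cdot> x) (cpmap F 1 [1] e \<cdot> x))
        (R (v (ixmap F 1 [0] e))) (R (v (ixmap F 1 [1] e)))"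
      by (rule act_bij[OF co y(1,2)]) (simp only: y)
    then show ?thesis by (subst (asm) bij_betw_cong[OF s0[OF e V x]])
  qed
  have "S_descent_datum F (R \<circ> v) s"
    unfolding S_descent_datum_def fc_eq comp_apply
  proof (intro conjI ballI)
    show "bij_betw (s e) (R (v (ixmap F 1 [0] e))) (R (v (ixmap F 1 [1] e)))" if "e \<in> Ix F 1" for e
      by (rule bij[OF that])
    fix i r assume i: "i \<in> Ix F 0" and r: "r \<in> R (v i)"
    obtain x where x: "x \<in> Ar E" "Src E x \<in> G" "Tgt E x = Cp F 0 i"
      using simplicial_familyD(6)[OF F i] initial_iff[OF simplicial_familyD(5)[OF F i]] by blast
    then have y: "(i, x) \<in> sel F (Src E x) 0" using i by (simp add: sel_def)
    note d = degen_sel[OF F y]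
    have vd: "vtx F 0 (degen F (i, x)) = (i, x)" "vtx F 1 (degen F (i, x)) = (i, x)"
      using vtx_degen[OF F y] by simp_all
    have "act \<phi> (v i) (v i) x x r = r" using coherentD(2)[OF co sel_elt[OF y x(2)]] r by simp
    moreover have "act \<phi> (v i) (v i) x x r = s (fst (degen F (i, x))) r"
      using s[of "degen F (i, x)" "Src E x" r] d x(2) r vd by simp
    ultimately show "s (ixmap F 0 [0, 0] i) r = r" by (simp add: degen_def sact_def)
  next
    fix w r assume w: "w \<in> Ix F 2" and r: "r \<in> R (v (ixmap F 1 [0] (ixmap F 2 [0, 1] w)))"
    obtain x where x: "x \<in> Ar E" "Src E x \<in> G" "Tgt E x = Cp F 2 w"
      using simplicial_familyD(6)[OF F w] initial_iff[OF simplicial_familyD(5)[OF F w]] by blast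
    then have y: "(w, x) \<in> sel F (Src E x) 2" using w by (simp add: sel_def)
    have m: "monotone_map 1 2 [0, 1]" "monotone_map 1 2 [1, 2]" "monotone_map 1 2 [0, 2]"
      by (simp_all add: monotone_map_1)
    define a where "a = sact F 2 [0, 1] (w, x)"
    define b where "b = sact F 2 [1, 2] (w, x)"
    define c where "c = sact F 2 [0, 2] (w, x)"
    have sel: "a \<in> sel F (Src E x) 1" "b \<in> sel F (Src E x) 1" "c \<in> sel F (Src E x) 1"
      unfolding a_def b_def c_def by (rule sact_sel[OF F y] m)+
    have vt: "vtx F k (sact F 2 \<alpha> (w, x)) = sact F 2 [\<alpha> ! k] (w, x)" if "monotone_map 1 2 \<alpha>" "k \<le> 1" for k \<alpha>
    proof -
      have "vtx F k (sact F 2 \<alpha> (w, x)) = sact F 2 (mcomp \<alpha> [k]) (w, x)"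
        unfolding vtx_def One_nat_def[symmetric] by (rule sact_mcomp[where l = 0, OF F y that(1)]) (use that(2) in \<open>simp add: monotone_map_0\<close>)
      then show ?thesis by (simp add: mcomp_def)
    qed
    \<comment> \<open>The three faces share their end points as elements and not only as indices, so
      the cocycle law of \<open>act\<close> applies to three points.\<close>
    have vv: "vtx F 0 c = vtx F 0 a" "vtx F 0 b = vtx F 1 a" "vtx F 1 c = vtx F 1 b"
      unfolding a_def b_def c_def using vt[OF m(1), of 0] vt[OF m(1), of 1] vt[OF m(2), of 0] vt[OF m(2), of 1]
        vt[OF m(3), of 0] vt[OF m(3), of 1] by simp_all
    note ea = vtx_elt[OF sel(1) x(2)] and eb = vtx_elt[OF sel(2) x(2)]
    have r': "r \<in> R (v (fst (vtx F 0 a)))" using r by (simp add: a_def sact_def vtx_def)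
    have ab: "Src E (snd (vtx F 1 a)) = Src E (snd (vtx F 0 a))" "Src E (snd (vtx F 1 b)) = Src E (snd (vtx F 0 a))"
      using ea eb by simp_all
    have sa: "s (fst a) r \<in> R (v (fst (vtx F 1 a)))"
      using act_spec(1)[OF tm ea(1,2) ab(1) r'] s[OF sel(1) x(2) r'] by simp
    have "s (fst c) r = act \<phi> (v (fst (vtx F 0 a))) (v (fst (vtx F 1 b))) (snd (vtx F 0 a)) (snd (vtx F 1 b)) r"
      using s[OF sel(3) x(2)] r' vv by simp
    also have "\<dots> = act \<phi> (v (fst (vtx F 1 a))) (v (fst (vtx F 1 b))) (snd (vtx F 1 a)) (snd (vtx F 1 b))
      (act \<phi> (v (fst (vtx F 0 a))) (v (fst (vtx F 1 a))) (snd (vtx F 0 a)) (snd (vtx F 1 a)) r)"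
      by (rule coherentD(3)[OF co ea(1,2) eb(2) ab r', symmetric])
    also have "\<dots> = s (fst b) (s (fst a) r)"
      unfolding s[OF sel(1) x(2) r'] using s[OF sel(2) x(2)] sa vv by simp
    finally show "s (ixmap F 2 [0, 2] w) r = s (ixmap F 2 [1, 2] w) (s (ixmap F 2 [0, 1] w) r)"
      by (simp add: a_def b_def c_def sact_def)
  qed
  moreover have "consistent E F (R \<circ> v) s"
    unfolding consistent_def fc_eq cfc_eq comp_apply
  proof (intro ballI impI, elim conjE bexE)
    fix e t r f assume e: "e \<in> Ix F 1" and t: "t \<in> Ix F 1" and r: "r \<in> R (v (ixmap F 1 [0] e))"
      and et: "ixmap F 1 [0] e = ixmap F 1 [0] t" "ixmap F 1 [1] e = ixmap F 1 [1] t"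
      and f: "f \<in> hom E (Cp F 1 e) (Cp F 1 t)" and eq: "cpmap F 1 [0] t \<cdot> f = cpmap F 1 [0] e" "cpmap F 1 [1] t \<cdot> f = cpmap F 1 [1] e"
    obtain V x where V: "V \<in> G" and x: "(e, x) \<in> sel F V 1" by (rule edge_sel[OF e])
    \<comment> \<open>\<open>f\<close> carries an element of the component at \<open>e\<close> to
      one at \<open>t\<close> with the same end points, and the action depends on the end points
      alone.\<close>
    have fx: "(t, f \<cdot> x) \<in> sel F V 1" using x f t by (simp add: sel_def)
    have "cpmap F 1 [0] t \<cdot> (f \<cdot> x) = cpmap F 1 [0] e \<cdot> x" "cpmap F 1 [1] t \<cdot> (f \<cdot> x) = cpmap F 1 [1] e \<cdot> x"
      unfolding eq[symmetric] by (rule Cmp_assoc[symmetric], use fc_I[OF t] f x in \<open>simp_all add: sel_def\<close>)+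
    then show "s e r = s t r"
      using s0[OF e V x r] s0[OF t V fx] r et by simp
  qed
  moreover have "corresponding_datum E I U v F R \<sigma> e = constant_datum E F (R \<circ> v) s e" if e: "e \<in> Ix F 1" for e
  proof -
    have "\<forall>r\<in>R (v (ixmap F 1 [0] e)). s e r \<in> R (v (ixmap F 1 [1] e))" using bij[OF e] by (auto simp: bij_betw_def)
    from corresponding_eq_constant[where s = s, OF \<sigma> e this] show ?thesis using s0[OF e] unfolding \<phi>_def by blast
  qed
  ultimately show ?thesis by blast
qed

end

end

section \<open>Covering projections from consistent descent data\<close>

context cech_cover
begin

context
  fixes F :: "('u, 'o, 'a) sfam" and s :: "'u \<Rightarrow> 'u \<Rightarrow> 'u"
  assumes hyp: "hypercover_refinement E I U (\<lambda>i. i) F" and dual: "self_dual E F" and G2: "condition_G F"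
    and S: "S_descent_datum F R s" and cons: "consistent E F R s"
begin

lemma
  shows refinement_simplicial: "simplicial_family E TYPE('u) F" and refinement_bij: "bij_betw (\<lambda>i. i) (Ix F 0) I"
    and refinement_Ix: "Ix F 0 = I" and refinement_Cp: "\<And>i. i \<in> Ix F 0 \<Longrightarrow> Cp F 0 i = U i"
    and refinement_epi: "\<And>k. 1 \<le> k \<Longrightarrow> \<exists>L \<pi> h. is_cosk E F k L \<pi> \<and> h \<in> hom E (tot E F k) L \<and>
        (\<forall>m \<alpha>. m < k \<and> monotone_map m k \<alpha> \<longrightarrow> \<pi> \<alpha> \<cdot> h = totmap E F m k \<alpha>) \<and> epi E h"
  using hyp unfolding hypercover_refinement_def by (auto simp: bij_betw_def)

lemmas F = refinement_simplicial

lemma refinement_lift: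
  assumes k: "1 \<le> k" and V: "V \<in> G" and Y: "matching F V k Y"
  shows "epi_family E V {c. c \<in> Ar E \<and> Src E c \<in> G \<and> Tgt E c = V \<and>
    (\<exists>y\<in>sel F (Src E c) k. \<forall>m \<alpha>. m < k \<and> monotone_map m k \<alpha> \<longrightarrow> sact F k \<alpha> y = pull (Y \<alpha>) c)}"
proof -
  obtain L \<pi> h where "is_cosk E F k L \<pi>" "h \<in> hom E (tot E F k) L" "epi E h"
    "\<And>m \<alpha>. m < k \<Longrightarrow> monotone_map m k \<alpha> \<Longrightarrow> \<pi> \<alpha> \<cdot> h = totmap E F m k \<alpha>"
    using refinement_epi[OF k] by blast
  from hypercover_lift[OF F this V Y] show ?thesis .
qed

lemma elt_sel: "elt i x \<Longrightarrow> (i, x) \<in> sel F (Src E x) 0"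
  using refinement_Ix refinement_Cp by (simp add: sel_def)

text \<open>Two points at one stage form a matching family in degree 1, so the hypercover condition
  joins them by an edge locally.\<close>

lemma edge_lift:
  assumes x: "elt i x" and y: "elt j y" "Src E y = Src E x"
  shows "epi_family E (Src E x) {c. c \<in> Ar E \<and> Src E c \<in> G \<and> Tgt E c = Src E x \<and>
    (\<exists>z\<in>sel F (Src E c) 1. vtx F 0 z = (i, x \<cdot> c) \<and> vtx F 1 z = (j, y \<cdot> c))}"
proof -
  let ?Y = "\<lambda>\<alpha>. if \<alpha> = [0] then (i, x) else (j, y)"
  have Y: "matching F (Src E x) (Suc 0) ?Y"
    by (rule edge_matching[OF F elt_sel[OF x]]) (use elt_sel[OF y(1)] y(2) in simp)
  have V: "Src E x \<in> G" using x by simp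
  have "epi_family E (Src E x) {c. c \<in> Ar E \<and> Src E c \<in> G \<and> Tgt E c = Src E x \<and>
    (\<exists>z\<in>sel F (Src E c) (Suc 0). \<forall>m \<alpha>. m < Suc 0 \<and> monotone_map m (Suc 0) \<alpha> \<longrightarrow> sact F (Suc 0) \<alpha> z = pull (?Y \<alpha>) c)}"
    by (rule refinement_lift[OF _ V Y]) simp
  then show ?thesis
  proof (rule epi_family_mono, intro Collect_mono impI, elim conjE bexE, intro conjI)
    fix c z assume c: "c \<in> Ar E" "Src E c \<in> G" "Tgt E c = Src E x" and z: "z \<in> sel F (Src E c) (Suc 0)"
      and eq: "\<forall>m \<alpha>. m < Suc 0 \<and> monotone_map m (Suc 0) \<alpha> \<longrightarrow> sact F (Suc 0) \<alpha> z = pull (?Y \<alpha>) c"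
    have "vtx F 0 z = (i, x \<cdot> c)" "vtx F 1 z = (j, y \<cdot> c)"
      unfolding vtx_def using eq[rule_format, of 0 "[0]"] eq[rule_format, of 0 "[1]"]
      by (simp_all add: monotone_map_0 pull_def)
    then show "\<exists>z\<in>sel F (Src E c) 1. vtx F 0 z = (i, x \<cdot> c) \<and> vtx F 1 z = (j, y \<cdot> c)" using z by auto
  qed auto
qed

lemma edge_ex:
  assumes x: "elt i x" and y: "elt j y" "Src E y = Src E x"
  obtains c z where "c \<in> Ar E" "Src E c \<in> G" "Tgt E c = Src E x" "z \<in> sel F (Src E c) 1"
    "vtx F 0 z = (i, x \<cdot> c)" "vtx F 1 z = (j, y \<cdot> c)"
proof -
  have "Src E x \<in> G" using x by simp
  from epi_family_nonempty[OF edge_lift[OF assms] this] show thesis using that by blast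
qed

text \<open>The triangle exists only after a restriction of the stage, but restriction changes the
  elements and not the simplices. As \<open>s\<close> depends on simplices alone, one member of the
  cover suffices and is then forgotten.\<close>

lemma triangle_ex:
  assumes V: "V \<in> G" and a: "a \<in> sel F V 1" and b: "b \<in> sel F V 1" and c: "c \<in> sel F V 1"
    and v: "vtx F 0 c = vtx F 0 a" "vtx F 0 b = vtx F 1 a" "vtx F 1 c = vtx F 1 b"
  obtains w where "w \<in> Ix F 2" "fc F 2 2 w = fst a" "fc F 2 0 w = fst b" "fc F 2 1 w = fst c"
proof -
  define vv where "vv k = (if k = 0 then vtx F 0 a else if k = 1 then vtx F 1 a else vtx F 1 b)" for k :: nat
  define e where "e k l = (if k = 0 then if l = 1 then a else c else b)" for k l :: nat
  note one = One_nat_def[symmetric]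
  have "matching F V 2 (\<lambda>\<alpha>. if length \<alpha> = 1 then vv (hd \<alpha>) else
    if \<alpha> ! 0 = \<alpha> ! 1 then degen F (vv (hd \<alpha>)) else e (\<alpha> ! 0) (\<alpha> ! 1))" (is "matching F V 2 ?Y")
  proof (rule triangle_matching[OF F])
    show "vv k \<in> sel F V 0" if "k \<le> 2" for k
      using vtx_sel[OF F a[unfolded One_nat_def]] vtx_sel[OF F b[unfolded One_nat_def]] by (simp add: vv_def)
    fix k l :: nat assume kl: "k < l" "l \<le> 2"
    then have cs: "(k = 0 \<and> l = 1) \<or> (k = 0 \<and> l = 2) \<or> (k = 1 \<and> l = 2)" by auto
    show "e k l \<in> sel F V (Suc 0)" "vtx F 0 (e k l) = vv k" "vtx F (Suc 0) (e k l) = vv l"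
      using cs a b c v by (auto simp: e_def vv_def)
  qed
  from epi_family_nonempty[OF refinement_lift[OF one_le_numeral V this] V]
  obtain d y where d: "d \<in> Ar E" "Src E d \<in> G" "Tgt E d = V" and y: "y \<in> sel F (Src E d) 2"
    and eq: "\<forall>m \<alpha>. m < 2 \<and> monotone_map m 2 \<alpha> \<longrightarrow> sact F 2 \<alpha> y = pull (?Y \<alpha>) d" by blast
  have "fst (sact F 2 [k, l] y) = fst (e k l)" if "k < l" "l \<le> 2" for k l
    using eq[rule_format, of 1 "[k, l]"] that by (simp add: monotone_map_1 pull_def)
  from this[of 0 1] this[of 1 2] this[of 0 2] show thesis
    using that[OF selD(1)[OF y]] unfolding fc_eq by (simp add: sact_def e_def)
qed

section \<open>Opposite edges, and independence of the action from the chosen edge\<close>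

definition opp :: "'u \<times> 'a \<Rightarrow> 'u \<times> 'a" where
  "opp y = (ixop F 1 (fst y), cpop F 1 (fst y) \<cdot> snd y)"

lemma ixop_edge:
  assumes "e \<in> Ix F 1"
  shows "ixop F 1 e \<in> Ix F 1" "ixmap F 1 [0] (ixop F 1 e) = ixmap F 1 [1] e"
    "ixmap F 1 [1] (ixop F 1 e) = ixmap F 1 [0] e"
    "cpmap F 1 [0] (ixop F 1 e) \<cdot> cpop F 1 e = cpmap F 1 [1] e"
    "cpmap F 1 [1] (ixop F 1 e) \<cdot> cpop F 1 e = cpmap F 1 [0] e"
proof -
  note d = dual[unfolded self_dual_def]
  show "ixop F 1 e \<in> Ix F 1" using d assms by (auto simp: bij_betw_def)
  have 0: "\<forall>w\<in>Ix F 0. ixop F 0 w = w \<and> cpop F 0 w = Idt E (Cp F 0 w)" using d by blast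
  have 1: "\<forall>n i. 1 \<le> n \<and> i \<le> n \<longrightarrow> (\<forall>w\<in>Ix F n.
        fc F n i (ixop F n w) = ixop F (n - 1) (fc F n (n - i) w) \<and>
        cfc F n i (ixop F n w) \<cdot> cpop F n w
          = cpop F (n - 1) (fc F n (n - i) w) \<cdot> cfc F n (n - i) w)" using d by blast
  have 2: "fc F 1 i (ixop F 1 e) = ixop F 0 (fc F 1 (1 - i) e) \<and>
        cfc F 1 i (ixop F 1 e) \<cdot> cpop F 1 e = cpop F 0 (fc F 1 (1 - i) e) \<cdot> cfc F 1 (1 - i) e" if "i \<le> 1" for i
    using 1[rule_format, of 1 i e] that assms by simp
  note fI = fc_I[OF F refinement_bij refinement_Cp dual assms]
  show "ixmap F 1 [0] (ixop F 1 e) = ixmap F 1 [1] e"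
    using 2[of 1] 0 fI by (simp add: fc_eq[unfolded One_nat_def])
  show "ixmap F 1 [1] (ixop F 1 e) = ixmap F 1 [0] e"
    using 2[of 0] 0 fI by (simp add: fc_eq[unfolded One_nat_def])
  show "cpmap F 1 [0] (ixop F 1 e) \<cdot> cpop F 1 e = cpmap F 1 [1] e"
    using 2[of 1] 0 fI refinement_Cp by (simp add: fc_eq[unfolded One_nat_def] cfc_eq[unfolded One_nat_def])
  show "cpmap F 1 [1] (ixop F 1 e) \<cdot> cpop F 1 e = cpmap F 1 [0] e"
    using 2[of 0] 0 fI refinement_Cp by (simp add: fc_eq[unfolded One_nat_def] cfc_eq[unfolded One_nat_def])
qed

lemma opp_sel:
  assumes y: "y \<in> sel F V 1"
  shows "opp y \<in> sel F V 1" "vtx F 0 (opp y) = vtx F 1 y" "vtx F 1 (opp y) = vtx F 0 y"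
proof -
  note d = selD[OF y]
  note op = ixop_edge[OF d(1)] and c = cpop_type[OF F refinement_bij refinement_Cp dual d(1)]
  note fI = fc_I[OF F refinement_bij refinement_Cp dual op(1)]
  show "opp y \<in> sel F V 1" using d op c by (simp add: opp_def sel_def)
  have a: "cpmap F 1 [k] (ixop F 1 (fst y)) \<cdot> (cpop F 1 (fst y) \<cdot> snd y)
      = (cpmap F 1 [k] (ixop F 1 (fst y)) \<cdot> cpop F 1 (fst y)) \<cdot> snd y" if "k = 0 \<or> k = 1" for k
    by (rule Cmp_assoc[symmetric]) (use that fI d c in auto)
  show "vtx F 0 (opp y) = vtx F 1 y" "vtx F 1 (opp y) = vtx F 0 y"
    unfolding vtx_def sact_def opp_def fst_conv snd_conv One_nat_def[symmetric] a[OF disjI1[OF refl]] a[OF disjI2[OF refl]] op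
    by (rule refl)+
qed

lemma S_D:
  shows S_bij: "e \<in> Ix F 1 \<Longrightarrow> bij_betw (s e) (R (ixmap F 1 [0] e)) (R (ixmap F 1 [1] e))"
    and S_id: "i \<in> I \<Longrightarrow> r \<in> R i \<Longrightarrow> s (ixmap F 0 [0, 0] i) r = r"
    and S_comp: "w \<in> Ix F 2 \<Longrightarrow> r \<in> R (ixmap F 1 [0] (fc F 2 2 w)) \<Longrightarrow>
       s (fc F 2 1 w) r = s (fc F 2 0 w) (s (fc F 2 2 w) r)"
  using S unfolding S_descent_datum_def fc_eq(1,2,6) refinement_Ix by blast+

lemma S_triangle:
  assumes "V \<in> G" "a \<in> sel F V 1" "b \<in> sel F V 1" "c \<in> sel F V 1"
    "vtx F 0 c = vtx F 0 a" "vtx F 0 b = vtx F 1 a" "vtx F 1 c = vtx F 1 b"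
    and r: "r \<in> R (fst (vtx F 0 a))"
  shows "s (fst c) r = s (fst b) (s (fst a) r)"
proof -
  obtain w where w: "w \<in> Ix F 2" "fc F 2 2 w = fst a" "fc F 2 0 w = fst b" "fc F 2 1 w = fst c"
    by (rule triangle_ex[OF assms(1-7)])
  show ?thesis using S_comp[OF w(1), of r] r unfolding w(2-4) by (simp add: vtx_def sact_def)
qed

text \<open>Condition G provides a triangle with faces \<open>e\<close>, its opposite and a loop
  \<open>m\<close> whose two end point maps coincide. Consistency compares \<open>m\<close> with a
  degenerate edge, so \<open>m\<close> acts as the identity, and the composition law gives the
  claim.\<close>

lemma S_op:
  assumes e: "e \<in> Ix F 1" and r: "r \<in> R (ixmap F 1 [0] e)"
  shows "s (ixop F 1 e) (s e r) = r"
proof -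
  obtain w where w: "w \<in> Ix F 2" and w2: "fc F 2 2 w = e" and w0: "fc F 2 0 w = ixop F 1 e"
    and w1: "cfc F 1 1 (fc F 2 1 w) = cfc F 1 0 (fc F 2 1 w)"
    using G2 e unfolding condition_G_def by blast
  define i where "i = ixmap F 1 [0] e"
  define m where "m = fc F 2 1 w"
  define t where "t = ixmap F 0 [0, 0] i"
  have mm: "monotone_map 1 2 [0, 1]" "monotone_map 1 2 [1, 2]" "monotone_map 1 2 [0, 2]"
    "monotone_map 0 1 [0]" "monotone_map 0 1 [1]" "monotone_map 1 0 [0, 0]"
    by (simp_all add: monotone_map_1 monotone_map_0)
  note ix = simplicial_familyD(2)[OF F] and ixc = simplicial_familyD(4)[OF F]
  have m: "m \<in> Ix F 1" unfolding m_def fc_eq by (rule ix[OF w mm(3)])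
  have i: "i \<in> Ix F 0" unfolding i_def by (rule ix[OF e mm(4)])
  have t: "t \<in> Ix F 1" unfolding t_def by (rule ix[OF i mm(6)])
  have m0: "ixmap F 1 [0] m = i"
    unfolding i_def w2[symmetric] m_def fc_eq ixc[OF w mm(3,4)] ixc[OF w mm(1,4)] by (simp add: mcomp_def)
  have "ixmap F 1 [1] m = ixmap F 1 [1] (fc F 2 0 w)"
    unfolding m_def fc_eq ixc[OF w mm(3,5)] ixc[OF w mm(2,5)] by (simp add: mcomp_def)
  then have m1: "ixmap F 1 [1] m = i" unfolding w0 ixop_edge(3)[OF e] i_def .
  have t01: "ixmap F 1 [0] t = i" "ixmap F 1 [1] t = i"
    unfolding t_def ixc[OF i mm(6,4)] ixc[OF i mm(6,5)] using simplicial_familyD(3)[OF F i] by (simp_all add: mcomp_def)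
  note cp = simplicial_familyD(7)[OF F]
  \<comment> \<open>From the component at \<open>m\<close> to that at the degenerate edge
    \<open>t\<close>: go to the end point, then degenerate. Both end points are respected because
    those of \<open>m\<close> agree.\<close>
  define f where "f = cpmap F 0 [0, 0] i \<cdot> cpmap F 1 [0] m"
  have cm: "cpmap F 1 [0] m \<in> hom E (Cp F 1 m) (Cp F 0 i)" using cp[OF m mm(4)] m0 by simp
  have c0: "cpmap F 0 [0, 0] i \<in> hom E (Cp F 0 i) (Cp F 1 t)" using cp[OF i mm(6)] by (simp add: t_def)
  have f: "f \<in> hom E (Cp F 1 m) (Cp F 1 t)" using cm c0 by (simp add: f_def)
  have tt: "cpmap F 1 [k] t \<cdot> cpmap F 0 [0, 0] i = Idt E (Cp F 0 i)" if "k = 0 \<or> k = 1" for k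
    using simplicial_familyD(9)[OF F i mm(6), of 0 "[k]"] that simplicial_familyD(8)[OF F i]
    by (auto simp: mcomp_def t_def monotone_map_0)
  have tf: "cpmap F 1 [k] t \<cdot> f = cpmap F 1 [0] m" if k: "k = 0 \<or> k = 1" for k
  proof -
    have "cpmap F 1 [k] t \<in> hom E (Cp F 1 t) (Cp F 0 i)"
      using cp[OF t mm(4)] cp[OF t mm(5)] t01 k by auto
    then have "cpmap F 1 [k] t \<cdot> f = (cpmap F 1 [k] t \<cdot> cpmap F 0 [0, 0] i) \<cdot> cpmap F 1 [0] m"
      unfolding f_def using cm c0 by simp
    then show ?thesis unfolding tt[OF k] using cm by simp
  qed
  have m01: "cpmap F 1 [1] m = cpmap F 1 [0] m" using w1 unfolding m_def[symmetric] cfc_eq by simp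
  have "s m r = s t r"
    using cons[unfolded consistent_def fc_eq(1,2) cfc_eq(1,2), THEN bspec, OF m, THEN bspec, OF t]
      f tf[of 0] tf[of 1] m01 m0 m1 t01 r unfolding i_def[symmetric] by auto
  also have "\<dots> = r" unfolding t_def by (rule S_id) (use i r refinement_Ix i_def in simp_all)
  finally have "s m r = r" .
  then show ?thesis using S_comp[OF w, of r] r unfolding m_def[symmetric] w0 w2 by simp
qed

text \<open>The triangle shows that \<open>s (fst (opp b))\<close> undoes \<open>s (fst a)\<close>,
  and \<open>S_op\<close> that it undoes \<open>s (fst b)\<close>; as it is injective, the two
  actions agree. The end points must agree as elements for the triangle to exist.\<close>

lemma S_parallel:
  assumes V: "V \<in> G" and a: "a \<in> sel F V 1" and b: "b \<in> sel F V 1"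
    and v: "vtx F 0 b = vtx F 0 a" "vtx F 1 b = vtx F 1 a" and r: "r \<in> R (fst (vtx F 0 a))"
  shows "s (fst a) r = s (fst b) r"
proof -
  have v0: "vtx F 0 a \<in> sel F V 0" using vtx_sel[OF F a[unfolded One_nat_def], of 0] by simp
  note dg = degen_sel[OF F v0, folded One_nat_def] vtx_degen[OF F v0]
  note op = opp_sel[OF b]
  have fa: "fst (vtx F k y) = ixmap F 1 [k] (fst y)" for k y by (simp add: vtx_def sact_def)
  have rb: "r \<in> R (ixmap F 1 [0] (fst b))" using r v(1) by (simp only: fa[symmetric])
  have "s (fst (degen F (vtx F 0 a))) r = s (fst (opp b)) (s (fst a) r)"
    by (rule S_triangle[OF V a op(1) dg(1)]) (use dg op v r in simp_all)
  moreover have "s (fst (degen F (vtx F 0 a))) r = r"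
    unfolding degen_def sact_def fst_conv
    by (rule S_id) (use selD(1)[OF v0] r refinement_Ix in simp_all)
  ultimately have 1: "s (fst (opp b)) (s (fst a) r) = r" by simp
  have 2: "s (fst (opp b)) (s (fst b) r) = r"
    unfolding opp_def fst_conv by (rule S_op[OF selD(1)[OF b] rb])
  have "s (fst a) r \<in> R (fst (vtx F 1 a))" "s (fst b) r \<in> R (fst (vtx F 1 a))"
    using bij_betw_apply[OF S_bij[OF selD(1)[OF a]], of r] bij_betw_apply[OF S_bij[OF selD(1)[OF b]] rb]
      r arg_cong[OF v(2), of fst] unfolding fa by simp_all
  moreover have "inj_on (s (fst (opp b))) (R (fst (vtx F 1 a)))"
    using S_bij[OF selD(1)[OF op(1)]] op(2) v(2) unfolding bij_betw_def fa[symmetric] by simp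
  ultimately show ?thesis using 1 2 by (metis inj_onD)
qed

section \<open>Gluing the actions of the edges to a descent datum on the Cech family\<close>

definition edges :: "'u \<Rightarrow> 'u \<Rightarrow> 'u set" where
  "edges i j = {e \<in> Ix F 1. ixmap F 1 [0] e = i \<and> ixmap F 1 [1] e = j}"

definition ends :: "'u \<Rightarrow> 'a" where
  "ends e = pair E (cpmap F 1 [0] e) (cpmap F 1 [1] e)"

lemma edgesD:
  assumes "e \<in> edges i j"
  shows "e \<in> Ix F 1" "i \<in> I" "j \<in> I" "Cp F 1 e \<in> Ob E"
    "cpmap F 1 [0] e \<in> hom E (Cp F 1 e) (U i)" "cpmap F 1 [1] e \<in> hom E (Cp F 1 e) (U j)"
    "ends e \<in> hom E (Cp F 1 e) (prd E (U i) (U j))"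
    "\<forall>r\<in>R i. s e r \<in> R j"
proof -
  show e: "e \<in> Ix F 1" using assms by (simp add: edges_def)
  have ij: "ixmap F 1 [0] e = i" "ixmap F 1 [1] e = j" using assms by (simp_all add: edges_def)
  note fI = fc_I[OF F refinement_bij refinement_Cp dual e]
  show "i \<in> I" "j \<in> I" using fI(1,2) ij refinement_Ix by simp_all
  show "Cp F 1 e \<in> Ob E" by (rule simplicial_familyD(5)[OF F e])
  show c: "cpmap F 1 [0] e \<in> hom E (Cp F 1 e) (U i)" "cpmap F 1 [1] e \<in> hom E (Cp F 1 e) (U j)"
    using fI(3,4) ij by simp_all
  then show "ends e \<in> hom E (Cp F 1 e) (prd E (U i) (U j))" by (simp add: ends_def)
  show "\<forall>r\<in>R i. s e r \<in> R j" using S_bij[OF e] ij by (auto simp: bij_betw_def)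
qed

lemma small_edges: "small u (edges i j)"
  by (rule small_subset[OF simplicial_familyD(1)[OF F, of 1]]) (auto simp: edges_def)

lemma ends_lift:
  assumes x: "elt i x" and y: "elt j y" "Src E y = Src E x"
  shows "epi_family E (Src E x) {c. c \<in> Ar E \<and> Src E c \<in> G \<and> Tgt E c = Src E x \<and>
    (\<exists>e\<in>edges i j. \<exists>z\<in>Ar E. Src E z = Src E c \<and> Tgt E z = Cp F 1 e \<and>
       cpmap F 1 [0] e \<cdot> z = x \<cdot> c \<and> cpmap F 1 [1] e \<cdot> z = y \<cdot> c)}"
proof (rule epi_family_mono[OF edge_lift[OF assms]])
  show "{c. c \<in> Ar E \<and> Src E c \<in> G \<and> Tgt E c = Src E x \<and>
    (\<exists>z\<in>sel F (Src E c) 1. vtx F 0 z = (i, x \<cdot> c) \<and> vtx F 1 z = (j, y \<cdot> c))}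
    \<subseteq> {c. c \<in> Ar E \<and> Src E c \<in> G \<and> Tgt E c = Src E x \<and>
    (\<exists>e\<in>edges i j. \<exists>z\<in>Ar E. Src E z = Src E c \<and> Tgt E z = Cp F 1 e \<and>
       cpmap F 1 [0] e \<cdot> z = x \<cdot> c \<and> cpmap F 1 [1] e \<cdot> z = y \<cdot> c)}"
  proof (intro Collect_mono impI, elim conjE bexE, intro conjI)
    fix c w assume w: "w \<in> sel F (Src E c) 1" and v: "vtx F 0 w = (i, x \<cdot> c)" "vtx F 1 w = (j, y \<cdot> c)"
    then have "fst w \<in> edges i j" using selD(1)[OF w] by (simp add: edges_def vtx_def sact_def)
    moreover have "cpmap F 1 [0] (fst w) \<cdot> snd w = x \<cdot> c" "cpmap F 1 [1] (fst w) \<cdot> snd w = y \<cdot> c"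
      using v by (simp_all add: vtx_def sact_def)
    ultimately show "\<exists>e\<in>edges i j. \<exists>z\<in>Ar E. Src E z = Src E c \<and> Tgt E z = Cp F 1 e \<and>
       cpmap F 1 [0] e \<cdot> z = x \<cdot> c \<and> cpmap F 1 [1] e \<cdot> z = y \<cdot> c"
      using selD[OF w] by blast
  qed
qed auto

text \<open>The hypercover condition in degree 1 for a fixed pair of indices. These maps are the
  ones shown later to come from action spans.\<close>

lemma ends_epi:
  assumes i: "i \<in> I" and j: "j \<in> I"
  shows "epi_family E (prd E (U i) (U j)) (ends ` edges i j)"
proof (rule epi_familyI)
  show "prd E (U i) (U j) \<in> Ob E" using i j by simp
  show "f \<in> Ar E \<and> Tgt E f = prd E (U i) (U j)" if "f \<in> ends ` edges i j" for f
    using that edgesD(7) by auto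
  fix b assume b: "b \<in> Ar E" "Src E b \<in> G" "Tgt E b = prd E (U i) (U j)"
  obtain x y where x: "x \<in> Ar E" and y: "y \<in> Ar E" and sb: "Src E b = Src E x" and yx: "Src E y = Src E x"
    and t: "Tgt E x = U i" "Tgt E y = U j" and bb: "b = pair E x y"
    by (rule prd_cases[OF b(1,3) U_Ob[OF i] U_Ob[OF j]])
  have ex: "elt i x" and ey: "elt j y" using x y sb yx t i j b(2) by simp_all
  show "epi_family E (Src E b) {c. c \<in> Ar E \<and> Src E c \<in> G \<and> Tgt E c = Src E b \<and>
      (\<exists>f\<in>ends ` edges i j. \<exists>y\<in>Ar E. Tgt E y = Src E f \<and> Src E y = Src E c \<and> f \<cdot> y = b \<cdot> c)}"
    unfolding sb
  proof (rule epi_family_mono[OF ends_lift[OF ex ey yx]], intro Collect_mono impI, elim conjE bexE, intro conjI)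
    fix c e z assume c: "c \<in> Ar E" "Tgt E c = Src E x" and e: "e \<in> edges i j"
      and z: "z \<in> Ar E" "Src E z = Src E c" "Tgt E z = Cp F 1 e"
        "cpmap F 1 [0] e \<cdot> z = x \<cdot> c" "cpmap F 1 [1] e \<cdot> z = y \<cdot> c"
    have "ends e \<cdot> z = b \<cdot> c"
      unfolding ends_def bb using edgesD(5,6)[OF e] z x y yx c by simp
    then show "\<exists>f\<in>ends ` edges i j. \<exists>y\<in>Ar E. Tgt E y = Src E f \<and> Src E y = Src E c \<and> f \<cdot> y = b \<cdot> c"
    proof (intro bexI conjI)
      show "ends e \<cdot> z = b \<cdot> c" by fact
    qed (use e z edgesD(7)[OF e] in simp_all)
  qed auto
qed

text \<open>The transport is glued in uncurried form, as an arrow out of a product with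
  \<open>gs E (R i)\<close>; the covering maps \<open>ends e\<close> are therefore multiplied by
  that constant object.\<close>

definition edge_map :: "'u \<Rightarrow> 'u \<Rightarrow> 'a" where
  "edge_map i e = pmap E (Idt E (gs E (R i))) (ends e)"

lemma edge_map_type:
  assumes "e \<in> edges i j"
  shows "edge_map i e \<in> Ar E" "Src E (edge_map i e) = prd E (gs E (R i)) (Cp F 1 e)"
    "Tgt E (edge_map i e) = prd E (gs E (R i)) (prd E (U i) (U j))"
    "\<lbrakk>z \<in> Ar E; Tgt E z = Cp F 1 e; r \<in> R i\<rbrakk> \<Longrightarrow> edge_map i e \<cdot> pair E (const (R i) (Src E z) r) z
      = pair E (const (R i) (Src E z) r) (pair E (cpmap F 1 [0] e \<cdot> z) (cpmap F 1 [1] e \<cdot> z))"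
proof -
  note i = edgesD(2)[OF assms]
  show "edge_map i e \<in> Ar E" "Src E (edge_map i e) = prd E (gs E (R i)) (Cp F 1 e)"
    "Tgt E (edge_map i e) = prd E (gs E (R i)) (prd E (U i) (U j))"
    using edgesD[OF assms] i by (simp_all add: edge_map_def)
  assume z: "z \<in> Ar E" "Tgt E z = Cp F 1 e" "r \<in> R i"
  have "ends e \<cdot> z = pair E (cpmap F 1 [0] e \<cdot> z) (cpmap F 1 [1] e \<cdot> z)"
    unfolding ends_def using edgesD(5,6)[OF assms] z by simp
  then show "edge_map i e \<cdot> pair E (const (R i) (Src E z) r) z
      = pair E (const (R i) (Src E z) r) (pair E (cpmap F 1 [0] e \<cdot> z) (cpmap F 1 [1] e \<cdot> z))"
    unfolding edge_map_def using edgesD(7)[OF assms] z i by simp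
qed

text \<open>An element of the product is a constant together with two points; the constant restricts
  to itself, so only the two points have to be lifted, by \<open>ends_lift\<close>.\<close>

lemma edge_map_epi:
  assumes i: "i \<in> I" and j: "j \<in> I"
  shows "epi_family E (prd E (gs E (R i)) (prd E (U i) (U j))) (edge_map i ` edges i j)"
proof (rule epi_familyI)
  show "prd E (gs E (R i)) (prd E (U i) (U j)) \<in> Ob E" using i j by simp
  show "f \<in> Ar E \<and> Tgt E f = prd E (gs E (R i)) (prd E (U i) (U j))" if "f \<in> edge_map i ` edges i j" for f
    using that edge_map_type by auto
  fix b assume b: "b \<in> Ar E" "Src E b \<in> G" "Tgt E b = prd E (gs E (R i)) (prd E (U i) (U j))"
  obtain r x y where r: "r \<in> R i" and x: "elt i x" and y: "elt j y" and sb: "Src E b = Src E x" and yx: "Src E y = Src E x"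
    and bb: "b = pair E (const (R i) (Src E x) r) (pair E x y)"
    by (rule transport_cases[OF i j b])
  show "epi_family E (Src E b) {c. c \<in> Ar E \<and> Src E c \<in> G \<and> Tgt E c = Src E b \<and>
      (\<exists>f\<in>edge_map i ` edges i j. \<exists>y\<in>Ar E. Tgt E y = Src E f \<and> Src E y = Src E c \<and> f \<cdot> y = b \<cdot> c)}"
    unfolding sb
  proof (rule epi_family_mono[OF ends_lift[OF x y yx]], intro Collect_mono impI, elim conjE bexE, intro conjI)
    fix c e z assume c: "c \<in> Ar E" "Tgt E c = Src E x" and e: "e \<in> edges i j"
      and z: "z \<in> Ar E" "Src E z = Src E c" "Tgt E z = Cp F 1 e"
        "cpmap F 1 [0] e \<cdot> z = x \<cdot> c" "cpmap F 1 [1] e \<cdot> z = y \<cdot> c"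
    have "edge_map i e \<cdot> pair E (const (R i) (Src E z) r) z = b \<cdot> c"
      unfolding edge_map_type(4)[OF e z(1,3) r] bb z(4,5) using x y yx r c z(2) by simp
    moreover have "pair E (const (R i) (Src E z) r) z \<in> Ar E"
      "Tgt E (pair E (const (R i) (Src E z) r) z) = Src E (edge_map i e)"
      "Src E (pair E (const (R i) (Src E z) r) z) = Src E c"
      using edge_map_type(1-3)[OF e] z c r i by simp_all
    ultimately show "\<exists>f\<in>edge_map i ` edges i j. \<exists>y\<in>Ar E. Tgt E y = Src E f \<and> Src E y = Src E c \<and> f \<cdot> y = b \<cdot> c"
      using e by blast
  qed auto
qed

text \<open>Two elements with the same image under the maps \<open>edge_map\<close> have the same
  label and the same end points, so by \<open>S_parallel\<close> they are sent to the same constant.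
  This is the compatibility that \<open>glue\<close> asks for.\<close>

lemma glued_transport:
  assumes i: "i \<in> I" and j: "j \<in> I"
  shows "\<exists>f. f \<in> hom E (prd E (gs E (R i)) (prd E (U i) (U j))) (gs E (R j)) \<and>
    (\<forall>e\<in>edges i j. f \<cdot> edge_map i e = gsmap E (R i) (R j) (s e) \<cdot> p1 E (gs E (R i)) (Cp F 1 e))"
proof -
  let ?g = "\<lambda>e. gsmap E (R i) (R j) (s e) \<cdot> p1 E (gs E (R i)) (Cp F 1 e)"
  let ?B = "prd E (gs E (R i)) (prd E (U i) (U j))"
  have B: "?B \<in> Ob E" and C: "gs E (R j) \<in> Ob E" using i j by simp_all
  have gz: "?g e \<cdot> pair E (const (R i) (Src E z) r) z = const (R j) (Src E z) (s e r)"
    if "e \<in> edges i j" "z \<in> Ar E" "Tgt E z = Cp F 1 e" "r \<in> R i" for e z r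
    using edgesD[OF that(1)] that i j by simp
  obtain h where "h \<in> hom E ?B (gs E (R j))" "\<And>e. e \<in> edges i j \<Longrightarrow> h \<cdot> edge_map i e = ?g e"
  proof (rule glue[OF small_edges B C, of i j "edge_map i" ?g])
    show "\<forall>e\<in>edges i j. edge_map i e \<in> Ar E \<and> Tgt E (edge_map i e) = ?B" using edge_map_type by blast
    show "\<forall>e\<in>edges i j. ?g e \<in> Ar E \<and> Src E (?g e) = Src E (edge_map i e) \<and> Tgt E (?g e) = gs E (R j)"
    proof
      fix e assume e: "e \<in> edges i j"
      show "?g e \<in> Ar E \<and> Src E (?g e) = Src E (edge_map i e) \<and> Tgt E (?g e) = gs E (R j)"
        using edgesD[OF e] edge_map_type[OF e] i j by simp
    qed
    show "epi_family E ?B (edge_map i ` edges i j)" by (rule edge_map_epi[OF i j])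
    fix e t x y
    assume e: "e \<in> edges i j" and t: "t \<in> edges i j" and x: "x \<in> Ar E" "y \<in> Ar E" "Src E x \<in> G" "Src E y = Src E x"
      "Tgt E x = Src E (edge_map i e)" "Tgt E y = Src E (edge_map i t)" and eq: "edge_map i e \<cdot> x = edge_map i t \<cdot> y"
    have x5: "Tgt E x = prd E (gs E (R i)) (Cp F 1 e)" and y5: "Src E y \<in> G" "Tgt E y = prd E (gs E (R i)) (Cp F 1 t)"
      using x edge_map_type[OF e] edge_map_type[OF t] by simp_all
    obtain r a where r: "r \<in> R i" and a: "a \<in> Ar E" "Src E x = Src E a" "Tgt E a = Cp F 1 e"
      and xx: "x = pair E (const (R i) (Src E a) r) a"
      by (rule gs_prd_cases[OF small_R[OF i] edgesD(4)[OF e] x(1,3) x5])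
    obtain q b where q: "q \<in> R i" and b: "b \<in> Ar E" "Src E y = Src E b" "Tgt E b = Cp F 1 t"
      and yy: "y = pair E (const (R i) (Src E b) q) b"
      by (rule gs_prd_cases[OF small_R[OF i] edgesD(4)[OF t] x(2) y5])
    have ab: "Src E b = Src E a" "Src E a \<in> G" using a b x(3,4) by simp_all
    have "pair E (const (R i) (Src E a) r) (pair E (cpmap F 1 [0] e \<cdot> a) (cpmap F 1 [1] e \<cdot> a))
      = pair E (const (R i) (Src E b) q) (pair E (cpmap F 1 [0] t \<cdot> b) (cpmap F 1 [1] t \<cdot> b))"
      using eq unfolding xx yy edge_map_type(4)[OF e a(1,3) r] edge_map_type(4)[OF t b(1,3) q] .
    then have c1: "const (R i) (Src E a) r = const (R i) (Src E b) q \<and>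
        pair E (cpmap F 1 [0] e \<cdot> a) (cpmap F 1 [1] e \<cdot> a) = pair E (cpmap F 1 [0] t \<cdot> b) (cpmap F 1 [1] t \<cdot> b)"
      by (rule iffD1[OF pair_eq_iff, rotated -1])
        (use edgesD(5,6)[OF e] edgesD(5,6)[OF t] a b q r i ab in simp_all)
    have c2: "cpmap F 1 [0] e \<cdot> a = cpmap F 1 [0] t \<cdot> b \<and> cpmap F 1 [1] e \<cdot> a = cpmap F 1 [1] t \<cdot> b"
      by (rule iffD1[OF pair_eq_iff, rotated -1, OF conjunct2[OF c1]])
        (use edgesD(5,6)[OF e] edgesD(5,6)[OF t] a b ab in simp_all)
    have rq: "r = q"
      by (rule const_inj[OF small_R[OF i] r q ab(2)]) (use conjunct1[OF c1] ab in simp)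
    have sa: "(e, a) \<in> sel F (Src E a) 1" and sb: "(t, b) \<in> sel F (Src E a) 1"
      using a b ab edgesD(1)[OF e] edgesD(1)[OF t] by (simp_all add: sel_def)
    have ee: "ixmap F 1 [0] e = i" "ixmap F 1 [1] e = j" "ixmap F 1 [0] t = i" "ixmap F 1 [1] t = j"
      using e t by (simp_all add: edges_def)
    have "s (fst (e, a)) r = s (fst (t, b)) r"
      by (rule S_parallel[OF ab(2) sa sb])
        (use ee c2 r in \<open>simp_all add: vtx_def sact_def One_nat_def[symmetric] del: One_nat_def\<close>)
    then show "?g e \<cdot> x = ?g t \<cdot> y"
      unfolding xx yy gz[OF e a(1,3) r] gz[OF t b(1,3) q] using rq ab by simp
  qed blast
  then show ?thesis by blast
qed

definition glued_map :: "'u \<Rightarrow> 'u \<Rightarrow> 'a" where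
  "glued_map i j = (SOME f. f \<in> hom E (prd E (gs E (R i)) (prd E (U i) (U j))) (gs E (R j)) \<and>
    (\<forall>e\<in>edges i j. f \<cdot> edge_map i e = gsmap E (R i) (R j) (s e) \<cdot> p1 E (gs E (R i)) (Cp F 1 e)))"

lemma glued_map:
  assumes "i \<in> I" "j \<in> I"
  shows "glued_map i j \<in> hom E (prd E (gs E (R i)) (prd E (U i) (U j))) (gs E (R j))"
    "e \<in> edges i j \<Longrightarrow> glued_map i j \<cdot> edge_map i e = gsmap E (R i) (R j) (s e) \<cdot> p1 E (gs E (R i)) (Cp F 1 e)"
  using someI_ex[OF glued_transport[OF assms], folded glued_map_def] by blast+

lemma transport_glued_map: "transport_map glued_map"
  unfolding transport_map_def using glued_map(1) adjD by blast

lemma act_glued_map: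
  assumes e: "e \<in> edges i j" and z: "z \<in> Ar E" "Src E z \<in> G" "Tgt E z = Cp F 1 e" and r: "r \<in> R i"
  shows "act glued_map i j (cpmap F 1 [0] e \<cdot> z) (cpmap F 1 [1] e \<cdot> z) r = s e r"
proof (rule act_eqI)
  note D = edgesD[OF e]
  show "elt i (cpmap F 1 [0] e \<cdot> z)" "elt j (cpmap F 1 [1] e \<cdot> z)" using D z by simp_all
  show "s e r \<in> R j" using D(8) r by blast
  have "glued_map i j \<cdot> (edge_map i e \<cdot> pair E (const (R i) (Src E z) r) z)
      = (glued_map i j \<cdot> edge_map i e) \<cdot> pair E (const (R i) (Src E z) r) z"
    by (rule Cmp_assoc[symmetric]) (use glued_map(1)[OF D(2,3)] edge_map_type(1-3)[OF e] z r D in simp_all)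
  also have "\<dots> = const (R j) (Src E z) (s e r)"
    unfolding glued_map(2)[OF D(2,3) e] using D z r by simp
  finally show "glued_map i j \<cdot> pair E (const (R i) (Src E (cpmap F 1 [0] e \<cdot> z)) r)
      (pair E (cpmap F 1 [0] e \<cdot> z) (cpmap F 1 [1] e \<cdot> z)) = const (R j) (Src E (cpmap F 1 [0] e \<cdot> z)) (s e r)"
    unfolding edge_map_type(4)[OF e z(1,3) r] using D z by simp
qed

lemma act_glued_vtx:
  assumes y: "y \<in> sel F V 1" and V: "V \<in> G" and r: "r \<in> R (fst (vtx F 0 y))"
  shows "act glued_map (fst (vtx F 0 y)) (fst (vtx F 1 y)) (snd (vtx F 0 y)) (snd (vtx F 1 y)) r = s (fst y) r"
proof -
  have "fst y \<in> edges (fst (vtx F 0 y)) (fst (vtx F 1 y))"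
    using selD(1)[OF y] by (simp add: edges_def vtx_def sact_def)
  from act_glued_map[OF this selD(2)[OF y] _ selD(4)[OF y] r]
  show ?thesis using V selD(3)[OF y] by (simp add: vtx_def sact_def)
qed

text \<open>The unit law is read off at a degenerate edge. For the cocycle law, edges between the
  three points exist only locally: the stage is restricted once for each of them,
  \<open>S_triangle\<close> applies there, and \<open>act_Cmp\<close> brings the identity
  back.\<close>

lemma coherent_glued_map: "coherent glued_map"
  unfolding coherent_def
proof (intro conjI allI impI)
  show "transport_map glued_map" by (rule transport_glued_map)
  fix i x r assume "elt i x \<and> r \<in> R i"
  then have x: "elt i x" and r: "r \<in> R i" by auto
  have V: "Src E x \<in> G" and i: "i \<in> I" using x by simp_all
  note d = degen_sel[OF F elt_sel[OF x], folded One_nat_def]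
  have v: "vtx F 0 (degen F (i, x)) = (i, x)" "vtx F 1 (degen F (i, x)) = (i, x)"
    using vtx_degen[OF F elt_sel[OF x]] by simp_all
  have "act glued_map i i x x r = s (fst (degen F (i, x))) r"
    using act_glued_vtx[OF d V, of r] v r by simp
  also have "\<dots> = r" unfolding degen_def sact_def fst_conv by (rule S_id[OF i r])
  finally show "act glued_map i i x x r = r" .
next
  note tm = transport_glued_map
  fix i j k x y z r
  assume "elt i x \<and> elt j y \<and> elt k z \<and> Src E y = Src E x \<and> Src E z = Src E x \<and> r \<in> R i"
  then have x: "elt i x" and y: "elt j y" "Src E y = Src E x" and z: "elt k z" "Src E z = Src E x"
    and r: "r \<in> R i" by auto
  obtain c a where c: "c \<in> Ar E" "Src E c \<in> G" "Tgt E c = Src E x" and a: "a \<in> sel F (Src E c) 1"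
    "vtx F 0 a = (i, x \<cdot> c)" "vtx F 1 a = (j, y \<cdot> c)" by (rule edge_ex[OF x y])
  have yc: "elt j (y \<cdot> c)" "elt k (z \<cdot> c)" "elt i (x \<cdot> c)" "Src E (z \<cdot> c) = Src E (y \<cdot> c)" "Src E (y \<cdot> c) = Src E c"
    using x y z c by simp_all
  obtain d b where d: "d \<in> Ar E" "Src E d \<in> G" "Tgt E d = Src E (y \<cdot> c)" and b: "b \<in> sel F (Src E d) 1"
    "vtx F 0 b = (j, (y \<cdot> c) \<cdot> d)" "vtx F 1 b = (k, (z \<cdot> c) \<cdot> d)" by (rule edge_ex[OF yc(1,2,4)])
  have d3: "Tgt E d = Src E c" using d(3) yc(5) by simp
  have cd: "c \<cdot> d \<in> Ar E" "Src E (c \<cdot> d) \<in> G" "Tgt E (c \<cdot> d) = Src E x" "Src E (c \<cdot> d) = Src E d" using c d d3 by simp_all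
  have xcd: "elt i (x \<cdot> (c \<cdot> d))" "elt k (z \<cdot> (c \<cdot> d))" "Src E (z \<cdot> (c \<cdot> d)) = Src E (x \<cdot> (c \<cdot> d))" "Src E (x \<cdot> (c \<cdot> d)) = Src E d"
    using x z cd by simp_all
  obtain f g where f: "f \<in> Ar E" "Src E f \<in> G" "Tgt E f = Src E (x \<cdot> (c \<cdot> d))" and g: "g \<in> sel F (Src E f) 1"
    "vtx F 0 g = (i, (x \<cdot> (c \<cdot> d)) \<cdot> f)" "vtx F 1 g = (k, (z \<cdot> (c \<cdot> d)) \<cdot> f)" by (rule edge_ex[OF xcd(1-3)])
  have f3: "Tgt E f = Src E d" using f(3) xcd(4) by simp
  \<comment> \<open>The restriction of the stage over which edges for \<open>x\<close>,
    \<open>y\<close>, for \<open>y\<close>, \<open>z\<close> and for \<open>x\<close>,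
    \<open>z\<close> exist together.\<close>
  define t where "t = c \<cdot> (d \<cdot> f)"
  have t: "t \<in> Ar E" "Src E t \<in> G" "Tgt E t = Src E x" "Src E t = Src E f" using c d d3 f f3 by (simp_all add: t_def)
  define a' where "a' = pull a (d \<cdot> f)"
  define b' where "b' = pull b f"
  have df: "d \<cdot> f \<in> Ar E" "Tgt E (d \<cdot> f) = Src E c" "Src E (d \<cdot> f) = Src E f" using d d3 f f3 by simp_all
  have a': "a' \<in> sel F (Src E f) 1" using pull_sel[OF F a(1) df(1,2)] df(3) by (simp add: a'_def)
  have b': "b' \<in> sel F (Src E f) 1" unfolding b'_def by (rule pull_sel[OF F b(1) f(1) f3])
  have va: "vtx F 0 a' = (i, x \<cdot> t)" "vtx F 1 a' = (j, y \<cdot> t)"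
    unfolding a'_def using vtx_pull[OF F a(1)[unfolded One_nat_def] _ df(1,2)] a(2,3) x y c d d3 f f3
    by (simp_all add: pull_def t_def)
  have vb: "vtx F 0 b' = (j, y \<cdot> t)" "vtx F 1 b' = (k, z \<cdot> t)"
    unfolding b'_def using vtx_pull[OF F b(1)[unfolded One_nat_def] _ f(1) f3] b(2,3) z y c d d3 f f3
    by (simp_all add: pull_def t_def)
  have vg: "vtx F 0 g = (i, x \<cdot> t)" "vtx F 1 g = (k, z \<cdot> t)"
    using g(2,3) x z c d d3 f f3 by (simp_all add: t_def)
  have "s (fst g) r = s (fst b') (s (fst a') r)"
    by (rule S_triangle[OF f(2) a' b' g(1)]) (simp_all only: va vb vg fst_conv r)
  moreover have A: "act glued_map i j (x \<cdot> t) (y \<cdot> t) r = s (fst a') r"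
    using act_glued_vtx[OF a' f(2), of r] va r by simp
  moreover have "act glued_map i k (x \<cdot> t) (z \<cdot> t) r = s (fst g) r"
    using act_glued_vtx[OF g(1) f(2), of r] vg r by simp
  moreover have Ain: "act glued_map i j (x \<cdot> t) (y \<cdot> t) r \<in> R j"
    by (rule act_spec(1)[OF tm]) (use x y t r in simp_all)
  moreover have "act glued_map j k (y \<cdot> t) (z \<cdot> t) (s (fst a') r) = s (fst b') (s (fst a') r)"
    using act_glued_vtx[OF b' f(2), of "s (fst a') r"] vb Ain A by simp
  ultimately have eq: "act glued_map j k (y \<cdot> t) (z \<cdot> t) (act glued_map i j (x \<cdot> t) (y \<cdot> t) r)
      = act glued_map i k (x \<cdot> t) (z \<cdot> t) r" by simp
  have yz: "Src E z = Src E y" "Tgt E t = Src E y" using y z t by simp_all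
  show "act glued_map j k y z (act glued_map i j x y r) = act glued_map i k x z r"
    using eq act_Cmp[OF tm x y r t(1-3)] act_Cmp[OF tm x z r t(1-3)]
      act_Cmp[OF tm y(1) z(1) yz(1) act_spec(1)[OF tm x y r] t(1,2) yz(2)] by simp
qed

text \<open>Two points at one stage are locally joined by an edge, and \<open>act\<close> survives
  restriction, so its values at the end points of edges determine it.\<close>

lemma act_determined:
  assumes \<phi>: "transport_map \<phi>"
    and e: "\<And>V y r. V \<in> G \<Longrightarrow> y \<in> sel F V 1 \<Longrightarrow> r \<in> R (fst (vtx F 0 y)) \<Longrightarrow>
      act \<phi> (fst (vtx F 0 y)) (fst (vtx F 1 y)) (snd (vtx F 0 y)) (snd (vtx F 1 y)) r = s (fst y) r"
    and x: "elt i x" and y: "elt j y" "Src E y = Src E x" and r: "r \<in> R i"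
  shows "act \<phi> i j x y r = act glued_map i j x y r"
proof -
  obtain c z where c: "c \<in> Ar E" "Src E c \<in> G" "Tgt E c = Src E x" and z: "z \<in> sel F (Src E c) 1"
    "vtx F 0 z = (i, x \<cdot> c)" "vtx F 1 z = (j, y \<cdot> c)" by (rule edge_ex[OF x y])
  have "act \<phi> i j (x \<cdot> c) (y \<cdot> c) r = act glued_map i j (x \<cdot> c) (y \<cdot> c) r"
    using e[OF c(2) z(1), of r] act_glued_vtx[OF z(1) c(2), of r] z(2,3) r by simp
  then show ?thesis
    using act_Cmp[OF \<phi> x y r] act_Cmp[OF transport_glued_map x y r] c by simp
qed

lemma corresponding_iff:
  assumes \<sigma>: "U_descent_datum E I U R \<sigma>"
  shows "(\<forall>e\<in>Ix F 1. corresponding_datum E I U (\<lambda>i. i) F R \<sigma> e = constant_datum E F R s e) \<longleftrightarrow>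
    (\<forall>V\<in>G. \<forall>y\<in>sel F V 1. \<forall>r\<in>R (fst (vtx F 0 y)).
      act (first \<sigma>) (fst (vtx F 0 y)) (fst (vtx F 1 y)) (snd (vtx F 0 y)) (snd (vtx F 1 y)) r = s (fst y) r)"
proof -
  have c: "corresponding_datum E I U (\<lambda>i. i) F R \<sigma> e = constant_datum E F R s e \<longleftrightarrow>
    (\<forall>V\<in>G. \<forall>x. (e, x) \<in> sel F V 1 \<longrightarrow> (\<forall>r\<in>R (ixmap F 1 [0] e).
      act (first \<sigma>) (ixmap F 1 [0] e) (ixmap F 1 [1] e) (cpmap F 1 [0] e \<cdot> x) (cpmap F 1 [1] e \<cdot> x) r = s e r))"
    if e: "e \<in> Ix F 1" for e
  proof -
    have "\<forall>r\<in>R (ixmap F 1 [0] e). s e r \<in> R (ixmap F 1 [1] e)" using S_bij[OF e] by (auto simp: bij_betw_def)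
    from corresponding_eq_constant[where v = "\<lambda>i. i" and s = s, OF F refinement_bij refinement_Cp dual \<sigma> e this] show ?thesis
      by (simp add: comp_def)
  qed
  have v: "vtx F 0 y = (ixmap F 1 [0] (fst y), cpmap F 1 [0] (fst y) \<cdot> snd y)"
    "vtx F 1 y = (ixmap F 1 [1] (fst y), cpmap F 1 [1] (fst y) \<cdot> snd y)" for y by (simp_all add: vtx_def sact_def)
  show ?thesis
  proof
    assume l: "\<forall>e\<in>Ix F 1. corresponding_datum E I U (\<lambda>i. i) F R \<sigma> e = constant_datum E F R s e"
    show "\<forall>V\<in>G. \<forall>y\<in>sel F V 1. \<forall>r\<in>R (fst (vtx F 0 y)).
      act (first \<sigma>) (fst (vtx F 0 y)) (fst (vtx F 1 y)) (snd (vtx F 0 y)) (snd (vtx F 1 y)) r = s (fst y) r"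
    proof (intro ballI)
      fix V y r assume V: "V \<in> G" and y: "y \<in> sel F V 1" and r: "r \<in> R (fst (vtx F 0 y))"
      have y': "(fst y, snd y) \<in> sel F V 1" using y by simp
      from l[THEN bspec, OF selD(1)[OF y], unfolded c[OF selD(1)[OF y]], THEN bspec, OF V, rule_format, OF y'] r
      show "act (first \<sigma>) (fst (vtx F 0 y)) (fst (vtx F 1 y)) (snd (vtx F 0 y)) (snd (vtx F 1 y)) r = s (fst y) r"
        unfolding v by simp
    qed
  next
    assume r: "\<forall>V\<in>G. \<forall>y\<in>sel F V 1. \<forall>r\<in>R (fst (vtx F 0 y)).
      act (first \<sigma>) (fst (vtx F 0 y)) (fst (vtx F 1 y)) (snd (vtx F 0 y)) (snd (vtx F 1 y)) r = s (fst y) r"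
    show "\<forall>e\<in>Ix F 1. corresponding_datum E I U (\<lambda>i. i) F R \<sigma> e = constant_datum E F R s e"
    proof (intro ballI, subst c, assumption, intro ballI allI impI)
      fix e V x q assume "V \<in> G" "(e, x) \<in> sel F V 1" "q \<in> R (ixmap F 1 [0] e)"
      then show "act (first \<sigma>) (ixmap F 1 [0] e) (ixmap F 1 [1] e) (cpmap F 1 [0] e \<cdot> x) (cpmap F 1 [1] e \<cdot> x) q = s e q"
        using r[unfolded v, rule_format, of V "(e, x)" q] by simp
    qed
  qed
qed

lemma glued_map_action_span:
  assumes e: "e \<in> edges i j"
  shows "action_span E U R (datum glued_map) i j (Cp F 1 e) (cpmap F 1 [0] e) (cpmap F 1 [1] e)"
  unfolding action_span_def
proof (intro conjI exI)
  note D = edgesD[OF e] and tm = transport_glued_map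
  let ?x = "cpmap F 1 [0] e" and ?y = "cpmap F 1 [1] e" and ?V = "Cp F 1 e"
  show "?V \<in> Ob E" "?x \<in> hom E ?V (U i)" "?y \<in> hom E ?V (U j)" by (fact D)+
  show "\<not> initial E ?V" by (rule simplicial_familyD(6)[OF F D(1)])
  show "bij_betw (s e) (R i) (R j)" using S_bij[OF D(1)] e by (simp add: edges_def)
  obtain z0 where "z0 \<in> Ar E" "Src E z0 \<in> G" "Tgt E z0 = ?V"
    using simplicial_familyD(6)[OF F D(1)] initial_iff[OF D(4)] by blast
  then have adj: "adj i j" by (intro adjI[of i "?x \<cdot> z0" j "?y \<cdot> z0"]) (use D in simp_all)
  note ty [simp] = datum_type[OF tm adj]
  show "datum glued_map [i, j] \<cdot> pmap E (Idt E (gs E (R i))) (pair E ?x ?y)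
        = pmap E (Idt E (gs E (R j))) (pair E ?y ?x) \<cdot> pmap E (gsmap E (R i) (R j) (s e)) (Idt E ?V)" (is "?l = ?r")
  proof (rule eqI)
    fix w assume w: "w \<in> Ar E" "Src E w \<in> G" "Tgt E w = Src E ?l"
    then have w3: "Tgt E w = prd E (gs E (R i)) ?V" using D by simp
    obtain r z where r: "r \<in> R i" and z: "z \<in> Ar E" "Src E w = Src E z" "Tgt E z = ?V"
      and ww: "w = pair E (const (R i) (Src E z) r) z"
      by (rule gs_prd_cases[OF small_R[OF D(2)] D(4) w(1,2) w3])
    have zG: "Src E z \<in> G" using z w by simp
    have el: "elt i (?x \<cdot> z)" "elt j (?y \<cdot> z)" "Src E (?y \<cdot> z) = Src E (?x \<cdot> z)" "Src E (?x \<cdot> z) = Src E z"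
      using D z zG by simp_all
    have "?l \<cdot> w = datum glued_map [i, j] \<cdot> pair E (const (R i) (Src E (?x \<cdot> z)) r) (pair E (?x \<cdot> z) (?y \<cdot> z))"
      unfolding ww using D z r by simp
    also have "\<dots> = pair E (const (R j) (Src E z) (s e r)) (pair E (?y \<cdot> z) (?x \<cdot> z))"
      using datum_pair[OF tm el(1-3) r] unfolding act_glued_map[OF e z(1) zG z(3) r] unfolding el(4) .
    also have "\<dots> = ?r \<cdot> w" unfolding ww using D z r by simp
    finally show "?l \<cdot> w = ?r \<cdot> w" .
  qed (use D in simp_all)
qed

text \<open>The components over the edges are action spans by \<open>glued_map_action_span\<close>,
  and by \<open>ends_epi\<close> they cover each \<open>U i \<times> U j\<close>. Uniqueness of
  \<open>\<sigma>\<close> comes from \<open>act_determined\<close>, that of X from descent of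
  maps.\<close>

lemma covering_projection_of_S_datum:
  "\<exists>\<sigma>. U_descent_datum E I U R \<sigma> \<and>
     (\<forall>e\<in>Ix F 1. corresponding_datum E I U (\<lambda>i. i) F R \<sigma> e = constant_datum E F R s e) \<and>
     (\<forall>\<sigma>'. U_descent_datum E I U R \<sigma>' \<and>
        (\<forall>e\<in>Ix F 1. corresponding_datum E I U (\<lambda>i. i) F R \<sigma>' e = constant_datum E F R s e) \<longrightarrow>
        (\<forall>e\<in>Ix (cech E I U) 1. \<sigma>' e = \<sigma> e)) \<and>
     (\<exists>X. covering_projection E I U X R \<sigma> \<and>
        (\<forall>Y. locally_constant E I U Y R \<sigma> \<longrightarrow> isomorphic E X Y))"
proof (intro exI conjI allI impI)
  let ?\<sigma> = "datum glued_map"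
  note tm = transport_glued_map
  note U = coherent_U_descent_datum[OF coherent_glued_map]
  show "U_descent_datum E I U R ?\<sigma>" by (rule U)
  have fd: "act (first ?\<sigma>) i j x y r = act glued_map i j x y r" if "elt i x" "elt j y" "Src E y = Src E x" for i j x y r
    unfolding act_def first_datum[OF tm adjI[OF that]] ..
  show "\<forall>e\<in>Ix F 1. corresponding_datum E I U (\<lambda>i. i) F R ?\<sigma> e = constant_datum E F R s e"
    unfolding corresponding_iff[OF U]
  proof (intro ballI)
    fix V y r assume V: "V \<in> G" and y: "y \<in> sel F V 1" and r: "r \<in> R (fst (vtx F 0 y))"
    note ve = vtx_elt[OF F refinement_bij refinement_Cp dual y V]
    show "act (first ?\<sigma>) (fst (vtx F 0 y)) (fst (vtx F 1 y)) (snd (vtx F 0 y)) (snd (vtx F 1 y)) r = s (fst y) r"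
      using fd[OF ve(1,2)] ve(3,4) act_glued_vtx[OF y V r] by simp
  qed
  show "\<forall>e\<in>Ix (cech E I U) 1. \<sigma>' e = ?\<sigma> e" if \<sigma>': "U_descent_datum E I U R \<sigma>' \<and>
        (\<forall>e\<in>Ix F 1. corresponding_datum E I U (\<lambda>i. i) F R \<sigma>' e = constant_datum E F R s e)" for \<sigma>'
  proof
    fix e assume "e \<in> Ix (cech E I U) 1"
    moreover from this obtain i j where e: "e = [i, j]" by (auto simp: cech_def length_Suc_conv)
    ultimately have ij: "adj i j" by simp
    note U' = conjunct1[OF \<sigma>'] and cor = conjunct2[OF \<sigma>']
    note tm' = coherentD(1)[OF U_descent_datumD(1)[OF U']]
    note i = adjD(1)[OF ij] and j = adjD(2)[OF ij]
    note ty = transport_mapD[OF tm' ij] transport_mapD[OF tm ij]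
    have "first \<sigma>' i j = glued_map i j"
    proof (rule eqI)
      fix z assume z: "z \<in> Ar E" "Src E z \<in> G" "Tgt E z = Src E (first \<sigma>' i j)"
      then have z3: "Tgt E z = prd E (gs E (R i)) (prd E (U i) (U j))" using ty by simp
      obtain r x y where r: "r \<in> R i" and x: "elt i x" and y: "elt j y" "Src E y = Src E x"
        and zz: "z = pair E (const (R i) (Src E x) r) (pair E x y)"
        by (rule transport_cases[OF i j z(1,2) z3])
      have "act (first \<sigma>') i j x y r = act glued_map i j x y r"
        by (rule act_determined[OF tm' _ x y r]) (use cor[unfolded corresponding_iff[OF U']] in blast)
      then show "first \<sigma>' i j \<cdot> z = glued_map i j \<cdot> z"
        unfolding zz using act_spec(2)[OF tm' x y r] act_spec(2)[OF tm x y r] by simp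
    qed (use ty in simp_all)
    then show "\<sigma>' e = ?\<sigma> e" unfolding e U_descent_datumD(2)[OF U' ij] by (simp add: datum_def)
  qed
  define X where "X = (SOME X. locally_constant E I U X R ?\<sigma>)"
  have X: "locally_constant E I U X R ?\<sigma>"
    unfolding X_def using descent_object[OF coherent_glued_map] by (metis someI_ex)
  show "isomorphic E X Y" if "locally_constant E I U Y R ?\<sigma>" for Y
    by (rule locally_constant_unique[OF X that])
  show "covering_projection E I U X R ?\<sigma>"
    unfolding covering_projection_def
  proof (intro conjI allI impI)
    show "locally_constant E I U X R ?\<sigma>" by (rule X)
    fix i j assume ij: "adj i j"
    note i = adjD(1)[OF ij] and j = adjD(2)[OF ij]
    show "epi_family E (prd E (U i) (U j)) {pair E x y |V x y. action_span E U R ?\<sigma> i j V x y}"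
    proof (rule epi_family_mono[OF ends_epi[OF i j]])
      show "ends ` edges i j \<subseteq> {pair E x y |V x y. action_span E U R ?\<sigma> i j V x y}"
        unfolding ends_def using glued_map_action_span by blast
      show "f \<in> Ar E \<and> Tgt E f = prd E (U i) (U j)"
        if "f \<in> {pair E x y |V x y. action_span E U R ?\<sigma> i j V x y}" for f
        using that by (auto simp: action_span_def)
    qed
  qed
qed

end

end

section \<open>Spans\<close>

lemma nonempty_subsets_iff [simp]: "A \<in> nonempty_subsets n \<longleftrightarrow> A \<noteq> {} \<and> A \<subseteq> {..n}"
  by (auto simp: nonempty_subsets_def)

abbreviation ind :: "('u, 'o, 'a) span \<Rightarrow> 'u list" where "ind w \<equiv> fst w"
abbreviation obj :: "('u, 'o, 'a) span \<Rightarrow> nat set \<Rightarrow> 'o" where "obj w \<equiv> fst (snd w)"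
abbreviation str :: "('u, 'o, 'a) span \<Rightarrow> nat set \<Rightarrow> nat set \<Rightarrow> 'a" where "str w \<equiv> snd (snd w)"

lemma spans_iff:
  "w \<in> spans E I U C n \<longleftrightarrow> length (ind w) = Suc n \<and> set (ind w) \<subseteq> I \<and>
     (\<forall>A. A \<noteq> {} \<and> A \<subseteq> {..n} \<longrightarrow> obj w A \<in> C) \<and>
     (\<forall>A. \<not> (A \<noteq> {} \<and> A \<subseteq> {..n}) \<longrightarrow> obj w A = undefined) \<and>
     (\<forall>k\<le>n. obj w {k} = U (ind w ! k)) \<and>
     (\<forall>A B. B \<noteq> {} \<and> B \<subseteq> A \<and> A \<subseteq> {..n} \<longrightarrow> str w A B \<in> hom E (obj w A) (obj w B)) \<and>
     (\<forall>A B. \<not> (B \<noteq> {} \<and> B \<subseteq> A \<and> A \<subseteq> {..n}) \<longrightarrow> str w A B = undefined) \<and>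
     (\<forall>A. A \<noteq> {} \<and> A \<subseteq> {..n} \<longrightarrow> str w A A = Idt E (obj w A)) \<and>
     (\<forall>A B B'. B' \<noteq> {} \<and> B' \<subseteq> B \<and> B \<subseteq> A \<and> A \<subseteq> {..n} \<longrightarrow> str w B B' \<cdot>\<^bsub>E\<^esub> str w A B = str w A B')"
proof -
  obtain i D d where w: "w = (i, D, d)" by (cases w)
  have 1: "D \<in> nonempty_subsets n \<rightarrow>\<^sub>E C \<longleftrightarrow> (\<forall>A. A \<noteq> {} \<and> A \<subseteq> {..n} \<longrightarrow> D A \<in> C) \<and>
     (\<forall>A. \<not> (A \<noteq> {} \<and> A \<subseteq> {..n}) \<longrightarrow> D A = undefined)"
    by (simp add: PiE_iff extensional_def Ball_def)
  have ne: "B \<noteq> {} \<and> B \<subseteq> A \<and> A \<subseteq> {..n} \<longleftrightarrow>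
      A \<in> nonempty_subsets n \<and> B \<in> nonempty_subsets n \<and> B \<subseteq> A" for A B
    by auto
  have ne': "B' \<noteq> {} \<and> B' \<subseteq> B \<and> B \<subseteq> A \<and> A \<subseteq> {..n} \<longleftrightarrow> A \<in> nonempty_subsets n \<and>
      B \<in> nonempty_subsets n \<and> B' \<in> nonempty_subsets n \<and> B \<subseteq> A \<and> B' \<subseteq> B" for A B B'
    by auto
  have 2: "(\<forall>A\<in>nonempty_subsets n. \<forall>B\<in>nonempty_subsets n. B \<subseteq> A \<longrightarrow> P A B) \<longleftrightarrow>
      (\<forall>A B. B \<noteq> {} \<and> B \<subseteq> A \<and> A \<subseteq> {..n} \<longrightarrow> P A B)" for P
    unfolding ne by blast
  have 3: "(\<forall>A B. \<not> (A \<in> nonempty_subsets n \<and> B \<in> nonempty_subsets n \<and> B \<subseteq> A) \<longrightarrow> P A B) \<longleftrightarrow>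
      (\<forall>A B. \<not> (B \<noteq> {} \<and> B \<subseteq> A \<and> A \<subseteq> {..n}) \<longrightarrow> P A B)" for P
    unfolding ne ..
  have 4: "(\<forall>A\<in>nonempty_subsets n. P A) \<longleftrightarrow> (\<forall>A. A \<noteq> {} \<and> A \<subseteq> {..n} \<longrightarrow> P A)" for P
    by (simp add: Ball_def)
  have 5: "(\<forall>A\<in>nonempty_subsets n. \<forall>B\<in>nonempty_subsets n. \<forall>B'\<in>nonempty_subsets n.
        B \<subseteq> A \<and> B' \<subseteq> B \<longrightarrow> P A B B') \<longleftrightarrow>
     (\<forall>A B B'. B' \<noteq> {} \<and> B' \<subseteq> B \<and> B \<subseteq> A \<and> A \<subseteq> {..n} \<longrightarrow> P A B B')" for P
    unfolding ne' by blast
  show ?thesis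
    unfolding w spans_def mem_Collect_eq prod.case 1 2 3 5 unfolding 4 fst_conv snd_conv conj_assoc ..
qed

lemma spansD:
  assumes "w \<in> spans E I U C n"
  shows "length (ind w) = Suc n" "set (ind w) \<subseteq> I"
    "\<lbrakk>A \<noteq> {}; A \<subseteq> {..n}\<rbrakk> \<Longrightarrow> obj w A \<in> C"
    "\<not> (A \<noteq> {} \<and> A \<subseteq> {..n}) \<Longrightarrow> obj w A = undefined"
    "k \<le> n \<Longrightarrow> obj w {k} = U (ind w ! k)"
    "\<lbrakk>B \<noteq> {}; B \<subseteq> A; A \<subseteq> {..n}\<rbrakk> \<Longrightarrow> str w A B \<in> hom E (obj w A) (obj w B)"
    "\<not> (B \<noteq> {} \<and> B \<subseteq> A \<and> A \<subseteq> {..n}) \<Longrightarrow> str w A B = undefined"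
    "\<lbrakk>A \<noteq> {}; A \<subseteq> {..n}\<rbrakk> \<Longrightarrow> str w A A = Idt E (obj w A)"
    "\<lbrakk>B' \<noteq> {}; B' \<subseteq> B; B \<subseteq> A; A \<subseteq> {..n}\<rbrakk> \<Longrightarrow> str w B B' \<cdot>\<^bsub>E\<^esub> str w A B = str w A B'"
proof -
  note d = assms[unfolded spans_iff]
  show "length (ind w) = Suc n" "set (ind w) \<subseteq> I" by (rule d[THEN conjunct1] d[THEN conjunct2, THEN conjunct1])+
  note d1 = d[THEN conjunct2, THEN conjunct2] note d2 = d1[THEN conjunct2] note d3 = d2[THEN conjunct2]
  note d4 = d3[THEN conjunct2] note d5 = d4[THEN conjunct2] note d6 = d5[THEN conjunct2]
  show "\<lbrakk>A \<noteq> {}; A \<subseteq> {..n}\<rbrakk> \<Longrightarrow> obj w A \<in> C" using d1[THEN conjunct1] by blast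
  show "\<not> (A \<noteq> {} \<and> A \<subseteq> {..n}) \<Longrightarrow> obj w A = undefined" using d2[THEN conjunct1] by blast
  show "k \<le> n \<Longrightarrow> obj w {k} = U (ind w ! k)" using d3[THEN conjunct1] by blast
  show "\<lbrakk>B \<noteq> {}; B \<subseteq> A; A \<subseteq> {..n}\<rbrakk> \<Longrightarrow> str w A B \<in> hom E (obj w A) (obj w B)" using d4[THEN conjunct1] by blast
  show "\<not> (B \<noteq> {} \<and> B \<subseteq> A \<and> A \<subseteq> {..n}) \<Longrightarrow> str w A B = undefined" using d5[THEN conjunct1] by blast
  show "\<lbrakk>A \<noteq> {}; A \<subseteq> {..n}\<rbrakk> \<Longrightarrow> str w A A = Idt E (obj w A)" using d6[THEN conjunct1] by blast
  show "\<lbrakk>B' \<noteq> {}; B' \<subseteq> B; B \<subseteq> A; A \<subseteq> {..n}\<rbrakk> \<Longrightarrow> str w B B' \<cdot>\<^bsub>E\<^esub> str w A B = str w A B'"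
    using d6[THEN conjunct2] by blast
qed

lemma span_eqI:
  assumes "w \<in> spans E I U C n" "w' \<in> spans E I U C n" "\<And>k. k \<le> n \<Longrightarrow> ind w ! k = ind w' ! k"
    "\<And>A. A \<noteq> {} \<Longrightarrow> A \<subseteq> {..n} \<Longrightarrow> obj w A = obj w' A"
    "\<And>A B. B \<noteq> {} \<Longrightarrow> B \<subseteq> A \<Longrightarrow> A \<subseteq> {..n} \<Longrightarrow> str w A B = str w' A B"
  shows "w = w'"
proof -
  have "ind w = ind w'"
    by (rule nth_equalityI) (use spansD(1)[OF assms(1)] spansD(1)[OF assms(2)] assms(3) in auto)
  moreover have "obj w = obj w'"
  proof
    fix A show "obj w A = obj w' A"
      using spansD(4)[OF assms(1), of A] spansD(4)[OF assms(2), of A] assms(4)[of A] by metis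
  qed
  moreover have "str w = str w'"
  proof (intro ext)
    fix A B show "str w A B = str w' A B"
      using spansD(7)[OF assms(1), of B A] spansD(7)[OF assms(2), of B A] assms(5)[of B A] by metis
  qed
  ultimately show ?thesis by (simp add: prod_eq_iff)
qed

lemma span_reindex_sel:
  "ind (span_reindex m \<alpha> w) = map (\<lambda>k. ind w ! \<alpha> k) [0..<Suc m]"
  "obj (span_reindex m \<alpha> w) A = (if A \<noteq> {} \<and> A \<subseteq> {..m} then obj w (\<alpha> ` A) else undefined)"
  "str (span_reindex m \<alpha> w) A B = (if B \<noteq> {} \<and> B \<subseteq> A \<and> A \<subseteq> {..m} then str w (\<alpha> ` A) (\<alpha> ` B) else undefined)"
  by (cases w; auto simp: span_reindex_def)+

lemma span_reindex_spans:
  assumes w: "w \<in> spans E I U C n" and \<alpha>: "\<And>k. k \<le> m \<Longrightarrow> \<alpha> k \<le> n"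
  shows "span_reindex m \<alpha> w \<in> spans E I U C m"
proof -
  note D = spansD[OF w]
  have im: "\<alpha> ` A \<noteq> {}" "\<alpha> ` A \<subseteq> {..n}" if "A \<noteq> {}" "A \<subseteq> {..m}" for A using that \<alpha> by auto
  have im2: "\<alpha> ` B \<noteq> {}" "\<alpha> ` B \<subseteq> \<alpha> ` A" "\<alpha> ` A \<subseteq> {..n}" if "B \<noteq> {}" "B \<subseteq> A" "A \<subseteq> {..m}" for A B
    using that \<alpha> by auto
  show ?thesis
    unfolding spans_iff
  proof (intro conjI allI impI)
    show "length (ind (span_reindex m \<alpha> w)) = Suc m" by (simp add: span_reindex_sel)
    show "set (ind (span_reindex m \<alpha> w)) \<subseteq> I"
    proof
      fix x assume "x \<in> set (ind (span_reindex m \<alpha> w))"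
      then obtain k where "k \<le> m" "x = ind w ! \<alpha> k" by (auto simp: span_reindex_sel less_Suc_eq_le simp del: upt_Suc)
      then have "x \<in> set (ind w)" using D(1) \<alpha>[of k] by simp
      then show "x \<in> I" using D(2) by blast
    qed
    show "obj (span_reindex m \<alpha> w) A \<in> C" if "A \<noteq> {} \<and> A \<subseteq> {..m}" for A
      using that D(3)[OF im[of A]] by (simp add: span_reindex_sel)
    show "obj (span_reindex m \<alpha> w) A = undefined" if "\<not> (A \<noteq> {} \<and> A \<subseteq> {..m})" for A
      using that unfolding span_reindex_sel by (rule if_not_P)
    show "obj (span_reindex m \<alpha> w) {k} = U (ind (span_reindex m \<alpha> w) ! k)" if "k \<le> m" for k
      using that D(5)[OF \<alpha>[OF that]] by (simp add: span_reindex_sel del: upt_Suc)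
    show "str (span_reindex m \<alpha> w) A B \<in> hom E (obj (span_reindex m \<alpha> w) A) (obj (span_reindex m \<alpha> w) B)"
      if "B \<noteq> {} \<and> B \<subseteq> A \<and> A \<subseteq> {..m}" for A B
    proof -
      have "A \<noteq> {}" "B \<subseteq> {..m}" using that by auto
      then show ?thesis using that D(6)[OF im2[of B A]] by (simp add: span_reindex_sel)
    qed
    show "str (span_reindex m \<alpha> w) A B = undefined" if "\<not> (B \<noteq> {} \<and> B \<subseteq> A \<and> A \<subseteq> {..m})" for A B
      using that unfolding span_reindex_sel by (rule if_not_P)
    show "str (span_reindex m \<alpha> w) A A = Idt E (obj (span_reindex m \<alpha> w) A)" if "A \<noteq> {} \<and> A \<subseteq> {..m}" for A
      using that D(8)[OF im[of A]] by (simp add: span_reindex_sel)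
    show "str (span_reindex m \<alpha> w) B B' \<cdot>\<^bsub>E\<^esub> str (span_reindex m \<alpha> w) A B = str (span_reindex m \<alpha> w) A B'"
      if a: "B' \<noteq> {} \<and> B' \<subseteq> B \<and> B \<subseteq> A \<and> A \<subseteq> {..m}" for A B B'
    proof -
      have "\<alpha> ` B' \<noteq> {}" "\<alpha> ` B' \<subseteq> \<alpha> ` B" "\<alpha> ` B \<subseteq> \<alpha> ` A" "\<alpha> ` A \<subseteq> {..n}" using a \<alpha> by auto
      moreover have "B \<noteq> {}" "B' \<subseteq> A" "B \<subseteq> {..m}" using a by auto
      ultimately show ?thesis using a D(9)[of "\<alpha> ` B'" "\<alpha> ` B" "\<alpha> ` A"] by (simp add: span_reindex_sel)
    qed
  qed
qed

lemma span_reindex_comp: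
  assumes \<beta>: "\<And>k. k \<le> l \<Longrightarrow> \<beta> k \<le> m"
  shows "span_reindex l \<beta> (span_reindex m \<alpha> w) = span_reindex l (\<alpha> \<circ> \<beta>) w"
proof -
  have im: "(A \<noteq> {} \<and> A \<subseteq> {..l}) \<Longrightarrow> (\<beta> ` A \<noteq> {} \<and> \<beta> ` A \<subseteq> {..m})" for A using \<beta> by auto
  have im2: "(B \<noteq> {} \<and> B \<subseteq> A \<and> A \<subseteq> {..l}) \<Longrightarrow> (\<beta> ` B \<noteq> {} \<and> \<beta> ` B \<subseteq> \<beta> ` A \<and> \<beta> ` A \<subseteq> {..m})" for A B using \<beta> by auto
  have 1: "ind (span_reindex l \<beta> (span_reindex m \<alpha> w)) = ind (span_reindex l (\<alpha> \<circ> \<beta>) w)"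
  proof (rule nth_equalityI)
    fix k assume "k < length (ind (span_reindex l \<beta> (span_reindex m \<alpha> w)))"
    then have k: "k \<le> l" by (simp add: span_reindex_sel)
    then show "ind (span_reindex l \<beta> (span_reindex m \<alpha> w)) ! k = ind (span_reindex l (\<alpha> \<circ> \<beta>) w) ! k"
      using \<beta>[OF k] by (simp add: span_reindex_sel del: upt_Suc)
  qed (simp add: span_reindex_sel)
  have 2: "obj (span_reindex l \<beta> (span_reindex m \<alpha> w)) A = obj (span_reindex l (\<alpha> \<circ> \<beta>) w) A" for A
    using im[of A] by (simp add: span_reindex_sel image_comp)
  have 3: "str (span_reindex l \<beta> (span_reindex m \<alpha> w)) A B = str (span_reindex l (\<alpha> \<circ> \<beta>) w) A B" for A B
    unfolding span_reindex_sel using im2[of B A] by (simp add: image_comp)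
  show ?thesis using 1 2 3 by (simp add: prod_eq_iff fun_eq_iff)
qed

lemma span_reindex_cong:
  assumes "\<And>k. k \<le> m \<Longrightarrow> \<alpha> k = \<beta> k"
  shows "span_reindex m \<alpha> w = span_reindex m \<beta> w"
proof -
  have im: "\<alpha> ` A = \<beta> ` A" if "A \<subseteq> {..m}" for A using assms that by (intro image_cong) auto
  have 1: "ind (span_reindex m \<alpha> w) = ind (span_reindex m \<beta> w)"
    using assms by (auto simp: span_reindex_sel)
  have 2: "obj (span_reindex m \<alpha> w) A = obj (span_reindex m \<beta> w) A" for A
    using im[of A] by (simp add: span_reindex_sel)
  have 3: "str (span_reindex m \<alpha> w) A B = str (span_reindex m \<beta> w) A B" for A B
  proof (cases "B \<noteq> {} \<and> B \<subseteq> A \<and> A \<subseteq> {..m}")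
    case True
    then have "\<alpha> ` A = \<beta> ` A" "\<alpha> ` B = \<beta> ` B" by (auto intro!: im)
    then show ?thesis by (simp add: span_reindex_sel)
  next
    case False
    then show ?thesis unfolding span_reindex_sel(3) by (simp only: if_not_P if_False)
  qed
  show ?thesis using 1 2 3 by (simp add: prod_eq_iff fun_eq_iff)
qed

lemma span_reindex_id:
  assumes w: "w \<in> spans E I U C n" and \<alpha>: "\<And>k. k \<le> n \<Longrightarrow> \<alpha> k = k"
  shows "span_reindex n \<alpha> w = w"
proof (rule span_eqI[OF span_reindex_spans[OF w] w])
  show "\<alpha> k \<le> n" if "k \<le> n" for k using \<alpha>[OF that] that by simp
  show "ind (span_reindex n \<alpha> w) ! k = ind w ! k" if "k \<le> n" for k
    using \<alpha>[OF that] that by (simp add: span_reindex_sel del: upt_Suc)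
  have im: "\<alpha> ` A = A" if "A \<subseteq> {..n}" for A
  proof -
    have "\<alpha> ` A = (\<lambda>k. k) ` A" by (rule image_cong) (use \<alpha> that in auto)
    then show ?thesis by simp
  qed
  show "obj (span_reindex n \<alpha> w) A = obj w A" if "A \<noteq> {}" "A \<subseteq> {..n}" for A
    using that im[of A] by (simp add: span_reindex_sel)
  show "str (span_reindex n \<alpha> w) A B = str w A B" if "B \<noteq> {}" "B \<subseteq> A" "A \<subseteq> {..n}" for A B
    using that im[of A] im[of B] by (simp add: span_reindex_sel)
qed

text \<open>A span takes the default value outside finitely many arguments, so it is determined by
  its indices and by finite families of objects and arrows drawn from small sets.\<close>

lemma small_spans:
  fixes E :: "('o, 'a) cat" and I :: "'v set"
  assumes u: "universe (u :: 'u itself)" and I: "small u I" and C: "small u C"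
    and hom: "\<And>A B. A \<in> C \<Longrightarrow> B \<in> C \<Longrightarrow> small u (hom E A B)"
  shows "small u (spans E I U C n)"
proof -
  let ?P = "Pow {..n}"
  let ?Q = "{(A, B). B \<noteq> {} \<and> B \<subseteq> A \<and> A \<subseteq> {..n}}"
  define M where "M = (\<Union>A\<in>C. \<Union>B\<in>C. hom E A B)"
  have M: "small u M" unfolding M_def by (intro small_UN u C hom)
  have fin: "finite ?Q" by (rule finite_subset[of _ "?P \<times> ?P"]) auto
  define f where "f w = (ind w, (\<lambda>A\<in>?P - {{}}. obj w A), (\<lambda>p\<in>?Q. str w (fst p) (snd p)))" for w :: "('v, 'o, 'a) span"
  have "small u ({xs. length xs = Suc n \<and> set xs \<subseteq> I} \<times> (Pi\<^sub>E (?P - {{}}) (\<lambda>_. C)) \<times> (Pi\<^sub>E ?Q (\<lambda>_. M)))"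
    by (intro small_Times[OF u] small_lists[OF u I] small_PiE[OF u]) (use fin C M in auto)
  then show ?thesis
  proof (rule small_inj_on[rotated 2])
    show "inj_on f (spans E I U C n)"
    proof (rule inj_onI)
      fix w w' assume w: "w \<in> spans E I U C n" "w' \<in> spans E I U C n" and eq: "f w = f w'"
      then have e: "ind w = ind w'" "(\<lambda>A\<in>?P - {{}}. obj w A) = (\<lambda>A\<in>?P - {{}}. obj w' A)"
        "(\<lambda>p\<in>?Q. str w (fst p) (snd p)) = (\<lambda>p\<in>?Q. str w' (fst p) (snd p))" by (simp_all add: f_def)
      show "w = w'"
      proof (rule span_eqI[OF w])
        show "obj w A = obj w' A" if "A \<noteq> {}" "A \<subseteq> {..n}" for A
          using fun_cong[OF e(2), of A] that by simp
        show "str w A B = str w' A B" if "B \<noteq> {}" "B \<subseteq> A" "A \<subseteq> {..n}" for A B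
          using fun_cong[OF e(3), of "(A, B)"] that by simp
      qed (simp add: e)
    qed
    show "f ` spans E I U C n \<subseteq> {xs. length xs = Suc n \<and> set xs \<subseteq> I} \<times> (Pi\<^sub>E (?P - {{}}) (\<lambda>_. C)) \<times> (Pi\<^sub>E ?Q (\<lambda>_. M))"
    proof
      fix x assume "x \<in> f ` spans E I U C n"
      then obtain w where w: "w \<in> spans E I U C n" and x: "x = f w" by blast
      note D = spansD[OF w]
      have "str w A B \<in> M" if "B \<noteq> {}" "B \<subseteq> A" "A \<subseteq> {..n}" for A B
      proof -
        have "obj w A \<in> C" "obj w B \<in> C" using that by (auto intro!: D(3))
        then show ?thesis unfolding M_def using D(6)[OF that] by blast
      qed
      then have "str w A B \<in> M" if "x \<in> B" "B \<subseteq> A" "A \<subseteq> {..n}" for A B x using that by blast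
      then show "x \<in> {xs. length xs = Suc n \<and> set xs \<subseteq> I} \<times> (Pi\<^sub>E (?P - {{}}) (\<lambda>_. C)) \<times> (Pi\<^sub>E ?Q (\<lambda>_. M))"
        unfolding x f_def using D(1-3) by auto
    qed
  qed
qed

section \<open>Monotone maps and subsets\<close>

lemma coface_nth: "i \<le> n \<Longrightarrow> k < n \<Longrightarrow> coface n i ! k = (if k < i then k else Suc k)"
  by (auto simp: coface_def nth_append)

lemma coface_length: "i \<le> n \<Longrightarrow> length (coface n i) = n"
  by (simp add: coface_def)

lemma codegen_nth: "i \<le> n \<Longrightarrow> k \<le> Suc n \<Longrightarrow> codegen n i ! k = (if k \<le> i then k else k - 1)"
  by (auto simp: codegen_def nth_append simp del: upt_Suc)

lemma set_nth_image: "length \<alpha> = Suc m \<Longrightarrow> set \<alpha> = (\<lambda>k. \<alpha> ! k) ` {..m}"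
  by (auto simp: set_conv_nth less_Suc_eq_le)

lemma monotone_map_nth: "monotone_map m n \<alpha> \<Longrightarrow> k \<le> m \<Longrightarrow> \<alpha> ! k \<le> n"
  by (metis atMost_iff le_imp_less_Suc monotone_map_def nth_mem subsetD)

lemma monotone_coface: "1 \<le> n \<Longrightarrow> i \<le> n \<Longrightarrow> monotone_map (n - 1) n (coface n i)"
  by (auto simp: monotone_map_def coface_length coface_def sorted_append)

lemma monotone_codegen: "i \<le> n \<Longrightarrow> monotone_map (Suc n) n (codegen n i)"
  by (auto simp: monotone_map_def codegen_def sorted_append simp del: upt_Suc)

lemma monotone_sorted_list:
  assumes "A \<noteq> {}" "A \<subseteq> {..n}"
  shows "monotone_map (card A - 1) n (sorted_list_of_set A)"
proof -
  have "finite A" using assms finite_subset by blast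
  moreover from this have "card A > 0" using assms by (simp add: card_gt_0_iff)
  ultimately show ?thesis using assms by (simp add: monotone_map_def)
qed

text \<open>\<open>\<beta>\<close> takes positions in the increasing enumeration of A. Through it
  every simplex of a matching family with vertices in A is expressed by the one at the enumeration
  of A.\<close>

lemma sorted_list_factor:
  assumes A: "finite A" "A \<noteq> {}" and \<alpha>: "monotone_map m n \<alpha>" "set \<alpha> \<subseteq> A"
  shows "\<exists>\<beta>. monotone_map m (card A - 1) \<beta> \<and> mcomp (sorted_list_of_set A) \<beta> = \<alpha>"
proof -
  let ?s = "sorted_list_of_set A"
  have len: "length ?s = card A" by simp
  have "\<exists>p<card A. ?s ! p = x" if "x \<in> A" for x
    using that A by (metis in_set_conv_nth len set_sorted_list_of_set)
  then obtain f where f: "\<And>x. x \<in> A \<Longrightarrow> f x < card A \<and> ?s ! f x = x" by metis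
  have mono: "f x \<le> f y" if "x \<in> A" "y \<in> A" "x \<le> y" for x y
  proof (rule ccontr)
    assume "\<not> f x \<le> f y"
    then have "f y < f x" by simp
    then have "?s ! f y < ?s ! f x"
      using f[OF that(1)] strict_sorted_list_of_set[of A] len sorted_wrt_nth_less by metis
    then show False using f[OF that(1)] f[OF that(2)] that(3) by simp
  qed
  have "monotone_map m (card A - 1) (map f \<alpha>)"
    unfolding monotone_map_def
  proof (intro conjI)
    show "length (map f \<alpha>) = Suc m" using \<alpha>(1) by (simp add: monotone_map_def)
    have "sorted \<alpha>" using \<alpha>(1) by (simp add: monotone_map_def)
    then show "sorted (map f \<alpha>)"
      unfolding sorted_map by (rule sorted_wrt_mono_rel[rotated]) (use \<alpha>(2) mono in auto)
    show "set (map f \<alpha>) \<subseteq> {..card A - 1}" using \<alpha>(2) f by fastforce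
  qed
  moreover have "mcomp ?s (map f \<alpha>) = \<alpha>"
    unfolding mcomp_def map_map by (rule map_idI) (use f \<alpha>(2) in auto)
  ultimately show ?thesis by blast
qed

text \<open>Identifies the subsets of A with the subsets of \<open>{..card A - 1}\<close>, so that a
  face of the simplex at A can be addressed inside that simplex.\<close>

definition pos :: "nat set \<Rightarrow> nat set \<Rightarrow> nat set" where
  "pos A B = {p. p < card A \<and> sorted_list_of_set A ! p \<in> B}"

text \<open>\<open>\<beta>\<close> is \<open>\<alpha>\<close> written in positions of A, so images
  under \<open>\<beta>\<close> are the positions of images under \<open>\<alpha>\<close>; the
  enumeration is injective, which gives the inclusion from right to left.\<close>

lemma pos_image:
  assumes "monotone_map m (card A - 1) \<beta>" "finite A" "A \<noteq> {}" "mcomp (sorted_list_of_set A) \<beta> = \<alpha>" "S \<subseteq> {..m}"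
  shows "(\<lambda>k. \<beta> ! k) ` S = pos A ((\<lambda>k. \<alpha> ! k) ` S)"
proof -
  let ?s = "sorted_list_of_set A"
  have cA: "card A > 0" using assms by (simp add: card_gt_0_iff)
  have b: "\<beta> ! k < card A" "\<alpha> ! k = ?s ! (\<beta> ! k)" if "k \<in> S" for k
  proof -
    have k: "k \<le> m" using that assms(5) by auto
    show "\<beta> ! k < card A" using monotone_map_nth[OF assms(1) k] cA by linarith
    show "\<alpha> ! k = ?s ! (\<beta> ! k)" using k assms(1) unfolding assms(4)[symmetric] mcomp_def by (simp add: monotone_map_def)
  qed
  have inj: "p = q" if "p < card A" "q < card A" "?s ! p = ?s ! q" for p q
    using that nth_eq_iff_index_eq[of ?s p q] by simp
  show ?thesis
    unfolding pos_def using b inj by (auto simp: image_iff) (metis b inj)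
qed

lemma pos_self: "finite A \<Longrightarrow> A \<noteq> {} \<Longrightarrow> pos A A = {..card A - 1}"
proof -
  assume A: "finite A" "A \<noteq> {}"
  then have c: "card A > 0" by (simp add: card_gt_0_iff)
  have "sorted_list_of_set A ! p \<in> A" if "p < card A" for p
    using that nth_mem[of p "sorted_list_of_set A"] A by simp
  then show ?thesis unfolding pos_def using c by auto
qed

section \<open>The span refinement\<close>

text \<open>The edges of a span are its restrictions along arbitrary maps from [1], not only monotone ones,
  so that a condition on all edges is stable under every reindexing.\<close>

locale span_cover = cech_cover E u G I U R
  for E :: "('o, 'a) cat" (structure) and u :: "'u itself" and G :: "'o set"
    and I :: "'u set" and U :: "'u \<Rightarrow> 'o" and R :: "'u \<Rightarrow> 'u set" +
  fixes C :: "'o set" and Q :: "('u, 'o, 'a) span \<Rightarrow> bool"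
  assumes small_C: "small u C" and C_Ob: "A \<in> C \<Longrightarrow> A \<in> Ob E" and C_ni: "A \<in> C \<Longrightarrow> \<not> initial E A"
    and U_C: "i \<in> I \<Longrightarrow> U i \<in> C" and G_C: "G \<subseteq> C"
    and Q_degenerate: "w \<in> spans E I U C 0 \<Longrightarrow> Q (span_reindex 1 (\<lambda>_. 0) w)"
    and Q_G: "w \<in> spans E I U C 1 \<Longrightarrow> obj w {..1} \<in> G \<Longrightarrow> Q w"
begin

definition good :: "nat \<Rightarrow> ('u, 'o, 'a) span set" where
  "good n = {w \<in> spans E I U C n. \<forall>f. f 0 \<le> n \<and> f 1 \<le> n \<longrightarrow> Q (span_reindex 1 f w)}"

definition Sp :: "(('u, 'o, 'a) span, 'o, 'a) sfam" where
  "Sp = (zero_span_family E I U C)\<lparr>Ix := good\<rparr>"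

lemma Sp_simps [simp]:
  "Ix Sp = good" "ixmap Sp n \<alpha> w = span_reindex (length \<alpha> - 1) (\<lambda>k. \<alpha> ! k) w"
  "Cp Sp n w = obj w {..n}" "cpmap Sp n \<alpha> w = str w {..n} (set \<alpha>)"
  "ixop Sp n w = span_reindex n (\<lambda>k. n - k) w" "cpop Sp n w = Idt E (obj w {..n})"
  by (simp_all add: Sp_def zero_span_family_def case_prod_unfold)

lemma good_spans: "w \<in> good n \<Longrightarrow> w \<in> spans E I U C n"
  by (simp add: good_def)

lemmas goodD = spansD[OF good_spans]

lemma good_reindex:
  assumes w: "w \<in> good n" and \<alpha>: "\<And>k. k \<le> m \<Longrightarrow> \<alpha> k \<le> n"
  shows "span_reindex m \<alpha> w \<in> good m"
  unfolding good_def
proof (intro CollectI conjI allI impI)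
  show "span_reindex m \<alpha> w \<in> spans E I U C m" by (rule span_reindex_spans[OF good_spans[OF w] \<alpha>])
  fix f :: "nat \<Rightarrow> nat" assume f: "f 0 \<le> m \<and> f 1 \<le> m"
  have "span_reindex 1 f (span_reindex m \<alpha> w) = span_reindex 1 (\<alpha> \<circ> f) w"
  proof (rule span_reindex_comp)
    fix k :: nat assume "k \<le> 1"
    then have "k = 0 \<or> k = 1" by auto
    then show "f k \<le> m" using f by auto
  qed
  then show "Q (span_reindex 1 f (span_reindex m \<alpha> w))" using w \<alpha> f by (simp add: good_def)
qed

lemma reindex_monotone:
  assumes "monotone_map m n \<alpha>" "w \<in> good n"
  shows "ixmap Sp n \<alpha> w = span_reindex m (\<lambda>k. \<alpha> ! k) w" "ixmap Sp n \<alpha> w \<in> good m"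
    "obj (ixmap Sp n \<alpha> w) {..m} = obj w (set \<alpha>)" "set \<alpha> \<noteq> {}" "set \<alpha> \<subseteq> {..n}"
proof -
  have len: "length \<alpha> = Suc m" using assms(1) by (simp add: monotone_map_def)
  show 1: "ixmap Sp n \<alpha> w = span_reindex m (\<lambda>k. \<alpha> ! k) w" using len by simp
  show "ixmap Sp n \<alpha> w \<in> good m"
    unfolding 1 by (rule good_reindex[OF assms(2)]) (rule monotone_map_nth[OF assms(1)])
  show "obj (ixmap Sp n \<alpha> w) {..m} = obj w (set \<alpha>)"
    unfolding 1 by (simp add: span_reindex_sel set_nth_image[OF len])
  show "set \<alpha> \<noteq> {}" "set \<alpha> \<subseteq> {..n}" using assms(1) by (auto simp: monotone_map_def)
qed

lemma mcomp_nth: "monotone_map l m \<beta> \<Longrightarrow> k \<le> l \<Longrightarrow> mcomp \<alpha> \<beta> ! k = \<alpha> ! (\<beta> ! k)"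
  by (simp add: mcomp_def monotone_map_def)

lemma Sp_simplicial: "simplicial_family E TYPE('u) Sp"
  unfolding simplicial_family_def simplicial_set_def
proof (intro conjI allI ballI impI)
  fix n
  have "small u (spans E I U C n)"
    by (rule small_spans[OF universe small_I small_C]) (auto intro: small_hom C_Ob)
  then have "small u (good n)" by (rule small_subset) (auto simp: good_def)
  then show "small TYPE('u) (Ix Sp n)" using small_cong_itself[of u "good n"] by simp
next
  fix m n \<alpha> assume a: "monotone_map m n \<alpha>"
  show "ixmap Sp n \<alpha> \<in> Ix Sp n \<rightarrow> Ix Sp m"
  proof
    fix w assume "w \<in> Ix Sp n"
    then show "ixmap Sp n \<alpha> w \<in> Ix Sp m" using reindex_monotone(2)[OF a] by simp
  qed
next
  fix n w assume "w \<in> Ix Sp n"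
  then have w: "w \<in> good n" by simp
  show "ixmap Sp n [0..<Suc n] w = w"
    using span_reindex_id[OF good_spans[OF w], of "\<lambda>k. [0..<Suc n] ! k"] by (simp del: upt_Suc)
  show "cpmap Sp n [0..<Suc n] w = Idt E (Cp Sp n w)"
    using goodD(8)[OF w, of "{..n}"] by (simp add: atLeast0LessThan lessThan_Suc_atMost del: upt_Suc)
  have "Cp Sp n w \<in> C" using goodD(3)[OF w, of "{..n}"] by simp
  then show "Cp Sp n w \<in> Ob E" "\<not> initial E (Cp Sp n w)" using C_Ob C_ni by blast+
next
  fix l m n \<alpha> \<beta> w assume ab: "monotone_map m n \<alpha> \<and> monotone_map l m \<beta>" and "w \<in> Ix Sp n"
  then have w: "w \<in> good n" and a: "monotone_map m n \<alpha>" and b: "monotone_map l m \<beta>" by simp_all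
  note mc = monotone_map_mcomp[OF a b]
  have "span_reindex l (\<lambda>k. \<beta> ! k) (span_reindex m (\<lambda>k. \<alpha> ! k) w) = span_reindex l ((\<lambda>k. \<alpha> ! k) \<circ> (\<lambda>k. \<beta> ! k)) w"
    by (rule span_reindex_comp) (rule monotone_map_nth[OF b])
  also have "\<dots> = span_reindex l (\<lambda>k. mcomp \<alpha> \<beta> ! k) w"
    by (rule span_reindex_cong) (simp add: mcomp_nth[OF b])
  finally show "ixmap Sp m \<beta> (ixmap Sp n \<alpha> w) = ixmap Sp n (mcomp \<alpha> \<beta>) w"
    unfolding reindex_monotone(1)[OF a w] reindex_monotone(1)[OF mc w]
      reindex_monotone(1)[OF b reindex_monotone(2)[OF a w, unfolded reindex_monotone(1)[OF a w]]] .
next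
  fix m n \<alpha> w assume a: "monotone_map m n \<alpha>" and "w \<in> Ix Sp n"
  then have w: "w \<in> good n" by simp
  note r = reindex_monotone[OF a w]
  have "str w {..n} (set \<alpha>) \<in> hom E (obj w {..n}) (obj w (set \<alpha>))" by (rule goodD(6)[OF w r(4,5)]) simp
  then show "cpmap Sp n \<alpha> w \<in> hom E (Cp Sp n w) (Cp Sp m (ixmap Sp n \<alpha> w))"
    using r(3) by simp
next
  fix l m n \<alpha> \<beta> w assume ab: "monotone_map m n \<alpha> \<and> monotone_map l m \<beta>" and "w \<in> Ix Sp n"
  then have w: "w \<in> good n" and a: "monotone_map m n \<alpha>" and b: "monotone_map l m \<beta>" by simp_all
  note r = reindex_monotone[OF a w] and rb = reindex_monotone[OF b reindex_monotone(2)[OF a w]]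
  have len: "length \<alpha> = Suc m" using a by (simp add: monotone_map_def)
  have sm: "set (mcomp \<alpha> \<beta>) = (\<lambda>k. \<alpha> ! k) ` set \<beta>" by (simp add: mcomp_def)
  have "str (ixmap Sp n \<alpha> w) {..m} (set \<beta>) = str w (set \<alpha>) (set (mcomp \<alpha> \<beta>))"
    unfolding r(1) span_reindex_sel using rb(4,5) by (simp add: sm set_nth_image[OF len])
  moreover have "str w (set \<alpha>) (set (mcomp \<alpha> \<beta>)) \<cdot> str w {..n} (set \<alpha>) = str w {..n} (set (mcomp \<alpha> \<beta>))"
  proof (rule goodD(9)[OF w])
    show "set (mcomp \<alpha> \<beta>) \<subseteq> set \<alpha>" unfolding sm set_nth_image[OF len] using rb(5) by auto
  qed (use r rb sm in auto)
  ultimately show "cpmap Sp m \<beta> (ixmap Sp n \<alpha> w) \<cdot> cpmap Sp n \<alpha> w = cpmap Sp n (mcomp \<alpha> \<beta>) w"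
    by simp
qed

text \<open>Reversal satisfies \<open>n - coface n i ! k = coface n (n - i) ! (n - 1 - k)\<close>,
  and similarly for degeneracies; the index identities follow by composing reindexings. As reversal
  maps [n] onto itself, the top object is unchanged, so identities can serve as the duality on
  components.\<close>

lemma Sp_self_dual: "self_dual E Sp"
  unfolding self_dual_def
proof (intro conjI allI impI ballI)
  have op_good: "ixop Sp n w \<in> good n" if "w \<in> good n" for n w
    using good_reindex[OF that, of n "\<lambda>k. n - k"] by simp
  have op_op: "ixop Sp n (ixop Sp n w) = w" if w: "w \<in> good n" for n w
  proof -
    have "span_reindex n (\<lambda>k. n - k) (span_reindex n (\<lambda>k. n - k) w) = span_reindex n ((\<lambda>k. n - k) \<circ> (\<lambda>k. n - k)) w"
      by (rule span_reindex_comp) simp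
    also have "\<dots> = w" by (rule span_reindex_id[OF good_spans[OF w]]) simp
    finally show ?thesis by simp
  qed
  show "bij_betw (ixop Sp n) (Ix Sp n) (Ix Sp n)" for n
    by (rule bij_betw_byWitness[where f' = "ixop Sp n"]) (use op_good op_op in auto)
  have rev: "(\<lambda>k. n - k) ` {..n} = {..n}" for n :: nat
  proof
    show "{..n} \<subseteq> (\<lambda>k. n - k) ` {..n}"
    proof
      fix x assume "x \<in> {..n}"
      then show "x \<in> (\<lambda>k. n - k) ` {..n}" by (intro image_eqI[of _ _ "n - x"]) auto
    qed
  qed auto
  have obj_op: "obj (ixop Sp n w) {..n} = obj w {..n}" for n w by (simp add: span_reindex_sel rev)
  have CO: "obj w {..n} \<in> Ob E" if "w \<in> good n" for n w using goodD(3)[OF that, of "{..n}"] C_Ob by simp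
  fix n w assume w0: "w \<in> Ix Sp n"
  show "cpop Sp n w \<in> hom E (Cp Sp n w) (Cp Sp n (ixop Sp n w))"
    using CO[of w n] w0 obj_op[of n w] by simp
  show "iso E (cpop Sp n w)" using CO[of w n] w0 by (simp add: iso_Idt)
next
  fix w assume "w \<in> Ix Sp 0"
  then have w: "w \<in> good 0" by simp
  show "ixop Sp 0 w = w" using span_reindex_id[OF good_spans[OF w], of "\<lambda>k. 0 - k"] by simp
  show "cpop Sp 0 w = Idt E (Cp Sp 0 w)" by simp
next
  fix n i w assume ni: "1 \<le> n \<and> i \<le> n" and "w \<in> Ix Sp n"
  then have w: "w \<in> good n" by simp
  have n: "Suc (n - 1) = n" "i \<le> n" "n - i \<le> n" "1 \<le> n" using ni by auto
  let ?c = "\<lambda>k. coface n i ! k" and ?c' = "\<lambda>k. coface n (n - i) ! k"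
  have pw: "n - ?c k = ?c' (n - 1 - k)" if "k \<le> n - 1" for k
    using that n by (auto simp: coface_nth)
  note m = monotone_coface[OF n(4,2)] and m' = monotone_coface[OF n(4,3)]
  have opw: "ixop Sp n w \<in> good n" using good_reindex[OF w, of n "\<lambda>k. n - k"] by simp
  have "fc Sp n i (ixop Sp n w) = span_reindex (n - 1) ?c (span_reindex n (\<lambda>k. n - k) w)"
    unfolding fc_def reindex_monotone(1)[OF m opw] by simp
  also have "\<dots> = span_reindex (n - 1) ((\<lambda>k. n - k) \<circ> ?c) w"
    by (rule span_reindex_comp) (rule monotone_map_nth[OF m])
  also have "\<dots> = span_reindex (n - 1) (?c' \<circ> (\<lambda>k. n - 1 - k)) w"
    by (rule span_reindex_cong) (use pw in simp)
  also have "\<dots> = span_reindex (n - 1) (\<lambda>k. n - 1 - k) (span_reindex (n - 1) ?c' w)"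
    by (rule span_reindex_comp[symmetric]) simp
  also have "\<dots> = ixop Sp (n - 1) (fc Sp n (n - i) w)"
    unfolding fc_def reindex_monotone(1)[OF m' w] by simp
  finally show "fc Sp n i (ixop Sp n w) = ixop Sp (n - 1) (fc Sp n (n - i) w)" .
  have rev: "(\<lambda>k. n - k) ` {..n} = {..n}" for n :: nat
  proof
    show "{..n} \<subseteq> (\<lambda>k. n - k) ` {..n}"
    proof
      fix x assume "x \<in> {..n}"
      then show "x \<in> (\<lambda>k. n - k) ` {..n}" by (intro image_eqI[of _ _ "n - x"]) auto
    qed
  qed auto
  have lc: "length (coface n i) = Suc (n - 1)" "length (coface n (n - i)) = Suc (n - 1)"
    using n by (simp_all add: coface_length)
  have sets: "(\<lambda>k. n - k) ` set (coface n i) = set (coface n (n - i))"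
  proof -
    have "(\<lambda>k. n - k) ` set (coface n i) = (\<lambda>k. n - ?c k) ` {..n - 1}"
      unfolding set_nth_image[OF lc(1)] image_image ..
    also have "\<dots> = (\<lambda>k. ?c' (n - 1 - k)) ` {..n - 1}" by (rule image_cong) (use pw in auto)
    also have "\<dots> = ?c' ` ((\<lambda>k. n - 1 - k) ` {..n - 1})" by (simp add: image_image)
    also have "\<dots> = set (coface n (n - i))" unfolding rev set_nth_image[OF lc(2)] ..
    finally show ?thesis .
  qed
  note r = reindex_monotone[OF m opw] and r' = reindex_monotone[OF m' w]
  have op_str: "str (ixop Sp n w) {..n} (set (coface n i)) = str w {..n} (set (coface n (n - i)))"
    using r(4,5) by (simp add: span_reindex_sel rev sets)
  have ty: "str w {..n} (set (coface n (n - i))) \<in> hom E (obj w {..n}) (obj w (set (coface n (n - i))))"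
    by (rule goodD(6)[OF w r'(4,5)]) simp
  then show "cfc Sp n i (ixop Sp n w) \<cdot> cpop Sp n w = cpop Sp (n - 1) (fc Sp n (n - i) w) \<cdot> cfc Sp n (n - i) w"
    using op_str r'(3) unfolding cfc_def fc_def by simp
next
  fix n i w assume ni: "1 \<le> n \<and> i \<le> n - 1" and "w \<in> Ix Sp (n - 1)"
  then have w: "w \<in> good (n - 1)" by simp
  define N where "N = n - 1"
  have n: "n = Suc N" "i \<le> N" "N - i \<le> N" using ni by (auto simp: N_def)
  note w = w[folded N_def]
  let ?c = "\<lambda>k. codegen N i ! k" and ?c' = "\<lambda>k. codegen N (N - i) ! k"
  have pw: "N - ?c k = ?c' (n - k)" if "k \<le> n" for k
    using that n by (auto simp: codegen_nth)
  note m = monotone_codegen[OF n(2)] and m' = monotone_codegen[OF n(3)]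
  have opw: "ixop Sp N w \<in> good N" using good_reindex[OF w, of N "\<lambda>k. N - k"] by simp
  have "dg Sp N i (ixop Sp N w) = span_reindex n ?c (span_reindex N (\<lambda>k. N - k) w)"
    unfolding dg_def reindex_monotone(1)[OF m opw] n by simp
  also have "\<dots> = span_reindex n ((\<lambda>k. N - k) \<circ> ?c) w"
    by (rule span_reindex_comp) (use monotone_map_nth[OF m] n in simp)
  also have "\<dots> = span_reindex n (?c' \<circ> (\<lambda>k. n - k)) w"
    by (rule span_reindex_cong) (use pw in simp)
  also have "\<dots> = span_reindex n (\<lambda>k. n - k) (span_reindex n ?c' w)"
    by (rule span_reindex_comp[symmetric]) simp
  also have "\<dots> = ixop Sp n (dg Sp N (N - i) w)"
    unfolding dg_def reindex_monotone(1)[OF m' w] n by simp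
  finally show "dg Sp (n - 1) i (ixop Sp (n - 1) w) = ixop Sp n (dg Sp (n - 1) (n - 1 - i) w)"
    unfolding N_def .
  have full: "set (codegen N j) = {..N}" if "j \<le> N" for j
    using that by (auto simp: codegen_def)
  have "str w {..N} {..N} = Idt E (obj w {..N})" by (rule goodD(8)[OF w]) auto
  moreover have "(\<lambda>k. N - k) ` {..N} = {..N}"
  proof
    show "{..N} \<subseteq> (\<lambda>k. N - k) ` {..N}"
    proof
      fix x assume "x \<in> {..N}"
      then show "x \<in> (\<lambda>k. N - k) ` {..N}" by (intro image_eqI[of _ _ "N - x"]) auto
    qed
  qed auto
  moreover note reindex_monotone(3)[OF m' w]
  ultimately show "cdg Sp (n - 1) i (ixop Sp (n - 1) w) \<cdot> cpop Sp (n - 1) w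
          = cpop Sp n (dg Sp (n - 1) (n - 1 - i) w) \<cdot> cdg Sp (n - 1) (n - 1 - i) w"
    unfolding N_def[symmetric] cdg_def dg_def using n full[OF n(2)] full[OF n(3)]
    by (simp add: span_reindex_sel)
qed

text \<open>The map with values 0, 1, 0 folds [2] onto [1] and is not monotone; the folded span is
  good because \<open>good\<close> is stable under arbitrary reindexing. Its face without the middle
  vertex is degenerate, whence the equality of the end point maps.\<close>

lemma Sp_condition_G: "condition_G Sp"
  unfolding condition_G_def
proof
  fix e assume "e \<in> Ix Sp 1"
  then have e: "e \<in> good 1" by simp
  let ?f = "\<lambda>k :: nat. if k = 1 then 1 else 0 :: nat"
  define w where "w = span_reindex 2 ?f e"
  have w: "w \<in> good 2" unfolding w_def by (rule good_reindex[OF e]) simp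
  have r: "span_reindex 1 (\<lambda>k. [a, b] ! k) w = span_reindex 1 (\<lambda>k. ?f ([a, b] ! k)) e" if "a \<le> 2" "b \<le> 2" for a b :: nat
  proof -
    have "span_reindex 1 (\<lambda>k. [a, b] ! k) w = span_reindex 1 (?f \<circ> (\<lambda>k. [a, b] ! k)) e"
      unfolding w_def by (rule span_reindex_comp) (use that in \<open>auto simp: le_Suc_eq\<close>)
    then show ?thesis by (simp add: comp_def)
  qed
  have v: "?f ([0, 1] ! k) = k" "?f ([1, 2] ! k) = 1 - k" "?f ([0, 2] ! k) = 0" if "k \<le> 1" for k
    using that by (auto simp: le_Suc_eq)
  have len: "length [a, b] - 1 = 1" for a b :: nat by simp
  have 2: "fc Sp 2 2 w = e"
    unfolding fc_eq Sp_simps len r[OF zero_le one_le_numeral] by (rule span_reindex_id[OF good_spans[OF e] v(1)])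
  have 0: "fc Sp 2 0 w = ixop Sp 1 e"
    unfolding fc_eq Sp_simps len r[OF one_le_numeral order_refl] by (rule span_reindex_cong[OF v(2)])
  have "fc Sp 2 1 w = span_reindex 1 (\<lambda>k. 0) e"
    unfolding fc_eq Sp_simps len r[OF zero_le order_refl] by (rule span_reindex_cong[OF v(3)])
  then have "cfc Sp 1 1 (fc Sp 2 1 w) = cfc Sp 1 0 (fc Sp 2 1 w)"
    unfolding cfc_eq by (simp add: span_reindex_sel)
  with 2 0 w show "\<exists>w\<in>Ix Sp 2. fc Sp 2 2 w = e \<and> fc Sp 2 0 w = ixop Sp 1 e \<and>
      cfc Sp 1 1 (fc Sp 2 1 w) = cfc Sp 1 0 (fc Sp 2 1 w)"
    by auto
qed

text \<open>Every map from [1] to [0] is constant, so the edges of a 0-span are degenerate, and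
  \<open>Q_degenerate\<close> admits them.\<close>

lemma good_0: "good 0 = spans E I U C 0"
proof
  show "spans E I U C 0 \<subseteq> good 0"
  proof
    fix w assume w: "w \<in> spans E I U C 0"
    have "Q (span_reindex 1 f w)" if "f 0 \<le> 0 \<and> f 1 \<le> 0" for f :: "nat \<Rightarrow> nat"
    proof -
      have "span_reindex 1 f w = span_reindex 1 (\<lambda>_. 0) w"
        by (rule span_reindex_cong) (use that in \<open>auto simp: le_Suc_eq\<close>)
      then show ?thesis using Q_degenerate[OF w] by simp
    qed
    then show "w \<in> good 0" using w by (simp add: good_def)
  qed
qed (auto simp: good_def)

lemma span_vertex_bij: "bij_betw span_vertex (Ix Sp 0) I"
  unfolding Sp_simps good_0 bij_betw_def
proof (intro conjI)
  have ne: "A \<noteq> {} \<and> A \<subseteq> {..0::nat} \<longleftrightarrow> A = {0}" for A by auto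
  have v: "span_vertex w = ind w ! 0" if "w \<in> spans E I U C 0" for w
    using spansD(1)[OF that] by (cases "ind w") (auto simp: span_vertex_def case_prod_unfold)
  show "inj_on span_vertex (spans E I U C 0)"
  proof (rule inj_onI)
    fix w w' assume w: "w \<in> spans E I U C 0" "w' \<in> spans E I U C 0" and eq: "span_vertex w = span_vertex w'"
    show "w = w'"
    proof (rule span_eqI[OF w])
      show i: "ind w ! k = ind w' ! k" if "k \<le> 0" for k using eq v w that by simp
      show o: "obj w A = obj w' A" if "A \<noteq> {}" "A \<subseteq> {..0}" for A
        using that ne[of A] spansD(5)[OF w(1), of 0] spansD(5)[OF w(2), of 0] i[of 0] by auto
      show "str w A B = str w' A B" if "B \<noteq> {}" "B \<subseteq> A" "A \<subseteq> {..0}" for A B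
      proof -
        have "A = {0}" "B = {0}" using that by auto
        then show ?thesis using spansD(8)[OF w(1), of "{0}"] spansD(8)[OF w(2), of "{0}"] o[of "{0}"] by simp
      qed
    qed
  qed
  show "span_vertex ` spans E I U C 0 = I"
  proof
    show "span_vertex ` spans E I U C 0 \<subseteq> I"
    proof clarify
      fix i D d assume "(i, D, d) \<in> spans E I U C 0"
      from spansD(1,2)[OF this] show "span_vertex (i, D, d) \<in> I"
        by (cases i) (auto simp: span_vertex_def)
    qed
    show "I \<subseteq> span_vertex ` spans E I U C 0"
    proof
      fix i assume i: "i \<in> I"
      define D :: "nat set \<Rightarrow> 'o" where "D A = (if A = {0} then U i else undefined)" for A
      define d :: "nat set \<Rightarrow> nat set \<Rightarrow> 'a"
        where "d A B = (if A = {0} \<and> B = {0} then Idt E (U i) else undefined)" for A B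
      have D0: "D {0} = U i" "d {0} {0} = Idt E (U i)" by (simp_all add: D_def d_def)
      have ne2: "B \<noteq> {} \<and> B \<subseteq> A \<and> A \<subseteq> {..0} \<longleftrightarrow> A = {0} \<and> B = {0}" for A B :: "nat set" by auto
      have ne3: "B' \<noteq> {} \<and> B' \<subseteq> B \<and> B \<subseteq> A \<and> A \<subseteq> {..0} \<longleftrightarrow> A = {0} \<and> B = {0} \<and> B' = {0}" for A B B' :: "nat set" by auto
      have "([i], D, d) \<in> spans E I U C 0"
        unfolding spans_iff ne ne2 ne3 fst_conv snd_conv
      proof (intro conjI allI impI)
        show "D {k} = U ([i] ! k)" if "k \<le> 0" for k using that D0 by simp
        show "D A = undefined" if "A \<noteq> {0}" for A using that by (simp add: D_def)
        show "d A B = undefined" if "\<not> (A = {0} \<and> B = {0})" for A B using that unfolding d_def by (rule if_not_P)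
      qed (use i U_C[OF i] D0 in auto)
      moreover have "span_vertex ([i], D, d) = i" by (simp add: span_vertex_def)
      ultimately show "i \<in> span_vertex ` spans E I U C 0" by (intro image_eqI) auto
    qed
  qed
qed

lemma span_vertex_Cp:
  assumes "w \<in> Ix Sp 0"
  shows "Cp Sp 0 w = U (span_vertex w)"
proof -
  have w: "w \<in> spans E I U C 0" using assms by (simp add: good_0)
  have "span_vertex w = ind w ! 0"
    using spansD(1)[OF w] by (cases "ind w") (auto simp: span_vertex_def case_prod_unfold)
  then show ?thesis using spansD(5)[OF w, of 0] by simp
qed

end

lemma pos_mono: "B \<subseteq> B' \<Longrightarrow> pos A B \<subseteq> pos A B'"
  by (auto simp: pos_def)

lemma pos_subset: "A \<noteq> {} \<Longrightarrow> finite A \<Longrightarrow> pos A B \<subseteq> {..card A - 1}"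
  by (auto simp: pos_def)

lemma nth_pos:
  assumes "finite A" "B \<subseteq> A"
  shows "(\<lambda>p. sorted_list_of_set A ! p) ` pos A B = B"
proof
  show "B \<subseteq> (\<lambda>p. sorted_list_of_set A ! p) ` pos A B"
  proof
    fix b assume b: "b \<in> B"
    then have "b \<in> set (sorted_list_of_set A)" using assms by auto
    then obtain p where "p < card A" "sorted_list_of_set A ! p = b" by (auto simp: in_set_conv_nth)
    then show "b \<in> (\<lambda>p. sorted_list_of_set A ! p) ` pos A B" using b by (auto simp: pos_def)
  qed
qed (auto simp: pos_def)

lemma pos_nonempty: "finite A \<Longrightarrow> B \<subseteq> A \<Longrightarrow> B \<noteq> {} \<Longrightarrow> pos A B \<noteq> {}"
  using nth_pos[of A B] by auto

context span_cover
begin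

text \<open>A matching family over \<open>V\<close> is a span with the value at the full set \<open>[k]\<close> missing; the filler
  takes \<open>V\<close> as that value. The simplex at a subset \<open>A\<close> is read off at the increasing enumeration
  of \<open>A\<close>, whose elements \<open>pos A B\<close> are the positions of those of \<open>B\<close>.\<close>

lemma Sp_fill:
  assumes V: "V \<in> G" and k: "1 \<le> k" and Y: "matching Sp V k Y"
  shows "\<exists>y\<in>sel Sp V k. \<forall>m \<alpha>. m < k \<and> monotone_map m k \<alpha> \<longrightarrow> sact Sp k \<alpha> y = Y \<alpha>"
proof -
  define W where "W A = fst (Y (sorted_list_of_set A))" for A
  define X where "X A = snd (Y (sorted_list_of_set A))" for A
  define c where "c A = card A - 1" for A :: "nat set"
  define face where "face A \<longleftrightarrow> A \<noteq> {} \<and> A \<subseteq> {..k} \<and> A \<noteq> {..k}" for A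
  have fin: "finite A" if "face A" for A using that finite_subset unfolding face_def by blast
  have faceD: "A \<noteq> {}" "A \<subseteq> {..k}" "finite A" if "face A" for A using that fin by (auto simp: face_def)
  have mono: "monotone_map (c A) k (sorted_list_of_set A)" if "face A" for A
    unfolding c_def by (rule monotone_sorted_list[OF faceD(1,2)[OF that]])
  have ck: "c A < k" if "face A" for A
  proof -
    have "card A < card {..k}" by (rule psubset_card_mono) (use that in \<open>auto simp: face_def\<close>)
    moreover have "card A > 0" using faceD[OF that] by (simp add: card_gt_0_iff)
    ultimately show ?thesis by (simp add: c_def)
  qed
  have Ysel: "Y \<alpha> \<in> sel Sp V m" if "m < k" "monotone_map m k \<alpha>" for m \<alpha> using Y that by (simp add: matching_def)
  have W: "W A \<in> good (c A)" and X: "X A \<in> hom E V (obj (W A) {..c A})" if "face A" for A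
    using selD[OF Ysel[OF ck[OF that] mono[OF that]]] by (simp_all add: W_def X_def)
  have sub: "face B" if "face A" "B \<subseteq> A" "B \<noteq> {}" for A B using that by (auto simp: face_def)
  \<comment> \<open>Every simplex of the family with vertices in a proper face A is a reindexing of
    the one at A, along \<open>\<alpha>\<close> written in positions of A.\<close>
  have F2: "\<exists>\<beta>. monotone_map m (c A) \<beta> \<and> mcomp (sorted_list_of_set A) \<beta> = \<alpha> \<and>
      fst (Y \<alpha>) = span_reindex m (\<lambda>p. \<beta> ! p) (W A) \<and> snd (Y \<alpha>) = str (W A) {..c A} (set \<beta>) \<cdot> X A \<and>
      (\<forall>S. S \<subseteq> {..m} \<longrightarrow> (\<lambda>p. \<beta> ! p) ` S = pos A ((\<lambda>p. \<alpha> ! p) ` S))"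
    if A: "face A" and m: "m < k" "monotone_map m k \<alpha>" "set \<alpha> \<subseteq> A" for A m \<alpha>
  proof -
    obtain \<beta> where b: "monotone_map m (c A) \<beta>" "mcomp (sorted_list_of_set A) \<beta> = \<alpha>"
      using sorted_list_factor[OF faceD(3,1)[OF A] m(2,3)] unfolding c_def by blast
    have "sact Sp (c A) \<beta> (Y (sorted_list_of_set A)) = Y \<alpha>"
      using Y ck[OF A] m mono[OF A] b unfolding matching_def by blast
    then have "Y \<alpha> = (ixmap Sp (c A) \<beta> (W A), cpmap Sp (c A) \<beta> (W A) \<cdot> X A)"
      unfolding sact_def W_def X_def by simp
    moreover note reindex_monotone(1)[OF b(1) W[OF A]]
    moreover have "(\<lambda>p. \<beta> ! p) ` S = pos A ((\<lambda>p. \<alpha> ! p) ` S)" if "S \<subseteq> {..m}" for S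
      by (rule pos_image[OF b(1)[unfolded c_def] faceD(3,1)[OF A] b(2) that])
    ultimately show ?thesis using b by (intro exI[of _ \<beta>]) simp
  qed
  have enum: "(\<lambda>p. sorted_list_of_set B ! p) ` {..c B} = B" if "face B" for B
    using nth_pos[OF faceD(3)[OF that] order_refl] pos_self[OF faceD(3,1)[OF that]] by (simp add: c_def)
  \<comment> \<open>For \<open>B \<subseteq> A\<close> the simplex at B is the face of the simplex
    at A on the positions \<open>pos A B\<close>. The three equations make \<open>d\<close> below
    well typed, functorial among proper faces, and functorial at the top.\<close>
  have F3: "obj (W B) {..c B} = obj (W A) (pos A B)"
    "B' \<subseteq> B \<Longrightarrow> B' \<noteq> {} \<Longrightarrow> str (W B) {..c B} (pos B B') = str (W A) (pos A B) (pos A B')"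
    "X B = str (W A) {..c A} (pos A B) \<cdot> X A"
    if A: "face A" and B: "B \<subseteq> A" "B \<noteq> {}" for A B B'
  proof -
    note fB = sub[OF A B]
    have sB: "set (sorted_list_of_set B) \<subseteq> A" using B faceD(3)[OF fB] by simp
    from F2[OF A ck[OF fB] mono[OF fB] sB]
    obtain \<beta> where b: "monotone_map (c B) (c A) \<beta>"
      and w: "W B = span_reindex (c B) (\<lambda>p. \<beta> ! p) (W A)" and x: "X B = str (W A) {..c A} (set \<beta>) \<cdot> X A"
      and im: "\<And>S. S \<subseteq> {..c B} \<Longrightarrow> (\<lambda>p. \<beta> ! p) ` S = pos A ((\<lambda>p. sorted_list_of_set B ! p) ` S)"
      unfolding W_def[symmetric] X_def[symmetric] by blast
    have full: "(\<lambda>p. \<beta> ! p) ` {..c B} = pos A B" using im[OF order_refl] enum[OF fB] by simp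
    have "length \<beta> = Suc (c B)" using b by (simp add: monotone_map_def)
    from set_nth_image[OF this] have sb: "set \<beta> = pos A B" using full by simp
    show "obj (W B) {..c B} = obj (W A) (pos A B)" unfolding w span_reindex_sel using full by simp
    show "X B = str (W A) {..c A} (pos A B) \<cdot> X A" unfolding x sb ..
    show "str (W B) {..c B} (pos B B') = str (W A) (pos A B) (pos A B')" if B': "B' \<subseteq> B" "B' \<noteq> {}"
    proof -
      have p: "pos B B' \<subseteq> {..c B}" "pos B B' \<noteq> {}"
        using pos_subset[OF faceD(1,3)[OF fB]] pos_nonempty[OF faceD(3)[OF fB] B'] by (simp_all add: c_def)
      have "(\<lambda>p. \<beta> ! p) ` pos B B' = pos A B'" using im[OF p(1)] nth_pos[OF faceD(3)[OF fB] B'(1)] by simp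
      then show ?thesis unfolding w span_reindex_sel using p full by simp
    qed
  qed
  have pp: "pos A B \<noteq> {}" "pos A B \<subseteq> {..c A}" if "face A" "B \<subseteq> A" "B \<noteq> {}" for A B
    using pos_nonempty[OF faceD(3)[OF that(1)] that(2,3)] pos_subset[OF faceD(1,3)[OF that(1)]]
    by (simp_all add: c_def)
  define vs where "vs = map (\<lambda>j. ind (W {j}) ! 0) [0..<Suc k]"
  define D where "D A = (if A = {..k} then V else if face A then obj (W A) {..c A} else undefined)" for A
  define d where "d A B = (if B \<noteq> {} \<and> B \<subseteq> A \<and> A \<subseteq> {..k} then
     if A = {..k} then if B = {..k} then Idt E V else X B else str (W A) {..c A} (pos A B) else undefined)" for A B
  define w where "w = (vs, D, d)"
  have Dface: "D A = obj (W A) {..c A}" "A \<noteq> {..k}" if "face A" for A using that by (auto simp: D_def face_def)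
  have Dfull: "D {..k} = V" by (simp add: D_def)
  have dface: "d A B = str (W A) {..c A} (pos A B)" if "face A" "B \<subseteq> A" "B \<noteq> {}" for A B
    using that by (simp add: d_def face_def)
  have dtop: "d {..k} B = X B" if "face B" for B using that by (simp add: d_def face_def)
  have dfull: "d {..k} {..k} = Idt E V" by (simp add: d_def)
  have cases: "A = {..k} \<or> face A" if "A \<noteq> {}" "A \<subseteq> {..k}" for A using that by (auto simp: face_def)
  have single: "face {j}" if "j \<le> k" for j
  proof -
    have "{j} \<noteq> {..k}"
    proof
      assume "{j} = {..k}"
      then have "card {j} = card {..k}" by simp
      then show False using k by simp
    qed
    then show ?thesis using that by (simp add: face_def)
  qed
  have c1: "c {j} = 0" for j by (simp add: c_def)
  have VO: "V \<in> C" using V G_C by blast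
  have ws: "w \<in> spans E I U C k"
    unfolding w_def spans_iff fst_conv snd_conv
  proof (intro conjI allI impI)
    show "length vs = Suc k" by (simp add: vs_def)
    show "set vs \<subseteq> I"
    proof
      fix i assume "i \<in> set vs"
      then obtain j where j: "j \<le> k" "i = ind (W {j}) ! 0" by (auto simp: vs_def less_Suc_eq_le simp del: upt_Suc)
      note g = W[OF single[OF j(1)], unfolded c1]
      have "i \<in> set (ind (W {j}))" using goodD(1)[OF g] j(2) by simp
      then show "i \<in> I" using goodD(2)[OF g] by blast
    qed
    show "D A \<in> C" if "A \<noteq> {} \<and> A \<subseteq> {..k}" for A
      using cases[of A] that VO Dfull Dface(1)[of A] goodD(3)[OF W, of A "{..c A}"] by auto
    show "D A = undefined" if "\<not> (A \<noteq> {} \<and> A \<subseteq> {..k})" for A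
      using that by (auto simp: D_def face_def)
    show "D {j} = U (vs ! j)" if j: "j \<le> k" for j
    proof -
      have "vs ! j = ind (W {j}) ! 0" using j by (simp add: vs_def del: upt_Suc)
      moreover have "D {j} = obj (W {j}) {0}" using Dface(1)[OF single[OF j]] by (simp add: c1)
      moreover have "obj (W {j}) {0} = U (ind (W {j}) ! 0)" by (rule goodD(5)[OF W[OF single[OF j], unfolded c1]]) simp
      ultimately show ?thesis by simp
    qed
    show "d A B \<in> hom E (D A) (D B)" if AB: "B \<noteq> {} \<and> B \<subseteq> A \<and> A \<subseteq> {..k}" for A B
    proof (cases "A = {..k}")
      case True
      show ?thesis
      proof (cases "B = {..k}")
        case True
        then show ?thesis using \<open>A = {..k}\<close> V by (simp add: dfull Dfull)
      next
        case False
        then have "face B" using AB True by (auto simp: face_def)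
        then show ?thesis using X[of B] Dface(1)[of B] dtop[of B] Dfull True by simp
      qed
    next
      case False
      then have A: "face A" using AB by (auto simp: face_def)
      have B: "B \<subseteq> A" "B \<noteq> {}" using AB by auto
      have "str (W A) {..c A} (pos A B) \<in> hom E (obj (W A) {..c A}) (obj (W A) (pos A B))"
        by (rule goodD(6)[OF W[OF A] pp[OF A B] order_refl])
      then show ?thesis unfolding dface[OF A B] Dface(1)[OF A] Dface(1)[OF sub[OF A B]] F3(1)[OF A B] .
    qed
    show "d A B = undefined" if "\<not> (B \<noteq> {} \<and> B \<subseteq> A \<and> A \<subseteq> {..k})" for A B
      using that unfolding d_def by (rule if_not_P)
    show "d A A = Idt E (D A)" if A: "A \<noteq> {} \<and> A \<subseteq> {..k}" for A
    proof (cases "A = {..k}")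
      case True
      then show ?thesis by (simp add: dfull Dfull)
    next
      case False
      then have f: "face A" using A by (auto simp: face_def)
      have "pos A A = {..c A}" unfolding c_def by (rule pos_self[OF faceD(3,1)[OF f]])
      then show ?thesis
        using dface[OF f order_refl] Dface(1)[OF f] goodD(8)[OF W[OF f], of "{..c A}"] A by simp
    qed
    show "d B B' \<cdot> d A B = d A B'" if AB: "B' \<noteq> {} \<and> B' \<subseteq> B \<and> B \<subseteq> A \<and> A \<subseteq> {..k}" for A B B'
    proof (cases "A = {..k}")
      case True
      show ?thesis
      proof (cases "B = {..k}")
        case Bk: True
        show ?thesis
        proof (cases "B' = {..k}")
          case True
          then show ?thesis using \<open>A = {..k}\<close> Bk V by (simp add: dfull)
        next
          case False
          then have "face B'" using AB Bk by (auto simp: face_def)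
          then show ?thesis using \<open>A = {..k}\<close> Bk X[of B'] by (simp add: dfull dtop)
        qed
      next
        case False
        then have fB: "face B" using AB True by (auto simp: face_def)
        have B': "B' \<subseteq> B" "B' \<noteq> {}" using AB by auto
        show ?thesis
          unfolding True dtop[OF fB] dtop[OF sub[OF fB B']] dface[OF fB B'] F3(3)[OF fB B'] ..
      qed
    next
      case False
      then have A: "face A" using AB by (auto simp: face_def)
      have B: "B \<subseteq> A" "B \<noteq> {}" and B': "B' \<subseteq> B" "B' \<noteq> {}" and AB': "B' \<subseteq> A" using AB by auto
      show ?thesis
        unfolding dface[OF A B] dface[OF A AB' B'(2)] dface[OF sub[OF A B] B'] F3(2)[OF A B B']
        by (rule goodD(9)[OF W[OF A] pp(1)[OF A AB' B'(2)] pos_mono[OF B'(1)] pp(2)[OF A B] order_refl])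
    qed
  qed
  \<comment> \<open>The image of \<open>\<alpha>\<close> has at most m + 1, hence at most k,
    elements, so it is a proper face and the missing top of \<open>w\<close> is not met.\<close>
  have restr: "span_reindex m (\<lambda>p. \<alpha> ! p) w = fst (Y \<alpha>)" if m: "m < k" "monotone_map m k \<alpha>" for m \<alpha>
  proof -
    define A where "A = set \<alpha>"
    have len: "length \<alpha> = Suc m" using m by (simp add: monotone_map_def)
    have A: "face A"
    proof -
      have "card A \<le> Suc m" unfolding A_def using card_length[of \<alpha>] len by simp
      then have "A \<noteq> {..k}" using m(1) by auto
      then show ?thesis using m(2) by (auto simp: face_def A_def monotone_map_def)
    qed
    have sA: "set \<alpha> \<subseteq> A" by (simp add: A_def)
    obtain \<beta> where b: "monotone_map m (c A) \<beta>" "mcomp (sorted_list_of_set A) \<beta> = \<alpha>"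
      and w': "fst (Y \<alpha>) = span_reindex m (\<lambda>p. \<beta> ! p) (W A)"
      and im: "\<And>S. S \<subseteq> {..m} \<Longrightarrow> (\<lambda>p. \<beta> ! p) ` S = pos A ((\<lambda>p. \<alpha> ! p) ` S)"
      using F2[OF A m sA] by blast
    have sub': "(\<lambda>p. \<alpha> ! p) ` S \<subseteq> A" if "S \<subseteq> {..m}" for S
      using that unfolding A_def set_nth_image[OF len] by (rule image_mono)
    show ?thesis
    proof (rule span_eqI)
      show "span_reindex m (\<lambda>p. \<alpha> ! p) w \<in> spans E I U C m"
        by (rule span_reindex_spans[OF ws]) (rule monotone_map_nth[OF m(2)])
      show "fst (Y \<alpha>) \<in> spans E I U C m" using selD(1)[OF Ysel[OF m]] good_spans by simp
      show "ind (span_reindex m (\<lambda>p. \<alpha> ! p) w) ! p = ind (fst (Y \<alpha>)) ! p" if p: "p \<le> m" for p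
      proof -
        have ap: "\<alpha> ! p \<le> k" by (rule monotone_map_nth[OF m(2) p])
        have bp: "\<beta> ! p \<le> c A" by (rule monotone_map_nth[OF b(1) p])
        have mo: "monotone_map 0 k [\<alpha> ! p]" and k0: "0 < k" and sp: "set [\<alpha> ! p] \<subseteq> A"
          using ap k sub'[of "{p}"] p by (auto simp: monotone_map_0)
        \<comment> \<open>Indices are extra data that the objects \<open>U i\<close> do not
          determine; they are compared through the 0-simplex of the family at this vertex.\<close>
        obtain \<gamma> where g: "monotone_map 0 (c A) \<gamma>"
          and wg: "fst (Y [\<alpha> ! p]) = span_reindex 0 (\<lambda>p. \<gamma> ! p) (W A)"
          and ig: "\<And>S. S \<subseteq> {..0} \<Longrightarrow> (\<lambda>q. \<gamma> ! q) ` S = pos A ((\<lambda>q. [\<alpha> ! p] ! q) ` S)"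
          using F2[OF A k0 mo sp] by blast
        have "{\<gamma> ! 0} = {\<beta> ! p}" using ig[of "{0}"] im[of "{p}"] p by simp
        then have "ind (W {\<alpha> ! p}) ! 0 = ind (W A) ! (\<beta> ! p)"
          using wg by (simp add: W_def span_reindex_sel)
        then show ?thesis
          unfolding w' span_reindex_sel w_def fst_conv using p ap by (simp add: vs_def del: upt_Suc)
      qed
      show "obj (span_reindex m (\<lambda>p. \<alpha> ! p) w) S = obj (fst (Y \<alpha>)) S" if S: "S \<noteq> {}" "S \<subseteq> {..m}" for S
      proof -
        let ?B = "(\<lambda>p. \<alpha> ! p) ` S"
        have B: "?B \<subseteq> A" "?B \<noteq> {}" using sub'[OF S(2)] S(1) by auto
        have "D ?B = obj (W A) ((\<lambda>p. \<beta> ! p) ` S)"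
          unfolding Dface(1)[OF sub[OF A B]] F3(1)[OF A B] im[OF S(2)] ..
        then show ?thesis unfolding w' span_reindex_sel w_def using S by simp
      qed
      show "str (span_reindex m (\<lambda>p. \<alpha> ! p) w) S T = str (fst (Y \<alpha>)) S T" if S: "T \<noteq> {}" "T \<subseteq> S" "S \<subseteq> {..m}" for S T
      proof -
        let ?B = "(\<lambda>p. \<alpha> ! p) ` S" and ?B' = "(\<lambda>p. \<alpha> ! p) ` T"
        have S': "S \<noteq> {}" "T \<subseteq> {..m}" using S by auto
        have B: "?B \<subseteq> A" "?B \<noteq> {}" "?B' \<subseteq> ?B" "?B' \<noteq> {}" using sub'[OF S(3)] S S' by auto
        have "d ?B ?B' = str (W A) ((\<lambda>p. \<beta> ! p) ` S) ((\<lambda>p. \<beta> ! p) ` T)"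
          unfolding dface[OF sub[OF A B(1,2)] B(3,4)] F3(2)[OF A B] im[OF S(3)] im[OF S'(2)] ..
        then show ?thesis unfolding w' span_reindex_sel w_def using S by simp
      qed
    qed
  qed
  have wg: "w \<in> good k"
    unfolding good_def
  proof (intro CollectI conjI allI impI)
    show "w \<in> spans E I U C k" by (rule ws)
    fix f :: "nat \<Rightarrow> nat" assume f: "f 0 \<le> k \<and> f 1 \<le> k"
    have f01: "f p \<le> k" if "p \<le> 1" for p using f that by (auto simp: le_Suc_eq)
    have one: "{..1::nat} = {0, 1}" by auto
    \<comment> \<open>If \<open>f\<close> reaches every vertex, which forces k = 1, the edge has
      apex V and \<open>Q_G\<close> applies; otherwise it is an edge of a proper face, which is good
      already.\<close>
    show "Q (span_reindex 1 f w)"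
    proof (cases "{f 0, f 1} = {..k}")
      case True
      have "obj (span_reindex 1 f w) {..1} = D (f ` {..1})" by (simp add: span_reindex_sel w_def)
      also have "f ` {..1} = {..k}" unfolding one using True by simp
      finally have g: "obj (span_reindex 1 f w) {..1} \<in> G" using V by (simp add: Dfull)
      show ?thesis by (rule Q_G[OF span_reindex_spans[OF ws f01] g])
    next
      case False
      define A where "A = {f 0, f 1}"
      have A: "face A" using False f by (simp add: face_def A_def)
      define s where "s = sorted_list_of_set A"
      have "\<exists>p\<le>c A. s ! p = a" if "a \<in> A" for a
        using enum[OF A] that unfolding s_def by (metis (no_types, lifting) atMost_iff imageE)
      \<comment> \<open>\<open>h\<close> gives positions in A; \<open>h\<close> after
        \<open>f\<close> may reverse the two vertices, and the definition of \<open>good\<close>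
        covers such maps too.\<close>
      then obtain h where h: "\<And>a. a \<in> A \<Longrightarrow> h a \<le> c A \<and> s ! h a = a" by metis
      have fA: "f p \<in> A" if "p \<le> 1" for p using that by (auto simp: A_def le_Suc_eq)
      have "span_reindex 1 f w = span_reindex 1 ((\<lambda>p. s ! p) \<circ> (\<lambda>p. h (f p))) w"
        by (rule span_reindex_cong) (use h fA in simp)
      also have "\<dots> = span_reindex 1 (\<lambda>p. h (f p)) (span_reindex (c A) (\<lambda>p. s ! p) w)"
        by (rule span_reindex_comp[symmetric]) (use h fA in simp)
      also have "span_reindex (c A) (\<lambda>p. s ! p) w = W A"
        unfolding s_def W_def by (rule restr[OF ck[OF A] mono[OF A]])
      finally have e: "span_reindex 1 f w = span_reindex 1 (\<lambda>p. h (f p)) (W A)" .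
      have "h (f 0) \<le> c A" "h (f 1) \<le> c A" using h fA by simp_all
      moreover have "\<forall>f. f 0 \<le> c A \<and> f 1 \<le> c A \<longrightarrow> Q (span_reindex 1 f (W A))"
        using W[OF A] by (simp add: good_def)
      ultimately show ?thesis unfolding e
        using spec[where x = "\<lambda>p. h (f p)"] by blast
    qed
  qed
  show ?thesis
  proof (intro bexI[of _ "(w, Idt E V)"] allI impI)
    show "(w, Idt E V) \<in> sel Sp V k"
      using wg V by (simp add: sel_def) (simp add: w_def Dfull)
    fix m \<alpha> assume a: "m < k \<and> monotone_map m k \<alpha>"
    then have m: "m < k" "monotone_map m k \<alpha>" by auto
    define A where "A = set \<alpha>"
    have len: "length \<alpha> = Suc m" using m by (simp add: monotone_map_def)
    have A: "face A"
    proof -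
      have "card A \<le> Suc m" unfolding A_def using card_length[of \<alpha>] len by simp
      then have "A \<noteq> {..k}" using m(1) by auto
      then show ?thesis using m(2) by (auto simp: face_def A_def monotone_map_def)
    qed
    have sA: "set \<alpha> \<subseteq> A" by (simp add: A_def)
    obtain \<beta> where b: "monotone_map m (c A) \<beta>"
      and x': "snd (Y \<alpha>) = str (W A) {..c A} (set \<beta>) \<cdot> X A"
      and im: "\<And>S. S \<subseteq> {..m} \<Longrightarrow> (\<lambda>p. \<beta> ! p) ` S = pos A ((\<lambda>p. \<alpha> ! p) ` S)"
      using F2[OF A m sA] by blast
    have lb: "length \<beta> = Suc m" using b by (simp add: monotone_map_def)
    have "set \<beta> = pos A A" unfolding set_nth_image[OF lb] im[OF order_refl] A_def set_nth_image[OF len] ..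
    then have sb: "set \<beta> = {..c A}" using pos_self[OF faceD(3,1)[OF A]] by (simp add: c_def)
    have "str (W A) {..c A} {..c A} = Idt E (obj (W A) {..c A})" by (rule goodD(8)[OF W[OF A]]) auto
    then have x: "snd (Y \<alpha>) = X A" unfolding x' sb using X[OF A] by simp
    have "ixmap Sp k \<alpha> w = fst (Y \<alpha>)" unfolding reindex_monotone(1)[OF m(2) wg] by (rule restr[OF m])
    moreover have "cpmap Sp k \<alpha> w \<cdot> Idt E V = snd (Y \<alpha>)"
      unfolding x using dtop[OF A] X[OF A] by (simp add: w_def A_def)
    ultimately show "sact Sp k \<alpha> (w, Idt E V) = Y \<alpha>" unfolding sact_def fst_conv snd_conv by (simp add: prod_eq_iff)
  qed
qed

lemma Sp_hypercover: "hypercover_refinement E I U span_vertex Sp"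
  unfolding hypercover_refinement_def
proof (intro conjI ballI allI impI)
  show "simplicial_family E TYPE('u) Sp" by (rule Sp_simplicial)
  show "bij_betw span_vertex (Ix Sp 0) I" by (rule span_vertex_bij)
  show "Cp Sp 0 x = U (span_vertex x)" if "x \<in> Ix Sp 0" for x by (rule span_vertex_Cp[OF that])
  show "\<exists>L \<pi> h. is_cosk E Sp k L \<pi> \<and> h \<in> hom E (tot E Sp k) L \<and>
        (\<forall>m \<alpha>. m < k \<and> monotone_map m k \<alpha> \<longrightarrow> \<pi> \<alpha> \<cdot> h = totmap E Sp m k \<alpha>) \<and> epi E h" if "1 \<le> k" for k
    by (rule cosk_epi_if_fillers[OF Sp_simplicial]) (rule Sp_fill[OF _ that])
qed

end

section \<open>Relabelling simplices\<close>

text \<open>Transport along injections of the index sets: families in the first two claims have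
  simplices in \<open>'u\<close> and I itself as set of vertices, while spans have another type. The
  degree of the target of an operator is read off from the length of its list.\<close>

definition relabel :: "(nat \<Rightarrow> 's \<Rightarrow> 't) \<Rightarrow> ('s, 'o, 'a) sfam \<Rightarrow> ('t, 'o, 'a) sfam" where
  "relabel g F = (let h = (\<lambda>n. inv_into (Ix F n) (g n)) in
     \<lparr> Ix = (\<lambda>n. g n ` Ix F n), ixmap = (\<lambda>n \<alpha> w. g (length \<alpha> - 1) (ixmap F n \<alpha> (h n w))),
       Cp = (\<lambda>n w. Cp F n (h n w)), cpmap = (\<lambda>n \<alpha> w. cpmap F n \<alpha> (h n w)),
       ixop = (\<lambda>n w. g n (ixop F n (h n w))), cpop = (\<lambda>n w. cpop F n (h n w)) \<rparr>)"

context connected_generators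
begin

context
  fixes F :: "('s, 'o, 'a) sfam" and g :: "nat \<Rightarrow> 's \<Rightarrow> 't"
  assumes F: "simplicial_family E TYPE('u) F" and g: "\<And>n. inj_on (g n) (Ix F n)"
begin

lemma relabel_Ix: "Ix (relabel g F) n = g n ` Ix F n"
  by (simp add: relabel_def Let_def)

lemma relabel_simps:
  assumes w: "w \<in> Ix F n"
  shows "monotone_map m n \<alpha> \<Longrightarrow> ixmap (relabel g F) n \<alpha> (g n w) = g m (ixmap F n \<alpha> w)"
    "Cp (relabel g F) n (g n w) = Cp F n w" "cpmap (relabel g F) n \<alpha> (g n w) = cpmap F n \<alpha> w"
    "ixop (relabel g F) n (g n w) = g n (ixop F n w)" "cpop (relabel g F) n (g n w) = cpop F n w"
  using w g[of n] by (simp_all add: relabel_def Let_def monotone_map_def)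

lemma relabel_ball: "(\<forall>w\<in>Ix (relabel g F) n. P w) \<longleftrightarrow> (\<forall>w\<in>Ix F n. P (g n w))"
  by (simp add: relabel_Ix)

lemma relabel_simplicial: "simplicial_family E TYPE('u) (relabel g F)"
  unfolding simplicial_family_def simplicial_set_def relabel_ball
proof (intro conjI allI ballI impI)
  note D = simplicial_familyD[OF F]
  note r = relabel_simps
  show "small TYPE('u) (Ix (relabel g F) n)" for n
    unfolding relabel_Ix small_def by (rule small_image[OF D(1), unfolded small_def])
  show "ixmap (relabel g F) n \<alpha> \<in> Ix (relabel g F) n \<rightarrow> Ix (relabel g F) m" if "monotone_map m n \<alpha>" for m n \<alpha>
    using r(1)[OF _ that] D(2)[OF _ that] by (auto simp: relabel_Ix)
  fix n w assume w: "w \<in> Ix F n"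
  have id: "monotone_map n n [0..<Suc n]" by (auto simp: monotone_map_def simp del: upt_Suc)
  show "ixmap (relabel g F) n [0..<Suc n] (g n w) = g n w"
    using r(1)[OF w id] D(3)[OF w] by (simp del: upt_Suc)
  show "Cp (relabel g F) n (g n w) \<in> Ob E" "\<not> initial E (Cp (relabel g F) n (g n w))"
    using r(2)[OF w] D(5,6)[OF w] by simp_all
  show "cpmap (relabel g F) n [0..<Suc n] (g n w) = Idt E (Cp (relabel g F) n (g n w))"
    using r(2,3)[OF w] D(8)[OF w] by (simp del: upt_Suc)
next
  note D = simplicial_familyD[OF F]
  note r = relabel_simps
  fix m n \<alpha> w assume a: "monotone_map m n \<alpha>" and w: "w \<in> Ix F n"
  show "cpmap (relabel g F) n \<alpha> (g n w) \<in> hom E (Cp (relabel g F) n (g n w)) (Cp (relabel g F) m (ixmap (relabel g F) n \<alpha> (g n w)))"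
    using r(1)[OF w a] r(2,3)[OF w] r(2)[OF D(2)[OF w a]] D(7)[OF w a] by simp
next
  note D = simplicial_familyD[OF F]
  note r = relabel_simps
  fix l m n \<alpha> \<beta> w assume ab: "monotone_map m n \<alpha> \<and> monotone_map l m \<beta>" and w: "w \<in> Ix F n"
  then have a: "monotone_map m n \<alpha>" and b: "monotone_map l m \<beta>" by auto
  note mc = monotone_map_mcomp[OF a b]
  show "ixmap (relabel g F) m \<beta> (ixmap (relabel g F) n \<alpha> (g n w)) = ixmap (relabel g F) n (mcomp \<alpha> \<beta>) (g n w)"
    using r(1)[OF w a] r(1)[OF D(2)[OF w a] b] r(1)[OF w mc] D(4)[OF w a b] by simp
  show "cpmap (relabel g F) m \<beta> (ixmap (relabel g F) n \<alpha> (g n w)) \<cdot> cpmap (relabel g F) n \<alpha> (g n w)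
      = cpmap (relabel g F) n (mcomp \<alpha> \<beta>) (g n w)"
    using r(1)[OF w a] r(3)[OF D(2)[OF w a]] r(3)[OF w] D(9)[OF w a b] by simp
qed

lemma relabel_faces:
  assumes w: "w \<in> Ix F n"
  shows "\<lbrakk>1 \<le> n; i \<le> n\<rbrakk> \<Longrightarrow> fc (relabel g F) n i (g n w) = g (n - 1) (fc F n i w)"
    "\<lbrakk>1 \<le> n; i \<le> n\<rbrakk> \<Longrightarrow> fc F n i w \<in> Ix F (n - 1)"
    "i \<le> n \<Longrightarrow> dg (relabel g F) n i (g n w) = g (Suc n) (dg F n i w)"
    "i \<le> n \<Longrightarrow> dg F n i w \<in> Ix F (Suc n)"
    "cfc (relabel g F) n i (g n w) = cfc F n i w" "cdg (relabel g F) n i (g n w) = cdg F n i w"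
  using relabel_simps[OF w] simplicial_familyD(2)[OF F w] monotone_coface monotone_codegen
  unfolding fc_def dg_def cfc_def cdg_def by blast+

lemma relabel_self_dual:
  assumes dual: "self_dual E F"
  shows "self_dual E (relabel g F)"
  unfolding self_dual_def relabel_ball
proof (intro conjI allI ballI impI)
  note d = dual[unfolded self_dual_def]
  note r = relabel_simps and f = relabel_faces
  have bij: "bij_betw (ixop F n) (Ix F n) (Ix F n)" for n using d by blast
  have op: "ixop F n w \<in> Ix F n" if "w \<in> Ix F n" for n w using bij_betw_apply[OF bij that] .
  show "bij_betw (ixop (relabel g F) n) (Ix (relabel g F) n) (Ix (relabel g F) n)" for n
  proof -
    have "bij_betw (g n \<circ> ixop F n) (Ix F n) (g n ` Ix F n)"
      by (rule bij_betw_trans[OF bij inj_on_imp_bij_betw[OF g]])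
    then have "bij_betw (ixop (relabel g F) n \<circ> g n) (Ix F n) (g n ` Ix F n)"
      by (subst bij_betw_cong[of _ _ "g n \<circ> ixop F n"]) (use r(4) in auto)
    then show ?thesis
      unfolding relabel_Ix using bij_betw_comp_iff[OF inj_on_imp_bij_betw[OF g]] by blast
  qed
  fix n w assume w: "w \<in> Ix F n"
  have "cpop F n w \<in> hom E (Cp F n w) (Cp F n (ixop F n w))" "iso E (cpop F n w)" using d w by blast+
  then show "cpop (relabel g F) n (g n w) \<in> hom E (Cp (relabel g F) n (g n w))
      (Cp (relabel g F) n (ixop (relabel g F) n (g n w)))" "iso E (cpop (relabel g F) n (g n w))"
    using r(2,4,5)[OF w] r(2)[OF op[OF w]] by simp_all
next
  note d = dual[unfolded self_dual_def]
  fix w assume w: "w \<in> Ix F 0"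
  have "ixop F 0 w = w" "cpop F 0 w = Idt E (Cp F 0 w)" using d w by blast+
  then show "ixop (relabel g F) 0 (g 0 w) = g 0 w" "cpop (relabel g F) 0 (g 0 w) = Idt E (Cp (relabel g F) 0 (g 0 w))"
    using relabel_simps[OF w] by simp_all
next
  note d = dual[unfolded self_dual_def]
  note r = relabel_simps and f = relabel_faces
  fix n i w assume ni: "1 \<le> n \<and> i \<le> n" and w: "w \<in> Ix F n"
  have op: "ixop F n w \<in> Ix F n" using d w by (auto simp: bij_betw_def)
  have n: "1 \<le> n" "i \<le> n" "n - i \<le> n" using ni by auto
  have "\<forall>n i. 1 \<le> n \<and> i \<le> n \<longrightarrow> (\<forall>w\<in>Ix F n.
        fc F n i (ixop F n w) = ixop F (n - 1) (fc F n (n - i) w) \<and>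
        cfc F n i (ixop F n w) \<cdot> cpop F n w
          = cpop F (n - 1) (fc F n (n - i) w) \<cdot> cfc F n (n - i) w)" using d by (elim conjE)
  then have e: "fc F n i (ixop F n w) = ixop F (n - 1) (fc F n (n - i) w)"
    "cfc F n i (ixop F n w) \<cdot> cpop F n w = cpop F (n - 1) (fc F n (n - i) w) \<cdot> cfc F n (n - i) w"
    using ni w by blast+
  note f1 = f(2)[OF w n(1,3)]
  show "fc (relabel g F) n i (ixop (relabel g F) n (g n w)) = ixop (relabel g F) (n - 1) (fc (relabel g F) n (n - i) (g n w))"
    unfolding r(4)[OF w] f(1)[OF op n(1,2)] f(1)[OF w n(1,3)] r(4)[OF f1] e(1) ..
  show "cfc (relabel g F) n i (ixop (relabel g F) n (g n w)) \<cdot> cpop (relabel g F) n (g n w)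
      = cpop (relabel g F) (n - 1) (fc (relabel g F) n (n - i) (g n w)) \<cdot> cfc (relabel g F) n (n - i) (g n w)"
    unfolding r(4,5)[OF w] f(5)[OF op] f(5)[OF w] f(1)[OF w n(1,3)] r(5)[OF f1] e(2) ..
next
  note d = dual[unfolded self_dual_def]
  note r = relabel_simps and f = relabel_faces
  fix n i w assume ni: "1 \<le> n \<and> i \<le> n - 1" and w: "w \<in> Ix F (n - 1)"
  have op: "ixop F (n - 1) w \<in> Ix F (n - 1)" using d w by (auto simp: bij_betw_def)
  have n: "i \<le> n - 1" "n - 1 - i \<le> n - 1" "Suc (n - 1) = n" using ni by auto
  have "\<forall>n i. 1 \<le> n \<and> i \<le> n - 1 \<longrightarrow> (\<forall>w\<in>Ix F (n - 1).
        dg F (n - 1) i (ixop F (n - 1) w) = ixop F n (dg F (n - 1) (n - 1 - i) w) \<and>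
        cdg F (n - 1) i (ixop F (n - 1) w) \<cdot> cpop F (n - 1) w
          = cpop F n (dg F (n - 1) (n - 1 - i) w) \<cdot> cdg F (n - 1) (n - 1 - i) w)" using d by (elim conjE)
  then have e: "dg F (n - 1) i (ixop F (n - 1) w) = ixop F n (dg F (n - 1) (n - 1 - i) w)"
    "cdg F (n - 1) i (ixop F (n - 1) w) \<cdot> cpop F (n - 1) w
          = cpop F n (dg F (n - 1) (n - 1 - i) w) \<cdot> cdg F (n - 1) (n - 1 - i) w"
    using ni w by blast+
  note f1 = f(4)[OF w n(2), unfolded n(3)]
  show "dg (relabel g F) (n - 1) i (ixop (relabel g F) (n - 1) (g (n - 1) w))
      = ixop (relabel g F) n (dg (relabel g F) (n - 1) (n - 1 - i) (g (n - 1) w))"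
    unfolding r(4)[OF w] f(3)[OF op n(1)] f(3)[OF w n(2)] n(3) r(4)[OF f1] e(1) ..
  show "cdg (relabel g F) (n - 1) i (ixop (relabel g F) (n - 1) (g (n - 1) w)) \<cdot> cpop (relabel g F) (n - 1) (g (n - 1) w)
      = cpop (relabel g F) n (dg (relabel g F) (n - 1) (n - 1 - i) (g (n - 1) w)) \<cdot> cdg (relabel g F) (n - 1) (n - 1 - i) (g (n - 1) w)"
    unfolding r(4,5)[OF w] f(6)[OF op] f(6)[OF w] f(3)[OF w n(2)] n(3) r(5)[OF f1] e(2) ..
qed

lemma relabel_condition_G:
  assumes dual: "self_dual E F" and G2: "condition_G F"
  shows "condition_G (relabel g F)"
  unfolding condition_G_def relabel_ball
proof
  fix e assume e: "e \<in> Ix F 1"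
  then obtain w where w: "w \<in> Ix F 2" and eq: "fc F 2 2 w = e" "fc F 2 0 w = ixop F 1 e"
    "cfc F 1 1 (fc F 2 1 w) = cfc F 1 0 (fc F 2 1 w)" using G2 unfolding condition_G_def by blast
  note f = relabel_faces[OF w]
  have two: "(2::nat) - 1 = 1" by simp
  have f2: "fc (relabel g F) 2 i (g 2 w) = g 1 (fc F 2 i w)" "fc F 2 i w \<in> Ix F 1" if "i \<le> 2" for i
    using f(1)[of i] f(2)[of i] that unfolding two by simp_all
  show "\<exists>w\<in>Ix (relabel g F) 2. fc (relabel g F) 2 2 w = g 1 e \<and> fc (relabel g F) 2 0 w = ixop (relabel g F) 1 (g 1 e) \<and>
      cfc (relabel g F) 1 1 (fc (relabel g F) 2 1 w) = cfc (relabel g F) 1 0 (fc (relabel g F) 2 1 w)"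
  proof (intro bexI conjI)
    show "fc (relabel g F) 2 2 (g 2 w) = g 1 e" using f2(1)[of 2] eq(1) by simp
    show "fc (relabel g F) 2 0 (g 2 w) = ixop (relabel g F) 1 (g 1 e)"
      using f2(1)[of 0] eq(2) relabel_simps(4)[OF e] by simp
    have 1: "fc (relabel g F) 2 1 (g 2 w) = g 1 (fc F 2 1 w)" "fc F 2 1 w \<in> Ix F 1"
      by (rule f2[OF one_le_numeral])+
    show "cfc (relabel g F) 1 1 (fc (relabel g F) 2 1 (g 2 w)) = cfc (relabel g F) 1 0 (fc (relabel g F) 2 1 (g 2 w))"
      unfolding 1(1) relabel_faces(5)[OF 1(2)] by (rule eq(3))
    show "g 2 w \<in> Ix (relabel g F) 2" using w by (simp add: relabel_Ix)
  qed
qed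

text \<open>Fillers are transported rather than coskeleta; \<open>cosk_epi_if_fillers\<close> then
  forms the coskeleta of the relabelled family afresh.\<close>

lemma relabel_fill:
  assumes fill: "\<And>Y. matching F V k Y \<Longrightarrow>
      \<exists>y\<in>sel F V k. \<forall>m \<alpha>. m < k \<and> monotone_map m k \<alpha> \<longrightarrow> sact F k \<alpha> y = Y \<alpha>"
    and Y: "matching (relabel g F) V k Y"
  shows "\<exists>y\<in>sel (relabel g F) V k. \<forall>m \<alpha>. m < k \<and> monotone_map m k \<alpha> \<longrightarrow> sact (relabel g F) k \<alpha> y = Y \<alpha>"
proof -
  define h where "h n = inv_into (Ix F n) (g n)" for n
  define Z where "Z \<alpha> = (h (length \<alpha> - 1) (fst (Y \<alpha>)), snd (Y \<alpha>))" for \<alpha>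
  note r = relabel_simps
  have Z: "Z \<alpha> \<in> sel F V m" "Y \<alpha> = (g m (fst (Z \<alpha>)), snd (Z \<alpha>))" if "m < k" "monotone_map m k \<alpha>" for m \<alpha>
  proof -
    have len: "length \<alpha> - 1 = m" using that by (simp add: monotone_map_def)
    have y: "Y \<alpha> \<in> sel (relabel g F) V m" using Y that by (simp add: matching_def)
    then obtain w where w: "w \<in> Ix F m" "fst (Y \<alpha>) = g m w" using selD(1)[OF y] by (auto simp: relabel_Ix)
    then have z: "fst (Z \<alpha>) = w" unfolding Z_def fst_conv len h_def by (simp add: g)
    show "Z \<alpha> \<in> sel F V m" using w(1) z selD[OF y] r(2)[OF w(1)] w(2) unfolding sel_def
      by (simp add: case_prod_unfold) (simp add: Z_def)
    show "Y \<alpha> = (g m (fst (Z \<alpha>)), snd (Z \<alpha>))" using z w(2) by (simp add: prod_eq_iff) (simp add: Z_def)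
  qed
  have sact: "sact (relabel g F) n \<alpha> (g n (fst y), snd y) = (g m (fst (sact F n \<alpha> y)), snd (sact F n \<alpha> y))"
    if "y \<in> sel F V n" "monotone_map m n \<alpha>" for y n m \<alpha>
    unfolding sact_def fst_conv snd_conv r(1)[OF selD(1)[OF that(1)] that(2)] r(3)[OF selD(1)[OF that(1)]] ..
  have "matching F V k Z"
    unfolding matching_def
  proof (intro conjI allI impI)
    show "Z \<alpha> \<in> sel F V m" if "m < k \<and> monotone_map m k \<alpha>" for m \<alpha> using Z(1) that by blast
    fix l m \<alpha> \<beta> assume a: "l < k \<and> m < k \<and> monotone_map m k \<alpha> \<and> monotone_map l m \<beta>"
    then have mm: "monotone_map m k \<alpha>" "monotone_map l m \<beta>" and lm: "l < k" "m < k" by auto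
    note mc = monotone_map_mcomp[OF mm]
    have s: "sact F m \<beta> (Z \<alpha>) \<in> sel F V l" by (rule sact_sel[OF F Z(1)[OF lm(2) mm(1)] mm(2)])
    have "sact (relabel g F) m \<beta> (Y \<alpha>) = Y (mcomp \<alpha> \<beta>)" using Y a unfolding matching_def by blast
    then have "(g l (fst (sact F m \<beta> (Z \<alpha>))), snd (sact F m \<beta> (Z \<alpha>))) = (g l (fst (Z (mcomp \<alpha> \<beta>))), snd (Z (mcomp \<alpha> \<beta>)))"
      unfolding Z(2)[OF lm(2) mm(1)] Z(2)[OF lm(1) mc] sact[OF Z(1)[OF lm(2) mm(1)] mm(2)] .
    then show "sact F m \<beta> (Z \<alpha>) = Z (mcomp \<alpha> \<beta>)"
      using inj_onD[OF g _ selD(1)[OF s] selD(1)[OF Z(1)[OF lm(1) mc]]] by (simp add: prod_eq_iff)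
  qed
  from fill[OF this] obtain y where y: "y \<in> sel F V k" "\<And>m \<alpha>. m < k \<Longrightarrow> monotone_map m k \<alpha> \<Longrightarrow> sact F k \<alpha> y = Z \<alpha>"
    by blast
  show ?thesis
  proof (intro bexI allI impI)
    show "(g k (fst y), snd y) \<in> sel (relabel g F) V k"
      using selD[OF y(1)] r(2)[OF selD(1)[OF y(1)]] by (simp add: sel_def relabel_Ix)
    fix m \<alpha> assume "m < k \<and> monotone_map m k \<alpha>"
    then have m: "m < k" "monotone_map m k \<alpha>" by auto
    show "sact (relabel g F) k \<alpha> (g k (fst y), snd y) = Y \<alpha>"
      unfolding sact[OF y(1) m(2)] y(2)[OF m] Z(2)[OF m, symmetric] ..
  qed
qed

end

end

section \<open>Locally constant objects are covering projections\<close>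

context cech_cover
begin

text \<open>Over a connected object the transport maps are constant, as every map to a constant object
  is.\<close>

lemma connected_edge_acts:
  assumes \<phi>: "coherent \<phi>" and x: "elt i x" and y: "elt j y" "Src E y = Src E x"
  shows "\<exists>s. \<forall>V\<in>G. \<forall>c. c \<in> Ar E \<and> Src E c = V \<and> Tgt E c = Src E x \<longrightarrow>
    (\<forall>r\<in>R i. act \<phi> i j (x \<cdot> c) (y \<cdot> c) r = s r)"
  using act_Cmp[OF coherentD(1)[OF \<phi>] x y] by blast

text \<open>The pointwise form of being an action span: \<open>act\<close> at the end points of an
  element of the apex is one function \<open>s\<close>, the same for all elements at
  generators.\<close>

definition action_edge :: "('u \<Rightarrow> 'u \<Rightarrow> 'a) \<Rightarrow> ('u, 'o, 'a) span \<Rightarrow> bool" where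
  "action_edge \<phi> w \<longleftrightarrow> (\<exists>s. \<forall>V\<in>G. \<forall>x. x \<in> Ar E \<and> Src E x = V \<and> Tgt E x = obj w {..1} \<longrightarrow>
     (\<forall>r\<in>R (ind w ! 0). act \<phi> (ind w ! 0) (ind w ! 1) (str w {..1} {0} \<cdot> x) (str w {..1} {1} \<cdot> x) r = s r))"

lemma action_edge_connected:
  assumes \<phi>: "coherent \<phi>" and w: "w \<in> spans E I U C 1" and V: "obj w {..1} \<in> G"
  shows "action_edge \<phi> w"
proof -
  note D = spansD[OF w]
  have i: "ind w ! 0 \<in> I" "ind w ! 1 \<in> I" using D(1,2) by (auto intro!: subsetD[OF D(2)] nth_mem)
  have x: "elt (ind w ! 0) (str w {..1} {0})" "elt (ind w ! 1) (str w {..1} {1})"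
    "Src E (str w {..1} {1}) = Src E (str w {..1} {0})" "Src E (str w {..1} {0}) = obj w {..1}"
    using D(6)[of "{0}" "{..1}"] D(6)[of "{1}" "{..1}"] D(5)[of 0] D(5)[of 1] i V by simp_all
  show ?thesis unfolding action_edge_def using connected_edge_acts[OF \<phi> x(1-3)] x(4) by simp
qed

text \<open>The apex is a possibly disconnected \<open>U i\<close>, yet both legs are identities, so
  the unit law makes the action the identity at every element.\<close>

lemma action_edge_degenerate:
  assumes \<phi>: "coherent \<phi>" and w: "w \<in> spans E I U C 0"
  shows "action_edge \<phi> (span_reindex 1 (\<lambda>_. 0) w)"
  unfolding action_edge_def
proof (intro exI ballI allI impI)
  note D = spansD[OF w]
  let ?w = "span_reindex 1 (\<lambda>_. 0) w"
  have i: "ind w ! 0 \<in> I" using D(1) by (intro subsetD[OF D(2)] nth_mem) simp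
  have im: "(\<lambda>_. 0::nat) ` {..Suc 0} = {0}" by auto
  have s: "ind ?w ! 0 = ind w ! 0" "ind ?w ! 1 = ind w ! 0" "obj ?w {..1} = U (ind w ! 0)"
    "str ?w {..1} {0} = Idt E (U (ind w ! 0))" "str ?w {..1} {1} = Idt E (U (ind w ! 0))"
    using D(5)[of 0] D(8)[of "{0}"] by (simp_all add: span_reindex_sel im upt_conv_Cons)
  fix V x r assume "V \<in> G" and "x \<in> Ar E \<and> Src E x = V \<and> Tgt E x = obj ?w {..1}" and r: "r \<in> R (ind ?w ! 0)"
  then have x: "elt (ind w ! 0) x" using i s(3) by simp
  have r': "r \<in> R (ind w ! 0)" using r unfolding s(1) .
  show "act \<phi> (ind ?w ! 0) (ind ?w ! 1) (str ?w {..1} {0} \<cdot> x) (str ?w {..1} {1} \<cdot> x) r = r"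
    unfolding s using coherentD(2)[OF \<phi> x r'] x by simp
qed

lemma span_cover_action_edge:
  assumes \<phi>: "coherent \<phi>" and C: "small u C" "C \<subseteq> Ob E" "\<And>A. A \<in> C \<Longrightarrow> \<not> initial E A" "\<And>i. i \<in> I \<Longrightarrow> U i \<in> C"
    "G \<subseteq> C"
  shows "span_cover E u G I U R C (action_edge \<phi>)"
proof (unfold_locales)
  show "A \<in> Ob E" if "A \<in> C" for A using that C(2) by blast
  show "action_edge \<phi> (span_reindex 1 (\<lambda>_. 0) w)" if "w \<in> spans E I U C 0" for w
    by (rule action_edge_degenerate[OF \<phi> that])
  show "action_edge \<phi> w" if "w \<in> spans E I U C 1" "obj w {..1} \<in> G" for w
    by (rule action_edge_connected[OF \<phi> that])
qed (use C in auto)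

end

context span_cover
begin

lemma good_action_edge:
  assumes "e \<in> Ix Sp 1" "action_edge \<phi> e"
  shows "\<exists>s. \<forall>V\<in>G. \<forall>x. (e, x) \<in> sel Sp V 1 \<longrightarrow> (\<forall>r\<in>R (span_vertex (ixmap Sp 1 [0] e)).
      act \<phi> (span_vertex (ixmap Sp 1 [0] e)) (span_vertex (ixmap Sp 1 [1] e)) (cpmap Sp 1 [0] e \<cdot> x) (cpmap Sp 1 [1] e \<cdot> x) r = s r)"
proof -
  have v: "span_vertex (ixmap Sp 1 [k] e) = ind e ! k" for k
  proof -
    have "span_vertex (span_reindex 0 (\<lambda>p. [k] ! p) e) = hd (ind (span_reindex 0 (\<lambda>p. [k] ! p) e))"
      by (simp add: span_vertex_def case_prod_unfold)
    then show ?thesis by (simp add: span_reindex_sel)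
  qed
  show ?thesis
    using assms(2) unfolding v action_edge_def by (simp add: sel_def) (metis)
qed

end

context cech_cover
begin

text \<open>Every edge of the span refinement acts constantly, so \<open>S_datum_exists\<close>
  applies to it once its simplices have been moved into \<open>'u\<close> by
  \<open>relabel\<close>.\<close>

lemma locally_constant_refinement:
  assumes \<sigma>: "U_descent_datum E I U R \<sigma>"
  shows "\<exists>(F :: ('u, 'o, 'a) sfam) s.
               hypercover_refinement E I U (\<lambda>i. i) F \<and> self_dual E F \<and> condition_G F \<and>
               S_descent_datum F R s \<and> consistent E F R s \<and>
               (\<forall>e\<in>Ix F 1. corresponding_datum E I U (\<lambda>i. i) F R \<sigma> e = constant_datum E F R s e)"
proof -
  define \<phi> where "\<phi> = first \<sigma>"
  have co: "coherent \<phi>" unfolding \<phi>_def by (rule U_descent_datumD(1)[OF \<sigma>])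
  \<comment> \<open>The generators are the tops of the fillers, and the \<open>U i\<close> are the
    values of spans at singletons. A \<open>U i\<close> may also occur as the apex of an edge; such
    an edge is kept only if it is an action edge.\<close>
  define C where "C = G \<union> U ` I"
  have "small u C"
  proof (rule small_subset)
    show "small u (\<Union>b\<in>(UNIV :: bool set). if b then G else U ` I)"
      by (rule small_UN[OF universe]) (use small_G small_image[OF small_I] in auto)
    show "C \<subseteq> (\<Union>b\<in>(UNIV :: bool set). if b then G else U ` I)" by (auto simp: C_def)
  qed
  then interpret S: span_cover E u G I U R C "action_edge \<phi>"
    by (intro span_cover_action_edge[OF co]) (auto simp: C_def G_not_initial U_not_initial)
  \<comment> \<open>In degree 0 a span is labelled by its vertex, so that the vertices become the
    elements of I; in the other degrees any injection will do.\<close>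
  define g :: "nat \<Rightarrow> ('u, 'o, 'a) span \<Rightarrow> 'u"
    where "g n = (if n = 0 then span_vertex else (SOME f. inj_on f (Ix S.Sp n)))" for n
  have g: "inj_on (g n) (Ix S.Sp n)" for n
  proof (cases "n = 0")
    case True
    then show ?thesis using S.span_vertex_bij by (simp add: g_def bij_betw_def)
  next
    case False
    have "\<exists>f :: ('u, 'o, 'a) span \<Rightarrow> 'u. inj_on f (Ix S.Sp n)"
      using small_encode[OF simplicial_familyD(1)[OF S.Sp_simplicial]] by blast
    from someI_ex[OF this] show ?thesis using False by (simp add: g_def)
  qed
  define F where "F = relabel g S.Sp"
  note simp = relabel_simps[OF S.Sp_simplicial g]
  note Ix = relabel_Ix[OF S.Sp_simplicial g, folded F_def]
  have F: "simplicial_family E TYPE('u) F" unfolding F_def by (rule relabel_simplicial[OF S.Sp_simplicial g])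
  have F0: "Ix F 0 = I" using S.span_vertex_bij unfolding Ix bij_betw_def by (simp add: g_def)
  have bij: "bij_betw (\<lambda>i. i) (Ix F 0) I" by (simp add: bij_betw_def F0)
  have FC: "Cp F 0 i = U i" if "i \<in> Ix F 0" for i
  proof -
    from that have "i \<in> g 0 ` Ix S.Sp 0" unfolding Ix .
    then obtain w where w: "w \<in> Ix S.Sp 0" "i = g 0 w" by (elim imageE)
    have "Cp F 0 i = Cp S.Sp 0 w" unfolding w(2) F_def by (rule simp(2)[OF w(1)])
    then show ?thesis using S.span_vertex_Cp[OF w(1)] w(2) by (simp add: g_def)
  qed
  have dual: "self_dual E F" unfolding F_def by (rule relabel_self_dual[OF S.Sp_simplicial g S.Sp_self_dual])
  have cG: "condition_G F"
    unfolding F_def by (rule relabel_condition_G[OF S.Sp_simplicial g S.Sp_self_dual S.Sp_condition_G])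
  have hyp: "hypercover_refinement E I U (\<lambda>i. i) F"
    unfolding hypercover_refinement_def
  proof (intro conjI ballI allI impI)
    fix k :: nat assume k: "1 \<le> k"
    show "\<exists>L \<pi> h. is_cosk E F k L \<pi> \<and> h \<in> hom E (tot E F k) L \<and>
        (\<forall>m \<alpha>. m < k \<and> monotone_map m k \<alpha> \<longrightarrow> \<pi> \<alpha> \<cdot> h = totmap E F m k \<alpha>) \<and> epi E h"
    proof (rule cosk_epi_if_fillers[OF F])
      fix V Y assume V: "V \<in> G" and Y: "matching F V k Y"
      show "\<exists>y\<in>sel F V k. \<forall>m \<alpha>. m < k \<and> monotone_map m k \<alpha> \<longrightarrow> sact F k \<alpha> y = Y \<alpha>"
        unfolding F_def
        by (rule relabel_fill[OF S.Sp_simplicial g S.Sp_fill[OF V k] Y[unfolded F_def]])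
    qed
  qed (fact F bij FC)+
  have "\<exists>s. S_descent_datum F (R \<circ> (\<lambda>i. i)) s \<and> consistent E F (R \<circ> (\<lambda>i. i)) s \<and>
    (\<forall>e\<in>Ix F 1. corresponding_datum E I U (\<lambda>i. i) F R \<sigma> e = constant_datum E F (R \<circ> (\<lambda>i. i)) s e)"
  proof (rule S_datum_exists[OF F bij FC dual \<sigma>])
    fix e assume "e \<in> Ix F 1"
    then obtain w where w: "w \<in> Ix S.Sp 1" and e: "e = g 1 w" unfolding Ix by blast
    have m: "monotone_map 0 1 [0]" "monotone_map 0 1 [1]" by (simp_all add: monotone_map_0)
    have ends: "ixmap F 1 [0] e = span_vertex (ixmap S.Sp 1 [0] w)" "ixmap F 1 [1] e = span_vertex (ixmap S.Sp 1 [1] w)"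
      unfolding e F_def simp(1)[OF w m(1)] simp(1)[OF w m(2)] by (simp_all add: g_def)
    have cp: "cpmap F 1 \<alpha> e = cpmap S.Sp 1 \<alpha> w" for \<alpha> unfolding e F_def by (rule simp(3)[OF w])
    have sl: "(e, x) \<in> sel F V 1 \<longleftrightarrow> (w, x) \<in> sel S.Sp V 1" for x V
      unfolding sel_def mem_Collect_eq prod.case using w \<open>e \<in> Ix F 1\<close> simp(2)[OF w] by (simp add: e F_def)
    have wQ: "action_edge \<phi> w"
    proof -
      have "w \<in> S.good 1" using w by simp
      then have "action_edge \<phi> (span_reindex 1 (\<lambda>k. k) w)" unfolding S.good_def by simp
      moreover have "span_reindex 1 (\<lambda>k. k) w = w" using S.good_spans[OF \<open>w \<in> S.good 1\<close>] by (rule span_reindex_id) simp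
      ultimately show ?thesis by simp
    qed
    show "\<exists>s. \<forall>V\<in>G. \<forall>x. (e, x) \<in> sel F V 1 \<longrightarrow> (\<forall>r\<in>R (ixmap F 1 [0] e).
      act (first \<sigma>) (ixmap F 1 [0] e) (ixmap F 1 [1] e) (cpmap F 1 [0] e \<cdot> x) (cpmap F 1 [1] e \<cdot> x) r = s r)"
      unfolding ends cp sl \<phi>_def[symmetric] by (rule S.good_action_edge[OF w wQ])
  qed
  then obtain s where "S_descent_datum F R s" "consistent E F R s"
    "\<forall>e\<in>Ix F 1. corresponding_datum E I U (\<lambda>i. i) F R \<sigma> e = constant_datum E F R s e"
    by (auto simp: comp_def)
  then show ?thesis using hyp dual cG by blast
qed

text \<open>With the connected generators themselves as the allowed objects, each edge has its apex
  in G and acts constantly. The condition on edges can be taken to be \<open>True\<close>, and the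
  family of good spans is then \<open>zero_span_family\<close> itself.\<close>

lemma zero_span_refinement:
  assumes \<sigma>: "U_descent_datum E I U R \<sigma>" and U_G: "\<And>i. i \<in> I \<Longrightarrow> U i \<in> G"
  shows "let F = zero_span_family E I U G in
    hypercover_refinement E I U span_vertex F \<and> self_dual E F \<and>
    (\<exists>s. S_descent_datum F (R \<circ> span_vertex) s \<and>
       (\<forall>e\<in>Ix F 1. corresponding_datum E I U span_vertex F R \<sigma> e = constant_datum E F (R \<circ> span_vertex) s e))"
proof -
  define \<phi> where "\<phi> = first \<sigma>"
  have co: "coherent \<phi>" unfolding \<phi>_def by (rule U_descent_datumD(1)[OF \<sigma>])
  interpret S: span_cover E u G I U R G "\<lambda>_. True"
    by unfold_locales (use small_G G_not_initial U_G in auto)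
  have "S.good = spans E I U G" by (simp add: S.good_def fun_eq_iff)
  then have Sp: "S.Sp = zero_span_family E I U G" by (simp add: S.Sp_def zero_span_family_def)
  have "\<exists>s. S_descent_datum S.Sp (R \<circ> span_vertex) s \<and> consistent E S.Sp (R \<circ> span_vertex) s \<and>
    (\<forall>e\<in>Ix S.Sp 1. corresponding_datum E I U span_vertex S.Sp R \<sigma> e = constant_datum E S.Sp (R \<circ> span_vertex) s e)"
  proof (rule S_datum_exists[OF S.Sp_simplicial S.span_vertex_bij S.span_vertex_Cp S.Sp_self_dual \<sigma>])
    fix e assume e: "e \<in> Ix S.Sp 1"
    then have ws: "e \<in> spans E I U G 1" using S.good_spans by simp
    have "obj e {..1} \<in> G" using spansD(3)[OF ws, of "{..1}"] by simp
    then have "action_edge \<phi> e" by (rule action_edge_connected[OF co ws])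
    then show "\<exists>s. \<forall>V\<in>G. \<forall>x. (e, x) \<in> sel S.Sp V 1 \<longrightarrow> (\<forall>r\<in>R (span_vertex (ixmap S.Sp 1 [0] e)).
      act (first \<sigma>) (span_vertex (ixmap S.Sp 1 [0] e)) (span_vertex (ixmap S.Sp 1 [1] e))
        (cpmap S.Sp 1 [0] e \<cdot> x) (cpmap S.Sp 1 [1] e \<cdot> x) r = s r)"
      unfolding \<phi>_def[symmetric] by (rule S.good_action_edge[OF e])
  qed
  then show ?thesis using S.Sp_hypercover S.Sp_self_dual unfolding Sp Let_def by blast
qed

end

theorem theorem7p9:
  fixes E :: "('o, 'a) cat" and I :: "'u set" and U :: "'u \<Rightarrow> 'o"
  assumes "universe TYPE('u)"
    and "grothendieck_topos E TYPE('u)"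
    and "locally_connected E TYPE('u)"
    and "cover E I U"
  shows "(\<forall>X R \<sigma>. locally_constant E I U X R \<sigma> \<longrightarrow>
            (\<exists>(F :: ('u, 'o, 'a) sfam) s.
               hypercover_refinement E I U (\<lambda>i. i) F \<and> self_dual E F \<and> condition_G F \<and>
               S_descent_datum F R s \<and> consistent E F R s \<and>
               (\<forall>e\<in>Ix F 1. corresponding_datum E I U (\<lambda>i. i) F R \<sigma> e = constant_datum E F R s e)))
       \<and> (\<forall>(F :: ('u, 'o, 'a) sfam) R s.
            hypercover_refinement E I U (\<lambda>i. i) F \<and> self_dual E F \<and> condition_G F \<and>
            (\<forall>i\<in>I. small TYPE('u) (R i)) \<and>
            S_descent_datum F R s \<and> consistent E F R s \<longrightarrow>
            (\<exists>\<sigma>. U_descent_datum E I U R \<sigma> \<and>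
               (\<forall>e\<in>Ix F 1. corresponding_datum E I U (\<lambda>i. i) F R \<sigma> e = constant_datum E F R s e) \<and>
               (\<forall>\<sigma>'. U_descent_datum E I U R \<sigma>' \<and>
                  (\<forall>e\<in>Ix F 1. corresponding_datum E I U (\<lambda>i. i) F R \<sigma>' e = constant_datum E F R s e) \<longrightarrow>
                  (\<forall>e\<in>Ix (cech E I U) 1. \<sigma>' e = \<sigma> e)) \<and>
               (\<exists>X. covering_projection E I U X R \<sigma> \<and>
                  (\<forall>Y. locally_constant E I U Y R \<sigma> \<longrightarrow> isomorphic E X Y))))
       \<and> (\<forall>X R \<sigma> K C.
            locally_constant E I U X R \<sigma> \<and> (\<forall>i\<in>I. connected_object E (U i)) \<and>
            admissible E I U K C \<and> (\<forall>A\<in>C. connected_object E A) \<and> generating E C \<longrightarrow>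
            (let F = zero_span_family E I U C in
               hypercover_refinement E I U span_vertex F \<and> self_dual E F \<and>
               (\<exists>s. S_descent_datum F (R \<circ> span_vertex) s \<and>
                  (\<forall>e\<in>Ix F 1. corresponding_datum E I U span_vertex F R \<sigma> e
                     = constant_datum E F (R \<circ> span_vertex) s e))))"
proof -
  have "category E" using assms(2)[unfolded grothendieck_topos_def] by (rule conjunct1)
  then interpret giraud_topos E "TYPE('u)" using assms(1,2) by unfold_locales
  obtain G where G: "small TYPE('u) G" "generating E G" "\<And>V. V \<in> G \<Longrightarrow> conn V"
    using ex_conn_generators[OF assms(3)] by blast
  \<comment> \<open>\<open>H\<close> is \<open>G\<close> in the first two claims and the admissible
    set \<open>C\<close> in the third.\<close>
  have cech: "cech_cover E TYPE('u) H I U R"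
    if "small TYPE('u) H" "generating E H" "\<And>V. V \<in> H \<Longrightarrow> conn V" "\<forall>i\<in>I. small TYPE('u) (R i)"
    for H and R :: "'u \<Rightarrow> 'u set"
    using that assms(4) by unfold_locales auto
  have lc: "U_descent_datum E I U R \<sigma>" "\<forall>i\<in>I. small TYPE('u) (R i)" if "locally_constant E I U X R \<sigma>" for X R \<sigma>
    using that unfolding locally_constant_def trivialization_def by blast+
  show ?thesis
  proof (intro conjI allI impI)
    fix X R \<sigma> assume "locally_constant E I U X R \<sigma>"
    note lc = lc[OF this]
    show "\<exists>(F :: ('u, 'o, 'a) sfam) s.
               hypercover_refinement E I U (\<lambda>i. i) F \<and> self_dual E F \<and> condition_G F \<and>
               S_descent_datum F R s \<and> consistent E F R s \<and>
               (\<forall>e\<in>Ix F 1. corresponding_datum E I U (\<lambda>i. i) F R \<sigma> e = constant_datum E F R s e)"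
      by (rule cech_cover.locally_constant_refinement[OF cech[OF G lc(2)] lc(1)])
  next
    fix F :: "('u, 'o, 'a) sfam" and R :: "'u \<Rightarrow> 'u set" and s
    assume a: "hypercover_refinement E I U (\<lambda>i. i) F \<and> self_dual E F \<and> condition_G F \<and>
            (\<forall>i\<in>I. small TYPE('u) (R i)) \<and> S_descent_datum F R s \<and> consistent E F R s"
    then have R: "\<forall>i\<in>I. small TYPE('u) (R i)" by blast
    show "\<exists>\<sigma>. U_descent_datum E I U R \<sigma> \<and>
               (\<forall>e\<in>Ix F 1. corresponding_datum E I U (\<lambda>i. i) F R \<sigma> e = constant_datum E F R s e) \<and>
               (\<forall>\<sigma>'. U_descent_datum E I U R \<sigma>' \<and>
                  (\<forall>e\<in>Ix F 1. corresponding_datum E I U (\<lambda>i. i) F R \<sigma>' e = constant_datum E F R s e) \<longrightarrow>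
                  (\<forall>e\<in>Ix (cech E I U) 1. \<sigma>' e = \<sigma> e)) \<and>
               (\<exists>X. covering_projection E I U X R \<sigma> \<and>
                  (\<forall>Y. locally_constant E I U Y R \<sigma> \<longrightarrow> isomorphic E X Y))"
      by (rule cech_cover.covering_projection_of_S_datum[OF cech[OF G R]]) (use a in blast)+
  next
    fix X R \<sigma> K C
    assume a: "locally_constant E I U X R \<sigma> \<and> (\<forall>i\<in>I. connected_object E (U i)) \<and>
            admissible E I U K C \<and> (\<forall>A\<in>C. connected_object E A) \<and> generating E C"
    then have X: "locally_constant E I U X R \<sigma>" by blast
    note lc = lc[OF X]
    have C: "small TYPE('u) C" "generating E C" "\<And>V. V \<in> C \<Longrightarrow> conn V" "\<And>i. i \<in> I \<Longrightarrow> U i \<in> C"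
      using a small_subset connected_object_conn unfolding admissible_def by blast+
    show "let F = zero_span_family E I U C in
               hypercover_refinement E I U span_vertex F \<and> self_dual E F \<and>
               (\<exists>s. S_descent_datum F (R \<circ> span_vertex) s \<and>
                  (\<forall>e\<in>Ix F 1. corresponding_datum E I U span_vertex F R \<sigma> e
                     = constant_datum E F (R \<circ> span_vertex) s e))"
      by (rule cech_cover.zero_span_refinement[OF cech[OF C(1-3) lc(2)] lc(1) C(4)])
  qed
qed

end
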